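(* Let $1<p<\infty$, $d\ge1$, and let $M$ be a nonempty compact subset of $\mathbb{R}^d$. Then there exists a trivial isomorphic extension $\theta_M$ of $K(l^p)$ by $C(M)$ such that $[\theta_M]=[\theta_M]+[\theta_M]$ and such that for every isomorphic extension $\phi$ of $K(l^p)$ by $C(M)$ there exists an isomorphic extension $\phi^{(-1)}$ of $K(l^p)$ by $C(M)$ with $[\theta_M]=[\phi]+[\phi^{(-1)}]$. Moreover, $\theta_M$ is unique up to equivalence (any two isomorphic extensions with these properties are equivalent).
   Context: $C(M)$ is the Banach algebra of continuous complex functions on $M$ with sup norm. $\pi:B(l^p)\to B(l^p)/K(l^p)$ is the quotient map. A homomorphism $\phi:\mathcal{A}_1\to\mathcal{A}_2$ of Banach algebras is an isomorphism (into) if there is $C\ge1$ with $C^{-1}\|a\|\le\|\phi(a)\|\le C\|a\|$ for all $a$. For a separable unital Banach algebra $\mathcal{A}$, an isomorphic extension of $K(l^p)$ by $\mathcal{A}$ is a unital isomorphism (into) $\phi:\mathcal{A}\to B(l^p)/K(l^p)$; it is trivial if $\phi=\pi\circ\rho$ for some unital isomorphism (into) $\rho:\mathcal{A}\to B(l^p)$. Two isomorphic extensions $\phi_1,\phi_2$ are equivalent if there is an invertible $S\in B(l^p)$ with $\phi_2(a)=\pi(S)\phi_1(a)\pi(S)^{-1}$ for all $a$; $[\phi]$ denotes the equivalence class. The sum is $[\phi_1]+[\phi_2]=[\phi]$ where $\phi(a)=\pi(S_0(T_1\oplus T_2)S_0^{-1})$, with $T_i\in B(l^p)$ any operators satisfying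 $\pi(T_i)=\phi_i(a)$ and $S_0:l^p\oplus l^p\to l^p$ any invertible operator; this makes the set of classes a commutative semigroup. *)

theory Defs
  imports "HOL-Analysis.Analysis"
begin

text \<open>Sequences and operators on l^p (complex scalars). An operator is a map on
  sequences; only its values on l^p matter.\<close>

type_synonym seq = "nat \<Rightarrow> complex"
type_synonym oper = "seq \<Rightarrow> seq"

definition lp_space :: "real \<Rightarrow> seq set" where
  "lp_space p = {x. summable (\<lambda>n. norm (x n) powr p)}"

definition lp_norm :: "real \<Rightarrow> seq \<Rightarrow> real" where
  "lp_norm p x = (\<Sum>n. norm (x n) powr p) powr (1 / p)"

definition bounded_op :: "real \<Rightarrow> oper \<Rightarrow> bool" where
  "bounded_op p T \<longleftrightarrow>
     (\<forall>x\<in>lp_space p. T x \<in> lp_space p) \<and>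
     (\<forall>x\<in>lp_space p. \<forall>y\<in>lp_space p. \<forall>a b::complex.
        T (\<lambda>n. a * x n + b * y n) = (\<lambda>n. a * T x n + b * T y n)) \<and>
     (\<exists>C. \<forall>x\<in>lp_space p. lp_norm p (T x) \<le> C * lp_norm p x)"

definition op_norm :: "real \<Rightarrow> oper \<Rightarrow> real" where
  "op_norm p T = Sup {lp_norm p (T x) | x. x \<in> lp_space p \<and> lp_norm p x \<le> 1}"

definition compact_op :: "real \<Rightarrow> oper \<Rightarrow> bool" where
  "compact_op p T \<longleftrightarrow> bounded_op p T \<and>
     (\<forall>xs. (\<forall>n. xs n \<in> lp_space p) \<and> (\<exists>B. \<forall>n. lp_norm p (xs n) \<le> B) \<longrightarrow>
        (\<exists>(r::nat \<Rightarrow> nat) y. strict_mono r \<and> y \<in> lp_space p \<and>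
           (\<lambda>n. lp_norm p (\<lambda>k. T (xs (r n)) k - y k)) \<longlonglongrightarrow> 0))"

definition mod_compact :: "real \<Rightarrow> oper \<Rightarrow> oper \<Rightarrow> bool" where
  "mod_compact p T S \<longleftrightarrow> compact_op p (\<lambda>x k. T x k - S x k)"

definition ess_norm :: "real \<Rightarrow> oper \<Rightarrow> real" where
  "ess_norm p T = Inf {op_norm p (\<lambda>x k. T x k + K x k) | K. compact_op p K}"

definition cfun :: "'a::topological_space set \<Rightarrow> ('a \<Rightarrow> complex) set" where
  "cfun M = {f. continuous_on M f}"

definition sup_norm :: "'a set \<Rightarrow> ('a \<Rightarrow> complex) \<Rightarrow> real" where
  "sup_norm M f = Sup ((\<lambda>x. norm (f x)) ` M)"

text \<open>An isomorphic extension phi : C(M) -> B/K, represented by a lift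
  Phi : C(M) -> B(l^p) with pi (Phi f) = phi f.\<close>
definition iso_ext :: "real \<Rightarrow> 'a::topological_space set \<Rightarrow> (('a \<Rightarrow> complex) \<Rightarrow> oper) \<Rightarrow> bool" where
  "iso_ext p M Phi \<longleftrightarrow>
     (\<forall>f\<in>cfun M. bounded_op p (Phi f)) \<and>
     (\<forall>f\<in>cfun M. \<forall>g\<in>cfun M. (\<forall>x\<in>M. f x = g x) \<longrightarrow> mod_compact p (Phi f) (Phi g)) \<and>
     (\<forall>f\<in>cfun M. \<forall>g\<in>cfun M. \<forall>a b::complex.
        mod_compact p (Phi (\<lambda>x. a * f x + b * g x)) (\<lambda>v k. a * Phi f v k + b * Phi g v k)) \<and>
     (\<forall>f\<in>cfun M. \<forall>g\<in>cfun M. mod_compact p (Phi (\<lambda>x. f x * g x)) (Phi f \<circ> Phi g)) \<and>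
     mod_compact p (Phi (\<lambda>x. 1)) id \<and>
     (\<exists>C\<ge>1. \<forall>f\<in>cfun M. sup_norm M f / C \<le> ess_norm p (Phi f) \<and>
                          ess_norm p (Phi f) \<le> C * sup_norm M f)"

definition trivial_ext :: "real \<Rightarrow> 'a::topological_space set \<Rightarrow> (('a \<Rightarrow> complex) \<Rightarrow> oper) \<Rightarrow> bool" where
  "trivial_ext p M Phi \<longleftrightarrow> iso_ext p M Phi \<and>
     (\<exists>rho. (\<forall>f\<in>cfun M. bounded_op p (rho f)) \<and>
       (\<forall>f\<in>cfun M. \<forall>g\<in>cfun M. (\<forall>x\<in>M. f x = g x) \<longrightarrow>
          (\<forall>v\<in>lp_space p. rho f v = rho g v)) \<and>
       (\<forall>f\<in>cfun M. \<forall>g\<in>cfun M. \<forall>a b::complex. \<forall>v\<in>lp_space p.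
          rho (\<lambda>x. a * f x + b * g x) v = (\<lambda>k. a * rho f v k + b * rho g v k)) \<and>
       (\<forall>f\<in>cfun M. \<forall>g\<in>cfun M. \<forall>v\<in>lp_space p. rho (\<lambda>x. f x * g x) v = rho f (rho g v)) \<and>
       (\<forall>v\<in>lp_space p. rho (\<lambda>x. 1) v = v) \<and>
       (\<exists>C\<ge>1. \<forall>f\<in>cfun M. sup_norm M f / C \<le> op_norm p (rho f) \<and>
                            op_norm p (rho f) \<le> C * sup_norm M f) \<and>
       (\<forall>f\<in>cfun M. mod_compact p (rho f) (Phi f)))"

definition inverse_ops :: "real \<Rightarrow> oper \<Rightarrow> oper \<Rightarrow> bool" where
  "inverse_ops p S S' \<longleftrightarrow> bounded_op p S \<and> bounded_op p S' \<and>
     (\<forall>x\<in>lp_space p. S (S' x) = x \<and> S' (S x) = x)"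

definition ext_equiv :: "real \<Rightarrow> 'a::topological_space set \<Rightarrow> (('a \<Rightarrow> complex) \<Rightarrow> oper) \<Rightarrow> (('a \<Rightarrow> complex) \<Rightarrow> oper) \<Rightarrow> bool" where
  "ext_equiv p M Phi1 Phi2 \<longleftrightarrow>
     (\<exists>S S'. inverse_ops p S S' \<and> (\<forall>f\<in>cfun M. mod_compact p (Phi2 f) (S \<circ> Phi1 f \<circ> S')))"

text \<open>Sum of extensions, using the invertible (isometric) interleaving operator
  S0 : l^p (+) l^p -> l^p, S0(x,y) = (x0,y0,x1,y1,...); thus
  S0 (T1 (+) T2) S0^{-1} x = interleave (T1 (evens x)) (T2 (odds x)).\<close>
definition interleave :: "seq \<Rightarrow> seq \<Rightarrow> seq" where
  "interleave x y = (\<lambda>n. if even n then x (n div 2) else y (n div 2))"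

definition ext_sum :: "(('a \<Rightarrow> complex) \<Rightarrow> oper) \<Rightarrow> (('a \<Rightarrow> complex) \<Rightarrow> oper) \<Rightarrow> (('a \<Rightarrow> complex) \<Rightarrow> oper)" where
  "ext_sum Phi1 Phi2 = (\<lambda>f x. interleave (Phi1 f (\<lambda>n. x (2 * n))) (Phi2 f (\<lambda>n. x (2 * n + 1))))"

end

theory Submission
  imports Defs "HOL-Library.Function_Algebras" "HOL-Library.Diagonal_Subsequence" "HOL-Library.Nat_Bijection"
begin

text \<open>The extension \<open>\<theta>\<close> lifts to a block sum, with infinite multiplicity, of representations of \<open>C(M)\<close> on
  \<open>\<ell>\<^sup>p({-1, 1}\<^sup>n)\<close>: \<open>f\<close> multiplies the \<open>j\<close>-th Rademacher function by \<open>f (t j)\<close>, where the points \<open>t j\<close> form a net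
  of \<open>M\<close>, and acts as a scalar on the complement of the Rademacher span. Khinchine's inequality bounds these
  representations uniformly.

  Let \<open>\<phi>\<close> be an extension and \<open>a j\<close> functions near \<open>t j\<close> with \<open>\<Sum>j. (a j)\<^sup>2 = 1\<close> and \<open>\<Sum>j. a j\<close> bounded independently of
  the mesh. The random sums \<open>A = \<Sum>j. r j * \<phi> (a j)\<close> with Rademacher signs \<open>r j\<close> are uniformly bounded, and their squares
  average to \<open>1\<close> modulo compact operators. Cutting them off quasicentrally for finer and finer nets yields \<open>V\<close> and \<open>W\<close>
  with \<open>W V = 1\<close> that intertwine \<open>\<phi>\<close> and \<open>\<theta>\<close> modulo compact operators.

  With \<open>Q = 1 - V W\<close>, the involution \<open>(x, y) \<mapsto> (W y, V x + Q y)\<close> conjugates \<open>\<theta> \<oplus> \<theta>\<close> to \<open>\<phi> \<oplus> \<psi>\<close> for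
  \<open>\<psi> f = V (\<theta> f) W + Q (\<theta> f) Q\<close>, and \<open>\<theta> \<oplus> \<theta>\<close> is equivalent to \<open>\<theta>\<close> by infinite multiplicity. Uniqueness is a
  computation in the semigroup: \<open>\<theta> = \<theta>' + \<omega> = \<theta>' + \<theta>' + \<omega> = \<theta>' + \<theta>\<close>, and symmetrically \<open>\<theta>' = \<theta> + \<theta>'\<close>.\<close>

section \<open>Inequalities for finite sums of powers\<close>

text \<open>An extension controls combinations of the operators \<open>\<phi> (a j)\<close> only
  through suprema of functions. For p = 2 the column of all \<open>\<phi> (a j) x\<close> would do
  as a dilation; for other exponents its norm need not be comparable with that of \<open>x\<close>
  uniformly in the mesh. Random signs repair this: a signed sum of the \<open>a j\<close> has
  supremum at most the sum of the \<open>a j\<close>, whatever the signs, and averaging p-th powers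
  over all signs stays within the class of p-summable families. The squares of the
  \<open>a j\<close> sum to 1 because a random sum is used twice, once on the way into the
  representation and once on the way back. The bound on the sum of the \<open>a j\<close> itself is
  where finite dimension enters. Every relation holds only up to a compact operator that changes
  with the mesh, whereas one operator has to serve all meshes. Hence the cut-offs that nearly
  commute with the lifts; this can be arranged for finitely many lifts at a time, and the coordinate
  functions suffice.\<close>

lemma bernoulli_powr:
  fixes t p :: real
  assumes "1 < p" "0 \<le> t"
  shows "1 + p * (t - 1) \<le> t powr p"
proof -
  define q where "q = p / (p - 1)"
  have q: "q > 1" "1/p + 1/q = 1" using assms by (auto simp: q_def field_simps)
  \<comment> \<open>The tangent line at 1 comes from Young's inequality with second factor
    1.\<close>
  have "t * 1 \<le> t powr p / p + 1 powr q / q"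
    by (rule Youngs_inequality) (use assms q in auto)
  then have "p * t \<le> t powr p + p / q" using assms by (simp add: field_simps)
  moreover have "p / q = p - 1" using assms by (simp add: q_def)
  ultimately show ?thesis by (simp add: algebra_simps)
qed

text \<open>Jensen for two points: the tangent bound is applied at the weighted mean
  \<open>w\<close>, where the linear terms cancel.\<close>

lemma powr_convex_comb:
  fixes u v l m p :: real
  assumes "1 < p" "0 \<le> u" "0 \<le> v" "0 \<le> l" "0 \<le> m" "l + m = 1"
  shows "(l * u + m * v) powr p \<le> l * u powr p + m * v powr p"
proof (cases "l * u + m * v = 0")
  case True
  then show ?thesis using assms by simp
next
  case False
  define w where "w = l * u + m * v"
  have w: "w > 0" using False assms by (simp add: w_def order_less_le)
  have "l * (1 + p * (u / w - 1)) + m * (1 + p * (v / w - 1))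
      \<le> l * (u / w) powr p + m * (v / w) powr p"
    by (intro add_mono mult_left_mono bernoulli_powr) (use assms w in auto)
  moreover have "l * (1 + p * (u / w - 1)) + m * (1 + p * (v / w - 1))
      = (l + m) + p * ((l * u + m * v) / w - (l + m))"
    by (simp add: algebra_simps add_divide_distrib)
  moreover have "\<dots> = 1" using w assms by (simp add: w_def[symmetric])
  ultimately have "1 \<le> l * (u / w) powr p + m * (v / w) powr p" by simp
  also have "\<dots> = (l * u powr p + m * v powr p) / w powr p"
    using assms w by (simp add: powr_divide add_divide_distrib)
  finally show ?thesis using w by (simp add: w_def[symmetric] field_simps)
qed

text \<open>By homogeneity \<open>(a i + b i) / (A + B)\<close> is the convex combination of
  \<open>a i / A\<close> and \<open>b i / B\<close> with weights \<open>A / (A + B)\<close> and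
  \<open>B / (A + B)\<close>; convexity is then summed over \<open>i\<close>. Bounds
  \<open>A\<close> and \<open>B\<close> in place of the exact norms let it be fed with estimates
  directly.\<close>

lemma minkowski_powr:
  fixes a b :: "'i \<Rightarrow> real"
  assumes p: "1 < p" and "finite F" and ab: "\<And>i. 0 \<le> a i" "\<And>i. 0 \<le> b i" and AB: "0 \<le> A" "0 \<le> B"
    and a: "(\<Sum>i\<in>F. a i powr p) \<le> A powr p" and b: "(\<Sum>i\<in>F. b i powr p) \<le> B powr p"
  shows "(\<Sum>i\<in>F. (a i + b i) powr p) \<le> (A + B) powr p"
proof -
  have z: "\<And>i. i \<in> F \<Longrightarrow> c i = 0" if "(\<Sum>i\<in>F. c i powr p) \<le> 0" "\<And>i. 0 \<le> c i" for c :: "'i \<Rightarrow> real"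
  proof -
    have "(\<Sum>i\<in>F. c i powr p) = 0" using that by (intro antisym sum_nonneg) auto
    then show "\<And>i. i \<in> F \<Longrightarrow> c i = 0" using \<open>finite F\<close> by (subst (asm) sum_nonneg_eq_0_iff) auto
  qed
  consider "A = 0" | "B = 0" | "A > 0" "B > 0" using AB by linarith
  then show ?thesis
  proof cases
    case 1
    then have "\<And>i. i \<in> F \<Longrightarrow> a i = 0" using z[of a] a ab p by auto
    then show ?thesis using b 1 by simp
  next
    case 2
    then have "\<And>i. i \<in> F \<Longrightarrow> b i = 0" using z[of b] b ab p by auto
    then show ?thesis using a 2 by simp
  next
    case 3
    define l where "l = A / (A + B)"
    define m where "m = B / (A + B)"
    have lm: "l > 0" "m > 0" "l + m = 1"
      using 3 by (simp_all add: l_def m_def add_divide_distrib[symmetric])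
    have "(a i + b i) powr p \<le> (A + B) powr p * (l * (a i powr p / A powr p) + m * (b i powr p / B powr p))" for i
    proof -
      have "a i + b i = (A + B) * (l * (a i / A) + m * (b i / B))"
        using 3 by (simp add: l_def m_def distrib_left)
      then have "(a i + b i) powr p = (A + B) powr p * (l * (a i / A) + m * (b i / B)) powr p"
        using 3 lm ab by (simp add: powr_mult)
      also have "\<dots> \<le> (A + B) powr p * (l * (a i / A) powr p + m * (b i / B) powr p)"
        by (intro mult_left_mono powr_convex_comb) (use p ab 3 lm in auto)
      finally show ?thesis using 3 ab by (simp add: powr_divide)
    qed
    then have "(\<Sum>i\<in>F. (a i + b i) powr p) \<le> (\<Sum>i\<in>F. (A + B) powr p * (l * (a i powr p / A powr p) + m * (b i powr p / B powr p)))"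
      by (rule sum_mono)
    also have "\<dots> = (A + B) powr p * (l * ((\<Sum>i\<in>F. a i powr p) / A powr p) + m * ((\<Sum>i\<in>F. b i powr p) / B powr p))"
      by (simp add: sum_distrib_left sum.distrib sum_divide_distrib distrib_left)
    also have "\<dots> \<le> (A + B) powr p * (l * 1 + m * 1)"
      by (intro mult_left_mono add_mono) (use a b 3 lm in \<open>auto simp: field_simps\<close>)
    finally show ?thesis using lm by simp
  qed
qed

text \<open>Young's inequality termwise after both families are normalised; the normalised bounds
  add up to \<open>1 / p + 1 / q = 1\<close>.\<close>

lemma holder_powr:
  fixes a b :: "'i \<Rightarrow> real"
  assumes pq: "1 < p" "1 < q" "1 / p + 1 / q = 1" and F: "finite F" and ab: "\<And>i. 0 \<le> a i" "\<And>i. 0 \<le> b i"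
  shows "(\<Sum>i\<in>F. a i * b i) \<le> (\<Sum>i\<in>F. a i powr p) powr (1 / p) * (\<Sum>i\<in>F. b i powr q) powr (1 / q)"
proof -
  define A where "A = (\<Sum>i\<in>F. a i powr p) powr (1 / p)"
  define B where "B = (\<Sum>i\<in>F. b i powr q) powr (1 / q)"
  have AB: "A powr p = (\<Sum>i\<in>F. a i powr p)" "B powr q = (\<Sum>i\<in>F. b i powr q)" "A \<ge> 0" "B \<ge> 0"
    using pq by (auto simp: A_def B_def powr_powr sum_nonneg)
  show ?thesis
  proof (cases "A = 0 \<or> B = 0")
    case True
    then have "(\<Sum>i\<in>F. a i powr p) = 0 \<or> (\<Sum>i\<in>F. b i powr q) = 0" using AB pq by auto
    then have "\<forall>i\<in>F. a i * b i = 0"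
      by (subst (asm) (1 2) sum_nonneg_eq_0_iff) (use F in auto)
    then have "(\<Sum>i\<in>F. a i * b i) = 0" by (rule sum.neutral)
    then show ?thesis by simp
  next
    case False
    then have pos: "A > 0" "B > 0" using AB by auto
    have "(\<Sum>i\<in>F. (a i / A) * (b i / B)) \<le> (\<Sum>i\<in>F. (a i / A) powr p / p + (b i / B) powr q / q)"
      by (intro sum_mono Youngs_inequality) (use pq ab pos in auto)
    also have "\<dots> = (\<Sum>i\<in>F. a i powr p) / A powr p / p + (\<Sum>i\<in>F. b i powr q) / B powr q / q"
      using ab pos by (simp add: powr_divide sum.distrib sum_divide_distrib)
    also have "\<dots> = 1" using pos pq by (simp add: AB(1,2)[symmetric])
    also have "(\<Sum>i\<in>F. (a i / A) * (b i / B)) = (\<Sum>i\<in>F. a i * b i) / (A * B)" by (simp add: sum_divide_distrib)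
    finally show ?thesis using pos by (simp add: A_def[symmetric] B_def[symmetric] field_simps)
  qed
qed

text \<open>Hoelder against the constant family 1. The factor \<open>card F powr (p - 1)\<close> is
  what the scaling of cube averages cancels later.\<close>

lemma power_mean_powr:
  fixes a :: "'i \<Rightarrow> real"
  assumes p: "1 < p" and F: "finite F" and a: "\<And>i. 0 \<le> a i"
  shows "(\<Sum>i\<in>F. a i) powr p \<le> real (card F) powr (p - 1) * (\<Sum>i\<in>F. a i powr p)"
proof -
  define q where "q = p / (p - 1)"
  have q: "q > 1" "1/p + 1/q = 1" using p by (auto simp: q_def field_simps)
  have "(\<Sum>i\<in>F. a i * 1) \<le> (\<Sum>i\<in>F. a i powr p) powr (1 / p) * (\<Sum>i\<in>F. 1 powr q) powr (1 / q)"
    by (rule holder_powr) (use p q F a in auto)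
  then have "(\<Sum>i\<in>F. a i) powr p \<le> ((\<Sum>i\<in>F. a i powr p) powr (1 / p) * real (card F) powr (1 / q)) powr p"
    by (intro powr_mono2) (use p a in \<open>auto intro: sum_nonneg\<close>)
  also have "\<dots> = (\<Sum>i\<in>F. a i powr p) * real (card F) powr (p / q)"
    using p by (simp add: powr_mult powr_powr sum_nonneg)
  also have "p / q = p - 1" using p by (simp add: q_def)
  finally show ?thesis by (simp add: mult.commute)
qed

lemmas pointwise = fun_eq_iff plus_fun_apply minus_apply uminus_apply zero_fun_apply times_fun_apply

text \<open>As simp rules these would eta-expand operator identities; use \<open>pointwise\<close> to expand on demand.\<close>

declare plus_fun_apply [simp del] minus_apply [simp del] uminus_apply [simp del]
  zero_fun_apply [simp del] times_fun_apply [simp del]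

section \<open>The spaces of p-summable families\<close>

definition restr :: "'i set \<Rightarrow> ('i \<Rightarrow> complex) \<Rightarrow> 'i \<Rightarrow> complex" where
  "restr F x = (\<lambda>i. if i \<in> F then x i else 0)"

lemma restr_simps [simp]:
  "restr F (x + y) = restr F x + restr F y" "restr F (x - y) = restr F x - restr F y"
  "restr F 0 = 0" "restr F (\<lambda>i. c * x i) = (\<lambda>i. c * restr F x i)"
  "restr F (restr G x) = restr (F \<inter> G) x" "restr UNIV x = x" "restr {} x = 0"
  by (auto simp: restr_def pointwise)

lemma restr_compl: "restr (- F) x = x - restr F x"
  by (auto simp: restr_def pointwise)

locale lp_exponent =
  fixes p :: real
  assumes p_gt_1: "1 < p"
begin

text \<open>Bounded finite partial sums make sense over any index type. Besides sequences the
  argument needs families indexed by level, sign vector and multiplicity, and this treats all of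
  them at once.\<close>

definition lp :: "('i \<Rightarrow> complex) set" where
  "lp = {x. \<exists>B. \<forall>F. finite F \<longrightarrow> (\<Sum>i\<in>F. norm (x i) powr p) \<le> B}"

definition nrm :: "('i \<Rightarrow> complex) \<Rightarrow> real" where
  "nrm x = (SUP F\<in>{F. finite F}. \<Sum>i\<in>F. norm (x i) powr p) powr (1 / p)"

lemma p_pos: "0 < p" "p \<noteq> 0" using p_gt_1 by auto

lemma nrm_nonneg [simp]: "0 \<le> nrm x"
  by (simp add: nrm_def)

lemma sum_le_nrm:
  assumes "x \<in> lp" "finite F"
  shows "(\<Sum>i\<in>F. norm (x i) powr p) \<le> nrm x powr p"
proof -
  let ?S = "\<lambda>F. \<Sum>i\<in>F. norm (x i) powr p"
  have bdd: "bdd_above (?S ` {F. finite F})" using assms(1) by (auto simp: lp_def bdd_above_def)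
  have "?S {} \<le> (SUP F\<in>{F. finite F}. ?S F)" using bdd by (intro cSUP_upper) auto
  then have "0 \<le> (SUP F\<in>{F. finite F}. ?S F)" by simp
  moreover have "?S F \<le> (SUP F\<in>{F. finite F}. ?S F)" using bdd assms(2) by (intro cSUP_upper) auto
  ultimately show ?thesis using p_pos by (simp add: nrm_def powr_powr)
qed

lemma lp_nrm_bound:
  assumes "0 \<le> c" "\<And>F. finite F \<Longrightarrow> (\<Sum>i\<in>F. norm (x i) powr p) \<le> c powr p"
  shows "x \<in> lp" "nrm x \<le> c"
proof -
  show "x \<in> lp" using assms(2) by (auto simp: lp_def)
  let ?S = "\<lambda>F. \<Sum>i\<in>F. norm (x i) powr p"
  have le: "(SUP F\<in>{F. finite F}. ?S F) \<le> c powr p" using assms by (intro cSUP_least) auto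
  have bdd: "bdd_above (?S ` {F. finite F})" using assms(2) by (auto simp: bdd_above_def)
  have "?S {} \<le> (SUP F\<in>{F. finite F}. ?S F)" using bdd by (intro cSUP_upper) auto
  then have "nrm x \<le> (c powr p) powr (1/p)" unfolding nrm_def
    by (intro powr_mono2 le) (use p_pos in auto)
  then show "nrm x \<le> c" using p_pos assms by (simp add: powr_powr)
qed

lemma lp_dom:
  assumes "y \<in> lp" "0 \<le> c" "\<And>i. norm (x i) \<le> c * norm (y i)"
  shows "x \<in> lp" "nrm x \<le> c * nrm y"
proof -
  have "(\<Sum>i\<in>F. norm (x i) powr p) \<le> (c * nrm y) powr p" if "finite F" for F
  proof -
    have "(\<Sum>i\<in>F. norm (x i) powr p) \<le> (\<Sum>i\<in>F. (c * norm (y i)) powr p)"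
      by (intro sum_mono powr_mono2) (use p_pos assms in auto)
    also have "\<dots> = c powr p * (\<Sum>i\<in>F. norm (y i) powr p)"
      using assms by (simp add: powr_mult sum_distrib_left)
    also have "\<dots> \<le> c powr p * nrm y powr p"
      by (intro mult_left_mono sum_le_nrm assms that) auto
    finally show ?thesis using assms by (simp add: powr_mult)
  qed
  then show "x \<in> lp" "nrm x \<le> c * nrm y" using assms by (auto intro!: lp_nrm_bound[of "c * nrm y"])
qed

lemma lp_add: assumes "x \<in> lp" "y \<in> lp"
  shows "x + y \<in> lp" "nrm (x + y) \<le> nrm x + nrm y"
proof -
  have "(\<Sum>i\<in>F. norm ((x + y) i) powr p) \<le> (nrm x + nrm y) powr p" if "finite F" for F
  proof -
    have "(\<Sum>i\<in>F. norm ((x + y) i) powr p) \<le> (\<Sum>i\<in>F. (norm (x i) + norm (y i)) powr p)"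
      by (intro sum_mono powr_mono2) (use p_pos in \<open>auto intro: norm_triangle_ineq simp: plus_fun_apply\<close>)
    also have "\<dots> \<le> (nrm x + nrm y) powr p"
      by (intro minkowski_powr p_gt_1 that sum_le_nrm assms) auto
    finally show ?thesis .
  qed
  then show "x + y \<in> lp" "nrm (x + y) \<le> nrm x + nrm y"
    by (auto intro!: lp_nrm_bound[of "nrm x + nrm y"])
qed

lemma nrm_scale: assumes "x \<in> lp" shows "(\<lambda>i. a * x i) \<in> lp" "nrm (\<lambda>i. a * x i) = norm a * nrm x"
proof -
  have 1: "(\<lambda>i. a * x i) \<in> lp" and le: "nrm (\<lambda>i. a * x i) \<le> norm a * nrm x"
    using assms by (auto intro!: lp_dom[of x "norm a"] simp: norm_mult)
  show "(\<lambda>i. a * x i) \<in> lp" by (fact 1)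
  show "nrm (\<lambda>i. a * x i) = norm a * nrm x"
  proof (cases "a = 0")
    case True
    then show ?thesis using le by (simp add: antisym)
  next
    case False
    have "nrm x \<le> norm (inverse a) * nrm (\<lambda>i. a * x i)" using 1 False
      by (intro lp_dom(2)) (auto simp: norm_mult norm_inverse mult.assoc[symmetric])
    then have "norm a * nrm x \<le> nrm (\<lambda>i. a * x i)" using False by (simp add: field_simps norm_divide)
    then show ?thesis using le by simp
  qed
qed

lemma lp_zero [simp]: "0 \<in> lp" "nrm 0 = 0"
  using lp_nrm_bound[of 0 0] p_pos by (auto simp: zero_fun_apply intro!: antisym[of "nrm 0" 0])

lemma lp_const_zero [simp]: "(\<lambda>i. 0) \<in> lp"
  using lp_zero(1) unfolding zero_fun_def .

lemma lp_uminus: "x \<in> lp \<Longrightarrow> - x \<in> lp" "x \<in> lp \<Longrightarrow> nrm (- x) = nrm x"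
  using nrm_scale[of x "-1"] by (auto simp: fun_Compl_def)

lemma lp_diff: assumes "x \<in> lp" "y \<in> lp"
  shows "x - y \<in> lp" "nrm (x - y) \<le> nrm x + nrm y"
  using lp_add[OF assms(1) lp_uminus(1)[OF assms(2)]] lp_uminus[OF assms(2)] by (auto simp: fun_diff_def fun_Compl_def plus_fun_def)

lemma lp_sum: assumes "finite A" "\<And>a. a \<in> A \<Longrightarrow> f a \<in> lp"
  shows "(\<Sum>a\<in>A. f a) \<in> lp" "nrm (\<Sum>a\<in>A. f a) \<le> (\<Sum>a\<in>A. nrm (f a))"
proof -
  have "(\<Sum>a\<in>A. f a) \<in> lp \<and> nrm (\<Sum>a\<in>A. f a) \<le> (\<Sum>a\<in>A. nrm (f a))" using assms
  proof (induction A)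
    case (insert b A)
    then have IH: "sum f A \<in> lp" "nrm (sum f A) \<le> (\<Sum>a\<in>A. nrm (f a))" and b: "f b \<in> lp" by auto
    have "nrm (f b + sum f A) \<le> nrm (f b) + (\<Sum>a\<in>A. nrm (f a))"
      using lp_add(2)[OF b IH(1)] IH(2) by linarith
    then show ?case using lp_add(1)[OF b IH(1)] insert.hyps by simp
  qed simp
  then show "(\<Sum>a\<in>A. f a) \<in> lp" "nrm (\<Sum>a\<in>A. f a) \<le> (\<Sum>a\<in>A. nrm (f a))" by auto
qed

lemma norm_le_nrm: "x \<in> lp \<Longrightarrow> norm (x i) \<le> nrm x"
  using sum_le_nrm[of x "{i}"] p_pos powr_less_mono2[of p "nrm x" "norm (x i)"] by force

lemma nrm_eq_0: "x \<in> lp \<Longrightarrow> nrm x = 0 \<Longrightarrow> x = 0"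
  using norm_le_nrm[of x] by (auto simp: pointwise)

lemma restr_lp [simp]: "x \<in> lp \<Longrightarrow> restr F x \<in> lp"
  and nrm_restr: "x \<in> lp \<Longrightarrow> nrm (restr F x) \<le> nrm x"
  using lp_dom[of x 1 "restr F x"] by (auto simp: restr_def)

lemma nrm_restr_mono: "x \<in> lp \<Longrightarrow> F \<subseteq> G \<Longrightarrow> nrm (restr F x) \<le> nrm (restr G x)"
proof -
  assume "x \<in> lp" "F \<subseteq> G"
  then have "nrm (restr F x) \<le> 1 * nrm (restr G x)" by (intro lp_dom(2) restr_lp) (auto simp: restr_def)
  then show ?thesis by simp
qed

lemma nrm_finite_powr:
  assumes "finite F" "\<And>i. i \<notin> F \<Longrightarrow> x i = 0"
  shows "x \<in> lp" "nrm x powr p = (\<Sum>i\<in>F. norm (x i) powr p)"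
proof -
  let ?s = "\<Sum>i\<in>F. norm (x i) powr p"
  have b: "(\<Sum>i\<in>G. norm (x i) powr p) \<le> (?s powr (1/p)) powr p" if "finite G" for G
  proof -
    have "(\<Sum>i\<in>G. norm (x i) powr p) = (\<Sum>i\<in>G \<inter> F. norm (x i) powr p)"
      using that assms by (intro sum.mono_neutral_right) auto
    also have "\<dots> \<le> ?s" using assms by (intro sum_mono2) auto
    finally show ?thesis using p_pos by (simp add: powr_powr sum_nonneg)
  qed
  then show x: "x \<in> lp" using lp_nrm_bound[of "?s powr (1/p)" x] by auto
  have "nrm x \<le> ?s powr (1/p)" using b lp_nrm_bound[of "?s powr (1/p)" x] by auto
  then have "nrm x powr p \<le> (?s powr (1/p)) powr p" using p_pos by (intro powr_mono2) auto
  then show "nrm x powr p = ?s" using sum_le_nrm[OF x assms(1)] p_pos by (simp add: powr_powr sum_nonneg)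
qed

lemma fin_supp_lp: "finite F \<Longrightarrow> restr F x \<in> lp"
  by (rule nrm_finite_powr[of F]) (auto simp: restr_def)

lemma nrm_disjoint:
  assumes "finite A" "finite B" "A \<inter> B = {}" "\<And>i. i \<notin> A \<Longrightarrow> x i = 0" "\<And>i. i \<notin> B \<Longrightarrow> y i = 0"
  shows "nrm (x + y) powr p = nrm x powr p + nrm y powr p"
proof -
  have "nrm (x + y) powr p = (\<Sum>i\<in>A \<union> B. norm ((x + y) i) powr p)"
    using assms by (intro nrm_finite_powr) (auto simp: plus_fun_apply)
  also have "\<dots> = (\<Sum>i\<in>A. norm ((x + y) i) powr p) + (\<Sum>i\<in>B. norm ((x + y) i) powr p)"
    using assms by (intro sum.union_disjoint) auto
  also have "(\<Sum>i\<in>A. norm ((x + y) i) powr p) = (\<Sum>i\<in>A. norm (x i) powr p)"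
    using assms(3,5) by (intro sum.cong refl) (auto simp: disjoint_iff plus_fun_apply)
  also have "(\<Sum>i\<in>B. norm ((x + y) i) powr p) = (\<Sum>i\<in>B. norm (y i) powr p)"
  proof (intro sum.cong refl)
    fix i assume "i \<in> B"
    then have "x i = 0" using assms(3,4) by (auto simp: disjoint_iff)
    then show "norm ((x + y) i) powr p = norm (y i) powr p" by (simp add: plus_fun_apply)
  qed
  finally show ?thesis using assms nrm_finite_powr(2)[of A x] nrm_finite_powr(2)[of B y] by simp
qed

text \<open>A finite sum within \<open>\<epsilon> powr p\<close> of the supremum leaves at most that
  much for any finite set outside.\<close>

lemma lp_tail:
  assumes x: "x \<in> lp" and "0 < \<epsilon>"
  obtains F where "finite F" "nrm (restr (- F) x) \<le> \<epsilon>"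
proof -
  let ?S = "\<lambda>F. \<Sum>i\<in>F. norm (x i) powr p"
  let ?s = "SUP F\<in>{F. finite F}. ?S F"
  have bdd: "bdd_above (?S ` {F. finite F})" using assms(1) by (auto simp: lp_def bdd_above_def)
  have "?s - \<epsilon> powr p < ?s" using \<open>0 < \<epsilon>\<close> by simp
  then obtain F where F: "finite F" "?s - \<epsilon> powr p < ?S F"
    by (subst (asm) less_cSUP_iff) (use bdd in auto)
  have "(\<Sum>i\<in>G. norm (restr (- F) x i) powr p) \<le> \<epsilon> powr p" if G: "finite G" for G
  proof -
    have "?S (G - F) + ?S F = ?S (G \<union> F)" using F G
      by (subst sum.union_disjoint[symmetric]) (auto intro!: sum.cong)
    also have "\<dots> \<le> ?s" using F G bdd by (intro cSUP_upper) auto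
    finally have "?S (G - F) \<le> \<epsilon> powr p" using F by linarith
    moreover have "(\<Sum>i\<in>G. norm (restr (- F) x i) powr p) = ?S (G - F)"
      using G p_pos by (intro sum.mono_neutral_cong_right) (auto simp: restr_def)
    ultimately show ?thesis by simp
  qed
  then have "nrm (restr (- F) x) \<le> \<epsilon>" using \<open>0 < \<epsilon>\<close> by (intro lp_nrm_bound) auto
  with F that show ?thesis by blast
qed

lemma reindex_lp:
  assumes "inj g" "x \<in> lp"
  shows "(\<lambda>i. x (g i)) \<in> lp" "nrm (\<lambda>i. x (g i)) \<le> nrm x"
proof -
  have "(\<Sum>i\<in>F. norm (x (g i)) powr p) \<le> nrm x powr p" if "finite F" for F
  proof -
    have "(\<Sum>i\<in>F. norm (x (g i)) powr p) = (\<Sum>i\<in>g ` F. norm (x i) powr p)"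
      using assms by (subst sum.reindex) (auto intro: inj_on_subset)
    also have "\<dots> \<le> nrm x powr p" using assms that by (intro sum_le_nrm) auto
    finally show ?thesis .
  qed
  then show "(\<lambda>i. x (g i)) \<in> lp" "nrm (\<lambda>i. x (g i)) \<le> nrm x" by (auto intro!: lp_nrm_bound[of "nrm x"])
qed

text \<open>A Fatou property: each finite partial sum passes to the limit, and these determine the
  norm.\<close>

lemma nrm_pointwise_limit:
  assumes c: "0 \<le> c" and z: "\<And>n. z n \<in> lp" "\<And>n. nrm (z n) \<le> c" and lim: "\<And>i. (\<lambda>n. z n i) \<longlonglongrightarrow> y i"
  shows "y \<in> lp" "nrm y \<le> c"
proof -
  have "(\<Sum>i\<in>F. norm (y i) powr p) \<le> c powr p" if "finite F" for F
  proof (rule LIMSEQ_le_const2)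
    show "(\<lambda>n. \<Sum>i\<in>F. norm (z n i) powr p) \<longlonglongrightarrow> (\<Sum>i\<in>F. norm (y i) powr p)"
      using p_pos by (intro tendsto_sum tendsto_powr' tendsto_norm lim tendsto_const) auto
    have "(\<Sum>i\<in>F. norm (z n i) powr p) \<le> c powr p" for n
      using sum_le_nrm[OF z(1) that] powr_mono2[of p "nrm (z n)" c] z(2) p_pos
      by (meson less_imp_le nrm_nonneg order_trans)
    then show "\<exists>N. \<forall>n\<ge>N. (\<Sum>i\<in>F. norm (z n i) powr p) \<le> c powr p" by blast
  qed
  then show "y \<in> lp" "nrm y \<le> c" using c by (auto intro!: lp_nrm_bound)
qed

lemma lp_space_eq: "lp_space p = lp"
proof -
  have "summable (\<lambda>n. norm (x n) powr p) \<longleftrightarrow> x \<in> lp" for x :: seq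
  proof
    assume s: "summable (\<lambda>n. norm (x n) powr p)"
    have "(\<Sum>i\<in>F. norm (x i) powr p) \<le> (\<Sum>n. norm (x n) powr p)" if "finite F" for F
      using s that by (intro sum_le_suminf) auto
    then show "x \<in> lp" by (auto simp: lp_def)
  next
    assume "x \<in> lp"
    then obtain B where "\<And>F. finite F \<Longrightarrow> (\<Sum>i\<in>F. norm (x i) powr p) \<le> B" by (auto simp: lp_def)
    then show "summable (\<lambda>n. norm (x n) powr p)"
      by (intro bounded_imp_summable[of _ B]) auto
  qed
  then show ?thesis by (auto simp: lp_space_def)
qed

lemma lp_norm_eq: assumes "x \<in> lp" shows "lp_norm p x = nrm x"
proof -
  have s: "summable (\<lambda>n. norm (x n) powr p)" using assms lp_space_eq by (auto simp: lp_space_def)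
  let ?s = "\<Sum>n. norm (x n) powr p"
  have s0: "?s \<ge> 0" by (intro suminf_nonneg s) auto
  have "(\<Sum>i\<in>F. norm (x i) powr p) \<le> (?s powr (1/p)) powr p" if "finite F" for F
    using sum_le_suminf[OF s that] s0 p_pos by (simp add: powr_powr)
  then have "nrm x \<le> lp_norm p x" unfolding lp_norm_def by (intro lp_nrm_bound) auto
  moreover have "?s \<le> nrm x powr p"
    by (intro suminf_le_const s sum_le_nrm assms) auto
  then have "?s powr (1/p) \<le> (nrm x powr p) powr (1/p)" using s0 p_pos by (intro powr_mono2) auto
  then have "lp_norm p x \<le> nrm x" using p_pos by (simp add: lp_norm_def powr_powr)
  ultimately show ?thesis by simp
qed

end

section \<open>Bounded and compact operators\<close>

context lp_exponent
begin

text \<open>\<open>bounded_op\<close> with source and target over different index types, as the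
  dilations map sequences to families over triples.\<close>

definition blin :: "(('i \<Rightarrow> complex) \<Rightarrow> 'j \<Rightarrow> complex) \<Rightarrow> bool" where
  "blin T \<longleftrightarrow> (\<forall>x\<in>lp. T x \<in> lp) \<and>
     (\<forall>x\<in>lp. \<forall>y\<in>lp. \<forall>a b. T (\<lambda>n. a * x n + b * y n) = (\<lambda>n. a * T x n + b * T y n)) \<and>
     (\<exists>C. \<forall>x\<in>lp. nrm (T x) \<le> C * nrm x)"

text \<open>Compactness as approximability by finitely many output coordinates; on \<open>\<ell>\<^sup>p(\<nat>)\<close> this agrees with
  sequential compactness (\<open>compact_op_iff\<close>).\<close>

definition cpt :: "(('i \<Rightarrow> complex) \<Rightarrow> 'j \<Rightarrow> complex) \<Rightarrow> bool" where
  "cpt T \<longleftrightarrow> blin T \<and> (\<forall>\<epsilon>>0. \<exists>F. finite F \<and> (\<forall>x\<in>lp. nrm (restr (- F) (T x)) \<le> \<epsilon> * nrm x))"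

lemma nrm_split: "x = y + z \<Longrightarrow> y \<in> lp \<Longrightarrow> z \<in> lp \<Longrightarrow> nrm x \<le> nrm y + nrm z"
  using lp_add(2) by blast

lemma lin_comb_lp: "x \<in> lp \<Longrightarrow> y \<in> lp \<Longrightarrow> (\<lambda>n. a * x n + b * y n) \<in> lp"
  using lp_add(1)[OF nrm_scale(1)[of x a] nrm_scale(1)[of y b]] by (simp add: plus_fun_def)

lemma blinI:
  assumes "\<And>x. x \<in> lp \<Longrightarrow> T x \<in> lp" "\<And>x. x \<in> lp \<Longrightarrow> nrm (T x) \<le> C * nrm x"
    "\<And>x y a b. x \<in> lp \<Longrightarrow> y \<in> lp \<Longrightarrow> T (\<lambda>n. a * x n + b * y n) = (\<lambda>n. a * T x n + b * T y n)"
  shows "blin T"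
  using assms unfolding blin_def by blast

lemma blin_lp: "blin T \<Longrightarrow> x \<in> lp \<Longrightarrow> T x \<in> lp"
  by (simp add: blin_def)

lemma blin_lin: "blin T \<Longrightarrow> x \<in> lp \<Longrightarrow> y \<in> lp \<Longrightarrow>
    T (\<lambda>n. a * x n + b * y n) = (\<lambda>n. a * T x n + b * T y n)"
  by (simp add: blin_def)

lemma blin_add: "blin T \<Longrightarrow> x \<in> lp \<Longrightarrow> y \<in> lp \<Longrightarrow> T (x + y) = T x + T y"
  using blin_lin[of T x y 1 1] by (simp add: plus_fun_def)

lemma blin_diff: "blin T \<Longrightarrow> x \<in> lp \<Longrightarrow> y \<in> lp \<Longrightarrow> T (x - y) = T x - T y"
  using blin_lin[of T x y 1 "-1"] by (simp add: fun_diff_def)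

lemma blin_scale: "blin T \<Longrightarrow> x \<in> lp \<Longrightarrow> T (\<lambda>n. a * x n) = (\<lambda>n. a * T x n)"
  using blin_lin[of T x x a 0] by simp

lemma blin_0: "blin T \<Longrightarrow> T 0 = 0"
  using blin_scale[of T 0 0] by (simp add: zero_fun_def)

lemma sum_fun_apply: "(sum f A :: 'x \<Rightarrow> complex) i = (\<Sum>a\<in>A. f a i)"
  by (induction A rule: infinite_finite_induct) (auto simp: pointwise)

lemma restr_eq_sum: "finite F \<Longrightarrow> restr F y = (\<Sum>i\<in>F. restr {i} y)"
  by (rule ext) (auto simp: sum_fun_apply restr_def)

lemma blin_sum:
  assumes "blin T" "finite A" "\<And>a. a \<in> A \<Longrightarrow> f a \<in> lp"
  shows "T (\<Sum>a\<in>A. f a) = (\<Sum>a\<in>A. T (f a))"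
  using assms(2,3)
proof (induction A)
  case empty
  show ?case using blin_0[OF assms(1)] by simp
next
  case (insert b A)
  then have "T (f b + sum f A) = T (f b) + T (sum f A)"
    by (intro blin_add assms(1) lp_sum insert) auto
  then show ?case using insert by simp
qed

lemma blin_bound:
  assumes "blin T"
  obtains C where "0 < C" "\<And>x. x \<in> lp \<Longrightarrow> nrm (T x) \<le> C * nrm x"
proof -
  obtain C where C: "\<And>x. x \<in> lp \<Longrightarrow> nrm (T x) \<le> C * nrm x" using assms unfolding blin_def by blast
  have "nrm (T x) \<le> max C 1 * nrm x" if "x \<in> lp" for x
    using C[OF that] mult_right_mono[of C "max C 1" "nrm x"] by simp
  then show ?thesis using that[of "max C 1"] by simp
qed

lemma blin_cong:
  assumes "blin T" "\<And>x. x \<in> lp \<Longrightarrow> S x = T x"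
  shows "blin S"
proof -
  obtain C where "\<And>x. x \<in> lp \<Longrightarrow> nrm (T x) \<le> C * nrm x" using blin_bound[OF assms(1)] by metis
  then show ?thesis
    by (intro blinI[of S C]) (simp_all add: assms lin_comb_lp blin_lin[OF assms(1)] blin_lp[OF assms(1)])
qed

lemma cpt_blin: "cpt T \<Longrightarrow> blin T"
  by (simp add: cpt_def)

lemma cpt_cong:
  assumes "cpt T" "\<And>x. x \<in> lp \<Longrightarrow> S x = T x"
  shows "cpt S"
  unfolding cpt_def using assms blin_cong[OF cpt_blin[OF assms(1)] assms(2)] by (simp add: cpt_def)

lemma blin_id: "blin (\<lambda>x. x)"
  by (intro blinI[of _ 1]) auto

lemma blin_zero: "blin (\<lambda>x. 0)"
  by (intro blinI[of _ 1]) (auto simp: zero_fun_def[symmetric] pointwise)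

lemma blin_comp: assumes "blin S" "blin T" shows "blin (\<lambda>x. S (T x))"
proof -
  obtain C where C: "0 < C" "\<And>x. x \<in> lp \<Longrightarrow> nrm (S x) \<le> C * nrm x" using blin_bound[OF assms(1)] by metis
  obtain D where D: "0 < D" "\<And>x. x \<in> lp \<Longrightarrow> nrm (T x) \<le> D * nrm x" using blin_bound[OF assms(2)] by metis
  show ?thesis
  proof (rule blinI[of _ "C * D"])
    show "nrm (S (T x)) \<le> C * D * nrm x" if "x \<in> lp" for x
      using order_trans[OF C(2)[of "T x"] mult_left_mono[OF D(2)[OF that], of C]] C(1) blin_lp[OF assms(2) that]
      by (simp add: mult.assoc)
  qed (simp_all add: blin_lp[OF assms(1)] blin_lp[OF assms(2)] blin_lin[OF assms(1)] blin_lin[OF assms(2)])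
qed

lemma blin_plus: assumes "blin S" "blin T" shows "blin (\<lambda>x. S x + T x)"
proof -
  obtain C where C: "0 < C" "\<And>x. x \<in> lp \<Longrightarrow> nrm (S x) \<le> C * nrm x" using blin_bound[OF assms(1)] by metis
  obtain D where D: "0 < D" "\<And>x. x \<in> lp \<Longrightarrow> nrm (T x) \<le> D * nrm x" using blin_bound[OF assms(2)] by metis
  show ?thesis
  proof (rule blinI[of _ "C + D"])
    show "S x + T x \<in> lp" if "x \<in> lp" for x
      by (rule lp_add(1)[OF blin_lp[OF assms(1) that] blin_lp[OF assms(2) that]])
    show "nrm (S x + T x) \<le> (C + D) * nrm x" if "x \<in> lp" for x
      using C(2)[OF that] D(2)[OF that] lp_add(2)[OF blin_lp[OF assms(1) that] blin_lp[OF assms(2) that]]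
      by (simp add: distrib_right)
  qed (simp_all add: blin_lin[OF assms(1)] blin_lin[OF assms(2)] pointwise algebra_simps)
qed

lemma blin_smult: assumes "blin T" shows "blin (\<lambda>x j. a * T x j)"
proof -
  obtain D where D: "0 < D" "\<And>x. x \<in> lp \<Longrightarrow> nrm (T x) \<le> D * nrm x" using blin_bound[OF assms] by metis
  show ?thesis
  proof (rule blinI[of _ "norm a * D"])
    show "nrm (\<lambda>j. a * T x j) \<le> norm a * D * nrm x" if "x \<in> lp" for x
      using mult_left_mono[OF D(2)[OF that], of "norm a"] nrm_scale(2)[OF blin_lp[OF assms that], of a]
      by (simp add: mult.assoc)
  qed (simp_all add: blin_lin[OF assms] blin_lp[OF assms] pointwise algebra_simps nrm_scale)
qed

lemma blin_minus: assumes "blin S" "blin T" shows "blin (\<lambda>x. S x - T x)"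
  by (rule blin_cong[OF blin_plus[OF assms(1) blin_smult[OF assms(2), of "-1"]]]) (auto simp: pointwise)

lemma blin_setsum: assumes "finite A" "\<And>a. a \<in> A \<Longrightarrow> blin (T a)" shows "blin (\<lambda>x. \<Sum>a\<in>A. T a x)"
  using assms
proof (induction A)
  case empty then show ?case by (simp add: blin_zero)
next
  case (insert b A)
  have "blin (\<lambda>x. T b x + (\<Sum>a\<in>A. T a x))" by (intro blin_plus insert) (use insert in auto)
  then show ?case using insert.hyps by simp
qed

lemma blin_mult:
  fixes h :: "'i \<Rightarrow> complex"
  assumes "\<And>i. norm (h i) \<le> c"
  shows "blin (\<lambda>x. h * x)" and nrm_mult_le: "x \<in> lp \<Longrightarrow> nrm (h * x) \<le> c * nrm x"
proof -
  have "0 \<le> c" using assms[of undefined] norm_ge_zero order_trans by blast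
  then have *: "x \<in> lp \<Longrightarrow> h * x \<in> lp \<and> nrm (h * x) \<le> c * nrm x" for x
    using lp_dom[of x c "h * x"] assms by (auto simp: times_fun_apply norm_mult mult_right_mono)
  then show "blin (\<lambda>x. h * x)" by (intro blinI[of _ c]) (auto simp: pointwise algebra_simps)
  show "x \<in> lp \<Longrightarrow> nrm (h * x) \<le> c * nrm x" using * by blast
qed

lemma blin_restr: "blin (restr F)"
  by (intro blinI[of _ 1]) (auto simp: nrm_restr, auto simp: restr_def pointwise)

lemma blin_reindex: "inj g \<Longrightarrow> blin (\<lambda>x i. x (g i))"
  by (intro blinI[of _ 1]) (auto simp: reindex_lp)

lemma nrm_restr_compl_mono: "x \<in> lp \<Longrightarrow> F \<subseteq> G \<Longrightarrow> nrm (restr (- G) x) \<le> nrm (restr (- F) x)"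
  by (rule nrm_restr_mono) auto

section \<open>The norm closed ideal of compact operators\<close>

lemma cpt_zero: "cpt (\<lambda>x. 0)"
  by (auto simp: cpt_def blin_zero intro!: exI[of _ "{}"])

text \<open>Compact operators are norm closed. Many later compactness proofs exhibit a compact main
  part and a remainder of arbitrarily small norm.\<close>

lemma cptI_approx:
  assumes "blin T" "\<And>\<epsilon>. 0 < \<epsilon> \<Longrightarrow> \<exists>K. cpt K \<and> (\<forall>x\<in>lp. nrm (T x - K x) \<le> \<epsilon> * nrm x)"
  shows "cpt T"
  unfolding cpt_def
proof (intro conjI allI impI assms(1))
  fix \<epsilon> :: real assume "\<epsilon> > 0"
  then obtain K where K: "cpt K" "\<And>x. x \<in> lp \<Longrightarrow> nrm (T x - K x) \<le> \<epsilon> / 2 * nrm x" using assms(2)[of "\<epsilon>/2"] by auto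
  obtain F where F: "finite F" "\<And>x. x \<in> lp \<Longrightarrow> nrm (restr (- F) (K x)) \<le> \<epsilon> / 2 * nrm x"
    using K(1) \<open>\<epsilon> > 0\<close> unfolding cpt_def by (metis half_gt_zero)
  have "nrm (restr (- F) (T x)) \<le> \<epsilon> * nrm x" if x: "x \<in> lp" for x
  proof -
    have [simp]: "T x \<in> lp" "K x \<in> lp" by (rule blin_lp[OF assms(1) x], rule blin_lp[OF cpt_blin[OF K(1)] x])
    have "restr (- F) (T x) = restr (- F) (T x - K x) + restr (- F) (K x)" by simp
    then have "nrm (restr (- F) (T x)) \<le> nrm (restr (- F) (T x - K x)) + nrm (restr (- F) (K x))"
      by (rule nrm_split) (auto simp: lp_diff)
    also have "\<dots> \<le> \<epsilon> / 2 * nrm x + \<epsilon> / 2 * nrm x"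
      using nrm_restr[OF lp_diff(1), of "T x" "K x" "- F"] K(2)[OF x] F(2)[OF x] by simp
    finally show ?thesis by (simp add: field_simps)
  qed
  then show "\<exists>F. finite F \<and> (\<forall>x\<in>lp. nrm (restr (- F) (T x)) \<le> \<epsilon> * nrm x)" using F by blast
qed

lemma cpt_plus: assumes "cpt S" "cpt T" shows "cpt (\<lambda>x. S x + T x)"
  unfolding cpt_def
proof (intro conjI allI impI)
  show "blin (\<lambda>x. S x + T x)" by (intro blin_plus cpt_blin assms)
  fix \<epsilon> :: real assume e: "\<epsilon> > 0"
  obtain F where F: "finite F" "\<And>x. x \<in> lp \<Longrightarrow> nrm (restr (- F) (S x)) \<le> \<epsilon> / 2 * nrm x"
    using assms(1) e unfolding cpt_def by (metis half_gt_zero)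
  obtain G where G: "finite G" "\<And>x. x \<in> lp \<Longrightarrow> nrm (restr (- G) (T x)) \<le> \<epsilon> / 2 * nrm x"
    using assms(2) e unfolding cpt_def by (metis half_gt_zero)
  have "nrm (restr (- (F \<union> G)) (S x + T x)) \<le> \<epsilon> * nrm x" if x: "x \<in> lp" for x
  proof -
    have [simp]: "S x \<in> lp" "T x \<in> lp" by (rule blin_lp[OF assms(1)[THEN cpt_blin] x], rule blin_lp[OF assms(2)[THEN cpt_blin] x])
    have "nrm (restr (- (F \<union> G)) (S x + T x)) \<le> nrm (restr (- (F \<union> G)) (S x)) + nrm (restr (- (F \<union> G)) (T x))"
      unfolding restr_simps by (intro lp_add restr_lp) auto
    also have "\<dots> \<le> \<epsilon> / 2 * nrm x + \<epsilon> / 2 * nrm x"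
      using F(2)[OF x] G(2)[OF x] nrm_restr_compl_mono[of "S x" F "F \<union> G"] nrm_restr_compl_mono[of "T x" G "F \<union> G"] by simp
    finally show ?thesis by (simp add: field_simps)
  qed
  then show "\<exists>F. finite F \<and> (\<forall>x\<in>lp. nrm (restr (- F) (S x + T x)) \<le> \<epsilon> * nrm x)" using F G by blast
qed

lemma cpt_comp_right: assumes "cpt T" "blin S" shows "cpt (\<lambda>x. T (S x))"
  unfolding cpt_def
proof (intro conjI allI impI)
  show "blin (\<lambda>x. T (S x))" by (intro blin_comp[of T S] cpt_blin assms)
  fix \<epsilon> :: real assume e: "\<epsilon> > 0"
  obtain C where C: "0 < C" "\<And>x. x \<in> lp \<Longrightarrow> nrm (S x) \<le> C * nrm x" using blin_bound[OF assms(2)] by metis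
  obtain F where F: "finite F" "\<And>x. x \<in> lp \<Longrightarrow> nrm (restr (- F) (T x)) \<le> \<epsilon> / C * nrm x"
    using assms(1) e C unfolding cpt_def by (meson divide_pos_pos)
  have "nrm (restr (- F) (T (S x))) \<le> \<epsilon> * nrm x" if x: "x \<in> lp" for x
  proof -
    have "nrm (restr (- F) (T (S x))) \<le> \<epsilon> / C * nrm (S x)" using F blin_lp[OF assms(2) x] by auto
    also have "\<dots> \<le> \<epsilon> / C * (C * nrm x)" using C x e by (intro mult_left_mono) auto
    finally show ?thesis using C by simp
  qed
  then show "\<exists>F. finite F \<and> (\<forall>x\<in>lp. nrm (restr (- F) (T (S x))) \<le> \<epsilon> * nrm x)" using F by blast
qed

text \<open>The functional \<open>x i\<close> is bounded by \<open>norm_le_nrm\<close>, and the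
  output tails are those of the single vector \<open>z\<close>.\<close>

lemma cpt_rank_one:
  fixes z :: "'j \<Rightarrow> complex" and i :: 'i
  assumes "z \<in> lp" shows "cpt (\<lambda>x j. x i * z j)"
  unfolding cpt_def
proof (intro conjI allI impI)
  have b: "nrm (\<lambda>j. x i * w j) \<le> nrm w * nrm x" if "x \<in> lp" "w \<in> lp" for x :: "'i \<Rightarrow> complex" and w :: "'j \<Rightarrow> complex"
    using mult_left_mono[OF norm_le_nrm[OF that(1), of i], of "nrm w"] that nrm_scale(2)[OF that(2), of "x i"]
    by (simp add: mult.commute[of _ "nrm w"])
  show "blin (\<lambda>x j. x i * z j)"
    by (intro blinI[of _ "nrm z"] b assms) (auto simp: nrm_scale assms pointwise algebra_simps)
  fix \<epsilon> :: real assume e: "\<epsilon> > 0"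
  obtain F where F: "finite F" "nrm (restr (- F) z) \<le> \<epsilon>" using lp_tail[OF assms e] by metis
  have "nrm (restr (- F) (\<lambda>j. x i * z j)) \<le> \<epsilon> * nrm x" if "x \<in> lp" for x
    using b[OF that, of "restr (- F) z"] mult_right_mono[OF F(2), of "nrm x"] assms by simp
  then show "\<exists>F. finite F \<and> (\<forall>x\<in>lp. nrm (restr (- F) (\<lambda>j. x i * z j)) \<le> \<epsilon> * nrm x)" using F by blast
qed

text \<open>Peeling off one coordinate at a time writes the operator as a finite sum of rank-one
  operators, \<open>x i\<close> times the image of the \<open>i\<close>-th unit vector.\<close>

lemma cpt_comp_restr: assumes "finite F" "blin S" shows "cpt (\<lambda>x. S (restr F x))"
  using assms(1)
proof (induction F)
  case empty
  then show ?case using blin_0[OF assms(2)] by (simp add: cpt_zero)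
next
  case (insert i F)
  define e :: "'a \<Rightarrow> complex" where "e = (\<lambda>j. if j = i then 1 else 0)"
  have e: "e \<in> lp" using fin_supp_lp[of "{i}" e] by (simp add: e_def restr_def cong: if_cong)
  have "restr (insert i F) x = (\<lambda>j. x i * e j) + restr F x" for x
    using insert.hyps by (auto simp: restr_def e_def pointwise)
  then have eq: "S (restr (insert i F) x) = (\<lambda>j. x i * S e j) + S (restr F x)" if "x \<in> lp" for x
    using that e assms by (simp add: blin_add nrm_scale blin_scale)
  have "cpt (\<lambda>x. (\<lambda>j. x i * S e j) + S (restr F x))"
    by (intro cpt_plus cpt_rank_one insert blin_lp[OF assms(2) e])
  then show ?case by (rule cpt_cong) (use eq in auto)
qed

text \<open>\<open>S\<close> need not respect coordinate cut-offs, so the cut-off is inserted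
  between the factors: \<open>S (restr F (T x))\<close> is compact since it passes through finitely
  many coordinates, and it approximates \<open>S (T x)\<close> in norm.\<close>

lemma cpt_comp_left: assumes "blin S" "cpt T" shows "cpt (\<lambda>x. S (T x))"
proof (rule cptI_approx)
  show "blin (\<lambda>x. S (T x))" by (intro blin_comp[of S T] cpt_blin assms)
  fix \<epsilon> :: real assume e: "\<epsilon> > 0"
  obtain C where C: "0 < C" "\<And>x. x \<in> lp \<Longrightarrow> nrm (S x) \<le> C * nrm x" using blin_bound[OF assms(1)] by metis
  obtain F where F: "finite F" "\<And>x. x \<in> lp \<Longrightarrow> nrm (restr (- F) (T x)) \<le> \<epsilon> / C * nrm x"
    using assms(2) e C unfolding cpt_def by (meson divide_pos_pos)
  have "cpt (\<lambda>x. S (restr F (T x)))"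
    using cpt_comp_right[OF cpt_comp_restr[OF F(1) assms(1)] cpt_blin[OF assms(2)]] .
  moreover have "nrm (S (T x) - S (restr F (T x))) \<le> \<epsilon> * nrm x" if x: "x \<in> lp" for x
  proof -
    have [simp]: "T x \<in> lp" by (rule blin_lp[OF cpt_blin[OF assms(2)] x])
    have eq: "S (T x) - S (restr F (T x)) = S (restr (- F) (T x))" using assms by (simp add: restr_compl blin_diff[OF assms(1)])
    have "nrm (S (T x) - S (restr F (T x))) \<le> C * nrm (restr (- F) (T x))" unfolding eq by (intro C) auto
    also have "\<dots> \<le> C * (\<epsilon> / C * nrm x)" using F(2)[OF x] C(1) by (intro mult_left_mono) auto
    finally show ?thesis using C by simp
  qed
  ultimately show "\<exists>K. cpt K \<and> (\<forall>x\<in>lp. nrm (S (T x) - K x) \<le> \<epsilon> * nrm x)" by blast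
qed

lemma cpt_smult: "cpt T \<Longrightarrow> cpt (\<lambda>x j. a * T x j)"
  using cpt_comp_left[OF blin_smult[OF blin_id, of a]] .

lemma cpt_minus: assumes "cpt S" "cpt T" shows "cpt (\<lambda>x. S x - T x)"
  by (rule cpt_cong[OF cpt_plus[OF assms(1) cpt_smult[OF assms(2), of "-1"]]]) (auto simp: pointwise)

lemma cpt_setsum: assumes "finite A" "\<And>a. a \<in> A \<Longrightarrow> cpt (T a)" shows "cpt (\<lambda>x. \<Sum>a\<in>A. T a x)"
  using assms
proof (induction A)
  case empty then show ?case by (simp add: cpt_zero)
next
  case (insert b A)
  have "cpt (\<lambda>x. T b x + (\<Sum>a\<in>A. T a x))" by (intro cpt_plus insert) (use insert in auto)
  then show ?case using insert.hyps by simp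
qed

section \<open>Behaviour on input tails\<close>

lemma nrm_bound_fin_supp:
  assumes T: "blin T" and c: "0 \<le> c" and b: "\<And>F x. finite F \<Longrightarrow> x \<in> lp \<Longrightarrow> x = restr F x \<Longrightarrow> nrm (T x) \<le> c * nrm x"
    and x: "x \<in> lp"
  shows "nrm (T x) \<le> c * nrm x"
proof (rule field_le_epsilon)
  fix e :: real assume e: "e > 0"
  obtain C where C: "0 < C" "\<And>x. x \<in> lp \<Longrightarrow> nrm (T x) \<le> C * nrm x" using blin_bound[OF T] by metis
  obtain F where F: "finite F" "nrm (restr (- F) x) \<le> e / C" using lp_tail[OF x, of "e/C"] e C by auto
  have "T x = T (restr F x) + T (restr (- F) x)" using x by (simp add: restr_compl blin_diff[OF T])
  then have "nrm (T x) \<le> nrm (T (restr F x)) + nrm (T (restr (- F) x))"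
    using x by (auto intro!: nrm_split blin_lp[OF T])
  also have "\<dots> \<le> c * nrm (restr F x) + C * nrm (restr (- F) x)"
    using F(1) x by (intro add_mono b C) auto
  also have "\<dots> \<le> c * nrm x + C * (e / C)" using F C x c
    by (intro add_mono mult_left_mono nrm_restr) auto
  finally show "nrm (T x) \<le> c * nrm x + e" using C by simp
qed

text \<open>A gliding hump. If the functional \<open>T x i\<close> stayed above
  \<open>\<epsilon>\<close> on all tails, it would take values of real part at least
  \<open>\<epsilon>\<close> on arbitrarily many unit vectors with disjoint finite supports. The sum
  of \<open>m\<close> of them has norm at most \<open>m powr (1 / p)\<close> but value at least
  \<open>m * \<epsilon>\<close>, which is impossible for large \<open>m\<close> because
  \<open>p > 1\<close>.\<close>

lemma blin_coord_tail:
  assumes T: "blin T" and e: "0 < \<epsilon>"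
  obtains G where "finite G" "\<And>x. x \<in> lp \<Longrightarrow> norm (T (restr (- G) x) i) \<le> \<epsilon> * nrm x"
proof (rule ccontr)
  assume "\<not> thesis"
  with that have neg: "\<exists>x\<in>lp. norm (T (restr (- G) x) i) > \<epsilon> * nrm x" if "finite G" for G
    using that by (meson not_le)
  obtain C where C: "0 < C" "\<And>x. x \<in> lp \<Longrightarrow> nrm (T x) \<le> C * nrm x" using blin_bound[OF T] by metis
  have step: "\<exists>H w. finite H \<and> H \<inter> G = {} \<and> w = restr H w \<and> nrm w = 1 \<and> Re (T w i) \<ge> \<epsilon>" if G: "finite G" for G
  proof -
    obtain x where x: "x \<in> lp" "norm (T (restr (- G) x) i) > \<epsilon> * nrm x" using neg[OF G] by blast
    define d where "d = norm (T (restr (- G) x) i) - \<epsilon> * nrm x"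
    have d: "d > 0" using x by (simp add: d_def)
    \<comment> \<open>Truncation to a finite support loses at most half of the excess
      \<open>d\<close>.\<close>
    obtain F where F: "finite F" "nrm (restr (- F) x) \<le> d / (2 * C)" using lp_tail[OF x(1), of "d/(2*C)"] d C by auto
    define z where "z = restr (F - G) x"
    have z: "z \<in> lp" using x by (simp add: z_def)
    have "restr (- G) x = z + restr (- G) (restr (- F) x)" by (auto simp: z_def restr_def pointwise)
    then have "T (restr (- G) x) i = T z i + T (restr (- G) (restr (- F) x)) i"
      using blin_add[OF T z, of "restr (- G) (restr (- F) x)"] x by (simp add: plus_fun_apply)
    then have "norm (T (restr (- G) x) i) \<le> norm (T z i) + norm (T (restr (- G) (restr (- F) x)) i)"
      by (simp add: norm_triangle_ineq)
    also have "norm (T (restr (- G) (restr (- F) x)) i) \<le> nrm (T (restr (- G) (restr (- F) x)))"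
      using x by (intro norm_le_nrm blin_lp[OF T] restr_lp)
    also have "\<dots> \<le> C * nrm (restr (- G) (restr (- F) x))" using x by (intro C restr_lp) auto
    also have "\<dots> \<le> C * nrm (restr (- F) x)" using x C by (intro mult_left_mono nrm_restr restr_lp) auto
    also have "\<dots> \<le> C * (d / (2 * C))" using F C by (intro mult_left_mono) auto
    also have "\<dots> = d / 2" using C by simp
    finally have gt: "norm (T z i) > \<epsilon> * nrm x" using d by (simp add: d_def field_simps)
    have "nrm z \<le> nrm x" using x nrm_restr by (simp add: z_def)
    then have "\<epsilon> * nrm z \<le> \<epsilon> * nrm x" using e by simp
    then have Tz: "norm (T z i) > \<epsilon> * nrm z" using gt by linarith
    have n0: "norm (T z i) > 0" using Tz e by (meson less_le_trans mult_nonneg_nonneg nrm_nonneg less_imp_le not_le)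
    have nz: "nrm z > 0"
    proof (rule ccontr)
      assume "\<not> nrm z > 0"
      then have "nrm z = 0" using nrm_nonneg[of z] by linarith
      then have "z = 0" using nrm_eq_0 z by blast
      then show False using n0 blin_0[OF T] by (simp add: zero_fun_apply)
    qed
    \<comment> \<open>Dividing by the norm and rotating the phase makes the value of the functional
      real and positive.\<close>
    define c where "c = cnj (T z i) / (norm (T z i) * nrm z)"
    define w where "w = (\<lambda>k. c * z k)"
    have nc: "norm c = 1 / nrm z" using n0 nz by (simp add: c_def norm_divide norm_mult)
    have "nrm w = 1" using nc nz nrm_scale(2)[OF z, of c] by (simp add: w_def)
    moreover have "T w i = c * T z i" using blin_scale[OF T z] by (simp add: w_def)
    moreover have "c * T z i = of_real (norm (T z i) / nrm z)"
    proof -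
      have "c * T z i = (T z i * cnj (T z i)) / of_real (norm (T z i) * nrm z)" by (simp add: c_def)
      also have "\<dots> = of_real ((norm (T z i))\<^sup>2 / (norm (T z i) * nrm z))"
        by (simp only: complex_norm_square[symmetric] of_real_divide of_real_power)
      also have "(norm (T z i))\<^sup>2 / (norm (T z i) * nrm z) = norm (T z i) / nrm z"
        using n0 by (simp add: power2_eq_square)
      finally show ?thesis .
    qed
    moreover have "norm (T z i) / nrm z \<ge> \<epsilon>" using Tz nz by (simp add: field_simps)
    moreover have "w = restr (F - G) w" by (auto simp: w_def z_def restr_def pointwise)
    ultimately show ?thesis using F by (intro exI[of _ "F - G"] exI[of _ w]) auto
  qed
  have hump: "\<exists>H w. finite H \<and> w = restr H w \<and> nrm w powr p \<le> real m \<and> Re (T w i) \<ge> real m * \<epsilon>" for m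
  proof (induction m)
    case 0
    have "T 0 i = 0" unfolding blin_0[OF T] by (rule zero_fun_apply)
    then show ?case using p_pos by (intro exI[of _ "{}"] exI[of _ 0]) auto
  next
    case (Suc m)
    then obtain H w where w: "finite H" "w = restr H w" "nrm w powr p \<le> real m" "Re (T w i) \<ge> real m * \<epsilon>" by blast
    obtain H' w' where w': "finite H'" "H' \<inter> H = {}" "w' = restr H' w'" "nrm w' = 1" "Re (T w' i) \<ge> \<epsilon>"
      using step[OF w(1)] by blast
    have lpw: "w \<in> lp" "w' \<in> lp" using w w' fin_supp_lp by metis+
    have w0: "w i = 0" if "i \<notin> H" for i using w(2) that by (metis restr_def)
    have w0': "w' i = 0" if "i \<notin> H'" for i using w'(3) that by (metis restr_def)
    have "nrm (w + w') powr p = nrm w powr p + nrm w' powr p"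
      by (rule nrm_disjoint[OF w(1) w'(1) _ w0 w0']) (use w' in auto)
    moreover have "restr (H \<union> H') (w + w') = w + w'"
      using w0 w0' by (auto simp: restr_def pointwise)
    moreover have "Re (T (w + w') i) \<ge> real (Suc m) * \<epsilon>"
      using blin_add[OF T lpw] w w' by (simp add: plus_fun_apply algebra_simps)
    ultimately show ?case using w w' by (intro exI[of _ "H \<union> H'"] exI[of _ "w + w'"]) auto
  qed
  \<comment> \<open>The two estimates for the value give \<open>m powr (p - 1) \<le> K\<close>; the
    \<open>m\<close> chosen next violates this.\<close>
  define K where "K = (C / \<epsilon>) powr p"
  obtain m :: nat where m: "real m > K powr (1 / (p - 1))" using reals_Archimedean2 by blast
  obtain H w where w: "finite H" "w = restr H w" "nrm w powr p \<le> real m" "Re (T w i) \<ge> real m * \<epsilon>" using hump by blast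
  have lpw: "w \<in> lp" using w fin_supp_lp by metis
  have "real m * \<epsilon> \<le> norm (T w i)" using w(4) complex_Re_le_cmod order_trans by blast
  also have "\<dots> \<le> C * nrm w" using norm_le_nrm[OF blin_lp[OF T lpw], of i] C(2)[OF lpw] by simp
  finally have "(real m * \<epsilon>) powr p \<le> (C * nrm w) powr p" using e p_pos by (intro powr_mono2) auto
  also have "\<dots> \<le> C powr p * real m" using w C by (simp add: powr_mult)
  finally have "real m powr p \<le> K * real m"
    using e C by (simp add: K_def powr_mult powr_divide field_simps)
  moreover have m0: "real m > 0" using m by (meson le_less_trans powr_ge_zero)
  moreover have "real m powr p = real m powr (p - 1) * real m" using m0 powr_add[of "real m" "p - 1" 1] by simp
  ultimately have "real m powr (p - 1) \<le> K" by simp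
  moreover have "(K powr (1 / (p - 1))) powr (p - 1) < real m powr (p - 1)"
    using m p_gt_1 by (intro powr_less_mono2) auto
  then have "K < real m powr (p - 1)" using p_gt_1 by (simp add: powr_powr K_def)
  ultimately show False by simp
qed

text \<open>Up to a small error the output lives on a finite set \<open>F\<close>, and each
  coordinate in \<open>F\<close> is a bounded functional with small tails, so finitely many input
  sets suffice. For \<open>p = 1\<close> this fails: the sum functional times a fixed unit vector is
  compact and has norm one on every tail.\<close>

lemma cpt_tail_right:
  assumes T: "cpt T" and e: "0 < \<epsilon>"
  obtains G where "finite G" "\<And>x. x \<in> lp \<Longrightarrow> nrm (T (restr (- G) x)) \<le> \<epsilon> * nrm x"
proof -
  have bT: "blin T" using T cpt_blin by blast
  obtain F where F: "finite F" "\<And>x. x \<in> lp \<Longrightarrow> nrm (restr (- F) (T x)) \<le> \<epsilon> / 2 * nrm x"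
    using T e unfolding cpt_def by (metis half_gt_zero)
  \<comment> \<open>Half of \<open>\<epsilon>\<close> is shared among the coordinates in
    \<open>F\<close>; the \<open>1 +\<close> covers an empty \<open>F\<close>.\<close>
  define d where "d = \<epsilon> / (2 * (1 + real (card F)))"
  have d: "d > 0" using e by (simp add: d_def add_pos_nonneg)
  have "\<forall>i. \<exists>G. finite G \<and> (\<forall>x\<in>lp. norm (T (restr (- G) x) i) \<le> d * nrm x)"
    using blin_coord_tail[OF bT d] by metis
  then obtain G where G: "\<And>i. finite (G i)" "\<And>i x. x \<in> lp \<Longrightarrow> norm (T (restr (- G i) x) i) \<le> d * nrm x" by metis
  define H where "H = (\<Union>i\<in>F. G i)"
  have "nrm (T (restr (- H) x)) \<le> \<epsilon> * nrm x" if x: "x \<in> lp" for x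
  proof -
    have c: "norm (T (restr (- H) x) i) \<le> d * nrm x" if "i \<in> F" for i
    proof -
      have "- G i \<inter> - H = - H" using that by (auto simp: H_def)
      then have "restr (- H) x = restr (- G i) (restr (- H) x)" by simp
      then have "norm (T (restr (- H) x) i) \<le> d * nrm (restr (- H) x)" using G(2)[of "restr (- H) x" i] x by simp
      also have "\<dots> \<le> d * nrm x" using d nrm_restr[OF x] by simp
      finally show ?thesis .
    qed
    define y where "y = T (restr (- H) x)"
    have y: "y \<in> lp" using x by (simp add: y_def blin_lp[OF bT])
    have "nrm (restr F y) \<le> (\<Sum>i\<in>F. norm (y i))"
    proof -
      have "nrm (restr F y) \<le> (\<Sum>i\<in>F. nrm (restr {i} y))"
        unfolding restr_eq_sum[OF F(1)] by (rule lp_sum) (use F y in auto)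
      also have "\<dots> = (\<Sum>i\<in>F. norm (y i))"
      proof (rule sum.cong[OF refl])
        fix i
        have "nrm (restr {i} y) powr p = norm (y i) powr p"
          using nrm_finite_powr(2)[of "{i}" "restr {i} y"] by (simp add: restr_def)
        then have "(nrm (restr {i} y) powr p) powr (1/p) = (norm (y i) powr p) powr (1/p)" by simp
        then show "nrm (restr {i} y) = norm (y i)" using p_pos by (simp add: powr_powr)
      qed
      finally show ?thesis .
    qed
    also have "\<dots> \<le> (\<Sum>i\<in>F. d * nrm x)" using c by (intro sum_mono) (auto simp: y_def)
    also have "\<dots> \<le> \<epsilon> / 2 * nrm x"
    proof -
      have "real (card F) * d \<le> \<epsilon> / 2" using e by (simp add: d_def field_simps)
      then show ?thesis using mult_right_mono[of "real (card F) * d" "\<epsilon> / 2" "nrm x"] by (simp add: mult.assoc)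
    qed
    finally have 1: "nrm (restr F y) \<le> \<epsilon> / 2 * nrm x" .
    have 2: "nrm (restr (- F) y) \<le> \<epsilon> / 2 * nrm (restr (- H) x)" unfolding y_def using F(2) x by auto
    have "\<epsilon> / 2 * nrm (restr (- H) x) \<le> \<epsilon> / 2 * nrm x" using e nrm_restr[OF x] by simp
    moreover have "nrm (restr F y + restr (- F) y) \<le> nrm (restr F y) + nrm (restr (- F) y)" using y by (intro lp_add) auto
    moreover have "restr F y + restr (- F) y = y" by (simp add: restr_compl)
    ultimately show ?thesis using 1 2 by (simp add: y_def)
  qed
  moreover have "finite H" using F G by (auto simp: H_def)
  ultimately show ?thesis using that by blast
qed

section \<open>Agreement with the given notions of boundedness, compactness and norm\<close>

lemma bounded_op_iff: "bounded_op p T \<longleftrightarrow> blin T"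
proof -
  have "(\<exists>C. \<forall>x\<in>lp. lp_norm p (T x) \<le> C * lp_norm p x) \<longleftrightarrow> (\<exists>C. \<forall>x\<in>lp. nrm (T x) \<le> C * nrm x)"
    if "\<forall>x\<in>lp. T x \<in> lp"
    using that by (simp add: lp_norm_eq)
  then show ?thesis unfolding bounded_op_def blin_def lp_space_eq by blast
qed

lemma le_mult_trans: "(a::real) \<le> C * b \<Longrightarrow> b \<le> d \<Longrightarrow> 0 \<le> C \<Longrightarrow> a \<le> C * d"
  using mult_left_mono[of b d C] by linarith

text \<open>Bolzano-Weierstrass in each coordinate, combined diagonally: from index
  \<open>Suc k\<close> on, \<open>diagseq\<close> is a subsequence of one that converges in
  coordinate \<open>k\<close>.\<close>

lemma bounded_coordinates_subseq:
  fixes z :: "nat \<Rightarrow> nat \<Rightarrow> complex"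
  assumes "\<And>n k. norm (z n k) \<le> B"
  obtains r :: "nat \<Rightarrow> nat" and y where "strict_mono r" "\<And>k. (\<lambda>n. z (r n) k) \<longlonglongrightarrow> y k"
proof -
  interpret D: subseqs "\<lambda>k s. convergent (\<lambda>m. z (s m) k)"
  proof
    fix n and s :: "nat \<Rightarrow> nat"
    have "bounded (range (\<lambda>m. z (s m) n))" using assms by (auto simp: bounded_iff)
    then obtain l r where "strict_mono r" "((\<lambda>m. z (s m) n) \<circ> r) \<longlonglongrightarrow> l"
      using bounded_imp_convergent_subsequence by blast
    then show "\<exists>r'. strict_mono r' \<and> convergent (\<lambda>m. z ((s \<circ> r') m) n)"
      by (auto simp: convergent_def o_def)
  qed
  have "\<exists>l. (\<lambda>m. z (D.diagseq m) k) \<longlonglongrightarrow> l" for k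
  proof -
    have "convergent (\<lambda>m. z ((D.diagseq \<circ> ((+) (Suc k))) m) k)"
    proof (rule D.diagseq_holds)
      fix r s :: "nat \<Rightarrow> nat" and n
      assume "strict_mono r" "convergent (\<lambda>m. z (s m) n)"
      then show "convergent (\<lambda>m. z ((s \<circ> r) m) n)"
        using convergent_subseq_convergent[of "\<lambda>m. z (s m) n" r] by (simp add: o_def)
    qed
    then obtain l where "(\<lambda>m. z (D.diagseq (m + Suc k)) k) \<longlonglongrightarrow> l"
      by (auto simp: convergent_def o_def add.commute)
    then show ?thesis using LIMSEQ_offset[of "\<lambda>m. z (D.diagseq m) k"] by blast
  qed
  then obtain y where "\<And>k. (\<lambda>n. z (D.diagseq n) k) \<longlonglongrightarrow> y k" by metis
  with D.subseq_diagseq that show ?thesis by blast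
qed

lemma nrm_restr_le_sum: "finite F \<Longrightarrow> y \<in> lp \<Longrightarrow> nrm (restr F y) \<le> (\<Sum>i\<in>F. norm (y i))"
proof -
  assume F: "finite F" and y: "y \<in> lp"
  have "nrm (restr F y) \<le> (\<Sum>i\<in>F. nrm (restr {i} y))"
    unfolding restr_eq_sum[OF F] by (rule lp_sum) (use F y in auto)
  also have "\<dots> = (\<Sum>i\<in>F. norm (y i))"
  proof (rule sum.cong[OF refl])
    fix i
    have "nrm (restr {i} y) powr p = norm (y i) powr p"
      using nrm_finite_powr(2)[of "{i}" "restr {i} y"] by (simp add: restr_def)
    then have "(nrm (restr {i} y) powr p) powr (1/p) = (norm (y i) powr p) powr (1/p)" by simp
    then show "nrm (restr {i} y) = norm (y i)" using p_pos by (simp add: powr_powr)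
  qed
  finally show ?thesis .
qed

text \<open>A coordinatewise limit exists along a diagonal subsequence. \<open>cpt\<close> bounds
  the tails of the images uniformly, the limit inherits this bound by
  \<open>nrm_pointwise_limit\<close>, and on the remaining finitely many coordinates pointwise
  convergence is norm convergence.\<close>

lemma cpt_subseq:
  fixes T :: "('i \<Rightarrow> complex) \<Rightarrow> seq"
  assumes T: "cpt T" and xs: "\<And>n. xs n \<in> lp" "\<And>n. nrm (xs n) \<le> B"
  obtains r :: "nat \<Rightarrow> nat" and y where "strict_mono r" "y \<in> lp" "(\<lambda>n. nrm (T (xs (r n)) - y)) \<longlonglongrightarrow> 0"
proof -
  have bT: "blin T" using T cpt_blin by blast
  obtain C where C: "0 < C" "\<And>x. x \<in> lp \<Longrightarrow> nrm (T x) \<le> C * nrm x" using blin_bound[OF bT] by metis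
  define z where "z = (\<lambda>n. T (xs n))"
  have B: "0 \<le> B" using xs(2)[of 0] nrm_nonneg order_trans by blast
  have z: "z n \<in> lp" for n unfolding z_def by (rule blin_lp[OF bT xs(1)])
  have zb: "nrm (z n) \<le> C * B" for n
    using le_mult_trans[OF C(2)[OF xs(1)[of n]] xs(2)[of n]] C(1) by (simp add: z_def)
  have "norm (z n k) \<le> C * B" for n k using norm_le_nrm[OF z] zb order_trans by blast
  then obtain r :: "nat \<Rightarrow> nat" and y where r: "strict_mono r" and lim: "\<And>k. (\<lambda>n. z (r n) k) \<longlonglongrightarrow> y k"
    using bounded_coordinates_subseq[of z "C * B"] by metis
  have y: "y \<in> lp" by (rule nrm_pointwise_limit[of "C * B" "\<lambda>n. z (r n)"]) (use C B z zb lim in auto)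
  have "(\<lambda>n. nrm (z (r n) - y)) \<longlonglongrightarrow> 0"
  proof (rule LIMSEQ_I)
    fix e :: real assume e: "e > 0"
    define d where "d = e / (4 * (1 + B))"
    have d: "d > 0" "d * B \<le> e / 4" using e B by (auto simp: d_def field_simps)
    obtain F where F: "finite F" "\<And>x. x \<in> lp \<Longrightarrow> nrm (restr (- F) (T x)) \<le> d * nrm x"
      using T d unfolding cpt_def by metis
    have Fz: "nrm (restr (- F) (z n)) \<le> e / 4" for n
      using le_mult_trans[OF F(2)[OF xs(1)[of n]] xs(2)[of n]] d by (simp add: z_def)
    have Fy: "nrm (restr (- F) y) \<le> e / 4"
    proof (rule nrm_pointwise_limit(2)[of "e / 4" "\<lambda>n. restr (- F) (z (r n))"])
      show "(\<lambda>n. restr (- F) (z (r n)) i) \<longlonglongrightarrow> restr (- F) y i" for i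
        using lim[of i] by (simp add: restr_def)
    qed (use e z Fz in auto)
    have "(\<lambda>n. \<Sum>i\<in>F. norm ((z (r n) - y) i)) \<longlonglongrightarrow> (\<Sum>i\<in>F. 0)"
      using lim by (intro tendsto_sum) (auto simp: minus_apply LIM_zero_iff tendsto_norm_zero_iff)
    then have "(\<lambda>n. \<Sum>i\<in>F. norm ((z (r n) - y) i)) \<longlonglongrightarrow> 0" by simp
    then obtain N where N: "\<And>n. n \<ge> N \<Longrightarrow> norm ((\<Sum>i\<in>F. norm ((z (r n) - y) i)) - 0) < e / 4"
      using LIMSEQ_D[of _ 0 "e/4"] e by (metis divide_pos_pos zero_less_numeral)
    have "nrm (z (r n) - y) < e" if n: "n \<ge> N" for n
    proof -
      have zy: "z (r n) - y \<in> lp" using z y lp_diff by blast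
      have 1: "nrm (restr F (z (r n) - y)) < e / 4"
        using nrm_restr_le_sum[OF F(1) zy] N[OF n] by simp
      have "nrm (restr (- F) (z (r n)) - restr (- F) y) \<le> nrm (restr (- F) (z (r n))) + nrm (restr (- F) y)"
        using z y by (intro lp_diff) auto
      then have 2: "nrm (restr (- F) (z (r n) - y)) \<le> e / 2" using Fz[of "r n"] Fy by simp
      have "nrm (z (r n) - y) \<le> nrm (restr F (z (r n) - y)) + nrm (restr (- F) (z (r n) - y))"
        by (rule nrm_split) (use y z in \<open>auto simp: restr_compl lp_diff(1)\<close>)
      then show ?thesis using 1 2 e by linarith
    qed
    then show "\<exists>N. \<forall>n\<ge>N. norm (nrm (z (r n) - y) - 0) < e" by auto
  qed
  then show ?thesis using that[OF r y] by (simp add: z_def)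
qed

lemma restr_lessThan_tail:
  fixes y :: seq
  assumes "y \<in> lp"
  shows "(\<lambda>n. nrm (restr (- {..<n}) y)) \<longlonglongrightarrow> 0"
proof (rule LIMSEQ_I)
  fix e :: real assume "e > 0"
  then obtain F where F: "finite F" "nrm (restr (- F) y) \<le> e / 2" using lp_tail[OF assms, of "e/2"] by auto
  then obtain N where N: "F \<subseteq> {..<N}" using finite_nat_bounded by blast
  have "nrm (restr (- {..<n}) y) < e" if "n \<ge> N" for n
  proof -
    have "F \<subseteq> {..<n}" using N that by auto
    then have "nrm (restr (- {..<n}) y) \<le> nrm (restr (- F) y)" by (rule nrm_restr_compl_mono[OF assms])
    then show ?thesis using F \<open>e > 0\<close> by simp
  qed
  then show "\<exists>N. \<forall>n\<ge>N. norm (nrm (restr (- {..<n}) y) - 0) < e" by auto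
qed

text \<open>Sequential compactness forces uniform tails: otherwise there are vectors of norm one
  whose images keep norm above \<open>e\<close> beyond the \<open>n\<close>-th coordinate, while the
  tails of a limit of such images tend to zero. The converse is \<open>cpt_subseq\<close>.\<close>

lemma compact_op_iff: "compact_op p T \<longleftrightarrow> cpt T"
proof
  assume T: "compact_op p T"
  then have bT: "blin T" by (simp add: compact_op_def bounded_op_iff)
  show "cpt T" unfolding cpt_def
  proof (intro conjI bT allI impI, rule ccontr)
    fix e :: real assume e: "e > 0" and neg: "\<not> (\<exists>F. finite F \<and> (\<forall>x\<in>lp. nrm (restr (- F) (T x)) \<le> e * nrm x))"
    have "\<exists>x\<in>lp. nrm x \<le> 1 \<and> nrm (restr (- {..<n}) (T x)) > e" for n :: nat
    proof -
      obtain x where x: "x \<in> lp" "nrm (restr (- {..<n}) (T x)) > e * nrm x" using neg by (meson finite_lessThan not_le)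
      have "nrm x \<noteq> 0"
      proof
        assume "nrm x = 0"
        then have "x = 0" using nrm_eq_0 x by blast
        then show False using x(2) blin_0[OF bT] by simp
      qed
      then have pos: "nrm x > 0" using nrm_nonneg[of x] by linarith
      define w where "w = (\<lambda>k. complex_of_real (1 / nrm x) * x k)"
      have w: "w \<in> lp" "nrm w = 1" using nrm_scale[OF x(1), of "complex_of_real (1 / nrm x)"] pos by (auto simp: w_def norm_divide)
      have Tw: "T w = (\<lambda>k. complex_of_real (1 / nrm x) * T x k)" unfolding w_def by (rule blin_scale[OF bT x(1)])
      have "nrm (restr (- {..<n}) (T w)) = 1 / nrm x * nrm (restr (- {..<n}) (T x))"
        unfolding Tw restr_simps using nrm_scale(2)[of "restr (- {..<n}) (T x)" "complex_of_real (1 / nrm x)"] blin_lp[OF bT x(1)] pos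
        by (simp add: norm_divide)
      also have "\<dots> > e" using x(2) pos by (simp add: field_simps)
      finally show ?thesis using w by (intro bexI[of _ w]) auto
    qed
    then obtain xs where xs: "\<And>n. xs n \<in> lp" "\<And>n. nrm (xs n) \<le> 1" "\<And>n. nrm (restr (- {..<n}) (T (xs n))) > e" by metis
    have "(\<forall>n. xs n \<in> lp_space p) \<and> (\<exists>B. \<forall>n. lp_norm p (xs n) \<le> B)" using xs by (auto simp: lp_space_eq lp_norm_eq)
    then obtain r :: "nat \<Rightarrow> nat" and y where r: "strict_mono r" "y \<in> lp_space p" "(\<lambda>n. lp_norm p (\<lambda>k. T (xs (r n)) k - y k)) \<longlonglongrightarrow> 0"
      using T unfolding compact_op_def by blast
    have y: "y \<in> lp" using r by (simp add: lp_space_eq)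
    have Txs: "T (xs n) \<in> lp" for n by (rule blin_lp[OF bT xs(1)])
    have "lp_norm p (\<lambda>k. T (xs (r n)) k - y k) = nrm (T (xs (r n)) - y)" for n
      using lp_norm_eq[OF lp_diff(1)[OF Txs y]] by (simp add: fun_diff_def)
    then have l1: "(\<lambda>n. nrm (T (xs (r n)) - y)) \<longlonglongrightarrow> 0" using r(3) by simp
    have l2: "(\<lambda>n. nrm (restr (- {..<r n}) y)) \<longlonglongrightarrow> 0"
      using LIMSEQ_subseq_LIMSEQ[OF restr_lessThan_tail[OF y] r(1)] by (simp add: o_def)
    have "(\<lambda>n. nrm (T (xs (r n)) - y) + nrm (restr (- {..<r n}) y)) \<longlonglongrightarrow> 0" using tendsto_add[OF l1 l2] by simp
    then obtain n where n: "nrm (T (xs (r n)) - y) + nrm (restr (- {..<r n}) y) < e"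
      using LIMSEQ_D[of _ 0 e] e by fastforce
    let ?R = "restr (- {..<r n})"
    have "nrm (?R (T (xs (r n)))) \<le> nrm (?R (T (xs (r n)) - y)) + nrm (?R y)"
      by (rule nrm_split) (auto simp: lp_diff(1) Txs y)
    also have "nrm (?R (T (xs (r n)) - y)) \<le> nrm (T (xs (r n)) - y)" by (intro nrm_restr lp_diff Txs y)
    finally show False using n xs(3)[of "r n"] by simp
  qed
next
  assume T: "cpt T"
  then have bT: "blin T" by (rule cpt_blin)
  show "compact_op p T" unfolding compact_op_def
  proof (intro conjI allI impI)
    show "bounded_op p T" using bT by (simp add: bounded_op_iff)
    fix xs :: "nat \<Rightarrow> seq"
    assume "(\<forall>n. xs n \<in> lp_space p) \<and> (\<exists>B. \<forall>n. lp_norm p (xs n) \<le> B)"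
    then obtain B where xs: "\<And>n. xs n \<in> lp" and "\<And>n. lp_norm p (xs n) \<le> B" unfolding lp_space_eq by blast
    then have xsB: "\<And>n. nrm (xs n) \<le> B" by (simp add: lp_norm_eq)
    obtain r :: "nat \<Rightarrow> nat" and y where ry: "strict_mono r" "y \<in> lp" "(\<lambda>n. nrm (T (xs (r n)) - y)) \<longlonglongrightarrow> 0"
      by (rule cpt_subseq[OF T xs xsB])
    have Txs: "T (xs n) \<in> lp" for n by (rule blin_lp[OF bT xs(1)])
    have "lp_norm p (\<lambda>k. T (xs (r n)) k - y k) = nrm (T (xs (r n)) - y)" for n
      using lp_norm_eq[OF lp_diff(1)[OF Txs ry(2)]] by (simp add: fun_diff_def)
    then show "\<exists>(r::nat \<Rightarrow> nat) y. strict_mono r \<and> y \<in> lp_space p \<and> (\<lambda>n. lp_norm p (\<lambda>k. T (xs (r n)) k - y k)) \<longlonglongrightarrow> 0"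
      using ry by (intro exI[of _ r] exI[of _ y]) (simp add: lp_space_eq)
  qed
qed

lemma mod_compact_iff: "mod_compact p T S \<longleftrightarrow> cpt (\<lambda>x. T x - S x)"
  by (simp add: mod_compact_def compact_op_iff fun_diff_def)

lemma op_norm_bound:
  assumes "blin T" "x \<in> lp"
  shows "nrm (T x) \<le> op_norm p T * nrm x"
proof -
  let ?S = "{lp_norm p (T x) | x. x \<in> lp_space p \<and> lp_norm p x \<le> 1}"
  obtain C where C: "0 < C" "\<And>x. x \<in> lp \<Longrightarrow> nrm (T x) \<le> C * nrm x" using blin_bound[OF assms(1)] by metis
  have "nrm (T y) \<le> C" if "y \<in> lp" "nrm y \<le> 1" for y
    using le_mult_trans[OF C(2)[OF that(1)] that(2)] C(1) by simp
  then have bdd: "bdd_above ?S"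
    by (intro bdd_aboveI[of _ C]) (auto simp: lp_space_eq lp_norm_eq blin_lp[OF assms(1)])
  show ?thesis
  proof (cases "nrm x = 0")
    case True
    then have "x = 0" using nrm_eq_0 assms by blast
    then show ?thesis using blin_0[OF assms(1)] by simp
  next
    case False
    then have pos: "nrm x > 0" using nrm_nonneg[of x] by linarith
    define w where "w = (\<lambda>k. complex_of_real (1 / nrm x) * x k)"
    have w: "w \<in> lp" "nrm w = 1" using nrm_scale[OF assms(2), of "complex_of_real (1 / nrm x)"] pos by (auto simp: w_def norm_divide)
    have Tw: "T w = (\<lambda>k. complex_of_real (1 / nrm x) * T x k)" unfolding w_def by (rule blin_scale[OF assms])
    have "nrm (T w) \<in> ?S" using w blin_lp[OF assms(1)] by (auto simp: lp_space_eq lp_norm_eq intro!: exI[of _ w])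
    then have "nrm (T w) \<le> op_norm p T" unfolding op_norm_def using bdd by (rule cSup_upper)
    moreover have "nrm (T w) = nrm (T x) / nrm x"
      unfolding Tw using nrm_scale(2)[OF blin_lp[OF assms], of "complex_of_real (1 / nrm x)"] pos by (simp add: norm_divide)
    ultimately show ?thesis using pos by (simp add: field_simps)
  qed
qed

lemma op_norm_le:
  assumes "0 \<le> c" "blin T" "\<And>x. x \<in> lp \<Longrightarrow> nrm (T x) \<le> c * nrm x"
  shows "op_norm p T \<le> c"
  unfolding op_norm_def
proof (rule cSup_least)
  have "lp_norm p (T 0) \<in> {lp_norm p (T x) | x. x \<in> lp_space p \<and> lp_norm p x \<le> 1}"
    by (auto simp: lp_space_eq lp_norm_eq intro!: exI[of _ 0])
  then show "{lp_norm p (T x) | x. x \<in> lp_space p \<and> lp_norm p x \<le> 1} \<noteq> {}" by blast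
  fix v assume "v \<in> {lp_norm p (T x) | x. x \<in> lp_space p \<and> lp_norm p x \<le> 1}"
  then obtain x where x: "x \<in> lp" "nrm x \<le> 1" "v = nrm (T x)"
    by (auto simp: lp_space_eq lp_norm_eq blin_lp[OF assms(2)])
  then show "v \<le> c" using le_mult_trans[OF assms(3)[OF x(1)] x(2) assms(1)] by simp
qed

lemma op_norm_nonneg: "blin T \<Longrightarrow> 0 \<le> op_norm p T"
proof -
  assume T: "blin T"
  \<comment> \<open>A nonzero vector is needed to read off the sign of
    \<open>op_norm\<close>.\<close>
  define e :: seq where "e = (\<lambda>i. if i = 0 then 1 else 0)"
  have e: "e \<in> lp" "nrm e powr p = 1" using nrm_finite_powr[of "{0}" e] by (auto simp: e_def)
  then have "nrm e \<noteq> 0" using p_pos by auto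
  then have "nrm e > 0" using nrm_nonneg[of e] by linarith
  moreover have "0 \<le> op_norm p T * nrm e" using op_norm_bound[OF T e(1)] nrm_nonneg order_trans by blast
  ultimately show ?thesis by (simp add: zero_le_mult_iff)
qed

text \<open>An essential norm bound realised by one explicit correction. The infimum in
  \<open>ess_norm\<close> is not known to be attained, which is why \<open>ess_norm_less\<close>
  starts from a strict inequality.\<close>

definition ess_bdd :: "(('i \<Rightarrow> complex) \<Rightarrow> 'j \<Rightarrow> complex) \<Rightarrow> real \<Rightarrow> bool" where
  "ess_bdd T c \<longleftrightarrow> (\<exists>K. cpt K \<and> (\<forall>x\<in>lp. nrm (T x + K x) \<le> c * nrm x))"

lemma ess_norm_alt: "ess_norm p T = Inf {op_norm p (\<lambda>x. T x + K x) | K. cpt K}"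
  by (simp add: ess_norm_def compact_op_iff plus_fun_def)

lemma ess_norm_le: assumes "blin T" "0 \<le> c" "ess_bdd T c" shows "ess_norm p T \<le> c"
proof -
  obtain K where K: "cpt K" "\<And>x. x \<in> lp \<Longrightarrow> nrm (T x + K x) \<le> c * nrm x" using assms(3) unfolding ess_bdd_def by blast
  have "op_norm p (\<lambda>x. T x + K x) \<in> {op_norm p (\<lambda>x. T x + K x) | K. cpt K}" using K by blast
  moreover have "bdd_below {op_norm p (\<lambda>x. T x + K x) | K. cpt K}"
    unfolding bdd_below_def using op_norm_nonneg[OF blin_plus[OF assms(1) cpt_blin]] by blast
  ultimately have "ess_norm p T \<le> op_norm p (\<lambda>x. T x + K x)" unfolding ess_norm_alt by (rule cInf_lower)
  also have "\<dots> \<le> c" by (rule op_norm_le[OF assms(2) blin_plus[OF assms(1) cpt_blin[OF K(1)]] K(2)])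
  finally show ?thesis .
qed

lemma ess_norm_less: assumes "blin T" "ess_norm p T < c" shows "ess_bdd T c"
proof -
  have ne: "{op_norm p (\<lambda>x. T x + K x) | K. cpt K} \<noteq> {}" using cpt_zero by blast
  obtain K where K: "cpt K" "op_norm p (\<lambda>x. T x + K x) < c"
    using cInf_lessD[OF ne assms(2)[unfolded ess_norm_alt]] by blast
  have "nrm (T x + K x) \<le> c * nrm x" if "x \<in> lp" for x
    using op_norm_bound[OF blin_plus[OF assms(1) cpt_blin[OF K(1)]] that] mult_right_mono[of _ c "nrm x"] K(2)
    by (meson less_imp_le nrm_nonneg order_trans)
  then show ?thesis using K(1) unfolding ess_bdd_def by blast
qed

lemma ess_norm_ge: assumes "blin T" "\<And>K. cpt K \<Longrightarrow> c \<le> op_norm p (\<lambda>x. T x + K x)"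
  shows "c \<le> ess_norm p T"
  unfolding ess_norm_alt
proof (rule cInf_greatest)
  show "{op_norm p (\<lambda>x. T x + K x) | K. cpt K} \<noteq> {}" using cpt_zero by blast
qed (use assms in auto)

end

section \<open>Quasicentral cut-offs\<close>

definition mulr :: "('i \<Rightarrow> real) \<Rightarrow> ('i \<Rightarrow> complex) \<Rightarrow> 'i \<Rightarrow> complex" where
  "mulr h x = (\<lambda>k. complex_of_real (h k) * x k)"

lemma mulr_add: "mulr h (x + y) = mulr h x + mulr h y"
  by (auto simp: mulr_def pointwise algebra_simps)

lemma mulr_minus: "mulr h (x - y) = mulr h x - mulr h y"
  by (auto simp: mulr_def pointwise algebra_simps)

context lp_exponent
begin

lemma blin_mulr:
  fixes h :: "'i \<Rightarrow> real"
  assumes "\<And>k. \<bar>h k\<bar> \<le> 1"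
  shows "blin (mulr h)" "x \<in> lp \<Longrightarrow> nrm (mulr h x) \<le> nrm x" "x \<in> lp \<Longrightarrow> mulr h x \<in> lp"
proof -
  have eq: "mulr h = (\<lambda>x. (\<lambda>k. complex_of_real (h k)) * x)" by (auto simp: mulr_def pointwise)
  have *: "norm (complex_of_real (h k)) \<le> 1" for k using assms by simp
  show b: "blin (mulr h)" unfolding eq by (rule blin_mult[OF *])
  show "x \<in> lp \<Longrightarrow> nrm (mulr h x) \<le> nrm x" unfolding eq using nrm_mult_le[OF *, of x] by simp
  show "x \<in> lp \<Longrightarrow> mulr h x \<in> lp" by (rule blin_lp[OF b])
qed

lemma cpt_restr: "finite F \<Longrightarrow> cpt (restr F)"
  using cpt_comp_restr[OF _ blin_id] by blast

lemma cpt_mulr: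
  assumes "\<And>k. \<bar>h k\<bar> \<le> 1" "finite {k. h k \<noteq> 0}"
  shows "cpt (mulr h)"
proof -
  have "cpt (\<lambda>x. mulr h (restr {k. h k \<noteq> 0} x))"
    by (rule cpt_comp_restr[OF assms(2) blin_mulr(1)[OF assms(1)]])
  moreover have "mulr h (restr {k. h k \<noteq> 0} x) = mulr h x" for x
    by (auto simp: mulr_def restr_def pointwise)
  ultimately show ?thesis by simp
qed

lemma nrm_block_sum:
  assumes "finite A" "\<And>n. n \<in> A \<Longrightarrow> finite (B n)" "\<And>m n. m \<in> A \<Longrightarrow> n \<in> A \<Longrightarrow> m \<noteq> n \<Longrightarrow> B m \<inter> B n = {}"
    and "\<And>n i. n \<in> A \<Longrightarrow> i \<notin> B n \<Longrightarrow> y n i = 0"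
  shows "nrm (\<Sum>n\<in>A. y n) powr p = (\<Sum>n\<in>A. nrm (y n) powr p)"
  using assms
proof (induction A)
  case empty
  then show ?case using p_pos by simp
next
  case (insert m A)
  have "nrm (y m + (\<Sum>n\<in>A. y n)) powr p = nrm (y m) powr p + nrm (\<Sum>n\<in>A. y n) powr p"
  proof (rule nrm_disjoint[of "B m" "\<Union>n\<in>A. B n"])
    show "B m \<inter> (\<Union>n\<in>A. B n) = {}" using insert by fastforce
    show "(\<Sum>n\<in>A. y n) i = 0" if "i \<notin> (\<Union>n\<in>A. B n)" for i
      unfolding sum_fun_apply using insert.prems that by (intro sum.neutral) auto
  qed (use insert in auto)
  also have "nrm (\<Sum>n\<in>A. y n) powr p = (\<Sum>n\<in>A. nrm (y n) powr p)" using insert by auto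
  finally show ?case using insert.hyps by simp
qed

text \<open>The p-th powers of norms add over disjoint blocks on the input and on the output side,
  so the bound \<open>C\<close> does not grow with the number of blocks.\<close>

lemma block_diagonal_bound:
  fixes B' :: "'n \<Rightarrow> 'i set" and B :: "'n \<Rightarrow> 'j set"
  assumes T: "blin T" and C: "0 \<le> C" "\<And>x. x \<in> lp \<Longrightarrow> nrm (T x) \<le> C * nrm x"
    and A: "finite A"
    and B: "\<And>n. n \<in> A \<Longrightarrow> finite (B n)" "\<And>m n. m \<in> A \<Longrightarrow> n \<in> A \<Longrightarrow> m \<noteq> n \<Longrightarrow> B m \<inter> B n = {}"
    and B': "\<And>n. n \<in> A \<Longrightarrow> finite (B' n)" "\<And>m n. m \<in> A \<Longrightarrow> n \<in> A \<Longrightarrow> m \<noteq> n \<Longrightarrow> B' m \<inter> B' n = {}"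
    and x: "x \<in> lp"
  shows "nrm (\<Sum>n\<in>A. restr (B n) (T (restr (B' n) x))) \<le> C * nrm x"
proof -
  have "nrm (\<Sum>n\<in>A. restr (B n) (T (restr (B' n) x))) powr p = (\<Sum>n\<in>A. nrm (restr (B n) (T (restr (B' n) x))) powr p)"
    by (rule nrm_block_sum[of A B]) (use A B in \<open>auto simp: restr_def\<close>)
  also have "\<dots> \<le> (\<Sum>n\<in>A. (C * nrm (restr (B' n) x)) powr p)"
  proof (intro sum_mono powr_mono2)
    fix n
    have Tx: "T (restr (B' n) x) \<in> lp" using x by (intro blin_lp[OF T]) auto
    show "nrm (restr (B n) (T (restr (B' n) x))) \<le> C * nrm (restr (B' n) x)"
      using order_trans[OF nrm_restr[OF Tx] C(2)] x by auto
  qed (use p_pos in auto)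
  also have "\<dots> = C powr p * (\<Sum>n\<in>A. nrm (restr (B' n) x) powr p)"
    using C by (simp add: powr_mult sum_distrib_left)
  also have "(\<Sum>n\<in>A. nrm (restr (B' n) x) powr p) = nrm (\<Sum>n\<in>A. restr (B' n) x) powr p"
    by (rule nrm_block_sum[of A B', symmetric]) (use A B' in \<open>auto simp: restr_def\<close>)
  also have "(\<Sum>n\<in>A. restr (B' n) x) = restr (\<Union>n\<in>A. B' n) x"
  proof (rule ext)
    fix i
    show "(\<Sum>n\<in>A. restr (B' n) x) i = restr (\<Union>n\<in>A. B' n) x i"
    proof (cases "\<exists>n\<in>A. i \<in> B' n")
      case True
      then obtain n where n: "n \<in> A" "i \<in> B' n" by blast
      have "(\<Sum>m\<in>A. restr (B' m) x i) = (\<Sum>m\<in>A. if m = n then x i else 0)"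
        by (rule sum.cong[OF refl]) (use n B' in \<open>auto simp: restr_def disjoint_iff\<close>)
      then show ?thesis using n A by (auto simp: sum_fun_apply restr_def)
    next
      case False
      then have "(\<Sum>m\<in>A. restr (B' m) x i) = 0" by (intro sum.neutral) (auto simp: restr_def)
      then show ?thesis using False by (auto simp: sum_fun_apply restr_def)
    qed
  qed
  also have "C powr p * nrm (restr (\<Union>n\<in>A. B' n) x) powr p \<le> C powr p * nrm x powr p"
    using x p_pos by (intro mult_left_mono powr_mono2 nrm_restr) auto
  also have "\<dots> = (C * nrm x) powr p" using C by (simp add: powr_mult)
  finally have "nrm (\<Sum>n\<in>A. restr (B n) (T (restr (B' n) x))) powr p \<le> (C * nrm x) powr p" .
  then show ?thesis
    using powr_less_mono2[of p "C * nrm x" "nrm (\<Sum>n\<in>A. restr (B n) (T (restr (B' n) x)))"] p_pos C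
    by (meson mult_nonneg_nonneg not_le nrm_nonneg)
qed

text \<open>Beyond \<open>k'\<close> the operators neither send anything noticeable from the first
  \<open>k\<close> coordinates nor feed anything noticeable into them: cutting \<open>T i\<close> to
  finitely many coordinates on either side gives a compact operator, whose tails are small.\<close>

lemma next_block:
  fixes T :: "'t \<Rightarrow> seq \<Rightarrow> seq"
  assumes I: "finite I" and T: "\<And>i. i \<in> I \<Longrightarrow> blin (T i)" and d: "0 < \<delta>"
  shows "\<exists>k'>k. \<forall>i\<in>I. \<forall>x\<in>lp. nrm (restr (- {..<k'}) (T i (restr {..<k} x))) \<le> \<delta> * nrm x \<and>
      nrm (restr {..<k} (T i (restr (- {..<k'}) x))) \<le> \<delta> * nrm x"
proof -
  have "\<exists>F. finite F \<and> (\<forall>x\<in>lp. nrm (restr (- F) (T i (restr {..<k} x))) \<le> \<delta> * nrm x) \<and>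
      (\<forall>x\<in>lp. nrm (restr {..<k} (T i (restr (- F) x))) \<le> \<delta> * nrm x)" if i: "i \<in> I" for i
  proof -
    have "cpt (\<lambda>x. T i (restr {..<k} x))" by (rule cpt_comp_restr[OF _ T[OF i]]) auto
    then obtain F where F: "finite F" "\<And>x. x \<in> lp \<Longrightarrow> nrm (restr (- F) (T i (restr {..<k} x))) \<le> \<delta> * nrm x"
      using d unfolding cpt_def by metis
    have c: "cpt (\<lambda>x. restr {..<k} (T i x))" by (rule cpt_comp_right[OF cpt_restr T[OF i]]) auto
    obtain G where G: "finite G" "\<And>x. x \<in> lp \<Longrightarrow> nrm (restr {..<k} (T i (restr (- G) x))) \<le> \<delta> * nrm x"
      using cpt_tail_right[OF c d] by metis
    have "nrm (restr (- (F \<union> G)) (T i (restr {..<k} x))) \<le> \<delta> * nrm x" if x: "x \<in> lp" for x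
    proof -
      have "T i (restr {..<k} x) \<in> lp" using x by (intro blin_lp[OF T[OF i]]) auto
      then have "nrm (restr (- (F \<union> G)) (T i (restr {..<k} x))) \<le> nrm (restr (- F) (T i (restr {..<k} x)))"
        by (rule nrm_restr_compl_mono) auto
      then show ?thesis using F(2)[OF x] by linarith
    qed
    moreover have "nrm (restr {..<k} (T i (restr (- (F \<union> G)) x))) \<le> \<delta> * nrm x" if x: "x \<in> lp" for x
    proof -
      have eq: "- G \<inter> - (F \<union> G) = - (F \<union> G)" by auto
      have "nrm (restr {..<k} (T i (restr (- G) (restr (- (F \<union> G)) x)))) \<le> \<delta> * nrm (restr (- (F \<union> G)) x)"
        using x by (intro G) auto
      then show ?thesis unfolding restr_simps(5) eq using le_mult_trans[OF _ nrm_restr[OF x]] d by auto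
    qed
    ultimately show ?thesis using F G by (intro exI[of _ "F \<union> G"]) auto
  qed
  then obtain F where F: "\<And>i. i \<in> I \<Longrightarrow> finite (F i)"
      "\<And>i x. i \<in> I \<Longrightarrow> x \<in> lp \<Longrightarrow> nrm (restr (- F i) (T i (restr {..<k} x))) \<le> \<delta> * nrm x"
      "\<And>i x. i \<in> I \<Longrightarrow> x \<in> lp \<Longrightarrow> nrm (restr {..<k} (T i (restr (- F i) x))) \<le> \<delta> * nrm x" by metis
  have "finite (\<Union>i\<in>I. F i)" using I F by auto
  then obtain k0 where k0: "(\<Union>i\<in>I. F i) \<subseteq> {..<k0}" using finite_nat_bounded by blast
  define k' where "k' = max k0 (Suc k)"
  have sub: "F i \<subseteq> {..<k'}" if "i \<in> I" for i using k0 that by (fastforce simp: k'_def)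
  have "nrm (restr (- {..<k'}) (T i (restr {..<k} x))) \<le> \<delta> * nrm x \<and>
      nrm (restr {..<k} (T i (restr (- {..<k'}) x))) \<le> \<delta> * nrm x" if i: "i \<in> I" and x: "x \<in> lp" for i x
  proof
    have "T i (restr {..<k} x) \<in> lp" using x by (intro blin_lp[OF T[OF i]]) auto
    then have "nrm (restr (- {..<k'}) (T i (restr {..<k} x))) \<le> nrm (restr (- F i) (T i (restr {..<k} x)))"
      by (rule nrm_restr_compl_mono[OF _ sub[OF i]])
    then show "nrm (restr (- {..<k'}) (T i (restr {..<k} x))) \<le> \<delta> * nrm x" using F(2)[OF i x] by linarith
    have eq: "- F i \<inter> - {..<k'} = - {..<k'}" using sub[OF i] by auto
    have "nrm (restr {..<k} (T i (restr (- F i) (restr (- {..<k'}) x)))) \<le> \<delta> * nrm (restr (- {..<k'}) x)"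
      using x by (intro F(3) i) auto
    then show "nrm (restr {..<k} (T i (restr (- {..<k'}) x))) \<le> \<delta> * nrm x"
      unfolding restr_simps(5) eq using le_mult_trans[OF _ nrm_restr[OF x]] d by auto
  qed
  then show ?thesis by (intro exI[of _ k']) (auto simp: k'_def)
qed

text \<open>The commutator of \<open>T\<close> with the average of \<open>m\<close> coordinate projections splits, up to small errors, into two
  block diagonal parts divided by \<open>m\<close>.\<close>

lemma quasicentral:
  fixes T :: "'t \<Rightarrow> seq \<Rightarrow> seq"
  assumes I: "finite I" and T: "\<And>i. i \<in> I \<Longrightarrow> blin (T i)" and e: "0 < \<epsilon>"
  obtains h :: "nat \<Rightarrow> real" where "\<And>k. 0 \<le> h k" "\<And>k. h k \<le> 1" "\<And>k. k < N \<Longrightarrow> h k = 1" "finite {k. h k \<noteq> 0}"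
    "\<And>i x. i \<in> I \<Longrightarrow> x \<in> lp \<Longrightarrow> nrm (T i (mulr h x) - mulr h (T i x)) \<le> \<epsilon> * nrm x"
proof -
  \<comment> \<open>Four error terms of size \<open>\<delta>\<close> will add up to
    \<open>\<epsilon> / 2\<close>.\<close>
  define \<delta> where "\<delta> = \<epsilon> / 8"
  have d: "\<delta> > 0" using e by (simp add: \<delta>_def)
  have "\<forall>k. \<exists>k'>k. \<forall>i\<in>I. \<forall>x\<in>lp. nrm (restr (- {..<k'}) (T i (restr {..<k} x))) \<le> \<delta> * nrm x \<and>
      nrm (restr {..<k} (T i (restr (- {..<k'}) x))) \<le> \<delta> * nrm x"
    by (intro allI next_block I T d)
  then obtain g where g: "\<And>k. g k > k"
    "\<And>k i x. i \<in> I \<Longrightarrow> x \<in> lp \<Longrightarrow> nrm (restr (- {..<g k}) (T i (restr {..<k} x))) \<le> \<delta> * nrm x"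
    "\<And>k i x. i \<in> I \<Longrightarrow> x \<in> lp \<Longrightarrow> nrm (restr {..<k} (T i (restr (- {..<g k}) x))) \<le> \<delta> * nrm x" by metis
  \<comment> \<open>Iterating the choice makes every \<open>T i\<close> nearly block tridiagonal for
    the blocks between consecutive \<open>b n\<close>.\<close>
  define b where "b = (\<lambda>n. (g ^^ n) N)"
  have b0: "b 0 = N" and bS: "b (Suc n) = g (b n)" for n by (auto simp: b_def)
  have bmono: "strict_mono b" by (rule strict_monoI_Suc) (simp add: bS g)
  have ble: "m \<le> n \<Longrightarrow> b m \<le> b n" for m n using bmono by (simp add: strict_mono_less_eq)
  have "\<forall>i\<in>I. \<exists>C>0. \<forall>x\<in>lp. nrm (T i x) \<le> C * nrm x" using blin_bound[OF T] by metis
  then obtain C where C: "\<And>i. i \<in> I \<Longrightarrow> C i > 0" "\<And>i x. i \<in> I \<Longrightarrow> x \<in> lp \<Longrightarrow> nrm (T i x) \<le> C i * nrm x" by metis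
  define D where "D = 1 + (\<Sum>i\<in>I. C i)"
  have D: "0 < D" "nrm (T i x) \<le> D * nrm x" if "i \<in> I" "x \<in> lp" for i x
  proof -
    have "0 \<le> (\<Sum>i\<in>I. C i)" using C by (intro sum_nonneg) (auto simp: less_imp_le)
    then show "0 < D" by (simp add: D_def)
    have "C i \<le> (\<Sum>i\<in>I. C i)" using that I C by (intro member_le_sum) (auto simp: less_imp_le)
    then have "C i * nrm x \<le> D * nrm x" by (intro mult_right_mono) (auto simp: D_def)
    then show "nrm (T i x) \<le> D * nrm x" using C(2)[OF that] by linarith
  qed
  \<comment> \<open>The two block diagonal parts together contribute \<open>2 * D / m\<close>, at
    most half of \<open>\<epsilon>\<close>.\<close>
  obtain m0 :: nat where m0: "real m0 > 4 * D / \<epsilon>" using reals_Archimedean2 by blast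
  define m where "m = Suc m0"
  have m: "m > 0" "4 * D \<le> \<epsilon> * real m" using m0 e by (auto simp: m_def field_simps)
  define h where "h = (\<lambda>k. (\<Sum>n=1..m. if k < b n then 1 else 0 :: real) / real m)"
  show ?thesis
  proof (rule that[of h])
    show "0 \<le> h k" for k unfolding h_def by (intro divide_nonneg_nonneg sum_nonneg) auto
    show "h k \<le> 1" for k
    proof -
      have "(\<Sum>n=1..m. if k < b n then 1 else 0 :: real) \<le> (\<Sum>n=1..m. 1)" by (intro sum_mono) auto
      then show ?thesis using m by (simp add: h_def)
    qed
    show "h k = 1" if "k < N" for k
    proof -
      have "k < b n" for n using ble[of 0 n] b0 that by simp
      then show ?thesis using m by (simp add: h_def)
    qed
    have "{k. h k \<noteq> 0} \<subseteq> {..<b m}"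
    proof
      fix k assume "k \<in> {k. h k \<noteq> 0}"
      then obtain n where "n \<in> {1..m}" "k < b n"
        unfolding h_def by (auto elim!: sum.not_neutral_contains_not_neutral split: if_splits)
      then show "k \<in> {..<b m}" using ble[of n m] by auto
    qed
    then show "finite {k. h k \<noteq> 0}" using finite_subset by blast
    fix i and x :: seq assume i: "i \<in> I" and x: "x \<in> lp"
    let ?T = "T i"
    have bT: "blin ?T" using T i by blast
    define P where "P = (\<lambda>n. restr {..<b n})"
    define Q where "Q = (\<lambda>n. restr {b n..<b (Suc n)})"
    have Plp: "y \<in> lp \<Longrightarrow> P n y \<in> lp" and Qlp: "y \<in> lp \<Longrightarrow> Q n y \<in> lp" for n y by (auto simp: P_def Q_def)
    have Tlp: "y \<in> lp \<Longrightarrow> ?T y \<in> lp" for y by (rule blin_lp[OF bT])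
    define E where "E = (\<lambda>n. restr (- {..<b (Suc n)}) (?T (P n x)) + Q n (?T (P (n - 1) x))
       - P n (?T (restr (- {..<b (Suc n)}) x)) - P (n - 1) (?T (Q n x)))"
    \<comment> \<open>Only the passage between the two blocks adjacent to \<open>b n\<close>
      survives in the commutator with \<open>P n\<close>; everything else is collected in
      \<open>E n\<close>.\<close>
    have comm: "?T (P n x) - P n (?T x) = Q n (?T (Q (n - 1) x)) - Q (n - 1) (?T (Q n x)) + E n" if n: "n \<ge> 1" for n
    proof -
      have le: "b (n - 1) \<le> b n" "b n \<le> b (Suc n)" by (auto intro: ble)
      have sn: "Suc (n - 1) = n" using n by simp
      have 1: "P n x = P (n - 1) x + Q (n - 1) x" using le sn by (auto simp: P_def Q_def restr_def pointwise)
      have 2: "x = P n x + Q n x + restr (- {..<b (Suc n)}) x" using le by (auto simp: P_def Q_def restr_def pointwise)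
      have 3: "y = P n y + Q n y + restr (- {..<b (Suc n)}) y" for y :: seq using le by (auto simp: P_def Q_def restr_def pointwise)
      have 4: "P n y = P (n - 1) y + Q (n - 1) y" for y :: seq using le sn by (auto simp: P_def Q_def restr_def pointwise)
      have T1: "?T (P n x) = ?T (P (n - 1) x) + ?T (Q (n - 1) x)"
        by (subst 1) (intro blin_add[OF bT] Plp Qlp x)
      have T2: "?T x = ?T (P n x) + ?T (Q n x) + ?T (restr (- {..<b (Suc n)}) x)"
        by (subst 2) (simp add: blin_add[OF bT] Plp Qlp x lp_add)
      have Qadd: "Q n (y + z) = Q n y + Q n z" for y z by (simp add: Q_def)
      have Padd: "P n (y + z) = P n y + P n z" for y z by (simp add: P_def)
      have "?T (P n x) - P n (?T x) = (P n (?T (P n x)) + Q n (?T (P n x)) + restr (- {..<b (Suc n)}) (?T (P n x)))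
          - (P n (?T (P n x)) + P n (?T (Q n x)) + P n (?T (restr (- {..<b (Suc n)}) x)))"
        using 3[of "?T (P n x)"] T2 Padd by metis
      also have "\<dots> = Q n (?T (P n x)) + restr (- {..<b (Suc n)}) (?T (P n x)) - P n (?T (Q n x)) - P n (?T (restr (- {..<b (Suc n)}) x))"
        by (simp add: algebra_simps)
      also have "Q n (?T (P n x)) = Q n (?T (P (n - 1) x)) + Q n (?T (Q (n - 1) x))" by (simp only: T1 Qadd)
      also have "P n (?T (Q n x)) = P (n - 1) (?T (Q n x)) + Q (n - 1) (?T (Q n x))" by (rule 4)
      finally show ?thesis by (simp add: E_def algebra_simps)
    qed
    have Elp: "E n \<in> lp" and En: "nrm (E n) \<le> 4 * \<delta> * nrm x" if n: "n \<ge> 1" for n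
    proof -
      have sn: "b n = g (b (n - 1))" using bS[of "n - 1"] n by simp
      have eQ: "Q n y = Q n (restr (- {..<b n}) y)" for y :: seq by (auto simp: Q_def restr_def pointwise)
      have e1: "nrm (restr (- {..<b (Suc n)}) (?T (P n x))) \<le> \<delta> * nrm x" unfolding bS P_def by (rule g(2)[OF i x])
      have "nrm (Q n (restr (- {..<b n}) (?T (P (n - 1) x)))) \<le> nrm (restr (- {..<b n}) (?T (P (n - 1) x)))"
        unfolding Q_def by (intro nrm_restr restr_lp Tlp Plp x)
      then have "nrm (Q n (?T (P (n - 1) x))) \<le> nrm (restr (- {..<b n}) (?T (P (n - 1) x)))"
        unfolding eQ[symmetric] .
      also have "\<dots> \<le> \<delta> * nrm x" unfolding sn P_def by (rule g(2)[OF i x])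
      finally have e2: "nrm (Q n (?T (P (n - 1) x))) \<le> \<delta> * nrm x" .
      have e3: "nrm (P n (?T (restr (- {..<b (Suc n)}) x))) \<le> \<delta> * nrm x" unfolding bS P_def by (rule g(3)[OF i x])
      have "nrm (P (n - 1) (?T (restr (- {..<b n}) (Q n x)))) \<le> \<delta> * nrm (Q n x)" unfolding sn P_def by (intro g(3)[OF i] Qlp x)
      moreover have "restr (- {..<b n}) (Q n x) = Q n x" by (auto simp: Q_def restr_def pointwise)
      moreover have "nrm (Q n x) \<le> nrm x" using nrm_restr x by (simp add: Q_def)
      ultimately have e4: "nrm (P (n - 1) (?T (Q n x))) \<le> \<delta> * nrm x" using le_mult_trans d by (metis less_imp_le)
      have l: "restr (- {..<b (Suc n)}) (?T (P n x)) \<in> lp" "Q n (?T (P (n - 1) x)) \<in> lp"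
        "P n (?T (restr (- {..<b (Suc n)}) x)) \<in> lp" "P (n - 1) (?T (Q n x)) \<in> lp"
        by (intro Plp Qlp Tlp restr_lp x)+
      show "E n \<in> lp" unfolding E_def by (intro lp_diff(1) lp_add(1) l)
      have "nrm (E n) \<le> nrm (restr (- {..<b (Suc n)}) (?T (P n x))) + nrm (Q n (?T (P (n - 1) x)))
        + nrm (P n (?T (restr (- {..<b (Suc n)}) x))) + nrm (P (n - 1) (?T (Q n x)))"
        unfolding E_def by (intro order_trans[OF lp_diff(2)] order_trans[OF lp_add(2)] add_right_mono lp_diff(1) lp_add l order_refl)
      then show "nrm (E n) \<le> 4 * \<delta> * nrm x" using e1 e2 e3 e4 by linarith
    qed
    define Y where "Y = (\<Sum>n=1..m. Q n (?T (Q (n - 1) x)))"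
    define Z where "Z = (\<Sum>n=1..m. Q (n - 1) (?T (Q n x)))"
    define W where "W = (\<Sum>n=1..m. E n)"
    have disj: "{b n..<b (Suc n)} \<inter> {b n'..<b (Suc n')} = {}" if "n \<noteq> n'" for n n'
    proof -
      have "Suc n \<le> n' \<or> Suc n' \<le> n" using that by linarith
      then show ?thesis using ble[of "Suc n" n'] ble[of "Suc n'" n] by auto
    qed
    have disj': "{b (n - 1)..<b (Suc (n - 1))} \<inter> {b (n' - 1)..<b (Suc (n' - 1))} = {}"
      if "n \<in> {1..m}" "n' \<in> {1..m}" "n \<noteq> n'" for n n'
      using that by (intro disj) auto
    have D0: "0 \<le> D" using D[OF i x] by simp
    have Yb: "nrm Y \<le> D * nrm x" unfolding Y_def Q_def
      by (rule block_diagonal_bound[OF bT D0 D(2)[OF i] _ _ disj _ disj' x]) auto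
    have Zb: "nrm Z \<le> D * nrm x" unfolding Z_def Q_def
      by (rule block_diagonal_bound[OF bT D0 D(2)[OF i] _ _ disj' _ disj x]) auto
    have Wb: "nrm W \<le> real m * (4 * \<delta> * nrm x)"
    proof -
      have "nrm W \<le> (\<Sum>n=1..m. nrm (E n))" unfolding W_def by (intro lp_sum Elp) auto
      also have "\<dots> \<le> (\<Sum>n=1..m. 4 * \<delta> * nrm x)" by (intro sum_mono En) auto
      finally show ?thesis by simp
    qed
    have YZW: "Y \<in> lp" "Z \<in> lp" "W \<in> lp" unfolding Y_def Z_def W_def by (auto intro!: lp_sum Qlp Tlp x Elp)
    have hy: "mulr h y = (\<lambda>k. complex_of_real (1 / real m) * (\<Sum>n=1..m. P n y) k)" for y
    proof
      fix k
      have "complex_of_real (\<Sum>n=1..m. if k < b n then 1 else 0 :: real) * y k = (\<Sum>n=1..m. P n y k)"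
        unfolding of_real_sum sum_distrib_right by (intro sum.cong refl) (auto simp: P_def restr_def)
      then show "mulr h y k = complex_of_real (1 / real m) * (\<Sum>n=1..m. P n y) k"
        by (simp add: mulr_def h_def sum_fun_apply)
    qed
    have "?T (mulr h x) = (\<lambda>k. complex_of_real (1 / real m) * (\<Sum>n=1..m. ?T (P n x)) k)"
    proof -
      have l: "(\<Sum>n=1..m. P n x) \<in> lp" by (intro lp_sum Plp x) auto
      have "?T (\<Sum>n=1..m. P n x) = (\<Sum>n=1..m. ?T (P n x))" by (intro blin_sum[OF bT] Plp x) auto
      then show ?thesis unfolding hy by (simp only: blin_scale[OF bT l])
    qed
    then have "?T (mulr h x) - mulr h (?T x) = (\<lambda>k. complex_of_real (1 / real m) * ((\<Sum>n=1..m. ?T (P n x)) - (\<Sum>n=1..m. P n (?T x))) k)"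
      unfolding hy by (simp add: pointwise right_diff_distrib)
    also have "(\<Sum>n=1..m. ?T (P n x)) - (\<Sum>n=1..m. P n (?T x)) = Y - Z + W"
      unfolding sum_subtractf[symmetric] Y_def Z_def W_def sum.distrib[symmetric]
      by (rule sum.cong[OF refl]) (use comm in auto)
    finally have eq: "?T (mulr h x) - mulr h (?T x) = (\<lambda>k. complex_of_real (1 / real m) * (Y - Z + W) k)" .
    have l: "Y - Z + W \<in> lp" using YZW by (intro lp_add(1) lp_diff(1))
    have "nrm (Y - Z + W) \<le> nrm Y + nrm Z + nrm W"
      using lp_add(2)[OF lp_diff(1)[OF YZW(1,2)] YZW(3)] lp_diff(2)[OF YZW(1,2)] by linarith
    also have "\<dots> \<le> D * nrm x + D * nrm x + real m * (4 * \<delta> * nrm x)" using Yb Zb Wb by linarith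
    also have "\<dots> \<le> \<epsilon> * real m * nrm x"
      using mult_right_mono[OF m(2), of "nrm x"] by (simp add: \<delta>_def algebra_simps)
    finally have "nrm (Y - Z + W) \<le> \<epsilon> * real m * nrm x" .
    then have "1 / real m * nrm (Y - Z + W) \<le> \<epsilon> * nrm x" using m by (simp add: field_simps)
    then show "nrm (?T (mulr h x) - mulr h (?T x)) \<le> \<epsilon> * nrm x" unfolding eq nrm_scale(2)[OF l] by (simp add: norm_divide)
  qed
qed

text \<open>Dependent choice: each cut-off is requested to be 1 on the finite support of the one
  before, so that differences of cut-offs have controlled overlap.\<close>

lemma quasicentral_sequence:
  fixes T :: "'t \<Rightarrow> seq \<Rightarrow> seq" and N :: "nat \<Rightarrow> nat" and \<epsilon> :: "nat \<Rightarrow> real"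
  assumes I: "finite I" and T: "\<And>i. i \<in> I \<Longrightarrow> blin (T i)" and e: "\<And>s. 0 < \<epsilon> s"
  obtains h :: "nat \<Rightarrow> nat \<Rightarrow> real" where "\<And>s k. 0 \<le> h s k" "\<And>s k. h s k \<le> 1" "\<And>s k. k < N s \<Longrightarrow> h s k = 1"
    "\<And>s. finite {k. h s k \<noteq> 0}"
    "\<And>s i x. i \<in> I \<Longrightarrow> x \<in> lp \<Longrightarrow> nrm (T i (mulr (h s) x) - mulr (h s) (T i x)) \<le> \<epsilon> s * nrm x"
    "\<And>s k. h s k \<noteq> 0 \<Longrightarrow> h (Suc s) k = 1"
proof -
  define P where "P = (\<lambda>s (h :: nat \<Rightarrow> real). (\<forall>k. 0 \<le> h k \<and> h k \<le> 1) \<and> (\<forall>k<N s. h k = 1) \<and>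
     finite {k. h k \<noteq> 0} \<and> (\<forall>i\<in>I. \<forall>x\<in>lp. nrm (T i (mulr h x) - mulr h (T i x)) \<le> \<epsilon> s * nrm x))"
  have ex: "\<exists>h. P s h \<and> (\<forall>k<M. h k = 1)" for s M
  proof (rule quasicentral[OF I T e[of s], where N = "max M (N s)"])
    fix h :: "nat \<Rightarrow> real"
    assume "\<And>k. 0 \<le> h k" "\<And>k. h k \<le> 1" "\<And>k. k < max M (N s) \<Longrightarrow> h k = 1" "finite {k. h k \<noteq> 0}"
      "\<And>i x. i \<in> I \<Longrightarrow> x \<in> lp \<Longrightarrow> nrm (T i (mulr h x) - mulr h (T i x)) \<le> \<epsilon> s * nrm x"
    then show ?thesis unfolding P_def by (intro exI[of _ h]) simp
  qed
  have "\<exists>h. \<forall>s. P s (h s) \<and> (\<forall>k. h s k \<noteq> 0 \<longrightarrow> h (Suc s) k = 1)"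
  proof (rule dependent_nat_choice)
    show "\<exists>h. P 0 h" using ex by blast
    fix g :: "nat \<Rightarrow> real" and s assume "P s g"
    then have "finite {k. g k \<noteq> 0}" by (simp add: P_def)
    then obtain M where "{k. g k \<noteq> 0} \<subseteq> {..<M}" using finite_nat_bounded by blast
    then show "\<exists>h. P (Suc s) h \<and> (\<forall>k. g k \<noteq> 0 \<longrightarrow> h k = 1)" using ex[of "Suc s" M] by blast
  qed
  then obtain h where h: "\<And>s. P s (h s)" "\<And>s k. h s k \<noteq> 0 \<Longrightarrow> h (Suc s) k = 1" by blast
  show ?thesis by (rule that[of h]) (use h in \<open>simp_all add: P_def\<close>)
qed

end

section \<open>Assembling operators from slices\<close>

definition stack :: "('a \<Rightarrow> ('i \<Rightarrow> complex) \<Rightarrow> 'k \<Rightarrow> complex) \<Rightarrow> ('i \<Rightarrow> complex) \<Rightarrow> 'a \<times> 'k \<Rightarrow> complex" where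
  "stack X x = (\<lambda>(a, k). X a x k)"

text \<open>The counterpart of \<open>stack\<close>: a sum of operators whose values live on sets
  that cover each coordinate finitely often. Making these sets an argument keeps every coordinate a
  finite sum although infinitely many levels take part.\<close>

definition glue :: "('s \<Rightarrow> 'k set) \<Rightarrow> ('s \<Rightarrow> 'y \<Rightarrow> 'k \<Rightarrow> complex) \<Rightarrow> 'y \<Rightarrow> 'k \<Rightarrow> complex" where
  "glue S B y = (\<lambda>k. \<Sum>s\<in>{s. k \<in> S s}. B s y k)"

definition slice :: "'a \<Rightarrow> ('a \<times> 'k \<Rightarrow> complex) \<Rightarrow> 'k \<Rightarrow> complex" where
  "slice a y = (\<lambda>k. y (a, k))"

definition embed :: "'a \<Rightarrow> ('k \<Rightarrow> complex) \<Rightarrow> 'a \<times> 'k \<Rightarrow> complex" where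
  "embed a z = (\<lambda>(b, k). if b = a then z k else 0)"

lemma slice_stack [simp]: "slice a (stack X x) = X a x"
  by (simp add: slice_def stack_def)

lemma slice_embed: "slice a (embed b z) = (if a = b then z else 0)"
  by (auto simp: slice_def embed_def pointwise)

context lp_exponent
begin

lemma powr_le_iff: "0 \<le> a \<Longrightarrow> 0 \<le> b \<Longrightarrow> a powr p \<le> b powr p \<longleftrightarrow> a \<le> b"
  using powr_mono2[of p a b] powr_less_mono2[of p b a] p_pos by (meson not_le less_imp_le)

lemma nrm_powr_approx:
  assumes "x \<in> lp" "0 < e"
  obtains F where "finite F" "nrm x powr p \<le> (\<Sum>i\<in>F. norm (x i) powr p) + e"
proof -
  let ?S = "\<lambda>F. \<Sum>i\<in>F. norm (x i) powr p"
  let ?s = "SUP F\<in>{F. finite F}. ?S F"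
  have bdd: "bdd_above (?S ` {F. finite F})" using assms(1) by (auto simp: lp_def bdd_above_def)
  have "?s - e < ?s" using \<open>0 < e\<close> by simp
  then obtain F where F: "finite F" "?s - e < ?S F"
    by (subst (asm) less_cSUP_iff) (use bdd in auto)
  have "?S {} \<le> ?s" using bdd by (intro cSUP_upper) auto
  then have "nrm x powr p = ?s" using p_pos by (simp add: nrm_def powr_powr)
  then show ?thesis using F that[of F] by linarith
qed

lemma blin_slice: "blin (slice a)" and slice_lp: "y \<in> lp \<Longrightarrow> slice a y \<in> lp"
proof -
  have i: "inj (Pair a)" by (auto simp: inj_def)
  show b: "blin (slice a)" unfolding slice_def by (rule blin_reindex[OF i])
  show "y \<in> lp \<Longrightarrow> slice a y \<in> lp" by (rule blin_lp[OF b])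
qed

lemma slices_le:
  assumes "finite A" and y: "y \<in> lp"
  shows "(\<Sum>a\<in>A. nrm (slice a y) powr p) \<le> nrm y powr p"
proof (rule field_le_epsilon)
  fix e :: real assume e: "e > 0"
  \<comment> \<open>Slices are infinite families, so each norm is first approximated by a finite
    sum, with total error at most \<open>e\<close>.\<close>
  define d where "d = e / (1 + real (card A))"
  have d: "d > 0" "real (card A) * d \<le> e" using e by (auto simp: d_def field_simps add_pos_nonneg)
  have "\<forall>a. \<exists>F. finite F \<and> nrm (slice a y) powr p \<le> (\<Sum>k\<in>F. norm (slice a y k) powr p) + d"
    using nrm_powr_approx[OF slice_lp[OF y] d(1)] by metis
  then obtain F where F: "\<And>a. finite (F a)" "\<And>a. nrm (slice a y) powr p \<le> (\<Sum>k\<in>F a. norm (slice a y k) powr p) + d"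
    by metis
  have "(\<Sum>a\<in>A. nrm (slice a y) powr p) \<le> (\<Sum>a\<in>A. (\<Sum>k\<in>F a. norm (y (a, k)) powr p) + d)"
    using F(2) by (intro sum_mono) (simp add: slice_def)
  also have "\<dots> = (\<Sum>a\<in>A. \<Sum>k\<in>F a. norm (y (a, k)) powr p) + real (card A) * d" by (simp add: sum.distrib)
  also have "(\<Sum>a\<in>A. \<Sum>k\<in>F a. norm (y (a, k)) powr p) = (\<Sum>i\<in>Sigma A F. norm (y i) powr p)"
    using assms F by (subst sum.Sigma) (auto simp: case_prod_beta)
  also have "\<dots> \<le> nrm y powr p" using assms F by (intro sum_le_nrm y) auto
  finally show "(\<Sum>a\<in>A. nrm (slice a y) powr p) \<le> nrm y powr p + e" using d by linarith
qed

lemma slices_bound: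
  assumes c: "0 \<le> c" and y: "\<And>a. slice a y \<in> lp"
    and le: "\<And>A. finite A \<Longrightarrow> (\<Sum>a\<in>A. nrm (slice a y) powr p) \<le> c powr p"
  shows "y \<in> lp" "nrm y \<le> c"
proof -
  have "(\<Sum>i\<in>F. norm (y i) powr p) \<le> c powr p" if F: "finite F" for F
  proof -
    have "(\<Sum>i\<in>F. norm (y i) powr p) \<le> (\<Sum>i\<in>fst ` F \<times> snd ` F. norm (y i) powr p)"
      using F by (intro sum_mono2) (auto intro: rev_image_eqI)
    also have "\<dots> = (\<Sum>a\<in>fst ` F. \<Sum>k\<in>snd ` F. norm (slice a y k) powr p)"
      by (simp add: sum.cartesian_product slice_def case_prod_beta)
    also have "\<dots> \<le> (\<Sum>a\<in>fst ` F. nrm (slice a y) powr p)"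
      using F y by (intro sum_mono sum_le_nrm) auto
    also have "\<dots> \<le> c powr p" using F le by auto
    finally show ?thesis .
  qed
  then show "y \<in> lp" "nrm y \<le> c" using lp_nrm_bound[OF c] by blast+
qed

lemma stack_bounded:
  assumes X: "\<And>a. blin (X a)" and c: "0 \<le> c"
    and le: "\<And>A x. finite A \<Longrightarrow> x \<in> lp \<Longrightarrow> (\<Sum>a\<in>A. nrm (X a x) powr p) \<le> (c * nrm x) powr p"
  shows "blin (stack X)"
proof -
  have *: "stack X x \<in> lp \<and> nrm (stack X x) \<le> c * nrm x" if x: "x \<in> lp" for x
    using slices_bound[of "c * nrm x" "stack X x"] le[OF _ x] blin_lp[OF X x] c by simp
  show "blin (stack X)"
  proof (rule blinI[of _ c])
    show "stack X (\<lambda>n. a * x n + b * y n) = (\<lambda>n. a * stack X x n + b * stack X y n)"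
      if "x \<in> lp" "y \<in> lp" for x y a b
      by (auto simp: stack_def fun_eq_iff blin_lin[OF X that])
  qed (use * in auto)
qed

lemma blin_embed: "blin (embed a :: ('k \<Rightarrow> complex) \<Rightarrow> _)"
proof -
  have *: "embed a z \<in> lp \<and> nrm (embed a z) \<le> nrm z" if z: "z \<in> lp" for z :: "'k \<Rightarrow> complex"
  proof -
    have "(\<Sum>b\<in>A. nrm (slice b (embed a z)) powr p) \<le> nrm z powr p" if A: "finite A" for A
    proof -
      have "(\<Sum>b\<in>A. nrm (slice b (embed a z)) powr p) = (\<Sum>b\<in>A. if b = a then nrm z powr p else 0)"
        using p_pos by (intro sum.cong refl) (auto simp: slice_embed)
      then show ?thesis using A by simp
    qed
    moreover have "slice b (embed a z) \<in> lp" for b using z by (auto simp: slice_embed)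
    ultimately show ?thesis using slices_bound[of "nrm z" "embed a z"] by auto
  qed
  show ?thesis
    by (rule blinI[of _ 1]) (use * in \<open>auto simp: embed_def fun_eq_iff\<close>)
qed

text \<open>Finitely many compact slices form a compact operator; the hypothesis \<open>tail\<close>
  makes the p-sum of the remaining ones uniformly small.\<close>

lemma cpt_stack:
  assumes X: "\<And>a. cpt (X a)" and b: "blin (stack X)"
    and tail: "\<And>\<epsilon>. 0 < \<epsilon> \<Longrightarrow> \<exists>A0. finite A0 \<and> (\<forall>A x. finite A \<longrightarrow> A \<inter> A0 = {} \<longrightarrow> x \<in> lp \<longrightarrow>
      (\<Sum>a\<in>A. nrm (X a x) powr p) \<le> (\<epsilon> * nrm x) powr p)"
  shows "cpt (stack X)"
proof (rule cptI_approx[OF b])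
  fix \<epsilon> :: real assume e: "\<epsilon> > 0"
  obtain A0 where A0: "finite A0" "\<And>A x. finite A \<Longrightarrow> A \<inter> A0 = {} \<Longrightarrow> x \<in> lp \<Longrightarrow>
      (\<Sum>a\<in>A. nrm (X a x) powr p) \<le> (\<epsilon> * nrm x) powr p" using tail[OF e] by blast
  have "cpt (\<lambda>x. \<Sum>a\<in>A0. embed a (X a x))"
    by (intro cpt_setsum A0 cpt_comp_left[OF blin_embed] X)
  moreover have "nrm (stack X x - (\<Sum>a\<in>A0. embed a (X a x))) \<le> \<epsilon> * nrm x" if x: "x \<in> lp" for x
  proof -
    let ?z = "stack X x - (\<Sum>a\<in>A0. embed a (X a x))"
    have sl: "slice a ?z = (if a \<in> A0 then 0 else X a x)" for a
    proof
      fix k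
      have "(\<Sum>b\<in>A0. embed b (X b x) (a, k)) = (\<Sum>b\<in>A0. if a = b then X a x k else 0)"
        by (rule sum.cong[OF refl]) (auto simp: embed_def)
      then show "slice a ?z k = (if a \<in> A0 then 0 else X a x) k"
        using A0(1) by (simp add: slice_def stack_def pointwise sum_fun_apply)
    qed
    show ?thesis
    proof (rule slices_bound(2))
      show "slice a ?z \<in> lp" for a unfolding sl using blin_lp[OF cpt_blin[OF X] x] by auto
      fix A :: "'a set" assume A: "finite A"
      have "(\<Sum>a\<in>A. nrm (slice a ?z) powr p) = (\<Sum>a\<in>A - A0. nrm (X a x) powr p)"
        using A p_pos by (intro sum.mono_neutral_cong_right) (auto simp: sl)
      also have "\<dots> \<le> (\<epsilon> * nrm x) powr p" using A by (intro A0(2) x) auto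
      finally show "(\<Sum>a\<in>A. nrm (slice a ?z) powr p) \<le> (\<epsilon> * nrm x) powr p" .
    qed (use e in auto)
  qed
  ultimately show "\<exists>K. cpt K \<and> (\<forall>x\<in>lp. nrm (stack X x - K x) \<le> \<epsilon> * nrm x)" by blast
qed

text \<open>At most two summands meet at any coordinate, so the power mean inequality costs at most
  \<open>2 powr (p - 1)\<close> there, rounded up to \<open>2 powr p\<close> to give the factor 2 in
  the norm.\<close>

lemma overlap_sum:
  assumes A: "finite A" and e: "\<And>s. s \<in> A \<Longrightarrow> e s \<in> lp" "\<And>s k. s \<in> A \<Longrightarrow> k \<notin> S s \<Longrightarrow> e s k = 0"
    and ov: "\<And>k. card {s\<in>A. k \<in> S s} \<le> 2" and c: "0 \<le> c" "(\<Sum>s\<in>A. nrm (e s) powr p) \<le> c powr p"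
  shows "nrm (\<Sum>s\<in>A. e s) \<le> 2 * c"
proof (rule lp_nrm_bound(2))
  fix F :: "'b set" assume F: "finite F"
  have "norm ((\<Sum>s\<in>A. e s) k) powr p \<le> 2 powr p * (\<Sum>s\<in>A. norm (e s k) powr p)" for k
  proof -
    let ?A = "{s\<in>A. k \<in> S s}"
    have "(\<Sum>s\<in>A. e s) k = (\<Sum>s\<in>?A. e s k)" unfolding sum_fun_apply
      using A e by (intro sum.mono_neutral_right) auto
    then have "norm ((\<Sum>s\<in>A. e s) k) powr p \<le> (\<Sum>s\<in>?A. norm (e s k)) powr p"
      using p_pos by (auto intro!: powr_mono2 norm_sum)
    also have "\<dots> \<le> real (card ?A) powr (p - 1) * (\<Sum>s\<in>?A. norm (e s k) powr p)"
      using A by (intro power_mean_powr p_gt_1) auto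
    also have "\<dots> \<le> 2 powr p * (\<Sum>s\<in>?A. norm (e s k) powr p)"
    proof (intro mult_right_mono sum_nonneg)
      have "real (card ?A) powr (p - 1) \<le> 2 powr (p - 1)" using ov[of k] p_gt_1 by (intro powr_mono2) auto
      also have "\<dots> \<le> 2 powr p" by (intro powr_mono) auto
      finally show "real (card ?A) powr (p - 1) \<le> 2 powr p" .
    qed auto
    also have "(\<Sum>s\<in>?A. norm (e s k) powr p) \<le> (\<Sum>s\<in>A. norm (e s k) powr p)" using A by (intro sum_mono2) auto
    finally show ?thesis by simp
  qed
  then have "(\<Sum>k\<in>F. norm ((\<Sum>s\<in>A. e s) k) powr p) \<le> (\<Sum>k\<in>F. 2 powr p * (\<Sum>s\<in>A. norm (e s k) powr p))"
    by (rule sum_mono)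
  also have "\<dots> = 2 powr p * (\<Sum>s\<in>A. \<Sum>k\<in>F. norm (e s k) powr p)"
    by (simp add: sum_distrib_left sum.swap[of _ F A])
  also have "\<dots> \<le> 2 powr p * (\<Sum>s\<in>A. nrm (e s) powr p)"
    using F e by (intro mult_left_mono sum_mono sum_le_nrm) auto
  also have "\<dots> \<le> 2 powr p * c powr p" using c by (intro mult_left_mono) auto
  finally show "(\<Sum>k\<in>F. norm ((\<Sum>s\<in>A. e s) k) powr p) \<le> (2 * c) powr p" using c by (simp add: powr_mult)
qed (use c in auto)

lemma glue_bounded:
  assumes S: "\<And>k. finite {s. k \<in> S s}" "\<And>k. card {s. k \<in> S s} \<le> 2"
    and B: "\<And>s. blin (B s)" "\<And>s y k. k \<notin> S s \<Longrightarrow> B s y k = 0" and c: "0 \<le> c"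
    and le: "\<And>A y. finite A \<Longrightarrow> y \<in> lp \<Longrightarrow> (\<Sum>s\<in>A. nrm (B s y) powr p) \<le> (c * nrm y) powr p"
  shows "blin (glue S B)" and nrm_glue: "y \<in> lp \<Longrightarrow> nrm (glue S B y) \<le> 2 * c * nrm y"
proof -
  have *: "glue S B y \<in> lp \<and> nrm (glue S B y) \<le> 2 * c * nrm y" if y: "y \<in> lp" for y
  proof -
    have "(\<Sum>k\<in>F. norm (glue S B y k) powr p) \<le> (2 * c * nrm y) powr p" if F: "finite F" for F
    proof -
      \<comment> \<open>Only finitely many levels are visible on \<open>F\<close>, so the glued sum
        agrees there with a finite one.\<close>
      define A where "A = (\<Union>k\<in>F. {s. k \<in> S s})"
      have A: "finite A" using F S by (auto simp: A_def)
      have "glue S B y k = (\<Sum>s\<in>A. B s y) k" if "k \<in> F" for k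
        unfolding glue_def sum_fun_apply using A B that by (intro sum.mono_neutral_left) (auto simp: A_def)
      then have "(\<Sum>k\<in>F. norm (glue S B y k) powr p) = (\<Sum>k\<in>F. norm ((\<Sum>s\<in>A. B s y) k) powr p)" by simp
      also have "\<dots> \<le> nrm (\<Sum>s\<in>A. B s y) powr p" by (intro sum_le_nrm F lp_sum A blin_lp[OF B(1)] y)
      also have "\<dots> \<le> (2 * (c * nrm y)) powr p"
      proof (intro powr_mono2 overlap_sum[where S = S] A blin_lp[OF B(1)] y B(2) le)
        show "card {s \<in> A. k \<in> S s} \<le> 2" for k
          using card_mono[OF S(1)[of k], of "{s \<in> A. k \<in> S s}"] S(2)[of k] by fastforce
      qed (use p_pos c in auto)
      finally show ?thesis by (simp add: mult.assoc)
    qed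
    then show ?thesis using lp_nrm_bound[of "2 * c * nrm y" "glue S B y"] c by auto
  qed
  show "blin (glue S B)"
  proof (rule blinI[of _ "2 * c"])
    show "glue S B (\<lambda>n. a * x n + b * y n) = (\<lambda>n. a * glue S B x n + b * glue S B y n)"
      if "x \<in> lp" "y \<in> lp" for x y a b
      by (auto simp: glue_def fun_eq_iff blin_lin[OF B(1) that] sum.distrib sum_distrib_left)
  qed (use * in auto)
  show "y \<in> lp \<Longrightarrow> nrm (glue S B y) \<le> 2 * c * nrm y" using * by blast
qed

lemma glue_finite:
  assumes "finite A" "\<And>k. finite {s. k \<in> S s}" "\<And>s k. k \<notin> S s \<Longrightarrow> B s y k = 0" "\<And>s k. s \<notin> A \<Longrightarrow> B s y k = 0"
  shows "glue S B y = (\<Sum>s\<in>A. B s y)"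
proof
  fix k
  have "(\<Sum>s\<in>{s. k \<in> S s}. B s y k) = (\<Sum>s\<in>{s. k \<in> S s} \<inter> A. B s y k)"
    using assms by (intro sum.mono_neutral_right) auto
  also have "\<dots> = (\<Sum>s\<in>A. B s y k)" using assms by (intro sum.mono_neutral_left) auto
  finally show "glue S B y k = (\<Sum>s\<in>A. B s y) k" by (simp add: glue_def sum_fun_apply)
qed

end

section \<open>Rademacher systems\<close>

text \<open>The binary digits of \<open>v\<close> serve as a sign vector. Encoding sign vectors by
  naturals lets cubes of all dimensions share one index type.\<close>

definition radem :: "nat \<Rightarrow> nat \<Rightarrow> real" where
  "radem j v = (if j \<in> set_decode v then - 1 else 1)"

definition cube :: "nat \<Rightarrow> nat set" where
  "cube n = set_encode ` Pow {..<n}"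

lemma abs_radem [simp]: "\<bar>radem j v\<bar> = 1"
  by (simp add: radem_def)

lemma radem_square [simp]: "radem j v * radem j v = 1"
  by (simp add: radem_def)

lemma finite_cube [simp]: "finite (cube n)"
  by (simp add: cube_def)

lemma inj_on_set_encode_Pow: "inj_on set_encode (Pow {..<n})"
  by (rule inj_on_subset[OF inj_on_set_encode]) (auto intro: finite_subset)

lemma card_cube [simp]: "card (cube n) = 2 ^ n"
  by (simp add: cube_def card_image[OF inj_on_set_encode_Pow] card_Pow)

lemma sum_cube: "(\<Sum>v\<in>cube n. g v) = (\<Sum>X\<in>Pow {..<n}. g (set_encode X))"
  unfolding cube_def by (rule sum.reindex_cong[OF inj_on_set_encode_Pow]) auto

lemma radem_set_encode: "X \<in> Pow {..<n} \<Longrightarrow> radem j (set_encode X) = (if j \<in> X then - 1 else 1)"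
  using finite_subset[of X "{..<n}"] by (auto simp: radem_def)

text \<open>For \<open>i \<noteq> j\<close>, flipping the \<open>i\<close>-th sign is an involution
  of the cube that negates every summand.\<close>

lemma radem_orthogonal:
  assumes "i < n" "j < n"
  shows "(\<Sum>v\<in>cube n. radem i v * radem j v) = (if i = j then 2 ^ n else 0)"
proof (cases "i = j")
  case True
  then show ?thesis by simp
next
  case False
  let ?s = "\<lambda>j X. (if j \<in> X then - 1 else 1 :: real)"
  let ?f = "\<lambda>X. if i \<in> X then X - {i} else insert i X"
  have eq: "(\<Sum>v\<in>cube n. radem i v * radem j v) = (\<Sum>X\<in>Pow {..<n}. ?s i X * ?s j X)"
    unfolding sum_cube by (intro sum.cong refl) (simp add: radem_set_encode)
  have "(\<Sum>X\<in>Pow {..<n}. ?s i X * ?s j X) = (\<Sum>X\<in>Pow {..<n}. - (?s i X * ?s j X))"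
    by (rule sum.reindex_bij_witness[of _ ?f ?f]) (use assms False in auto)
  then have "(\<Sum>X\<in>Pow {..<n}. ?s i X * ?s j X) = 0" by (simp only: sum_negf)
  then show ?thesis using eq False by simp
qed

section \<open>Khinchine's inequality\<close>

lemma exp_add_exp_minus_le: "exp c + exp (- c) \<le> 2 * exp (c\<^sup>2)" for c :: real
proof -
  have 1: "(\<lambda>n. if even n then c ^ n /\<^sub>R fact n else 0) sums cosh c" by (rule cosh_converges)
  have "(\<lambda>n. (c\<^sup>2) ^ n /\<^sub>R fact n) sums exp (c\<^sup>2)" by (rule exp_converges)
  from sums_if[OF sums_zero this]
  have 2: "(\<lambda>n. if even n then (c\<^sup>2) ^ (n div 2) /\<^sub>R fact (n div 2) else 0) sums exp (c\<^sup>2)" by simp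
  have "cosh c \<le> exp (c\<^sup>2)"
  \<comment> \<open>Termwise comparison of the power series: the factorial of \<open>2 * m\<close>
    is at least that of \<open>m\<close>.\<close>
  proof (rule sums_le[OF _ 1 2])
    fix n :: nat
    show "(if even n then c ^ n /\<^sub>R fact n else 0) \<le> (if even n then (c\<^sup>2) ^ (n div 2) /\<^sub>R fact (n div 2) else 0)"
    proof (cases "even n")
      case True
      then obtain m where m: "n = 2 * m" by blast
      have "inverse (fact n :: real) \<le> inverse (fact m)" unfolding m by (intro le_imp_inverse_le fact_mono) auto
      then show ?thesis using m by (simp add: power_mult mult_right_mono)
    qed simp
  qed
  then show ?thesis by (simp add: cosh_def)
qed

text \<open>Independence of the signs: expanding the product of the sums
  \<open>exp (- c j) + exp (c j)\<close> over all subsets gives exactly the sum over the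
  cube.\<close>

lemma radem_exp_moment:
  fixes c :: "nat \<Rightarrow> real"
  shows "(\<Sum>v\<in>cube n. exp (\<Sum>j<n. c j * radem j v)) \<le> 2 ^ n * exp (\<Sum>j<n. (c j)\<^sup>2)"
proof -
  have "(\<Sum>v\<in>cube n. exp (\<Sum>j<n. c j * radem j v))
      = (\<Sum>X\<in>Pow {..<n}. (\<Prod>j\<in>X. exp (- c j)) * (\<Prod>j\<in>{..<n} - X. exp (c j)))"
    unfolding sum_cube
  proof (rule sum.cong[OF refl])
    fix X assume X: "X \<in> Pow {..<n}"
    then have fX: "finite X" using finite_subset by auto
    have "(\<Sum>j<n. c j * radem j (set_encode X)) = (\<Sum>j<n. if j \<in> X then - c j else c j)"
      by (rule sum.cong[OF refl]) (use X in \<open>simp add: radem_set_encode\<close>)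
    also have "\<dots> = (\<Sum>j\<in>X. - c j) + (\<Sum>j\<in>{..<n} - X. c j)"
    proof -
      have "{..<n} \<inter> {j. j \<in> X} = X" "{..<n} \<inter> - {j. j \<in> X} = {..<n} - X" using X by auto
      then show ?thesis by (simp add: sum.If_cases)
    qed
    finally show "exp (\<Sum>j<n. c j * radem j (set_encode X)) = (\<Prod>j\<in>X. exp (- c j)) * (\<Prod>j\<in>{..<n} - X. exp (c j))"
      using fX by (simp add: exp_add exp_sum)
  qed
  also have "\<dots> = (\<Prod>j<n. exp (- c j) + exp (c j))" by (rule prod_add[symmetric]) auto
  also have "\<dots> \<le> (\<Prod>j<n. 2 * exp ((c j)\<^sup>2))"
    by (intro prod_mono) (use exp_add_exp_minus_le in \<open>auto simp: add.commute add_nonneg_nonneg\<close>)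
  also have "\<dots> = 2 ^ n * exp (\<Sum>j<n. (c j)\<^sup>2)" by (simp add: prod.distrib exp_sum)
  finally show ?thesis .
qed

text \<open>A single term of the exponential series, of degree \<open>\<lceil>q\<rceil>\<close>,
  dominates the power; arguments below 1 are trivial.\<close>

lemma powr_le_exp:
  assumes "0 < q"
  obtains C :: real where "0 < C" "\<And>t. 0 \<le> t \<Longrightarrow> t powr q \<le> C * exp t"
proof
  define n where "n = nat \<lceil>q\<rceil>"
  have n: "q \<le> real n" using assms by (simp add: n_def of_nat_ceiling)
  show "0 < (fact n :: real)" by simp
  fix t :: real assume t: "0 \<le> t"
  have 1: "(1::real) \<le> fact n" by (simp add: fact_ge_1)
  show "t powr q \<le> fact n * exp t"
  proof (cases "t < 1")
    case True
    have "t powr q \<le> 1" using t True assms powr_mono2[of q t 1] by simp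
    also have "1 \<le> fact n * exp t" using mult_mono[of 1 "fact n" 1 "exp t"] 1 t by simp
    finally show ?thesis .
  next
    case False
    then have "t powr q \<le> t powr real n" using n by (intro powr_mono) auto
    also have "\<dots> = t ^ n" using False by (simp add: powr_realpow)
    also have "t ^ n \<le> fact n * exp t"
    proof -
      have "(\<Sum>i\<in>{n}. t ^ i /\<^sub>R fact i) \<le> (\<Sum>i. t ^ i /\<^sub>R fact i)"
        using t by (intro sum_le_suminf summable_exp_generic) auto
      then have "t ^ n /\<^sub>R fact n \<le> exp t" by (simp add: exp_def)
      then show ?thesis by (simp add: field_simps)
    qed
    finally show ?thesis .
  qed
qed

text \<open>A subgaussian argument. After normalising the squares of the coefficients to sum 1, the
  power of the absolute value is dominated by \<open>C\<close> times the sum of the exponentials for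
  both signs, and each exponential moment is at most \<open>2 ^ n * exp 1\<close>. This explains
  \<open>K = 2 * C * exp 1\<close>.\<close>

lemma khinchine_real:
  assumes q: "0 < q"
  obtains K :: real where "0 < K" "\<And>n c :: nat \<Rightarrow> real.
    (\<Sum>v\<in>cube n. \<bar>\<Sum>j<n. c j * radem j v\<bar> powr q) \<le> 2 ^ n * K * (\<Sum>j<n. (c j)\<^sup>2) powr (q / 2)"
proof -
  obtain C :: real where C: "0 < C" "\<And>t. 0 \<le> t \<Longrightarrow> t powr q \<le> C * exp t" by (rule powr_le_exp[OF q]) blast
  define K where "K = 2 * C * exp 1"
  show ?thesis
  proof (rule that[of K])
    show "0 < K" using C by (simp add: K_def)
    fix n and c :: "nat \<Rightarrow> real"
    define S where "S = sqrt (\<Sum>j<n. (c j)\<^sup>2)"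
    have S2: "S\<^sup>2 = (\<Sum>j<n. (c j)\<^sup>2)" "S \<ge> 0" by (auto simp: S_def sum_nonneg)
    show "(\<Sum>v\<in>cube n. \<bar>\<Sum>j<n. c j * radem j v\<bar> powr q) \<le> 2 ^ n * K * (\<Sum>j<n. (c j)\<^sup>2) powr (q / 2)"
    proof (cases "S = 0")
      case True
      then have "(\<Sum>j<n. (c j)\<^sup>2) = 0" using S2 by simp
      then have "\<forall>j<n. c j = 0" by (subst (asm) sum_nonneg_eq_0_iff) auto
      then show ?thesis by simp
    next
      case False
      then have S: "S > 0" using S2 by simp
      define b where "b = (\<lambda>j. c j / S)"
      have b: "(\<Sum>j<n. (b j)\<^sup>2) = 1" using S by (simp add: b_def power_divide sum_divide_distrib[symmetric] flip: S2(1))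
      define T where "T = (\<lambda>v. \<Sum>j<n. b j * radem j v)"
      have cT: "(\<Sum>j<n. c j * radem j v) = S * T v" for v using S by (simp add: T_def b_def sum_distrib_left)
      have "(\<Sum>v\<in>cube n. \<bar>T v\<bar> powr q) \<le> (\<Sum>v\<in>cube n. C * (exp (T v) + exp (- T v)))"
      proof (rule sum_mono)
        fix v
        have e: "exp \<bar>T v\<bar> \<le> exp (T v) + exp (- T v)" by (cases "T v \<ge> 0") auto
        show "\<bar>T v\<bar> powr q \<le> C * (exp (T v) + exp (- T v))"
          using order_trans[OF C(2)[OF abs_ge_zero] mult_left_mono[OF e]] C(1) by simp
      qed
      also have "\<dots> = C * ((\<Sum>v\<in>cube n. exp (\<Sum>j<n. b j * radem j v)) + (\<Sum>v\<in>cube n. exp (\<Sum>j<n. (- b j) * radem j v)))"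
        by (simp add: T_def sum.distrib sum_distrib_left distrib_left sum_negf)
      also have "\<dots> \<le> C * (2 ^ n * exp (\<Sum>j<n. (b j)\<^sup>2) + 2 ^ n * exp (\<Sum>j<n. (- b j)\<^sup>2))"
        using C by (intro mult_left_mono add_mono radem_exp_moment) auto
      also have "\<dots> = 2 ^ n * K" by (simp add: b K_def)
      finally have T: "(\<Sum>v\<in>cube n. \<bar>T v\<bar> powr q) \<le> 2 ^ n * K" .
      have "(\<Sum>v\<in>cube n. \<bar>\<Sum>j<n. c j * radem j v\<bar> powr q) = S powr q * (\<Sum>v\<in>cube n. \<bar>T v\<bar> powr q)"
        unfolding cT using S by (simp add: abs_mult powr_mult sum_distrib_left)
      also have "\<dots> \<le> S powr q * (2 ^ n * K)" using T by (intro mult_left_mono) auto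
      also have "S powr q = (S\<^sup>2) powr (q / 2)" using S by (simp add: powr_powr flip: powr_numeral)
      finally show ?thesis by (simp add: S2 mult.commute)
    qed
  qed
qed

lemma khinchine:
  assumes q: "1 < q"
  obtains K :: real where "0 < K" "\<And>n c :: nat \<Rightarrow> complex.
    (\<Sum>v\<in>cube n. norm (\<Sum>j<n. c j * of_real (radem j v)) powr q) \<le> 2 ^ n * K powr q * (\<Sum>j<n. (norm (c j))\<^sup>2) powr (q / 2)"
proof -
  obtain L :: real where L: "0 < L" "\<And>n c :: nat \<Rightarrow> real.
    (\<Sum>v\<in>cube n. \<bar>\<Sum>j<n. c j * radem j v\<bar> powr q) \<le> 2 ^ n * L * (\<Sum>j<n. (c j)\<^sup>2) powr (q / 2)"
    by (rule khinchine_real[of q]) (use q in auto)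
  \<comment> \<open>The factor \<open>2 powr q\<close> bounds the power of a sum of two terms, and
    the 2 counts the real and the imaginary part.\<close>
  define K where "K = (2 powr q * (2 * L)) powr (1 / q)"
  have K: "K powr q = 2 powr q * (2 * L)" using q L by (simp add: K_def powr_powr)
  show ?thesis
  proof (rule that[of K])
    show "0 < K" using L by (simp add: K_def)
    fix n and c :: "nat \<Rightarrow> complex"
    let ?Z = "\<lambda>v. \<Sum>j<n. c j * of_real (radem j v)"
    let ?R = "\<lambda>v. \<Sum>j<n. Re (c j) * radem j v" and ?I = "\<lambda>v. \<Sum>j<n. Im (c j) * radem j v"
    have "norm (?Z v) powr q \<le> 2 powr q * (\<bar>?R v\<bar> powr q + \<bar>?I v\<bar> powr q)" for v
    proof -
      have "norm (?Z v) \<le> \<bar>?R v\<bar> + \<bar>?I v\<bar>" using cmod_le[of "?Z v"] by simp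
      also have "\<dots> \<le> 2 * max \<bar>?R v\<bar> \<bar>?I v\<bar>" by simp
      finally have "norm (?Z v) powr q \<le> (2 * max \<bar>?R v\<bar> \<bar>?I v\<bar>) powr q" using q by (intro powr_mono2) auto
      also have "\<dots> = 2 powr q * (max \<bar>?R v\<bar> \<bar>?I v\<bar>) powr q" by (simp add: powr_mult)
      also have "\<dots> \<le> 2 powr q * (\<bar>?R v\<bar> powr q + \<bar>?I v\<bar> powr q)" by (intro mult_left_mono) (auto simp: max_def)
      finally show ?thesis .
    qed
    then have "(\<Sum>v\<in>cube n. norm (?Z v) powr q) \<le> (\<Sum>v\<in>cube n. 2 powr q * (\<bar>?R v\<bar> powr q + \<bar>?I v\<bar> powr q))"
      by (rule sum_mono)
    also have "\<dots> = 2 powr q * ((\<Sum>v\<in>cube n. \<bar>?R v\<bar> powr q) + (\<Sum>v\<in>cube n. \<bar>?I v\<bar> powr q))"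
      by (simp add: sum.distrib sum_distrib_left distrib_left)
    also have "\<dots> \<le> 2 powr q * (2 ^ n * L * (\<Sum>j<n. (Re (c j))\<^sup>2) powr (q / 2) + 2 ^ n * L * (\<Sum>j<n. (Im (c j))\<^sup>2) powr (q / 2))"
      by (intro mult_left_mono add_mono L) auto
    also have "\<dots> \<le> 2 powr q * (2 ^ n * L * (\<Sum>j<n. (norm (c j))\<^sup>2) powr (q / 2) + 2 ^ n * L * (\<Sum>j<n. (norm (c j))\<^sup>2) powr (q / 2))"
      using q L by (intro mult_left_mono add_mono powr_mono2 sum_mono sum_nonneg)
        (auto simp: abs_le_square_iff[symmetric] abs_Re_le_cmod abs_Im_le_cmod)
    also have "\<dots> = 2 ^ n * K powr q * (\<Sum>j<n. (norm (c j))\<^sup>2) powr (q / 2)" by (simp add: K algebra_simps)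
    finally show "(\<Sum>v\<in>cube n. norm (?Z v) powr q) \<le> 2 ^ n * K powr q * (\<Sum>j<n. (norm (c j))\<^sup>2) powr (q / 2)" .
  qed
qed

section \<open>The multiplier on the Rademacher span\<close>

definition rcoef :: "nat \<Rightarrow> nat \<Rightarrow> (nat \<Rightarrow> complex) \<Rightarrow> complex" where
  "rcoef n j y = (\<Sum>v\<in>cube n. of_real (radem j v) * y v) / 2 ^ n"

text \<open>Khinchine for \<open>p\<close> bounds the multiplier on the Rademacher span in terms of the \<open>\<ell>\<^sup>2\<close> norm of the
  coefficients; Hoelder and Khinchine for the conjugate exponent bound that norm by \<open>\<parallel>y\<parallel>\<^sub>p\<close>.\<close>

lemma radem_multiplier_bound:
  assumes p: "1 < p"
  obtains \<kappa> :: real where "0 < \<kappa>" "\<And>n d y D. (\<And>j. j < n \<Longrightarrow> norm (d j) \<le> D) \<Longrightarrow> 0 \<le> D \<Longrightarrow>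
    (\<Sum>u\<in>cube n. norm (\<Sum>j<n. d j * of_real (radem j u) * rcoef n j y) powr p) \<le> (\<kappa> * D) powr p * (\<Sum>v\<in>cube n. norm (y v) powr p)"
proof -
  define q where "q = p / (p - 1)"
  have q: "q > 1" "1/p + 1/q = 1" using p by (auto simp: q_def field_simps)
  obtain K :: real where K: "0 < K" "\<And>n c :: nat \<Rightarrow> complex.
    (\<Sum>v\<in>cube n. norm (\<Sum>j<n. c j * of_real (radem j v)) powr p) \<le> 2 ^ n * K powr p * (\<Sum>j<n. (norm (c j))\<^sup>2) powr (p / 2)"
    by (rule khinchine[OF p]) blast
  obtain L :: real where L: "0 < L" "\<And>n c :: nat \<Rightarrow> complex.
    (\<Sum>v\<in>cube n. norm (\<Sum>j<n. c j * of_real (radem j v)) powr q) \<le> 2 ^ n * L powr q * (\<Sum>j<n. (norm (c j))\<^sup>2) powr (q / 2)"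
    by (rule khinchine[OF q(1)]) blast
  show ?thesis
  proof (rule that[of "K * L"])
    show "0 < K * L" using K L by simp
    fix n and d y :: "nat \<Rightarrow> complex" and D :: real
    assume d: "\<And>j. j < n \<Longrightarrow> norm (d j) \<le> D" and D: "0 \<le> D"
    define c where "c = (\<lambda>j. rcoef n j y)"
    define A where "A = (\<Sum>j<n. (norm (c j))\<^sup>2)"
    define Y where "Y = (\<Sum>v\<in>cube n. norm (y v) powr p)"
    have A0: "A \<ge> 0" and Y0: "Y \<ge> 0" by (auto simp: A_def Y_def sum_nonneg)
    \<comment> \<open>Duality: pairing \<open>y\<close> with the Rademacher sum of the conjugate
      coefficients returns \<open>A\<close>. Hoelder and Khinchine for \<open>q\<close> bound
      \<open>A\<close> by a multiple of \<open>A powr (1/2)\<close>, which then cancels.\<close>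
    have "complex_of_real A = (\<Sum>j<n. cnj (c j) * c j)"
      unfolding A_def of_real_sum by (intro sum.cong refl) (simp only: complex_norm_square mult.commute)
    also have "\<dots> = (\<Sum>j<n. \<Sum>v\<in>cube n. cnj (c j) * of_real (radem j v) * y v) / 2 ^ n"
      by (simp add: c_def rcoef_def[of n _ y] sum_distrib_left sum_divide_distrib mult.assoc)
    also have "\<dots> = (\<Sum>v\<in>cube n. (\<Sum>j<n. cnj (c j) * of_real (radem j v)) * y v) / 2 ^ n"
      by (subst sum.swap) (simp add: sum_distrib_right)
    finally have "A = norm ((\<Sum>v\<in>cube n. (\<Sum>j<n. cnj (c j) * of_real (radem j v)) * y v) / 2 ^ n)"
      using A0 by (metis abs_of_nonneg norm_of_real)
    also have "\<dots> \<le> (\<Sum>v\<in>cube n. norm (y v) * norm (\<Sum>j<n. cnj (c j) * of_real (radem j v))) / 2 ^ n"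
      by (simp add: norm_divide norm_power divide_right_mono sum_norm_le norm_mult mult.commute)
    also have "\<dots> \<le> (Y powr (1/p) * (\<Sum>v\<in>cube n. norm (\<Sum>j<n. cnj (c j) * of_real (radem j v)) powr q) powr (1/q)) / 2 ^ n"
      unfolding Y_def by (intro divide_right_mono holder_powr p q) auto
    also have "\<dots> \<le> (Y powr (1/p) * (2 ^ n * L powr q * A powr (q / 2)) powr (1/q)) / 2 ^ n"
      using L(2)[of "\<lambda>j. cnj (c j)" n] q by (intro divide_right_mono mult_left_mono powr_mono2) (auto simp: A_def sum_nonneg)
    also have "(2 ^ n * L powr q * A powr (q / 2)) powr (1/q) = (2 ^ n) powr (1/q) * L * A powr (1/2)"
      using q L A0 by (simp add: powr_mult powr_powr)
    finally have *: "A \<le> Y powr (1/p) * ((2 ^ n) powr (1/q) * L * A powr (1/2)) / 2 ^ n" .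
    have A12: "A powr (1/2) \<le> L * (Y / 2 ^ n) powr (1/p)"
    proof (cases "A = 0")
      case True
      then show ?thesis using L by simp
    next
      case False
      then have Ap: "A powr (1/2) > 0" using A0 by simp
      have "A = A powr (1/2) * A powr (1/2)" using A0 by (simp flip: powr_add)
      then have "A powr (1/2) * A powr (1/2) \<le> (L * (Y powr (1/p) * ((2 ^ n) powr (1/q) / 2 ^ n))) * A powr (1/2)" using * by (simp add: algebra_simps)
      then have "A powr (1/2) \<le> L * (Y powr (1/p) * ((2 ^ n) powr (1/q) / 2 ^ n))"
        by (rule mult_right_le_imp_le) (rule Ap)
      also have "(2 ^ n :: real) powr (1/q) / 2 ^ n = 1 / (2 ^ n) powr (1/p)"
      proof -
        have "(2 ^ n :: real) powr (1/q) * (2 ^ n) powr (1/p) = (2 ^ n) powr (1/p + 1/q)" by (simp add: powr_add mult.commute)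
        also have "\<dots> = 2 ^ n" using q by simp
        finally show ?thesis by (simp add: field_simps)
      qed
      finally show ?thesis using Y0 by (simp add: powr_divide)
    qed
    have "(\<Sum>u\<in>cube n. norm (\<Sum>j<n. d j * of_real (radem j u) * c j) powr p) \<le> 2 ^ n * K powr p * (\<Sum>j<n. (norm (d j * c j))\<^sup>2) powr (p / 2)"
      using K(2)[of "\<lambda>j. d j * c j" n] by (simp add: mult_ac)
    also have "\<dots> \<le> 2 ^ n * K powr p * (D\<^sup>2 * A) powr (p / 2)"
    proof (intro mult_left_mono powr_mono2)
      have "(\<Sum>j<n. (norm (d j * c j))\<^sup>2) \<le> (\<Sum>j<n. D\<^sup>2 * (norm (c j))\<^sup>2)"
        using d by (intro sum_mono) (auto simp: norm_mult power_mult_distrib intro!: mult_right_mono power_mono)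
      then show "(\<Sum>j<n. (norm (d j * c j))\<^sup>2) \<le> D\<^sup>2 * A" by (simp add: A_def sum_distrib_left)
    qed (use p in \<open>auto simp: sum_nonneg\<close>)
    also have "(D\<^sup>2 * A) powr (p / 2) = D powr p * (A powr (1/2)) powr p"
      using D A0 by (simp add: powr_mult powr_powr flip: powr_numeral)
    also have "2 ^ n * K powr p * (D powr p * (A powr (1/2)) powr p) \<le> 2 ^ n * K powr p * (D powr p * (L * (Y / 2 ^ n) powr (1/p)) powr p)"
      using A12 p by (intro mult_left_mono powr_mono2) auto
    also have "(L * (Y / 2 ^ n) powr (1/p)) powr p = L powr p * (Y / 2 ^ n)" using L Y0 p by (simp add: powr_mult powr_powr)
    also have "2 ^ n * K powr p * (D powr p * (L powr p * (Y / 2 ^ n))) = (K * L * D) powr p * Y"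
      using K L D by (simp add: powr_mult)
    finally show "(\<Sum>u\<in>cube n. norm (\<Sum>j<n. d j * of_real (radem j u) * rcoef n j y) powr p) \<le> (K * L * D) powr p * (\<Sum>v\<in>cube n. norm (y v) powr p)"
      by (simp add: c_def Y_def)
  qed
qed

lemma rcoef_radem_sum:
  assumes "i < n"
  shows "rcoef n i (\<lambda>v. \<Sum>j<n. of_real (radem j v) * z j) = z i"
proof -
  have "(\<Sum>v\<in>cube n. of_real (radem i v) * (\<Sum>j<n. of_real (radem j v) * z j)) = (\<Sum>v\<in>cube n. \<Sum>j<n. of_real (radem i v * radem j v) * z j)"
    by (simp add: sum_distrib_left mult.assoc)
  also have "\<dots> = (\<Sum>j<n. of_real (\<Sum>v\<in>cube n. radem i v * radem j v) * z j)"
    by (subst sum.swap) (simp add: sum_distrib_right)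
  also have "\<dots> = (\<Sum>j<n. if j = i then 2 ^ n * z j else 0)"
    using assms by (intro sum.cong refl) (simp add: radem_orthogonal)
  also have "\<dots> = 2 ^ n * z i" using assms by simp
  finally show ?thesis by (simp add: rcoef_def)
qed

lemma rcoef_add: "rcoef n j (\<lambda>v. a * x v + b * y v) = a * rcoef n j x + b * rcoef n j y"
  by (simp add: rcoef_def sum.distrib sum_distrib_left distrib_left add_divide_distrib mult_ac)

section \<open>The universal representation\<close>

text \<open>On the \<open>s\<close>-th cube, \<open>f\<close> acts as multiplication by \<open>f (t s j)\<close> on the \<open>j\<close>-th Rademacher function and by
  \<open>f t0\<close> on the complement of the Rademacher span. For \<open>p \<noteq> 2\<close> a diagonal representation would not absorb
  these.\<close>

definition urep :: "(nat \<Rightarrow> nat) \<Rightarrow> (nat \<Rightarrow> nat \<Rightarrow> 'm) \<Rightarrow> 'm \<Rightarrow> ('m \<Rightarrow> complex) \<Rightarrow>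
    ((nat \<times> nat) \<times> nat \<Rightarrow> complex) \<Rightarrow> (nat \<times> nat) \<times> nat \<Rightarrow> complex" where
  "urep ns t t0 f y = (\<lambda>((s, u), k). f t0 * y ((s, u), k) +
     (if u \<in> cube (ns s) then \<Sum>j<ns s. (f (t s j) - f t0) * of_real (radem j u) * rcoef (ns s) j (\<lambda>v. y ((s, v), k)) else 0))"

lemma rcoef_cong: "(\<And>v. v \<in> cube n \<Longrightarrow> x v = y v) \<Longrightarrow> rcoef n j x = rcoef n j y"
  by (simp add: rcoef_def)

text \<open>The scalar \<open>f t0\<close> cancels in the Rademacher coefficients, on which the
  representation is diagonal; multiplicativity in \<open>f\<close> reduces to this.\<close>

lemma rcoef_urep:
  assumes "j < ns s"
  shows "rcoef (ns s) j (\<lambda>v. urep ns t t0 f y ((s, v), k)) = f (t s j) * rcoef (ns s) j (\<lambda>v. y ((s, v), k))"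
proof -
  let ?c = "\<lambda>j. rcoef (ns s) j (\<lambda>v. y ((s, v), k))"
  have "rcoef (ns s) j (\<lambda>v. urep ns t t0 f y ((s, v), k))
      = rcoef (ns s) j (\<lambda>v. f t0 * y ((s, v), k) + 1 * (\<Sum>i<ns s. of_real (radem i v) * ((f (t s i) - f t0) * ?c i)))"
    by (rule rcoef_cong) (simp add: urep_def mult_ac)
  also have "\<dots> = f t0 * ?c j + 1 * ((f (t s j) - f t0) * ?c j)"
    unfolding rcoef_add rcoef_radem_sum[OF assms] ..
  finally show ?thesis by (simp add: algebra_simps)
qed

lemma urep_mult: "urep ns t t0 f (urep ns t t0 g y) = urep ns t t0 (\<lambda>x. f x * g x) y"
proof
  fix i :: "(nat \<times> nat) \<times> nat"
  obtain s u k where i: "i = ((s, u), k)" by (metis surj_pair)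
  let ?c = "\<lambda>j. rcoef (ns s) j (\<lambda>v. y ((s, v), k))"
  show "urep ns t t0 f (urep ns t t0 g y) i = urep ns t t0 (\<lambda>x. f x * g x) y i"
  proof (cases "u \<in> cube (ns s)")
    case True
    have "urep ns t t0 f (urep ns t t0 g y) i = f t0 * (g t0 * y i + (\<Sum>j<ns s. (g (t s j) - g t0) * of_real (radem j u) * ?c j))
       + (\<Sum>j<ns s. (f (t s j) - f t0) * of_real (radem j u) * (g (t s j) * ?c j))"
      using True by (simp add: urep_def[of ns t t0 f] i rcoef_urep) (simp add: urep_def)
    also have "\<dots> = f t0 * g t0 * y i + ((\<Sum>j<ns s. f t0 * ((g (t s j) - g t0) * of_real (radem j u) * ?c j))
       + (\<Sum>j<ns s. (f (t s j) - f t0) * of_real (radem j u) * (g (t s j) * ?c j)))"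
      by (simp add: distrib_left sum_distrib_left mult.assoc)
    also have "\<dots> = urep ns t t0 (\<lambda>x. f x * g x) y i"
      using True unfolding sum.distrib[symmetric] by (simp add: urep_def i algebra_simps)
    finally show ?thesis .
  qed (simp add: urep_def i)
qed

lemma urep_one: "urep ns t t0 (\<lambda>x. 1) y = y"
  by (auto simp: urep_def fun_eq_iff)

lemma urep_lin_fun: "urep ns t t0 (\<lambda>x. a * f x + b * g x) y = (\<lambda>k. a * urep ns t t0 f y k + b * urep ns t t0 g y k)"
proof
  fix i :: "(nat \<times> nat) \<times> nat"
  obtain s u k where i: "i = ((s, u), k)" by (metis surj_pair)
  show "urep ns t t0 (\<lambda>x. a * f x + b * g x) y i = a * urep ns t t0 f y i + b * urep ns t t0 g y i"
  proof (cases "u \<in> cube (ns s)")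
    case True
    then show ?thesis
      by (simp add: urep_def i distrib_left sum_distrib_left)
        (simp add: algebra_simps sum.distrib sum_subtractf)
  qed (simp add: urep_def i algebra_simps)
qed

lemma urep_lin: "urep ns t t0 f (\<lambda>i. a * x i + b * y i) = (\<lambda>k. a * urep ns t t0 f x k + b * urep ns t t0 f y k)"
proof
  fix i :: "(nat \<times> nat) \<times> nat"
  obtain s u k where i: "i = ((s, u), k)" by (metis surj_pair)
  show "urep ns t t0 f (\<lambda>i. a * x i + b * y i) i = a * urep ns t t0 f x i + b * urep ns t t0 f y i"
  proof (cases "u \<in> cube (ns s)")
    case True
    then show ?thesis
      by (simp add: urep_def i rcoef_add distrib_left sum_distrib_left)
        (simp add: algebra_simps sum.distrib sum_subtractf)
  qed (simp add: urep_def i algebra_simps)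
qed

text \<open>On a vector already in the Rademacher span the scalar part recombines with the
  multiplier, so no trace of \<open>t0\<close> remains.\<close>

lemma urep_radem_vector:
  assumes "\<And>u. u \<in> cube (ns s) \<Longrightarrow> y ((s, u), k) = (\<Sum>j<ns s. of_real (radem j u) * z j)" "u \<in> cube (ns s)"
  shows "urep ns t t0 f y ((s, u), k) = (\<Sum>j<ns s. of_real (radem j u) * (f (t s j) * z j))"
proof -
  have c: "rcoef (ns s) j (\<lambda>v. y ((s, v), k)) = z j" if "j < ns s" for j
  proof -
    have "rcoef (ns s) j (\<lambda>v. y ((s, v), k)) = rcoef (ns s) j (\<lambda>v. \<Sum>j<ns s. of_real (radem j v) * z j)"
      by (rule rcoef_cong) (rule assms)
    then show ?thesis using rcoef_radem_sum[OF that] by simp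
  qed
  have "urep ns t t0 f y ((s, u), k) = f t0 * (\<Sum>j<ns s. of_real (radem j u) * z j) + (\<Sum>j<ns s. (f (t s j) - f t0) * of_real (radem j u) * z j)"
    using assms c by (simp add: urep_def)
  then show ?thesis unfolding sum_distrib_left sum.distrib[symmetric] by (simp add: algebra_simps)
qed

section \<open>Two-sided norm bounds for the representation\<close>

locale universal_rep = lp_exponent +
  fixes M :: "'m :: metric_space set" and ns :: "nat \<Rightarrow> nat" and t :: "nat \<Rightarrow> nat \<Rightarrow> 'm" and t0 :: 'm
  assumes compact_M: "compact M" and t_in: "\<And>s j. j < ns s \<Longrightarrow> t s j \<in> M" and t0_in: "t0 \<in> M"
    and t_dense: "\<And>x e. x \<in> M \<Longrightarrow> 0 < e \<Longrightarrow> \<exists>s. \<exists>j<ns s. dist x (t s j) < e"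
begin

abbreviation \<Theta> where "\<Theta> \<equiv> urep ns t t0"

lemma norm_le_sup_norm: "f \<in> cfun M \<Longrightarrow> x \<in> M \<Longrightarrow> norm (f x) \<le> sup_norm M f"
  unfolding sup_norm_def cfun_def
  by (rule cSup_upper) (auto intro!: bounded_imp_bdd_above compact_imp_bounded compact_continuous_image
      continuous_on_norm compact_M)

lemma sup_norm_le: "(\<And>x. x \<in> M \<Longrightarrow> norm (f x) \<le> c) \<Longrightarrow> sup_norm M f \<le> c"
  unfolding sup_norm_def by (rule cSup_least) (use t0_in in auto)

lemma sup_norm_nonneg: "f \<in> cfun M \<Longrightarrow> 0 \<le> sup_norm M f"
  using norm_le_sup_norm[OF _ t0_in] norm_ge_zero order_trans by blast

text \<open>The representation is the scalar \<open>f t0\<close> plus a Rademacher multiplier with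
  entries \<open>f (t s j) - f t0\<close>, at most twice the supremum of \<open>f\<close>, whence
  the constant \<open>1 + \<kappa> * 2\<close>. The multiplier acts separately on each cube at fixed
  level and multiplicity, always with the same \<open>\<kappa>\<close>.\<close>

lemma urep_bounded:
  obtains \<kappa> where "1 \<le> \<kappa>" "\<And>f y. f \<in> cfun M \<Longrightarrow> y \<in> lp \<Longrightarrow> \<Theta> f y \<in> lp \<and> nrm (\<Theta> f y) \<le> \<kappa> * sup_norm M f * nrm y"
proof -
  obtain \<kappa> :: real where k: "0 < \<kappa>" "\<And>n d y D. (\<And>j. j < n \<Longrightarrow> norm (d j) \<le> D) \<Longrightarrow> 0 \<le> D \<Longrightarrow>
    (\<Sum>u\<in>cube n. norm (\<Sum>j<n. d j * of_real (radem j u) * rcoef n j y) powr p) \<le> (\<kappa> * D) powr p * (\<Sum>v\<in>cube n. norm (y v) powr p)"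
    by (rule radem_multiplier_bound[OF p_gt_1]) blast
  show ?thesis
  proof (rule that[of "1 + \<kappa> * 2"])
    show "1 \<le> 1 + \<kappa> * 2" using k by simp
    fix f :: "'m \<Rightarrow> complex" and y :: "(nat \<times> nat) \<times> nat \<Rightarrow> complex"
    assume f: "f \<in> cfun M" and y: "y \<in> lp"
    define D where "D = sup_norm M f"
    have D: "0 \<le> D" using sup_norm_nonneg[OF f] by (simp add: D_def)
    define w where "w = (\<lambda>((s, u), k). if u \<in> cube (ns s) then \<Sum>j<ns s. (f (t s j) - f t0) * of_real (radem j u) * rcoef (ns s) j (\<lambda>v. y ((s, v), k)) else 0)"
    have eq: "\<Theta> f y = (\<lambda>i. f t0 * y i) + w" by (auto simp: urep_def w_def pointwise)
    have "(\<Sum>i\<in>F. norm (w i) powr p) \<le> (\<kappa> * (2 * D) * nrm y) powr p" if F: "finite F" for F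
    proof -
      \<comment> \<open>The multiplier estimate needs whole cubes: \<open>G\<close> collects the
        pairs of level and multiplicity met by \<open>F\<close>, and \<open>H\<close> all sign
        vectors over them.\<close>
      define G where "G = (\<lambda>((s, u), k). (s, k)) ` F"
      define H where "H = (SIGMA g:G. cube (ns (fst g)))"
      let ?h = "\<lambda>(g, u). ((fst g, u), snd g)"
      have G: "finite G" and H: "finite H" using F by (auto simp: G_def H_def)
      have inj: "inj_on ?h H" by (auto simp: inj_on_def)
      have d: "norm (f (t s j) - f t0) \<le> 2 * D" if "j < ns s" for s j
        using norm_triangle_ineq4[of "f (t s j)" "f t0"] norm_le_sup_norm[OF f t_in[OF that]] norm_le_sup_norm[OF f t0_in]
        by (simp add: D_def)
      have "(\<Sum>i\<in>F. norm (w i) powr p) = (\<Sum>i\<in>F \<inter> ?h ` H. norm (w i) powr p)"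
      proof (intro sum.mono_neutral_right ballI)
        fix i assume i: "i \<in> F - F \<inter> ?h ` H"
        obtain s u k where ii: "i = ((s, u), k)" by (metis surj_pair)
        have "(s, k) \<in> G" using i ii by (force simp: G_def)
        then have "u \<notin> cube (ns s)" using i ii by (force simp: H_def)
        then show "norm (w i) powr p = 0" using p_pos by (simp add: w_def ii)
      qed (use F in auto)
      also have "\<dots> \<le> (\<Sum>i\<in>?h ` H. norm (w i) powr p)" using H by (intro sum_mono2) auto
      also have "\<dots> = (\<Sum>(g, u)\<in>H. norm (w ((fst g, u), snd g)) powr p)"
        by (subst sum.reindex[OF inj]) (auto intro: sum.cong)
      also have "\<dots> = (\<Sum>g\<in>G. \<Sum>u\<in>cube (ns (fst g)). norm (w ((fst g, u), snd g)) powr p)"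
        unfolding H_def using G by (subst sum.Sigma) auto
      also have "\<dots> = (\<Sum>g\<in>G. \<Sum>u\<in>cube (ns (fst g)). norm (\<Sum>j<ns (fst g). (f (t (fst g) j) - f t0) * of_real (radem j u) * rcoef (ns (fst g)) j (\<lambda>v. y ((fst g, v), snd g))) powr p)"
        by (intro sum.cong refl) (simp add: w_def)
      also have "\<dots> \<le> (\<Sum>g\<in>G. (\<kappa> * (2 * D)) powr p * (\<Sum>v\<in>cube (ns (fst g)). norm (y ((fst g, v), snd g)) powr p))"
        using D by (intro sum_mono k(2) d) auto
      also have "\<dots> = (\<kappa> * (2 * D)) powr p * (\<Sum>(g, u)\<in>H. norm (y ((fst g, u), snd g)) powr p)"
        unfolding H_def using G by (subst sum.Sigma[symmetric]) (auto simp: sum_distrib_left)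
      also have "(\<Sum>(g, u)\<in>H. norm (y ((fst g, u), snd g)) powr p) = (\<Sum>i\<in>?h ` H. norm (y i) powr p)"
        by (subst sum.reindex[OF inj]) (auto intro: sum.cong)
      also have "(\<kappa> * (2 * D)) powr p * (\<Sum>i\<in>?h ` H. norm (y i) powr p) \<le> (\<kappa> * (2 * D)) powr p * nrm y powr p"
        using H by (intro mult_left_mono sum_le_nrm y) auto
      also have "\<dots> = (\<kappa> * (2 * D) * nrm y) powr p" using k D by (simp add: powr_mult)
      finally show ?thesis .
    qed
    then have w: "w \<in> lp" "nrm w \<le> \<kappa> * (2 * D) * nrm y" using lp_nrm_bound[of "\<kappa> * (2 * D) * nrm y" w] k D by auto
    have "norm (f t0) * nrm y \<le> D * nrm y" using norm_le_sup_norm[OF f t0_in] by (intro mult_right_mono) (auto simp: D_def)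
    moreover have "nrm (\<Theta> f y) \<le> norm (f t0) * nrm y + nrm w"
      unfolding eq using lp_add(2)[OF nrm_scale(1)[OF y] w(1)] nrm_scale(2)[OF y] by metis
    ultimately have "nrm (\<Theta> f y) \<le> (1 + \<kappa> * 2) * sup_norm M f * nrm y"
      using w(2) by (simp add: algebra_simps flip: D_def)
    moreover have "\<Theta> f y \<in> lp" unfolding eq by (intro lp_add(1) nrm_scale(1) y w)
    ultimately show "\<Theta> f y \<in> lp \<and> nrm (\<Theta> f y) \<le> (1 + \<kappa> * 2) * sup_norm M f * nrm y" by simp
  qed
qed

lemma blin_urep: "f \<in> cfun M \<Longrightarrow> blin (\<Theta> f)"
proof -
  assume f: "f \<in> cfun M"
  obtain \<kappa> where k: "1 \<le> \<kappa>" "\<And>f y. f \<in> cfun M \<Longrightarrow> y \<in> lp \<Longrightarrow> \<Theta> f y \<in> lp \<and> nrm (\<Theta> f y) \<le> \<kappa> * sup_norm M f * nrm y"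
    by (rule urep_bounded) blast
  show ?thesis by (rule blinI[of _ "\<kappa> * sup_norm M f"]) (use k(2)[OF f] urep_lin in auto)
qed

text \<open>The \<open>j\<close>-th Rademacher function is an eigenvector, and infinite multiplicity
  provides a copy of it away from any given finite set.\<close>

lemma urep_eigenvector:
  assumes "j < ns s" "finite F"
  obtains w where "w \<in> lp" "w \<noteq> 0" "restr (- F) w = w" "\<And>f. \<Theta> f w = (\<lambda>i. f (t s j) * w i)"
proof -
  obtain k where k: "k \<notin> snd ` F" using assms(2) by (meson ex_new_if_finite finite_imageI infinite_UNIV_nat)
  define w :: "(nat \<times> nat) \<times> nat \<Rightarrow> complex" where
    "w = (\<lambda>((s', u), k'). if s' = s \<and> k' = k \<and> u \<in> cube (ns s) then of_real (radem j u) else 0)"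
  have "finite ((\<lambda>u. ((s, u), k)) ` cube (ns s))" by simp
  then have "w \<in> lp" by (rule nrm_finite_powr(1)) (auto simp: w_def split: prod.splits if_splits)
  moreover have "w \<noteq> 0"
  proof -
    have "card (cube (ns s)) > 0" by simp
    then obtain u where "u \<in> cube (ns s)" by (metis card_gt_0_iff ex_in_conv)
    then have "w ((s, u), k) \<noteq> 0" by (simp add: w_def radem_def)
    then show ?thesis by (auto simp: zero_fun_apply)
  qed
  moreover have "restr (- F) w = w"
    using k by (auto simp: restr_def w_def fun_eq_iff intro: rev_image_eqI)
  moreover have "\<Theta> f w = (\<lambda>i. f (t s j) * w i)" for f
  proof
    fix i :: "(nat \<times> nat) \<times> nat"
    obtain s' u k' where i: "i = ((s', u), k')" by (metis surj_pair)
    show "\<Theta> f w i = f (t s j) * w i"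
    proof (cases "s' = s \<and> k' = k \<and> u \<in> cube (ns s)")
      case True
      have "\<Theta> f w ((s, u), k) = (\<Sum>i<ns s. of_real (radem i u) * (f (t s i) * (if i = j then 1 else 0)))"
      proof (rule urep_radem_vector)
        show "w ((s, u), k) = (\<Sum>i<ns s. of_real (radem i u) * (if i = j then 1 else 0))" if "u \<in> cube (ns s)" for u
          using that assms(1) by (simp add: w_def if_distrib cong: if_cong)
      qed (use True in auto)
      also have "\<dots> = (\<Sum>i<ns s. if i = j then of_real (radem i u) * f (t s i) else 0)"
        by (intro sum.cong refl) auto
      also have "\<dots> = f (t s j) * w i" using True assms(1) by (simp add: w_def i)
      finally show ?thesis using True i by simp
    next
      case False
      have "rcoef (ns s') l (\<lambda>v. w ((s', v), k')) = 0" if "u \<in> cube (ns s')" for l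
      proof -
        have "w ((s', v), k') = 0" for v using False that by (auto simp: w_def)
        then show ?thesis by (simp add: rcoef_def)
      qed
      then show ?thesis using False by (auto simp: urep_def i w_def)
    qed
  qed
  ultimately show ?thesis using that by blast
qed

text \<open>A compact perturbation is negligible on eigenvectors supported far out, so no essential
  bound can go below the values of \<open>f\<close> at the points \<open>t s j\<close>, and these
  are dense in \<open>M\<close>.\<close>

lemma urep_lower_bound:
  assumes f: "f \<in> cfun M" and K: "cpt K" and c: "0 \<le> c" "\<And>y. y \<in> lp \<Longrightarrow> nrm (\<Theta> f y + K y) \<le> c * nrm y"
  shows "sup_norm M f \<le> c"
proof (rule sup_norm_le)
  have tj: "norm (f (t s j)) \<le> c" if j: "j < ns s" for s j
  proof (rule field_le_epsilon)
    fix e :: real assume e: "e > 0"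
    obtain F where F: "finite F" "\<And>x. x \<in> lp \<Longrightarrow> nrm (K (restr (- F) x)) \<le> e * nrm x"
      by (rule cpt_tail_right[OF K e]) blast
    obtain w where w: "w \<in> lp" "w \<noteq> 0" "restr (- F) w = w" "\<Theta> f w = (\<lambda>i. f (t s j) * w i)"
      by (rule urep_eigenvector[OF j F(1)]) blast
    have pos: "nrm w > 0" using nrm_eq_0[OF w(1)] w(2) nrm_nonneg[of w] by linarith
    have Kw: "K w \<in> lp" "nrm (K w) \<le> e * nrm w" using blin_lp[OF cpt_blin[OF K] w(1)] F(2)[OF w(1)] w(3) by auto
    have Tw: "\<Theta> f w \<in> lp" by (rule blin_lp[OF blin_urep[OF f] w(1)])
    have "norm (f (t s j)) * nrm w = nrm (\<Theta> f w)" unfolding w(4) by (simp add: nrm_scale(2)[OF w(1)])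
    also have "\<dots> \<le> nrm (\<Theta> f w + K w) + nrm (K w)"
      using lp_diff(2)[OF lp_add(1)[OF Tw Kw(1)] Kw(1)] by simp
    also have "\<dots> \<le> c * nrm w + e * nrm w" using c(2)[OF w(1)] Kw by linarith
    finally have "norm (f (t s j)) * nrm w \<le> (c + e) * nrm w" by (simp add: algebra_simps)
    then show "norm (f (t s j)) \<le> c + e" using pos by simp
  qed
  fix x assume x: "x \<in> M"
  show "norm (f x) \<le> c"
  proof (rule field_le_epsilon)
    fix e :: real assume e: "e > 0"
    have "continuous_on M f" using f by (simp add: cfun_def)
    then obtain d where d: "d > 0" "\<And>y. y \<in> M \<Longrightarrow> dist y x < d \<Longrightarrow> dist (f y) (f x) < e"
      using x e unfolding continuous_on_iff by metis
    obtain s j where j: "j < ns s" "dist x (t s j) < d" using t_dense[OF x d(1)] by blast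
    have "dist (f (t s j)) (f x) < e" using j by (intro d(2) t_in) (auto simp: dist_commute)
    then have "norm (f x) \<le> norm (f (t s j)) + e"
      by (metis dist_norm norm_minus_commute norm_triangle_sub add_left_mono less_imp_le order_trans)
    then show "norm (f x) \<le> c + e" using tj[OF j(1)] by linarith
  qed
qed

end

section \<open>Geometric tails and averages over cubes\<close>

lemma sum_powr_le_powr_sum:
  fixes a :: "'s \<Rightarrow> real"
  assumes p: "1 \<le> p" and a: "\<And>s. s \<in> A \<Longrightarrow> 0 \<le> a s"
  shows "(\<Sum>s\<in>A. a s powr p) \<le> (\<Sum>s\<in>A. a s) powr p"
  using a
proof (induction A rule: infinite_finite_induct)
  case (insert b A)
  define S where "S = (\<Sum>s\<in>A. a s)"
  have S: "S \<ge> 0" "a b \<ge> 0" using insert.prems by (auto simp: S_def intro!: sum_nonneg)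
  have "a b powr p + S powr p \<le> (a b + S) powr p"
  proof (cases "a b + S = 0")
    case True
    then have "a b = 0" "S = 0" using S by auto
    then show ?thesis using p by simp
  next
    case False
    define T where "T = a b + S"
    have T: "T > 0" using False S by (simp add: T_def)
    \<comment> \<open>Superadditivity of the power comes from linearising each part with the common
      slope \<open>T powr (p - 1)\<close>.\<close>
    have *: "u powr p \<le> u * T powr (p - 1)" if "0 \<le> u" "u \<le> T" for u
    proof (cases "u = 0")
      case False
      then have "u powr p = u * u powr (p - 1)" using that powr_add[of u 1 "p - 1"] by simp
      also have "\<dots> \<le> u * T powr (p - 1)" using that p by (intro mult_left_mono powr_mono2) auto
      finally show ?thesis .
    qed simp
    have "a b powr p + S powr p \<le> a b * T powr (p - 1) + S * T powr (p - 1)"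
      using S by (intro add_mono *) (auto simp: T_def)
    also have "\<dots> = T * T powr (p - 1)" by (simp add: T_def distrib_right)
    also have "\<dots> = T powr p" using T powr_add[of T 1 "p - 1"] by simp
    finally show ?thesis by (simp add: T_def)
  qed
  then show ?case using insert by (simp add: S_def)
qed simp_all

lemma half_powers_tail:
  assumes "finite A" "A \<subseteq> {s0..}"
  shows "(\<Sum>s\<in>A. (1/2) ^ s) \<le> 2 * (1/2 :: real) ^ s0"
proof -
  obtain n where n: "A \<subseteq> {..<n}" using assms(1) finite_nat_bounded by blast
  have "(\<Sum>s\<in>A. (1/2 :: real) ^ s) \<le> (\<Sum>s\<in>{s0..<s0 + n}. (1/2) ^ s)"
    using n assms(2) by (intro sum_mono2) (auto simp: subset_iff)
  also have "\<dots> = (\<Sum>s<n. (1/2) ^ (s + s0))"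
    using sum.shift_bounds_nat_ivl[of "\<lambda>s. (1/2 :: real) ^ s" 0 s0 n] by (simp add: atLeast0LessThan add.commute)
  also have "\<dots> = (1/2) ^ s0 * (\<Sum>s<n. (1/2) ^ s)" by (simp add: power_add sum_distrib_left mult.commute)
  also have "(\<Sum>s<n. (1/2 :: real) ^ s) = 2 * (1 - (1/2) ^ n)" by (simp only: sum_gp_strict) simp
  also have "(1/2) ^ s0 * (2 * (1 - (1/2) ^ n)) \<le> (1/2) ^ s0 * (2 * 1 :: real)" by (intro mult_left_mono) auto
  finally show ?thesis by simp
qed

context lp_exponent
begin

lemma half_powers_tail_powr:
  assumes "finite A" "A \<subseteq> {s0..}" "0 \<le> c"
  shows "(\<Sum>s\<in>A. ((1/2) ^ s * c) powr p) \<le> (2 * (1/2) ^ s0 * c) powr p"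
proof -
  have "(\<Sum>s\<in>A. ((1/2) ^ s * c) powr p) \<le> (\<Sum>s\<in>A. (1/2) ^ s * c) powr p"
    using assms p_gt_1 by (intro sum_powr_le_powr_sum) auto
  also have "\<dots> \<le> (2 * (1/2) ^ s0 * c) powr p"
    using assms p_pos half_powers_tail[OF assms(1,2)] unfolding sum_distrib_right[symmetric]
    by (intro powr_mono2 mult_right_mono) (auto intro!: sum_nonneg mult_nonneg_nonneg)
  finally show ?thesis .
qed

text \<open>With \<open>2 ^ n\<close> sign vectors, \<open>stack_scale\<close> turns a p-sum over
  the cube into an average of p-th powers, and \<open>avg_scale\<close> is the factor belonging to
  the dual exponent. Their product is the weight of the uniform probability.\<close>

definition stack_scale :: "nat \<Rightarrow> real" where "stack_scale n = (2 ^ n) powr (- 1 / p)"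

definition avg_scale :: "nat \<Rightarrow> real" where "avg_scale n = (2 ^ n) powr (1 / p - 1)"

lemma scale_mult: "avg_scale n * stack_scale n = 1 / 2 ^ n"
proof -
  have "(2 ^ n :: real) powr (1 / p - 1 + - 1 / p) = (2 ^ n) powr (- 1)" by simp
  then show ?thesis unfolding avg_scale_def stack_scale_def powr_add[symmetric]
    by (simp add: powr_minus_divide)
qed

text \<open>Levels of different dimension share the index type, so sign vectors outside the cube of
  their level carry zero. One of these idle slots is put to use later.\<close>

definition cube_stack :: "(nat \<Rightarrow> nat) \<Rightarrow> (nat \<Rightarrow> nat \<Rightarrow> ('i \<Rightarrow> complex) \<Rightarrow> 'k \<Rightarrow> complex) \<Rightarrow> nat \<times> nat \<Rightarrow>
    ('i \<Rightarrow> complex) \<Rightarrow> 'k \<Rightarrow> complex" where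
  "cube_stack ns E = (\<lambda>(s, u) x k. if u \<in> cube (ns s) then of_real (stack_scale (ns s)) * E s u x k else 0)"

definition cube_avg :: "nat \<Rightarrow> nat \<Rightarrow> (nat \<Rightarrow> ('i \<Rightarrow> complex) \<Rightarrow> 'k \<Rightarrow> complex) \<Rightarrow>
    ((nat \<times> nat) \<times> 'i \<Rightarrow> complex) \<Rightarrow> 'k \<Rightarrow> complex" where
  "cube_avg n s E y = (\<lambda>k. of_real (avg_scale n) * (\<Sum>u\<in>cube n. E u (slice (s, u) y)) k)"

lemma blin_cube_stack:
  assumes "\<And>s u. u \<in> cube (ns s) \<Longrightarrow> blin (E s u)"
  shows "blin (cube_stack ns E a)"
proof -
  obtain s u where a: "a = (s, u)" by (metis surj_pair)
  show ?thesis
  proof (cases "u \<in> cube (ns s)")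
    case True
    then have "cube_stack ns E a = (\<lambda>x k. of_real (stack_scale (ns s)) * E s u x k)" by (simp add: cube_stack_def a)
    then show ?thesis using blin_smult[OF assms[OF True]] by simp
  next
    case False
    then have "cube_stack ns E a = (\<lambda>x. 0)" by (auto simp: cube_stack_def a pointwise)
    then show ?thesis by (simp add: blin_zero)
  qed
qed

lemma cpt_cube_stack:
  assumes "\<And>s u. u \<in> cube (ns s) \<Longrightarrow> cpt (E s u)"
  shows "cpt (cube_stack ns E a)"
proof -
  obtain s u where a: "a = (s, u)" by (metis surj_pair)
  show ?thesis
  proof (cases "u \<in> cube (ns s)")
    case True
    then have "cube_stack ns E a = (\<lambda>x k. of_real (stack_scale (ns s)) * E s u x k)" by (simp add: cube_stack_def a)
    then show ?thesis using cpt_smult[OF assms[OF True]] by simp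
  next
    case False
    then have "cube_stack ns E a = (\<lambda>x. 0)" by (auto simp: cube_stack_def a pointwise)
    then show ?thesis by (simp add: cpt_zero)
  qed
qed

text \<open>The scaling makes a whole cube contribute the mean of the p-th powers, hence at most
  \<open>d s powr p\<close>, however large its dimension.\<close>

lemma cube_stack_sum_le:
  assumes A: "finite A" and S: "finite S" "\<And>s u. (s, u) \<in> A \<Longrightarrow> u \<in> cube (ns s) \<Longrightarrow> s \<in> S"
    and E: "\<And>s u. u \<in> cube (ns s) \<Longrightarrow> E s u x \<in> lp" "\<And>s u. u \<in> cube (ns s) \<Longrightarrow> nrm (E s u x) \<le> d s"
  shows "(\<Sum>a\<in>A. nrm (cube_stack ns E a x) powr p) \<le> (\<Sum>s\<in>S. d s powr p)"
proof -
  let ?B = "SIGMA s:S. cube (ns s)"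
  have "(\<Sum>a\<in>A. nrm (cube_stack ns E a x) powr p) = (\<Sum>a\<in>A \<inter> ?B. nrm (cube_stack ns E a x) powr p)"
  proof (intro sum.mono_neutral_right ballI)
    fix a assume a: "a \<in> A - A \<inter> ?B"
    obtain s u where su: "a = (s, u)" by (metis surj_pair)
    have "u \<notin> cube (ns s)" using a su S by auto
    then have "cube_stack ns E a x = 0" by (auto simp: cube_stack_def su pointwise)
    then show "nrm (cube_stack ns E a x) powr p = 0" using p_pos by simp
  qed (use A in auto)
  also have "\<dots> \<le> (\<Sum>a\<in>?B. nrm (cube_stack ns E a x) powr p)" using S by (intro sum_mono2) auto
  also have "\<dots> = (\<Sum>s\<in>S. \<Sum>u\<in>cube (ns s). nrm (cube_stack ns E (s, u) x) powr p)"
    using S by (subst sum.Sigma) auto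
  also have "\<dots> \<le> (\<Sum>s\<in>S. \<Sum>u\<in>cube (ns s). d s powr p / 2 ^ ns s)"
  proof (intro sum_mono)
    fix s u assume u: "u \<in> cube (ns s)"
    have "nrm (cube_stack ns E (s, u) x) = stack_scale (ns s) * nrm (E s u x)"
      using u nrm_scale(2)[OF E(1)[OF u], of "of_real (stack_scale (ns s))"] by (simp add: cube_stack_def stack_scale_def)
    then have "nrm (cube_stack ns E (s, u) x) powr p = stack_scale (ns s) powr p * nrm (E s u x) powr p"
      by (simp add: powr_mult stack_scale_def)
    also have "stack_scale (ns s) powr p = 1 / 2 ^ ns s"
      unfolding stack_scale_def powr_powr using p_pos by (simp add: powr_minus_divide)
    also have "1 / 2 ^ ns s * nrm (E s u x) powr p \<le> d s powr p / 2 ^ ns s"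
      using powr_mono2[of p "nrm (E s u x)" "d s"] E(2)[OF u] p_pos by (simp add: divide_right_mono)
    finally show "nrm (cube_stack ns E (s, u) x) powr p \<le> d s powr p / 2 ^ ns s" .
  qed
  finally show ?thesis by simp
qed

lemma blin_cube_avg:
  assumes "\<And>u. u \<in> cube n \<Longrightarrow> blin (E u)"
  shows "blin (cube_avg n s E)"
proof -
  have "blin (\<lambda>y. \<Sum>u\<in>cube n. E u (slice (s, u) y))"
    by (intro blin_setsum finite_cube blin_comp[OF _ blin_slice] assms)
  from blin_smult[OF this, of "of_real (avg_scale n)"] show ?thesis unfolding cube_avg_def .
qed

text \<open>The loss \<open>(2 ^ n) powr (p - 1)\<close> of the power mean inequality is exactly
  undone by the p-th power of \<open>avg_scale n\<close>, so the bound is free of the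
  dimension.\<close>

lemma nrm_cube_avg:
  assumes E: "\<And>u z. u \<in> cube n \<Longrightarrow> z \<in> lp \<Longrightarrow> E u z \<in> lp" "\<And>u z. u \<in> cube n \<Longrightarrow> z \<in> lp \<Longrightarrow> nrm (E u z) \<le> b * nrm z"
    and b: "0 \<le> b" and y: "y \<in> lp"
  shows "nrm (cube_avg n s E y) powr p \<le> b powr p * (\<Sum>u\<in>cube n. nrm (slice (s, u) y) powr p)"
proof -
  let ?q = "\<Sum>u\<in>cube n. E u (slice (s, u) y)"
  have l: "?q \<in> lp" by (intro lp_sum E slice_lp y) auto
  have a0: "0 \<le> avg_scale n" by (simp add: avg_scale_def)
  have "nrm ?q \<le> (\<Sum>u\<in>cube n. nrm (E u (slice (s, u) y)))" by (intro lp_sum E slice_lp y) auto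
  also have "\<dots> \<le> (\<Sum>u\<in>cube n. b * nrm (slice (s, u) y))" by (intro sum_mono E slice_lp y)
  finally have "nrm ?q powr p \<le> (\<Sum>u\<in>cube n. b * nrm (slice (s, u) y)) powr p" using p_pos by (intro powr_mono2) auto
  also have "\<dots> \<le> real (card (cube n)) powr (p - 1) * (\<Sum>u\<in>cube n. (b * nrm (slice (s, u) y)) powr p)"
    by (intro power_mean_powr p_gt_1) (use b in auto)
  also have "\<dots> = (2 ^ n) powr (p - 1) * (b powr p * (\<Sum>u\<in>cube n. nrm (slice (s, u) y) powr p))"
    using b by (simp add: powr_mult sum_distrib_left)
  finally have *: "nrm ?q powr p \<le> (2 ^ n) powr (p - 1) * (b powr p * (\<Sum>u\<in>cube n. nrm (slice (s, u) y) powr p))" .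
  have "nrm (cube_avg n s E y) powr p = avg_scale n powr p * nrm ?q powr p"
    unfolding cube_avg_def nrm_scale(2)[OF l] using a0 by (simp add: powr_mult)
  also have "\<dots> \<le> avg_scale n powr p * ((2 ^ n) powr (p - 1) * (b powr p * (\<Sum>u\<in>cube n. nrm (slice (s, u) y) powr p)))"
    using * by (intro mult_left_mono) auto
  also have "avg_scale n powr p = (2 ^ n) powr (1 - p)"
    using p_pos by (simp add: avg_scale_def powr_powr left_diff_distrib)
  also have "(2 ^ n) powr (1 - p) * ((2 ^ n) powr (p - 1) * (b powr p * (\<Sum>u\<in>cube n. nrm (slice (s, u) y) powr p)))
      = b powr p * (\<Sum>u\<in>cube n. nrm (slice (s, u) y) powr p)"
    by (simp flip: mult.assoc powr_add)
  finally show ?thesis .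
qed

lemma slices_cube_sum_le:
  assumes "finite A" "y \<in> lp"
  shows "(\<Sum>s\<in>A. \<Sum>u\<in>cube (ns s). nrm (slice (s, u) y) powr p) \<le> nrm y powr p"
proof -
  have "(\<Sum>s\<in>A. \<Sum>u\<in>cube (ns s). nrm (slice (s, u) y) powr p) = (\<Sum>a\<in>(SIGMA s:A. cube (ns s)). nrm (slice a y) powr p)"
    using assms by (subst sum.Sigma) (auto intro!: sum.cong)
  also have "\<dots> \<le> nrm y powr p" using assms by (intro slices_le) auto
  finally show ?thesis .
qed

lemma ess_bdd_cpt: "cpt K \<Longrightarrow> 0 \<le> c \<Longrightarrow> ess_bdd K c"
  unfolding ess_bdd_def
  by (intro exI[of _ "\<lambda>x. 0 - K x"] conjI cpt_minus cpt_zero) simp_all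

lemma ess_bdd_mod_cpt: "ess_bdd T c \<Longrightarrow> cpt (\<lambda>x. S x - T x) \<Longrightarrow> ess_bdd S c"
  unfolding ess_bdd_def
proof (elim exE conjE)
  fix K assume K: "cpt K" "\<forall>x\<in>lp. nrm (T x + K x) \<le> c * nrm x" and ST: "cpt (\<lambda>x. S x - T x)"
  show "\<exists>K. cpt K \<and> (\<forall>x\<in>lp. nrm (S x + K x) \<le> c * nrm x)"
  proof (intro exI[of _ "\<lambda>x. K x - (S x - T x)"] conjI cpt_minus[OF K(1) ST])
    have eq: "S x + (K x - (S x - T x)) = T x + K x" for x by (auto simp: pointwise)
    show "\<forall>x\<in>lp. nrm (S x + (K x - (S x - T x))) \<le> c * nrm x" unfolding eq by (rule K(2))
  qed
qed

text \<open>An essential bound becomes a genuine bound beyond some \<open>N\<close>, because the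
  correction \<open>K\<close> has small tails on both sides; the slack \<open>c' - c\<close> absorbs
  it.\<close>

lemma ess_bdd_tail:
  fixes T :: "seq \<Rightarrow> seq"
  assumes T: "blin T" and b: "ess_bdd T c" and cc: "c < c'"
  shows "\<forall>\<^sub>F N in sequentially. \<forall>x\<in>lp. nrm (T (restr (- {..<N}) x)) \<le> c' * nrm x \<and> nrm (restr (- {..<N}) (T x)) \<le> c' * nrm x"
proof -
  obtain K where K: "cpt K" "\<And>x. x \<in> lp \<Longrightarrow> nrm (T x + K x) \<le> c * nrm x" using b unfolding ess_bdd_def by blast
  have bK: "blin K" using K cpt_blin by blast
  define d where "d = c' - c"
  have d: "d > 0" using cc by (simp add: d_def)
  obtain F where F: "finite F" "\<And>x. x \<in> lp \<Longrightarrow> nrm (K (restr (- F) x)) \<le> d * nrm x"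
    by (rule cpt_tail_right[OF K(1) d]) blast
  obtain G where G: "finite G" "\<And>x. x \<in> lp \<Longrightarrow> nrm (restr (- G) (K x)) \<le> d * nrm x"
    using K(1) d unfolding cpt_def by metis
  have "finite (F \<union> G)" using F G by simp
  then obtain N0 where N0: "F \<union> G \<subseteq> {..<N0}" using finite_nat_bounded by blast
  \<comment> \<open>The sign is needed when the norm of the restricted vector is replaced by that of
    \<open>x\<close>.\<close>
  have c0: "0 \<le> c"
  proof -
    define e :: seq where "e = (\<lambda>i. if i = 0 then 1 else 0)"
    have e: "e \<in> lp" "nrm e powr p = 1" using nrm_finite_powr[of "{0}" e] by (auto simp: e_def)
    then have "nrm e \<noteq> 0" using p_pos by auto
    then have "nrm e > 0" using nrm_nonneg[of e] by linarith
    moreover have "0 \<le> c * nrm e" using K(2)[OF e(1)] nrm_nonneg order_trans by blast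
    ultimately show ?thesis by (simp add: zero_le_mult_iff)
  qed
  have "nrm (T (restr (- {..<N}) x)) \<le> c' * nrm x \<and> nrm (restr (- {..<N}) (T x)) \<le> c' * nrm x"
    if N: "N \<ge> N0" and x: "x \<in> lp" for N x
  proof
    let ?R = "restr (- {..<N}) :: seq \<Rightarrow> seq"
    have sub: "F \<subseteq> {..<N}" "G \<subseteq> {..<N}" using N0 N by auto
    have R: "?R x \<in> lp" "nrm (?R x) \<le> nrm x" using x nrm_restr by auto
    have l: "T (?R x) \<in> lp" "K (?R x) \<in> lp" "T x \<in> lp" "K x \<in> lp"
      by (rule blin_lp[OF T R(1)], rule blin_lp[OF bK R(1)], rule blin_lp[OF T x], rule blin_lp[OF bK x])
    have eq: "restr (- F) (?R x) = ?R x" using sub by (auto simp: restr_def fun_eq_iff)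
    have "nrm (T (?R x)) \<le> nrm (T (?R x) + K (?R x)) + nrm (K (?R x))"
      using lp_diff(2)[OF lp_add(1)[OF l(1,2)] l(2)] by simp
    also have "\<dots> \<le> c * nrm (?R x) + d * nrm (?R x)" using K(2)[OF R(1)] F(2)[OF R(1)] eq by simp
    also have "\<dots> = c' * nrm (?R x)" by (simp add: d_def algebra_simps)
    finally show "nrm (T (?R x)) \<le> c' * nrm x" by (rule le_mult_trans[OF _ R(2)]) (use c0 cc in simp)
    have "nrm (?R (T x)) \<le> nrm (?R (T x) + ?R (K x)) + nrm (?R (K x))"
      using lp_diff(2)[OF lp_add(1)[OF restr_lp[OF l(3)] restr_lp[OF l(4)]] restr_lp[OF l(4)]] by (metis add_diff_cancel_right')
    also have "?R (T x) + ?R (K x) = ?R (T x + K x)" by simp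
    also have "nrm (?R (T x + K x)) \<le> nrm (T x + K x)" by (intro nrm_restr lp_add l)
    also have "nrm (T x + K x) \<le> c * nrm x" by (rule K(2)[OF x])
    also have "nrm (?R (K x)) \<le> nrm (restr (- G) (K x))" by (rule nrm_restr_compl_mono[OF l(4) sub(2)])
    also have "\<dots> \<le> d * nrm x" by (rule G(2)[OF x])
    finally show "nrm (?R (T x)) \<le> c' * nrm x" by (simp add: d_def algebra_simps)
  qed
  then show ?thesis unfolding eventually_sequentially by blast
qed

text \<open>Geometric decay makes the tails of the glued sum small in norm, and finitely many terms
  are compact.\<close>

lemma cpt_glue_summable:
  assumes S: "\<And>k. finite {s. k \<in> S s}" "\<And>k. card {s :: nat. k \<in> S s} \<le> 2"
    and B: "\<And>s. cpt (B s)" "\<And>s y k. k \<notin> S s \<Longrightarrow> B s y k = 0"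
    and le: "\<And>s x. x \<in> lp \<Longrightarrow> nrm (B s x) \<le> (1/2) ^ s * nrm x"
  shows "cpt (glue S B)"
proof -
  \<comment> \<open>\<open>C\<close> is \<open>B\<close> with the first \<open>s0\<close> terms
    removed; \<open>s0 = 0\<close> gives boundedness of the whole sum.\<close>
  have bound: "blin (glue S C)" "\<And>x. x \<in> lp \<Longrightarrow> nrm (glue S C x) \<le> 2 * (2 * (1/2) ^ s0) * nrm x"
    if "C = (\<lambda>s. if s < s0 then (\<lambda>x. 0) else B s)" for s0 C
  proof -
    have C: "blin (C s)" "\<And>y k. k \<notin> S s \<Longrightarrow> C s y k = 0" for s
      using B(2) cpt_blin[OF B(1)] blin_zero by (auto simp: that zero_fun_apply)
    have sum: "(\<Sum>s\<in>A. nrm (C s x) powr p) \<le> (2 * (1/2) ^ s0 * nrm x) powr p" if A: "finite A" and x: "x \<in> lp" for A x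
    proof -
      have "(\<Sum>s\<in>A. nrm (C s x) powr p) = (\<Sum>s\<in>A \<inter> {s0..}. nrm (B s x) powr p)"
        using A p_pos by (intro sum.mono_neutral_cong_right) (auto simp: \<open>C = _\<close>)
      also have "\<dots> \<le> (\<Sum>s\<in>A \<inter> {s0..}. ((1/2) ^ s * nrm x) powr p)"
        using p_pos le[OF x] by (intro sum_mono powr_mono2) auto
      also have "\<dots> \<le> (2 * (1/2) ^ s0 * nrm x) powr p" using A by (intro half_powers_tail_powr) auto
      finally show ?thesis .
    qed
    show "blin (glue S C)" by (rule glue_bounded[OF S C, where c = "2 * (1/2) ^ s0"]) (use sum in auto)
    show "\<And>x. x \<in> lp \<Longrightarrow> nrm (glue S C x) \<le> 2 * (2 * (1/2) ^ s0) * nrm x"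
      by (rule nrm_glue[OF S C, where c = "2 * (1/2) ^ s0"]) (use sum in auto)
  qed
  show ?thesis
  proof (rule cptI_approx)
    show "blin (glue S B)" using bound(1)[of "B" 0] by simp
    fix \<epsilon> :: real assume e: "\<epsilon> > 0"
    obtain s0 where s0: "(1/2 :: real) ^ s0 < \<epsilon> / 4" using real_arch_pow_inv[of "\<epsilon>/4" "1/2"] e by auto
    define C where "C = (\<lambda>s. if s < s0 then (\<lambda>x. 0) else B s)"
    have eq: "glue S B x - (\<Sum>s<s0. B s x) = glue S C x" for x
    proof
      fix k
      have "(\<Sum>s<s0. B s x k) = (\<Sum>s\<in>{s. k \<in> S s}. if s < s0 then B s x k else 0)"
      proof -
        have "(\<Sum>s\<in>{s. k \<in> S s}. if s < s0 then B s x k else 0) = (\<Sum>s\<in>{s. k \<in> S s} \<inter> {..<s0}. B s x k)"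
          using S(1) by (intro sum.mono_neutral_cong_right) auto
        also have "\<dots> = (\<Sum>s<s0. B s x k)" using B(2) by (intro sum.mono_neutral_left) auto
        finally show ?thesis by simp
      qed
      then show "(glue S B x - (\<Sum>s<s0. B s x)) k = glue S C x k"
        unfolding glue_def C_def minus_apply sum_fun_apply
        by (simp add: sum_subtractf[symmetric], intro sum.cong) (auto simp: zero_fun_apply)
    qed
    have "nrm (glue S B x - (\<Sum>s<s0. B s x)) \<le> \<epsilon> * nrm x" if x: "x \<in> lp" for x
      unfolding eq using bound(2)[OF C_def x] s0 mult_right_mono[of "2 * (2 * (1/2) ^ s0)" \<epsilon> "nrm x"] by simp
    moreover have "cpt (\<lambda>x. \<Sum>s<s0. B s x)" by (intro cpt_setsum B) auto
    ultimately show "\<exists>K. cpt K \<and> (\<forall>x\<in>lp. nrm (glue S B x - K x) \<le> \<epsilon> * nrm x)" by blast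
  qed
qed

end

section \<open>Dilation of an extension into the universal representation\<close>

lemma mulr_mulr: "mulr f (mulr g x) = mulr (\<lambda>k. f k * g k) x"
  by (simp add: mulr_def mult.assoc)

text \<open>Think of \<open>P s j\<close> as a lift of the \<open>j\<close>-th function of a square partition of unity of mesh \<open>1 / (s + 1)\<close> and of
  \<open>X i\<close> as a lift of \<open>\<xi> i\<close>. The cut-offs \<open>h s\<close> increase to \<open>1\<close>; the \<open>\<omega> s\<close> slice \<open>\<nat>\<close> up and \<open>\<eta> s = 1\<close> on
  the support of \<open>\<omega> s\<close>. The defect \<open>K s\<close> is small on the \<open>s\<close>-th slice.\<close>

locale slicing = universal_rep p M ns t t0
  for p :: real and M :: "'m :: metric_space set" and ns t t0 +
  fixes P :: "nat \<Rightarrow> nat \<Rightarrow> seq \<Rightarrow> seq" and I :: "'i set" and X :: "'i \<Rightarrow> seq \<Rightarrow> seq" and \<xi> :: "'i \<Rightarrow> 'm \<Rightarrow> complex"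
    and h :: "nat \<Rightarrow> nat \<Rightarrow> real" and C1 c0 :: real and B e :: "nat \<Rightarrow> real"
    and A :: "nat \<Rightarrow> nat \<Rightarrow> seq \<Rightarrow> seq" and G G' :: "nat \<Rightarrow> nat \<Rightarrow> 'i \<Rightarrow> seq \<Rightarrow> seq" and K :: "nat \<Rightarrow> seq \<Rightarrow> seq"
    and \<omega> \<eta> :: "nat \<Rightarrow> nat \<Rightarrow> real"
  defines "A \<equiv> (\<lambda>s u x. \<Sum>j<ns s. (\<lambda>k. of_real (radem j u) * P s j x k))"
    and "G \<equiv> (\<lambda>s u i x. \<Sum>j<ns s. (\<lambda>k. of_real (radem j u) * (\<xi> i (t s j) * P s j x k - P s j (X i x) k)))"
    and "G' \<equiv> (\<lambda>s u i x. \<Sum>j<ns s. (\<lambda>k. of_real (radem j u) * (X i (P s j x) k - \<xi> i (t s j) * P s j x k)))"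
    and "K \<equiv> (\<lambda>s x. (\<Sum>j<ns s. P s j (P s j x)) - x)"
    and "\<omega> \<equiv> (\<lambda>s k. h (s + 2) k - h (s + 1) k)"
    and "\<eta> \<equiv> (\<lambda>s k. h (s + 3) k - h s k)"
  assumes P_blin: "\<And>s j. j < ns s \<Longrightarrow> blin (P s j)" and X_blin: "\<And>i. i \<in> I \<Longrightarrow> blin (X i)"
    and xi: "\<And>i. i \<in> I \<Longrightarrow> \<xi> i \<in> cfun M"
    and C1: "0 \<le> C1" and c0: "0 \<le> c0" and B0: "\<And>s. 0 \<le> B s" and e0: "\<And>s. 0 \<le> e s"
    and h_range: "\<And>s k. 0 \<le> h s k" "\<And>s k. h s k \<le> 1"
    and h_fin: "\<And>s. finite {k. h s k \<noteq> 0}" and h_step: "\<And>s k. h s k \<noteq> 0 \<Longrightarrow> h (Suc s) k = 1"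
    and h_one: "\<And>s k. k < s \<Longrightarrow> h s k = 1"
    and A_right: "\<And>s u x. u \<in> cube (ns s) \<Longrightarrow> x \<in> lp \<Longrightarrow> nrm (A s u (mulr (\<eta> s) x)) \<le> C1 * nrm (mulr (\<eta> s) x)"
    and A_left: "\<And>s u x. u \<in> cube (ns s) \<Longrightarrow> x \<in> lp \<Longrightarrow> nrm (mulr (\<omega> s) (A s u x)) \<le> C1 * nrm x"
    and A_bound: "\<And>s u x. u \<in> cube (ns s) \<Longrightarrow> x \<in> lp \<Longrightarrow> nrm (A s u x) \<le> B s * nrm x"
    and G_right: "\<And>s u i x. u \<in> cube (ns s) \<Longrightarrow> i \<in> I \<Longrightarrow> x \<in> lp \<Longrightarrow>
      nrm (G s u i (mulr (\<eta> s) x)) \<le> c0 / real (Suc s) * nrm (mulr (\<eta> s) x)"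
    and G_left: "\<And>s u i x. u \<in> cube (ns s) \<Longrightarrow> i \<in> I \<Longrightarrow> x \<in> lp \<Longrightarrow>
      nrm (mulr (\<omega> s) (G' s u i x)) \<le> c0 / real (Suc s) * nrm x"
    and K_cpt: "\<And>s. cpt (K s)" and K_left: "\<And>s x. x \<in> lp \<Longrightarrow> nrm (mulr (\<omega> s) (K s x)) \<le> (1/2) ^ s * nrm x"
    and comm_eta: "\<And>s i x. i \<in> I \<Longrightarrow> x \<in> lp \<Longrightarrow> nrm (X i (mulr (\<eta> s) x) - mulr (\<eta> s) (X i x)) \<le> e s * nrm x"
    and comm_omega: "\<And>s i x. i \<in> I \<Longrightarrow> x \<in> lp \<Longrightarrow> nrm (X i (mulr (\<omega> s) x) - mulr (\<omega> s) (X i x)) \<le> e s * nrm x"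
    and e_B: "\<And>s. e s * B s \<le> (1/2) ^ s"
begin

section \<open>Overlap of the cut-offs\<close>

lemma h_step_add: "h s k \<noteq> 0 \<Longrightarrow> h (Suc s + n) k = 1"
proof (induction n)
  case 0
  then show ?case using h_step by simp
next
  case (Suc n)
  then show ?case using h_step[of "Suc s + n" k] by simp
qed

lemma h_later: "h s k \<noteq> 0 \<Longrightarrow> s < s' \<Longrightarrow> h s' k = 1"
  using h_step_add[of s k "s' - Suc s"] by simp

lemma h_mono: "s \<le> s' \<Longrightarrow> h s k \<le> h s' k"
  using h_later[of s k s'] h_range[of s k] h_range[of s' k] by (cases "s = s'"; cases "h s k = 0") auto

lemma omega_abs_le_1: "\<bar>\<omega> s k\<bar> \<le> 1"
  using h_mono[of "s + 1" "s + 2" k] h_range[of "s + 1" k] h_range[of "s + 2" k] by (auto simp: \<omega>_def)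

lemma eta_range: "0 \<le> \<eta> s k" "\<eta> s k \<le> 1" "\<bar>\<eta> s k\<bar> \<le> 1"
  using h_mono[of s "s + 3" k] h_range[of s k] h_range[of "s + 3" k] by (auto simp: \<eta>_def)

text \<open>\<open>\<eta> s\<close> starts one cut-off earlier and ends one later than
  \<open>\<omega> s\<close>, and each cut-off is 1 on the support of the one before.\<close>

lemma omega_eta: "\<omega> s k * \<eta> s k = \<omega> s k"
proof (cases "\<omega> s k = 0")
  case False
  then have "h (s + 1) k \<noteq> 1 \<or> h (s + 2) k \<noteq> 1" by (auto simp: \<omega>_def)
  then have "h s k = 0" using h_later[of s k "s + 1"] h_later[of s k "s + 2"] by auto
  moreover have "h (s + 3) k = 1"
  proof -
    have "h (s + 1) k \<noteq> 0 \<or> h (s + 2) k \<noteq> 0" using False by (auto simp: \<omega>_def)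
    then show ?thesis using h_later[of "s + 1" k "s + 3"] h_later[of "s + 2" k "s + 3"] by auto
  qed
  ultimately show ?thesis by (simp add: \<eta>_def)
qed simp

lemma omega_fin: "finite {k. \<omega> s k \<noteq> 0}" and eta_fin: "finite {k. \<eta> s k \<noteq> 0}"
proof -
  have "{k. \<omega> s k \<noteq> 0} \<subseteq> {k. h (s + 2) k \<noteq> 0} \<union> {k. h (s + 1) k \<noteq> 0}" by (auto simp: \<omega>_def)
  then show "finite {k. \<omega> s k \<noteq> 0}" using h_fin by (meson finite_UnI finite_subset)
  have "{k. \<eta> s k \<noteq> 0} \<subseteq> {k. h (s + 3) k \<noteq> 0} \<union> {k. h s k \<noteq> 0}" by (auto simp: \<eta>_def)
  then show "finite {k. \<eta> s k \<noteq> 0}" using h_fin by (meson finite_UnI finite_subset)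
qed

definition S :: "nat \<Rightarrow> nat set" where "S s = {k. \<omega> s k \<noteq> 0}"

text \<open>Since \<open>h s\<close> is 1 below \<open>s\<close>, differences beyond level
  \<open>k\<close> vanish at coordinate \<open>k\<close>.\<close>

lemma S_subset: "{s. k \<in> S s} \<subseteq> {..k}"
proof
  fix s assume s: "s \<in> {s. k \<in> S s}"
  show "s \<in> {..k}"
  proof (rule ccontr)
    assume "s \<notin> {..k}"
    then have "h (s + 1) k = 1" "h (s + 2) k = 1" by (auto intro!: h_one)
    then show False using s by (simp add: S_def \<omega>_def)
  qed
qed

lemma S_fin: "finite {s. k \<in> S s}"
  using S_subset finite_subset by blast

text \<open>At a given coordinate the cut-offs pass from 0 to 1 with at most one value in between,
  so only two consecutive differences can be nonzero.\<close>

lemma S_card: "card {s. k \<in> S s} \<le> 2"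
proof (cases "{s. k \<in> S s} = {}")
  case False
  define s0 where "s0 = Min {s. k \<in> S s}"
  have s0: "k \<in> S s0" using Min_in[OF S_fin False] by (simp add: s0_def)
  have "{s. k \<in> S s} \<subseteq> {s0, Suc s0}"
  proof
    fix s assume s: "s \<in> {s. k \<in> S s}"
    have "s0 \<le> s" using Min_le[OF S_fin s] by (simp add: s0_def)
    moreover have "\<not> s0 + 2 \<le> s"
    proof
      assume le: "s0 + 2 \<le> s"
      have "h (s0 + 1) k \<noteq> 0 \<or> h (s0 + 2) k \<noteq> 0" using s0 by (auto simp: S_def \<omega>_def)
      then have "h (s + 1) k = 1 \<and> h (s + 2) k = 1"
        using le h_later[of "s0 + 1" k "s + 1"] h_later[of "s0 + 2" k "s + 1"] h_later[of "s0 + 1" k "s + 2"] h_later[of "s0 + 2" k "s + 2"] by auto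
      then show False using s by (simp add: S_def \<omega>_def)
    qed
    ultimately show "s \<in> {s0, Suc s0}" by auto
  qed
  then show ?thesis using card_mono[of "{s0, Suc s0}" "{s. k \<in> S s}"] by (simp add: numeral_2_eq_2)
qed simp

lemmas mulr_omega = blin_mulr[of "\<omega> s" for s, OF omega_abs_le_1]
lemmas mulr_eta = blin_mulr[of "\<eta> s" for s, OF eta_range(3)]

lemma cpt_omega: "cpt (mulr (\<omega> s))" and cpt_eta: "cpt (mulr (\<eta> s))"
  using cpt_mulr[OF omega_abs_le_1 omega_fin] cpt_mulr[OF eta_range(3) eta_fin] by auto

lemma A_blin: "blin (A s u)"
  unfolding A_def by (intro blin_setsum blin_smult P_blin) auto

lemma G'_blin: "i \<in> I \<Longrightarrow> blin (G' s u i)"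
proof -
  assume i: "i \<in> I"
  have "blin (\<lambda>x k. of_real (radem j u) * (X i (P s j x) k - \<xi> i (t s j) * P s j x k))" if "j < ns s" for j
  proof -
    have "blin (\<lambda>x. X i (P s j x) - (\<lambda>k. \<xi> i (t s j) * P s j x k))"
      by (intro blin_minus blin_comp[OF X_blin[OF i]] blin_smult P_blin that)
    from blin_smult[OF this] show ?thesis by (simp add: minus_apply)
  qed
  then show ?thesis unfolding G'_def by (intro blin_setsum) auto
qed

text \<open>Since \<open>\<eta> s k\<close> lies between 0 and 1, its p-th power is at most itself,
  and the sum over \<open>s\<close> splits into three telescoping sums. This is the origin of the
  3.\<close>

lemma eta_sum_le:
  assumes "finite T" "x \<in> lp"
  shows "(\<Sum>s\<in>T. nrm (mulr (\<eta> s) x) powr p) \<le> (3 * nrm x) powr p"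
proof -
  define F where "F = (\<Union>s\<in>T. {k. \<eta> s k \<noteq> 0})"
  have F: "finite F" using assms eta_fin by (auto simp: F_def)
  have "(\<Sum>s\<in>T. nrm (mulr (\<eta> s) x) powr p) = (\<Sum>s\<in>T. \<Sum>k\<in>F. norm (mulr (\<eta> s) x k) powr p)"
    by (intro sum.cong refl nrm_finite_powr(2)[OF F]) (auto simp: mulr_def F_def)
  also have "\<dots> = (\<Sum>k\<in>F. \<Sum>s\<in>T. norm (mulr (\<eta> s) x k) powr p)" by (rule sum.swap)
  also have "\<dots> \<le> (\<Sum>k\<in>F. 3 * norm (x k) powr p)"
  proof (rule sum_mono)
    fix k
    obtain n where n: "T \<subseteq> {..<n}" using assms(1) finite_nat_bounded by blast
    have "(\<Sum>s\<in>T. \<eta> s k) \<le> (\<Sum>s<n. \<eta> s k)" using n eta_range by (intro sum_mono2) auto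
    also have "\<dots> = (\<Sum>s<n. h (Suc s) k - h s k) + (\<Sum>s<n. h (Suc (Suc s)) k - h (Suc s) k) + (\<Sum>s<n. h (Suc (Suc (Suc s))) k - h (Suc (Suc s)) k)"
      unfolding sum.distrib[symmetric] by (intro sum.cong refl) (simp add: \<eta>_def numeral_3_eq_3)
    also have "\<dots> = (h n k - h 0 k) + (h (Suc n) k - h (Suc 0) k) + (h (Suc (Suc n)) k - h (Suc (Suc 0)) k)"
      using sum_lessThan_telescope[of "\<lambda>s. h s k" n] sum_lessThan_telescope[of "\<lambda>s. h (Suc s) k" n] sum_lessThan_telescope[of "\<lambda>s. h (Suc (Suc s)) k" n] by simp
    also have "\<dots> \<le> 3" using h_range[of 0 k] h_range[of 1 k] h_range[of "Suc (Suc 0)" k] h_range[of n k] h_range[of "Suc n" k] h_range[of "Suc (Suc n)" k] by simp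
    finally have le3: "(\<Sum>s\<in>T. \<eta> s k) \<le> 3" .
    have "(\<Sum>s\<in>T. norm (mulr (\<eta> s) x k) powr p) \<le> (\<Sum>s\<in>T. \<eta> s k * norm (x k) powr p)"
    proof (rule sum_mono)
      fix s
      have "\<eta> s k powr p \<le> \<eta> s k powr 1"
        using powr_mono'[of 1 p "\<eta> s k"] eta_range(1,2)[of s k] p_gt_1 by auto
      then have "\<eta> s k powr p \<le> \<eta> s k" using eta_range(1)[of s k] by simp
      then show "norm (mulr (\<eta> s) x k) powr p \<le> \<eta> s k * norm (x k) powr p"
        using eta_range(1)[of s k] by (simp add: mulr_def norm_mult powr_mult mult_right_mono)
    qed
    also have "\<dots> \<le> 3 * norm (x k) powr p"
      unfolding sum_distrib_right[symmetric] using le3 by (intro mult_right_mono) auto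
    finally show "(\<Sum>s\<in>T. norm (mulr (\<eta> s) x k) powr p) \<le> 3 * norm (x k) powr p" .
  qed
  also have "\<dots> = 3 * (\<Sum>k\<in>F. norm (x k) powr p)" by (simp add: sum_distrib_left)
  also have "\<dots> \<le> 3 * nrm x powr p" by (intro mult_left_mono sum_le_nrm assms F) auto
  also have "\<dots> \<le> 3 powr p * nrm x powr p"
    using powr_mono[of 1 p 3] p_gt_1 by (intro mult_right_mono) auto
  finally show ?thesis by (simp add: powr_mult)
qed

text \<open>\<open>V\<close> cuts off its input by \<open>\<eta> s\<close>, and \<open>W\<close>
  below cuts off its output by \<open>\<omega> s\<close>. As
  \<open>\<omega> s * \<eta> s = \<omega> s\<close>, level \<open>s\<close> of \<open>W\<close>
  after \<open>V\<close> is multiplication by \<open>\<omega> s\<close> up to a term from the defect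
  \<open>K s\<close>.\<close>

definition V :: "seq \<Rightarrow> (nat \<times> nat) \<times> nat \<Rightarrow> complex" where
  "V = stack (cube_stack ns (\<lambda>s u x. A s u (mulr (\<eta> s) x)))"

definition Bs :: "nat \<Rightarrow> ((nat \<times> nat) \<times> nat \<Rightarrow> complex) \<Rightarrow> seq" where
  "Bs s y = mulr (\<omega> s) (cube_avg (ns s) s (A s) y)"

definition W :: "((nat \<times> nat) \<times> nat \<Rightarrow> complex) \<Rightarrow> seq" where
  "W = glue S Bs"

lemma A_eta_blin: "blin (\<lambda>x. A s u (mulr (\<eta> s) x))"
  by (rule blin_comp[OF A_blin mulr_eta(1)])

lemma V_blin: "blin V"
  unfolding V_def
proof (rule stack_bounded[where c = "C1 * 3"])
  show "blin (cube_stack ns (\<lambda>s u x. A s u (mulr (\<eta> s) x)) a)" for a by (intro blin_cube_stack A_eta_blin)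
  fix T :: "(nat \<times> nat) set" and x :: seq assume T: "finite T" and x: "x \<in> lp"
  have "(\<Sum>a\<in>T. nrm (cube_stack ns (\<lambda>s u x. A s u (mulr (\<eta> s) x)) a x) powr p) \<le> (\<Sum>s\<in>fst ` T. (C1 * nrm (mulr (\<eta> s) x)) powr p)"
    using T x A_right blin_lp[OF A_eta_blin x] by (intro cube_stack_sum_le) (auto intro: rev_image_eqI)
  also have "\<dots> = C1 powr p * (\<Sum>s\<in>fst ` T. nrm (mulr (\<eta> s) x) powr p)"
    using C1 by (simp add: powr_mult sum_distrib_left)
  also have "\<dots> \<le> C1 powr p * (3 * nrm x) powr p" using T x by (intro mult_left_mono eta_sum_le) auto
  also have "\<dots> = (C1 * 3 * nrm x) powr p" using C1 by (simp add: powr_mult)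
  finally show "(\<Sum>a\<in>T. nrm (cube_stack ns (\<lambda>s u x. A s u (mulr (\<eta> s) x)) a x) powr p) \<le> (C1 * 3 * nrm x) powr p" .
qed (use C1 in auto)

lemma mulr_cube_avg: "mulr f (cube_avg n s E y) = cube_avg n s (\<lambda>u z. mulr f (E u z)) y"
  by (auto simp: mulr_def cube_avg_def fun_eq_iff sum_fun_apply sum_distrib_left mult_ac)

lemma Bs_blin: "blin (Bs s)"
  unfolding Bs_def by (rule blin_comp[OF mulr_omega(1) blin_cube_avg[OF A_blin]])

lemma Bs_cpt: "cpt (Bs s)"
  unfolding Bs_def by (rule cpt_comp_right[OF cpt_omega blin_cube_avg[OF A_blin]])

lemma Bs_supp: "k \<notin> S s \<Longrightarrow> Bs s y k = 0"
  by (simp add: Bs_def mulr_def S_def)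

lemma Bs_sum_le:
  assumes T: "finite T" and y: "y \<in> lp"
  shows "(\<Sum>s\<in>T. nrm (Bs s y) powr p) \<le> (C1 * nrm y) powr p"
proof -
  have "(\<Sum>s\<in>T. nrm (Bs s y) powr p) \<le> (\<Sum>s\<in>T. C1 powr p * (\<Sum>u\<in>cube (ns s). nrm (slice (s, u) y) powr p))"
    unfolding Bs_def mulr_cube_avg
    by (intro sum_mono nrm_cube_avg A_left C1 y mulr_omega(3) blin_lp[OF A_blin])
  also have "\<dots> = C1 powr p * (\<Sum>s\<in>T. \<Sum>u\<in>cube (ns s). nrm (slice (s, u) y) powr p)" by (simp add: sum_distrib_left)
  also have "\<dots> \<le> C1 powr p * nrm y powr p" by (intro mult_left_mono slices_cube_sum_le T y) auto
  finally show ?thesis using C1 by (simp add: powr_mult)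
qed

lemma W_blin: "blin W"
  unfolding W_def by (rule glue_bounded[OF S_fin S_card Bs_blin Bs_supp C1 Bs_sum_le])

text \<open>Orthogonality of the signs removes all cross terms of the squares.\<close>

lemma A_square_avg:
  assumes x: "x \<in> lp"
  shows "(\<Sum>u\<in>cube (ns s). A s u (A s u x)) = (\<lambda>k. 2 ^ ns s * (\<Sum>j<ns s. P s j (P s j x)) k)"
proof
  fix k
  have Px: "j < ns s \<Longrightarrow> P s j x \<in> lp" for j using x by (intro blin_lp[OF P_blin])
  have A2: "A s u (A s u x) k = (\<Sum>i<ns s. \<Sum>j<ns s. of_real (radem i u * radem j u) * P s i (P s j x) k)" for u
  proof -
    have "P s i (A s u x) k = (\<Sum>j<ns s. of_real (radem j u) * P s i (P s j x) k)" if i: "i < ns s" for i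
    proof -
      have "P s i (A s u x) = (\<Sum>j<ns s. P s i (\<lambda>k. of_real (radem j u) * P s j x k))"
        unfolding A_def by (intro blin_sum[OF P_blin[OF i]] nrm_scale(1) Px) auto
      also have "\<dots> = (\<Sum>j<ns s. (\<lambda>k. of_real (radem j u) * P s i (P s j x) k))"
        by (intro sum.cong refl blin_scale[OF P_blin[OF i] Px]) auto
      finally show ?thesis by (simp add: sum_fun_apply)
    qed
    then show ?thesis by (simp add: A_def sum_fun_apply sum_distrib_left mult.assoc)
  qed
  have "(\<Sum>u\<in>cube (ns s). A s u (A s u x) k)
      = (\<Sum>i<ns s. \<Sum>j<ns s. of_real (\<Sum>u\<in>cube (ns s). radem i u * radem j u) * P s i (P s j x) k)"
    unfolding A2 by (subst sum.swap, rule sum.cong[OF refl], subst sum.swap) (simp add: sum_distrib_right)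
  also have "\<dots> = (\<Sum>i<ns s. \<Sum>j<ns s. if i = j then 2 ^ ns s * P s i (P s j x) k else 0)"
    by (intro sum.cong refl) (simp add: radem_orthogonal)
  also have "\<dots> = (\<Sum>i<ns s. 2 ^ ns s * P s i (P s i x) k)" by simp
  finally show "(\<Sum>u\<in>cube (ns s). A s u (A s u x)) k = 2 ^ ns s * (\<Sum>j<ns s. P s j (P s j x)) k"
    by (simp add: sum_fun_apply sum_distrib_left)
qed

text \<open>The scales multiply to the weight of one sign vector, so the sum of the squares becomes
  their mean, the identity plus \<open>K s\<close>.\<close>

lemma Bs_V:
  assumes x: "x \<in> lp"
  shows "Bs s (V x) = mulr (\<omega> s) x + mulr (\<omega> s) (K s (mulr (\<eta> s) x))"
proof -
  let ?x = "mulr (\<eta> s) x"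
  have ex: "?x \<in> lp" using x by (rule mulr_eta(3))
  have sl: "slice (s, u) (V x) = (\<lambda>k. of_real (stack_scale (ns s)) * A s u ?x k)" if "u \<in> cube (ns s)" for u
    using that by (simp add: V_def cube_stack_def)
  have "A s u (slice (s, u) (V x)) = (\<lambda>k. of_real (stack_scale (ns s)) * A s u (A s u ?x) k)" if "u \<in> cube (ns s)" for u
    unfolding sl[OF that] by (rule blin_scale[OF A_blin blin_lp[OF A_blin ex]])
  then have "(\<Sum>u\<in>cube (ns s). A s u (slice (s, u) (V x))) = (\<lambda>k. of_real (stack_scale (ns s)) * (\<Sum>u\<in>cube (ns s). A s u (A s u ?x)) k)"
    by (simp add: fun_eq_iff sum_fun_apply sum_distrib_left)
  also have "\<dots> = (\<lambda>k. of_real (stack_scale (ns s)) * (2 ^ ns s * (\<Sum>j<ns s. P s j (P s j ?x)) k))"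
    unfolding A_square_avg[OF ex] ..
  finally have "cube_avg (ns s) s (A s) (V x) = (\<lambda>k. of_real (avg_scale (ns s) * stack_scale (ns s) * 2 ^ ns s) * (\<Sum>j<ns s. P s j (P s j ?x)) k)"
    unfolding cube_avg_def by (simp add: mult.assoc)
  also have "\<dots> = ?x + K s ?x" by (simp add: scale_mult K_def)
  finally have "Bs s (V x) = mulr (\<omega> s) (?x + K s ?x)" by (simp add: Bs_def)
  also have "\<dots> = mulr (\<omega> s) x + mulr (\<omega> s) (K s ?x)" by (simp add: mulr_add mulr_mulr omega_eta)
  finally show ?thesis .
qed

lemma omega_sum: "(\<Sum>s\<in>{s. k \<in> S s}. \<omega> s k) = 1 - h 1 k"
proof -
  have "(\<Sum>s\<in>{s. k \<in> S s}. \<omega> s k) = (\<Sum>s<Suc k. \<omega> s k)"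
    using S_subset[of k] by (intro sum.mono_neutral_left) (auto simp: S_def)
  also have "\<dots> = (\<Sum>s<Suc k. h (Suc (Suc s)) k - h (Suc s) k)" by (intro sum.cong refl) (simp add: \<omega>_def)
  also have "\<dots> = h (Suc (Suc k)) k - h 1 k" using sum_lessThan_telescope[of "\<lambda>s. h (Suc s) k" "Suc k"] by simp
  also have "h (Suc (Suc k)) k = 1" by (rule h_one) simp
  finally show ?thesis .
qed

lemma W_V_cpt: "cpt (\<lambda>x. W (V x) - x)"
proof -
  define R where "R = (\<lambda>s x. mulr (\<omega> s) (K s (mulr (\<eta> s) x)))"
  have R: "cpt (R s)" for s
    unfolding R_def by (rule cpt_comp_left[OF mulr_omega(1) cpt_comp_right[OF K_cpt mulr_eta(1)]])
  have "cpt (glue S R)"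
  proof (rule cpt_glue_summable[OF S_fin S_card R])
    show "R s y k = 0" if "k \<notin> S s" for s y k using that by (simp add: R_def mulr_def S_def)
    show "nrm (R s x) \<le> (1/2) ^ s * nrm x" if "x \<in> lp" for s x
      using le_mult_trans[OF K_left[OF mulr_eta(3)[OF that]] mulr_eta(2)[OF that]] by (simp add: R_def)
  qed
  \<comment> \<open>The \<open>\<omega> s\<close> telescope only to \<open>1 - h 1\<close>; what is
    missing has finite support.\<close>
  moreover have "cpt (mulr (h 1))" using h_range[of 1] h_fin[of 1] by (intro cpt_mulr) (auto simp: abs_le_iff intro: order_trans[of _ 0])
  ultimately have c: "cpt (\<lambda>x. glue S R x - mulr (h 1) x)" by (rule cpt_minus)
  have "W (V x) - x = glue S R x - mulr (h 1) x" if x: "x \<in> lp" for x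
  proof
    fix k
    have "W (V x) k = (\<Sum>s\<in>{s. k \<in> S s}. \<omega> s k * x k + R s x k)"
      unfolding W_def glue_def by (intro sum.cong refl) (simp add: Bs_V[OF x] R_def pointwise, simp add: mulr_def)
    also have "\<dots> = of_real (1 - h 1 k) * x k + glue S R x k"
      unfolding omega_sum[symmetric] by (simp add: glue_def sum.distrib sum_distrib_right)
    finally show "(W (V x) - x) k = (glue S R x - mulr (h 1) x) k"
      by (simp add: pointwise mulr_def algebra_simps)
  qed
  then show ?thesis by (rule cpt_cong[OF c])
qed

section \<open>Compactness of the intertwining defects\<close>

lemma small_index:
  assumes "0 < \<epsilon>"
  obtains s0 where "3 * (c0 / real (Suc s0)) + 2 * (1/2) ^ s0 \<le> \<epsilon>"
proof -
  \<comment> \<open>The two terms bound what is left from level \<open>s0\<close> on: the first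
    comes from the mesh, the second from the commutators with the cut-offs.\<close>
  obtain a where a: "real a > 6 * c0 / \<epsilon>" using reals_Archimedean2 by blast
  obtain b where b: "(1/2 :: real) ^ b < \<epsilon> / 4" using real_arch_pow_inv[of "\<epsilon>/4" "1/2"] assms by auto
  define s0 where "s0 = max a b"
  have "6 * c0 / \<epsilon> \<le> real (Suc s0)" using a by (simp add: s0_def)
  then have "3 * (c0 / real (Suc s0)) \<le> \<epsilon> / 2" using assms by (simp add: field_simps)
  moreover have "(1/2 :: real) ^ s0 \<le> (1/2) ^ b" by (rule power_decreasing) (auto simp: s0_def)
  ultimately have "3 * (c0 / real (Suc s0)) + 2 * (1/2) ^ s0 \<le> \<epsilon>" using b by linarith
  then show ?thesis by (rule that)
qed

lemma c0_decreasing: "s0 \<le> s \<Longrightarrow> c0 / real (Suc s) \<le> c0 / real (Suc s0)"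
  using c0 by (intro divide_left_mono) auto

lemma G_blin: "i \<in> I \<Longrightarrow> blin (G s u i)"
proof -
  assume i: "i \<in> I"
  have "blin (\<lambda>x k. of_real (radem j u) * (\<xi> i (t s j) * P s j x k - P s j (X i x) k))" if "j < ns s" for j
  proof -
    have "blin (\<lambda>x. (\<lambda>k. \<xi> i (t s j) * P s j x k) - P s j (X i x))"
      by (intro blin_minus blin_comp[OF P_blin[OF that] X_blin[OF i]] blin_smult P_blin that)
    from blin_smult[OF this] show ?thesis by (simp add: minus_apply)
  qed
  then show ?thesis unfolding G_def by (intro blin_setsum) auto
qed

text \<open>At level \<open>s\<close> the defect is \<open>G s u i\<close> on the cut-off input plus
  \<open>A s u\<close> applied to the commutator of \<open>X i\<close> with \<open>\<eta> s\<close>.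
  Each level is compact because the cut-offs have finite support. The first term is of order
  \<open>1 / (s + 1)\<close> and the second at most \<open>(1/2) ^ s\<close>, so late levels are
  negligible.\<close>

lemma intertwine_V:
  assumes i: "i \<in> I"
  shows "cpt (\<lambda>x. \<Theta> (\<xi> i) (V x) - V (X i x))"
proof -
  define E where "E = (\<lambda>s u x. G s u i (mulr (\<eta> s) x) + A s u (X i (mulr (\<eta> s) x) - mulr (\<eta> s) (X i x)))"
  have Xlp: "x \<in> lp \<Longrightarrow> X i x \<in> lp" for x by (rule blin_lp[OF X_blin[OF i]])
  have E_cpt: "cpt (E s u)" for s u
    unfolding E_def
    by (intro cpt_plus cpt_comp_left[OF G_blin[OF i] cpt_eta] cpt_comp_left[OF A_blin] cpt_minus
        cpt_comp_left[OF X_blin[OF i] cpt_eta] cpt_comp_right[OF cpt_eta X_blin[OF i]])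
  have eq: "\<Theta> (\<xi> i) (V x) - V (X i x) = stack (cube_stack ns E) x" if x: "x \<in> lp" for x
  proof
    fix a :: "(nat \<times> nat) \<times> nat"
    obtain s u k where a: "a = ((s, u), k)" by (metis surj_pair)
    have ex: "mulr (\<eta> s) x \<in> lp" using x by (rule mulr_eta(3))
    show "(\<Theta> (\<xi> i) (V x) - V (X i x)) a = stack (cube_stack ns E) x a"
    proof (cases "u \<in> cube (ns s)")
      case False
      then show ?thesis by (simp add: a urep_def V_def stack_def cube_stack_def minus_apply)
    next
      case True
      \<comment> \<open>On this cube \<open>V x\<close> is a Rademacher sum with coefficients
        \<open>z\<close>, so \<open>\<Theta>\<close> only multiplies each coefficient by
        \<open>\<xi> i (t s j)\<close>.\<close>
      define z where "z = (\<lambda>j. of_real (stack_scale (ns s)) * P s j (mulr (\<eta> s) x) k)"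
      have "\<Theta> (\<xi> i) (V x) a = (\<Sum>j<ns s. of_real (radem j u) * (\<xi> i (t s j) * z j))"
        unfolding a
      proof (rule urep_radem_vector)
        show "V x ((s, u), k) = (\<Sum>j<ns s. of_real (radem j u) * z j)" if "u \<in> cube (ns s)" for u
          using that by (simp add: V_def stack_def cube_stack_def A_def sum_fun_apply z_def sum_distrib_left mult_ac)
      qed (use True in auto)
      also have "\<dots> = of_real (stack_scale (ns s)) * (\<Sum>j<ns s. of_real (radem j u) * (\<xi> i (t s j) * P s j (mulr (\<eta> s) x) k))"
        by (simp add: z_def sum_distrib_left mult_ac)
      finally have 1: "\<Theta> (\<xi> i) (V x) a = of_real (stack_scale (ns s)) * (\<Sum>j<ns s. of_real (radem j u) * (\<xi> i (t s j) * P s j (mulr (\<eta> s) x) k))" .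
      have 2: "V (X i x) a = of_real (stack_scale (ns s)) * A s u (mulr (\<eta> s) (X i x)) k"
        using True by (simp add: a V_def stack_def cube_stack_def)
      have "A s u (X i (mulr (\<eta> s) x) - mulr (\<eta> s) (X i x)) = A s u (X i (mulr (\<eta> s) x)) - A s u (mulr (\<eta> s) (X i x))"
        by (intro blin_diff[OF A_blin] Xlp ex mulr_eta(3) x)
      then have 3: "E s u x k = (\<Sum>j<ns s. of_real (radem j u) * (\<xi> i (t s j) * P s j (mulr (\<eta> s) x) k)) - A s u (mulr (\<eta> s) (X i x)) k"
        by (simp add: E_def G_def A_def pointwise sum_fun_apply right_diff_distrib sum_subtractf)
      show ?thesis using True by (simp add: minus_apply 1 2, simp add: a stack_def cube_stack_def 3 right_diff_distrib)
    qed
  qed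
  have b1: "blin (\<lambda>x. \<Theta> (\<xi> i) (V x) - V (X i x))"
    by (intro blin_minus blin_comp[OF blin_urep[OF xi[OF i]] V_blin] blin_comp[OF V_blin X_blin[OF i]])
  have "cpt (stack (cube_stack ns E))"
  proof (rule cpt_stack)
    show "cpt (cube_stack ns E a)" for a by (rule cpt_cube_stack[OF E_cpt])
    show "blin (stack (cube_stack ns E))" by (rule blin_cong[OF b1]) (simp add: eq)
    fix \<epsilon> :: real assume "\<epsilon> > 0"
    then obtain s0 where s0: "3 * (c0 / real (Suc s0)) + 2 * (1/2) ^ s0 \<le> \<epsilon>" by (rule small_index)
    have "(\<Sum>a\<in>T. nrm (cube_stack ns E a x) powr p) \<le> (\<epsilon> * nrm x) powr p"
      if T: "finite T" "T \<inter> (SIGMA s:{..<s0}. cube (ns s)) = {}" and x: "x \<in> lp" for T x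
    proof -
      define S' where "S' = fst ` T \<inter> {s0..}"
      have S': "finite S'" "S' \<subseteq> {s0..}" using T by (auto simp: S'_def)
      let ?d = "\<lambda>s. c0 / real (Suc s) * nrm (mulr (\<eta> s) x) + (1/2) ^ s * nrm x"
      have "(\<Sum>a\<in>T. nrm (cube_stack ns E a x) powr p) \<le> (\<Sum>s\<in>S'. ?d s powr p)"
      proof (rule cube_stack_sum_le[OF T(1) S'(1)])
        show "s \<in> S'" if "(s, u) \<in> T" "u \<in> cube (ns s)" for s u
          using that T(2) by (auto simp: S'_def not_less[symmetric] intro: rev_image_eqI)
        fix s u assume u: "u \<in> cube (ns s)"
        have ex: "mulr (\<eta> s) x \<in> lp" using x by (rule mulr_eta(3))
        let ?c = "X i (mulr (\<eta> s) x) - mulr (\<eta> s) (X i x)"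
        have c: "?c \<in> lp" by (intro lp_diff Xlp ex mulr_eta(3) x)
        have l: "G s u i (mulr (\<eta> s) x) \<in> lp" "A s u ?c \<in> lp" by (rule blin_lp[OF G_blin[OF i] ex], rule blin_lp[OF A_blin c])
        show "E s u x \<in> lp" unfolding E_def by (rule lp_add(1)[OF l])
        have "nrm (A s u ?c) \<le> B s * nrm ?c" by (rule A_bound[OF u c])
        also have "\<dots> \<le> B s * (e s * nrm x)" by (intro mult_left_mono comm_eta[OF i x] B0)
        also have "\<dots> \<le> (1/2) ^ s * nrm x" using mult_right_mono[OF e_B[of s], of "nrm x"] by (simp add: mult_ac)
        finally show "nrm (E s u x) \<le> ?d s" unfolding E_def using lp_add(2)[OF l] G_right[OF u i x] by linarith
      qed
      \<comment> \<open>The mesh terms are p-summed by \<open>eta_sum_le\<close>, which gives the 3;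
        the commutator terms are summed geometrically, which gives the 2.\<close>
      also have "\<dots> \<le> (3 * (c0 / real (Suc s0)) * nrm x + 2 * (1/2) ^ s0 * nrm x) powr p"
      proof (rule minkowski_powr[OF p_gt_1 S'(1)])
        have "(\<Sum>s\<in>S'. (c0 / real (Suc s) * nrm (mulr (\<eta> s) x)) powr p) \<le> (\<Sum>s\<in>S'. (c0 / real (Suc s0) * nrm (mulr (\<eta> s) x)) powr p)"
          using S' p_pos c0 by (intro sum_mono powr_mono2 mult_right_mono c0_decreasing) (auto simp: subset_iff)
        also have "\<dots> = (c0 / real (Suc s0)) powr p * (\<Sum>s\<in>S'. nrm (mulr (\<eta> s) x) powr p)"
          unfolding sum_distrib_left by (intro sum.cong refl powr_mult)
        also have "\<dots> \<le> (c0 / real (Suc s0)) powr p * (3 * nrm x) powr p"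
          by (intro mult_left_mono eta_sum_le S' x) auto
        also have "\<dots> = (3 * (c0 / real (Suc s0)) * nrm x) powr p"
          using c0 by (simp add: mult_ac flip: powr_mult)
        finally show "(\<Sum>s\<in>S'. (c0 / real (Suc s) * nrm (mulr (\<eta> s) x)) powr p) \<le> (3 * (c0 / real (Suc s0)) * nrm x) powr p" .
        show "(\<Sum>s\<in>S'. ((1/2) ^ s * nrm x) powr p) \<le> (2 * (1/2) ^ s0 * nrm x) powr p"
          by (intro half_powers_tail_powr S') auto
      qed (use c0 in auto)
      also have "\<dots> \<le> (\<epsilon> * nrm x) powr p"
        using p_pos c0 mult_right_mono[OF s0, of "nrm x"] by (intro powr_mono2) (auto simp: distrib_right)
      finally show ?thesis .
    qed
    then show "\<exists>A0. finite A0 \<and> (\<forall>T x. finite T \<longrightarrow> T \<inter> A0 = {} \<longrightarrow> x \<in> lp \<longrightarrow>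
        (\<Sum>a\<in>T. nrm (cube_stack ns E a x) powr p) \<le> (\<epsilon> * nrm x) powr p)"
      by (intro exI[of _ "SIGMA s:{..<s0}. cube (ns s)"]) auto
  qed
  then show ?thesis by (rule cpt_cong) (rule eq)
qed

definition low :: "nat \<Rightarrow> ((nat \<times> nat) \<times> nat) set" where
  "low s0 = {((s, u), k). s < s0}"

lemma slice_restr_low:
  "slice (s, u) (restr (low s0) y) = (if s < s0 then slice (s, u) y else 0)"
  "slice (s, u) (restr (- low s0) y) = (if s < s0 then 0 else slice (s, u) y)"
  by (auto simp: slice_def restr_def low_def fun_eq_iff zero_fun_apply)

lemma Bs_slice_zero:
  assumes "\<And>u. slice (s, u) y = 0"
  shows "Bs s y = 0"
proof -
  have "(\<Sum>u\<in>cube (ns s). A s u 0) = 0" by (simp add: blin_0[OF A_blin])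
  then show ?thesis unfolding Bs_def cube_avg_def assms by (simp add: mulr_def fun_eq_iff zero_fun_apply)
qed

lemma Bs_slice_cong:
  assumes "\<And>u. slice (s, u) y = slice (s, u) y'"
  shows "Bs s y = Bs s y'"
  unfolding Bs_def cube_avg_def assms ..

lemma urep_slice_zero:
  assumes "\<And>v. slice (s, v) y = 0"
  shows "slice (s, u) (\<Theta> f y) = 0"
proof -
  have "y ((s, v), k) = 0" for v k using fun_cong[OF assms[of v], of k] by (simp add: slice_def zero_fun_apply)
  then show ?thesis by (auto simp: slice_def urep_def rcoef_def fun_eq_iff zero_fun_apply)
qed

text \<open>The representation is block diagonal over the levels.\<close>

lemma urep_restr_low: "\<Theta> f (restr (low s0) y) = restr (low s0) (\<Theta> f y)"
proof
  fix a :: "(nat \<times> nat) \<times> nat"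
  obtain s u k where a: "a = ((s, u), k)" by (metis surj_pair)
  show "\<Theta> f (restr (low s0) y) a = restr (low s0) (\<Theta> f y) a"
    by (cases "s < s0") (simp_all add: a urep_def restr_def low_def rcoef_def)
qed

text \<open>Only the levels below \<open>s0\<close> contribute, and each is compact because
  \<open>\<omega> s\<close> has finite support.\<close>

lemma W_low_cpt: "cpt (\<lambda>y. W (restr (low s0) y))"
proof -
  have "W (restr (low s0) y) = (\<Sum>s<s0. Bs s y)" for y
  proof -
    have "W (restr (low s0) y) = (\<Sum>s\<in>{..<s0}. Bs s (restr (low s0) y))"
      unfolding W_def
    proof (rule glue_finite)
      show "Bs s (restr (low s0) y) k = 0" if "s \<notin> {..<s0}" for s k
        using that Bs_slice_zero[of s "restr (low s0) y"] by (simp add: slice_restr_low zero_fun_apply)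
    qed (auto simp: S_fin Bs_supp)
    also have "\<dots> = (\<Sum>s\<in>{..<s0}. Bs s y)"
      by (intro sum.cong refl Bs_slice_cong) (simp add: slice_restr_low)
    finally show ?thesis .
  qed
  moreover have "cpt (\<lambda>y. \<Sum>s<s0. Bs s y)" by (intro cpt_setsum Bs_cpt) auto
  ultimately show ?thesis by simp
qed

text \<open>The sum over signs sees only the Rademacher coefficients of \<open>y\<close>, which
  \<open>\<Theta>\<close> multiplies by \<open>\<xi> i (t s j)\<close>; in the other term
  \<open>X i\<close> is brought inside the average, and \<open>G'\<close> is the difference.\<close>

lemma X_avg:
  assumes i: "i \<in> I" and y: "y \<in> lp"
  shows "X i (cube_avg (ns s) s (A s) y) - cube_avg (ns s) s (A s) (\<Theta> (\<xi> i) y) = cube_avg (ns s) s (\<lambda>u. G' s u i) y"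
proof
  fix k
  have sl: "slice (s, u) y \<in> lp" for u by (rule slice_lp[OF y])
  have As: "A s u (slice (s, u) y) \<in> lp" for u by (rule blin_lp[OF A_blin sl])
  have Ps: "j < ns s \<Longrightarrow> P s j (slice (s, u) y) \<in> lp" for j u by (rule blin_lp[OF P_blin sl])
  have XA: "X i (A s u (slice (s, u) y)) = (\<Sum>j<ns s. (\<lambda>k. of_real (radem j u) * X i (P s j (slice (s, u) y)) k))" for u
  proof -
    have "X i (A s u (slice (s, u) y)) = (\<Sum>j<ns s. X i (\<lambda>k. of_real (radem j u) * P s j (slice (s, u) y) k))"
      unfolding A_def by (intro blin_sum[OF X_blin[OF i]] nrm_scale(1) Ps) auto
    also have "\<dots> = (\<Sum>j<ns s. (\<lambda>k. of_real (radem j u) * X i (P s j (slice (s, u) y)) k))"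
      by (intro sum.cong refl blin_scale[OF X_blin[OF i] Ps]) auto
    finally show ?thesis .
  qed
  have "X i (cube_avg (ns s) s (A s) y) = (\<lambda>k. of_real (avg_scale (ns s)) * X i (\<Sum>u\<in>cube (ns s). A s u (slice (s, u) y)) k)"
    unfolding cube_avg_def by (intro blin_scale[OF X_blin[OF i]] lp_sum As) auto
  also have "X i (\<Sum>u\<in>cube (ns s). A s u (slice (s, u) y)) = (\<Sum>u\<in>cube (ns s). X i (A s u (slice (s, u) y)))"
    by (intro blin_sum[OF X_blin[OF i]] As) auto
  finally have 1: "X i (cube_avg (ns s) s (A s) y) k = of_real (avg_scale (ns s)) *
      (\<Sum>u\<in>cube (ns s). \<Sum>j<ns s. of_real (radem j u) * X i (P s j (slice (s, u) y)) k)"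
    by (simp add: XA sum_fun_apply)
  have swap: "(\<Sum>u\<in>cube (ns s). A s u (slice (s, u) z)) = (\<Sum>j<ns s. P s j (\<lambda>k. 2 ^ ns s * rcoef (ns s) j (\<lambda>v. z ((s, v), k))))"
    if z: "z \<in> lp" for z
  proof -
    have sz: "slice (s, u) z \<in> lp" for u by (rule slice_lp[OF z])
    have "(\<Sum>u\<in>cube (ns s). A s u (slice (s, u) z)) = (\<Sum>u\<in>cube (ns s). \<Sum>j<ns s. P s j (\<lambda>k. of_real (radem j u) * slice (s, u) z k))"
      unfolding A_def by (intro sum.cong refl blin_scale[OF P_blin sz, symmetric]) auto
    also have "\<dots> = (\<Sum>j<ns s. \<Sum>u\<in>cube (ns s). P s j (\<lambda>k. of_real (radem j u) * slice (s, u) z k))" by (rule sum.swap)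
    also have "\<dots> = (\<Sum>j<ns s. P s j (\<Sum>u\<in>cube (ns s). (\<lambda>k. of_real (radem j u) * slice (s, u) z k)))"
      by (intro sum.cong refl blin_sum[OF P_blin, symmetric] nrm_scale(1) sz) auto
    also have "\<dots> = (\<Sum>j<ns s. P s j (\<lambda>k. 2 ^ ns s * rcoef (ns s) j (\<lambda>v. z ((s, v), k))))"
      by (intro sum.cong refl arg_cong[where f = "P s _"]) (simp add: fun_eq_iff sum_fun_apply slice_def rcoef_def)
    finally show ?thesis .
  qed
  have Ty: "\<Theta> (\<xi> i) y \<in> lp" by (rule blin_lp[OF blin_urep[OF xi[OF i]] y])
  have E1: "(\<Sum>u\<in>cube (ns s). A s u (slice (s, u) (\<Theta> (\<xi> i) y)))
      = (\<Sum>j<ns s. (\<lambda>k. \<xi> i (t s j) * P s j (\<lambda>k. 2 ^ ns s * rcoef (ns s) j (\<lambda>v. y ((s, v), k))) k))"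
    unfolding swap[OF Ty]
  proof (intro sum.cong refl)
    fix j assume "j \<in> {..<ns s}"
    then have j: "j < ns s" by simp
    have "(\<lambda>k. 2 ^ ns s * rcoef (ns s) j (\<lambda>v. y ((s, v), k))) = (\<Sum>u\<in>cube (ns s). (\<lambda>k. of_real (radem j u) * slice (s, u) y k))"
      by (simp add: fun_eq_iff sum_fun_apply slice_def rcoef_def)
    moreover have "\<dots> \<in> lp" by (intro lp_sum nrm_scale(1) sl) auto
    ultimately have l: "(\<lambda>k. 2 ^ ns s * rcoef (ns s) j (\<lambda>v. y ((s, v), k))) \<in> lp" by simp
    show "P s j (\<lambda>k. 2 ^ ns s * rcoef (ns s) j (\<lambda>v. \<Theta> (\<xi> i) y ((s, v), k)))
        = (\<lambda>k. \<xi> i (t s j) * P s j (\<lambda>k. 2 ^ ns s * rcoef (ns s) j (\<lambda>v. y ((s, v), k))) k)"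
      unfolding rcoef_urep[of j ns s, OF j] blin_scale[OF P_blin[OF j] l, symmetric] by (simp add: mult.left_commute)
  qed
  have E2: "(\<Sum>j<ns s. (\<lambda>k. \<xi> i (t s j) * P s j (\<lambda>k. 2 ^ ns s * rcoef (ns s) j (\<lambda>v. y ((s, v), k))) k)) k
      = (\<Sum>u\<in>cube (ns s). \<Sum>j<ns s. of_real (radem j u) * (\<xi> i (t s j) * P s j (slice (s, u) y) k))"
  proof -
    have "P s j (\<lambda>k. 2 ^ ns s * rcoef (ns s) j (\<lambda>v. y ((s, v), k))) k = (\<Sum>u\<in>cube (ns s). of_real (radem j u) * P s j (slice (s, u) y) k)"
      if j: "j < ns s" for j
    proof -
      have "(\<lambda>k. 2 ^ ns s * rcoef (ns s) j (\<lambda>v. y ((s, v), k))) = (\<Sum>u\<in>cube (ns s). (\<lambda>k. of_real (radem j u) * slice (s, u) y k))"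
        by (simp add: fun_eq_iff sum_fun_apply slice_def rcoef_def)
      then have "P s j (\<lambda>k. 2 ^ ns s * rcoef (ns s) j (\<lambda>v. y ((s, v), k))) = (\<Sum>u\<in>cube (ns s). P s j (\<lambda>k. of_real (radem j u) * slice (s, u) y k))"
        by (simp only:) (intro blin_sum[OF P_blin[OF j]] nrm_scale(1) sl finite_cube)
      also have "\<dots> = (\<Sum>u\<in>cube (ns s). (\<lambda>k. of_real (radem j u) * P s j (slice (s, u) y) k))"
        by (intro sum.cong refl blin_scale[OF P_blin[OF j] sl])
      finally show ?thesis by (simp add: sum_fun_apply)
    qed
    then have "(\<Sum>j<ns s. (\<lambda>k. \<xi> i (t s j) * P s j (\<lambda>k. 2 ^ ns s * rcoef (ns s) j (\<lambda>v. y ((s, v), k))) k)) k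
       = (\<Sum>j<ns s. \<Sum>u\<in>cube (ns s). of_real (radem j u) * (\<xi> i (t s j) * P s j (slice (s, u) y) k))"
      by (simp add: sum_fun_apply sum_distrib_left mult_ac)
    also have "\<dots> = (\<Sum>u\<in>cube (ns s). \<Sum>j<ns s. of_real (radem j u) * (\<xi> i (t s j) * P s j (slice (s, u) y) k))" by (rule sum.swap)
    finally show ?thesis .
  qed
  have 2: "(\<Sum>u\<in>cube (ns s). A s u (slice (s, u) (\<Theta> (\<xi> i) y))) k = (\<Sum>u\<in>cube (ns s). \<Sum>j<ns s. of_real (radem j u) * (\<xi> i (t s j) * P s j (slice (s, u) y) k))"
    unfolding E1 E2 ..
  show "(X i (cube_avg (ns s) s (A s) y) - cube_avg (ns s) s (A s) (\<Theta> (\<xi> i) y)) k = cube_avg (ns s) s (\<lambda>u. G' s u i) y k"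
    unfolding minus_apply 1 unfolding cube_avg_def 2
    by (simp add: G'_def sum_fun_apply right_diff_distrib sum_subtractf)
qed

text \<open>Levels below \<open>s0\<close> form a compact operator. Above, finitely supported inputs
  suffice by density, so only finitely many levels occur: commutators with \<open>\<omega> s\<close>
  are summed geometrically, while the mesh terms live on slices of bounded overlap and are summed by
  p-th powers.\<close>

lemma intertwine_W:
  assumes i: "i \<in> I"
  shows "cpt (\<lambda>y. X i (W y) - W (\<Theta> (\<xi> i) y))"
proof -
  have Tb: "blin (\<Theta> (\<xi> i))" by (rule blin_urep[OF xi[OF i]])
  have Xb: "blin (X i)" by (rule X_blin[OF i])
  define E where "E = (\<lambda>y. X i (W y) - W (\<Theta> (\<xi> i) y))"
  have Eb: "blin E" unfolding E_def
    by (intro blin_minus blin_comp[OF Xb W_blin] blin_comp[OF W_blin Tb])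
  have "cpt E"
  proof (rule cptI_approx[OF Eb])
    fix \<epsilon> :: real assume "\<epsilon> > 0"
    then obtain s0 where s0: "3 * (c0 / real (Suc s0)) + 2 * (1/2) ^ s0 \<le> \<epsilon>" by (rule small_index)
    have e0': "0 \<le> \<epsilon>" using \<open>\<epsilon> > 0\<close> by simp
    have "cpt (\<lambda>y. E (restr (low s0) y))"
    proof -
      have "cpt (\<lambda>y. X i (W (restr (low s0) y)) - W (restr (low s0) (\<Theta> (\<xi> i) y)))"
        by (intro cpt_minus cpt_comp_left[OF Xb W_low_cpt] cpt_comp_right[OF W_low_cpt Tb])
      then show ?thesis by (simp add: E_def urep_restr_low)
    qed
    moreover have "nrm (E y - E (restr (low s0) y)) \<le> \<epsilon> * nrm y" if y: "y \<in> lp" for y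
    proof -
      have "nrm (E (restr (- low s0) y)) \<le> \<epsilon> * nrm y"
      proof (rule nrm_bound_fin_supp[OF blin_comp[OF Eb blin_restr] e0' _ y])
        fix F and y :: "(nat \<times> nat) \<times> nat \<Rightarrow> complex"
        assume F: "finite F" and y: "y \<in> lp" "y = restr F y"
        define z where "z = restr (- low s0) y"
        have z: "z \<in> lp" "nrm z \<le> nrm y" using y nrm_restr by (auto simp: z_def)
        have Tz: "\<Theta> (\<xi> i) z \<in> lp" by (rule blin_lp[OF Tb z(1)])
        define T where "T = (fst \<circ> fst) ` F \<inter> {s0..}"
        have T: "finite T" "T \<subseteq> {s0..}" using F by (auto simp: T_def)
        have sz: "slice (s, u) z = 0" if "s \<notin> T" for s u
        proof (cases "s < s0")
          case True
          then show ?thesis by (simp add: z_def slice_restr_low)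
        next
          case False
          then have "((s, u), k) \<notin> F" for u k using that by (force simp: T_def)
          then have "y ((s, u), k) = 0" for u k using fun_cong[OF y(2), of "((s, u), k)"] by (simp add: restr_def)
          then show ?thesis by (auto simp: z_def slice_def restr_def fun_eq_iff zero_fun_apply)
        qed
        have Wz: "W z = (\<Sum>s\<in>T. Bs s z)" unfolding W_def
          by (rule glue_finite) (simp_all add: T(1) S_fin Bs_supp Bs_slice_zero[OF sz] zero_fun_apply)
        have WTz: "W (\<Theta> (\<xi> i) z) = (\<Sum>s\<in>T. Bs s (\<Theta> (\<xi> i) z))" unfolding W_def
          by (rule glue_finite)
            (simp_all add: T(1) S_fin Bs_supp Bs_slice_zero[OF urep_slice_zero[OF sz]] zero_fun_apply)
        define q where "q = (\<lambda>s. cube_avg (ns s) s (A s) z)"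
        have q: "q s \<in> lp" for s unfolding q_def by (rule blin_lp[OF blin_cube_avg[OF A_blin] z(1)])
        define g where "g = (\<lambda>s. cube_avg (ns s) s (\<lambda>u. G' s u i) z)"
        have g: "g s \<in> lp" for s unfolding g_def by (rule blin_lp[OF blin_cube_avg[OF G'_blin[OF i]] z(1)])
        \<comment> \<open>Moving \<open>X i\<close> past the cut-off costs a commutator; moving it
          past the average costs \<open>G'\<close>.\<close>
        have XBs: "X i (Bs s z) - Bs s (\<Theta> (\<xi> i) z) = (X i (mulr (\<omega> s) (q s)) - mulr (\<omega> s) (X i (q s))) + mulr (\<omega> s) (g s)" for s
        proof -
          have "g s = X i (q s) - cube_avg (ns s) s (A s) (\<Theta> (\<xi> i) z)"
            unfolding g_def q_def X_avg[OF i z(1)] ..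
          then show ?thesis by (simp add: Bs_def q_def mulr_minus)
        qed
        have "E z = (\<Sum>s\<in>T. X i (Bs s z) - Bs s (\<Theta> (\<xi> i) z))"
          unfolding E_def Wz WTz sum_subtractf
          by (subst blin_sum[OF Xb T(1)]) (auto intro: blin_lp[OF Bs_blin z(1)])
        also have "\<dots> = (\<Sum>s\<in>T. X i (mulr (\<omega> s) (q s)) - mulr (\<omega> s) (X i (q s))) + (\<Sum>s\<in>T. mulr (\<omega> s) (g s))"
          unfolding XBs sum.distrib ..
        finally have Ez: "E z = (\<Sum>s\<in>T. X i (mulr (\<omega> s) (q s)) - mulr (\<omega> s) (X i (q s))) + (\<Sum>s\<in>T. mulr (\<omega> s) (g s))" .
        have l1: "X i (mulr (\<omega> s) (q s)) - mulr (\<omega> s) (X i (q s)) \<in> lp" for s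
          by (intro lp_diff blin_lp[OF Xb] mulr_omega(3) q)
        have l2: "mulr (\<omega> s) (g s) \<in> lp" for s by (intro mulr_omega(3) g)
        have b1: "nrm (\<Sum>s\<in>T. X i (mulr (\<omega> s) (q s)) - mulr (\<omega> s) (X i (q s))) \<le> 2 * (1/2) ^ s0 * nrm z"
        proof -
          have "nrm (X i (mulr (\<omega> s) (q s)) - mulr (\<omega> s) (X i (q s))) \<le> (1/2) ^ s * nrm z" for s
          proof -
            have "nrm (q s) powr p \<le> B s powr p * (\<Sum>u\<in>cube (ns s). nrm (slice (s, u) z) powr p)"
              unfolding q_def by (intro nrm_cube_avg A_bound B0 z blin_lp[OF A_blin])
            also have "(\<Sum>u\<in>cube (ns s). nrm (slice (s, u) z) powr p) \<le> nrm z powr p"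
              using slices_cube_sum_le[of "{s}" z ns] z by simp
            finally have "nrm (q s) powr p \<le> (B s * nrm z) powr p" using B0[of s] by (simp add: powr_mult mult_left_mono)
            then have qb: "nrm (q s) \<le> B s * nrm z" using B0 by (subst (asm) powr_le_iff) auto
            have "nrm (X i (mulr (\<omega> s) (q s)) - mulr (\<omega> s) (X i (q s))) \<le> e s * (B s * nrm z)"
              by (rule le_mult_trans[OF comm_omega[OF i q] qb e0])
            also have "\<dots> \<le> (1/2) ^ s * nrm z" using mult_right_mono[OF e_B[of s], of "nrm z"] by (simp add: mult_ac)
            finally show ?thesis .
          qed
          then have "(\<Sum>s\<in>T. nrm (X i (mulr (\<omega> s) (q s)) - mulr (\<omega> s) (X i (q s)))) \<le> (\<Sum>s\<in>T. (1/2) ^ s * nrm z)"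
            by (intro sum_mono)
          also have "\<dots> \<le> 2 * (1/2) ^ s0 * nrm z"
            unfolding sum_distrib_right[symmetric] by (intro mult_right_mono half_powers_tail T) auto
          finally show ?thesis by (rule order_trans[OF lp_sum(2)[OF T(1) l1]])
        qed
        have b2: "nrm (\<Sum>s\<in>T. mulr (\<omega> s) (g s)) \<le> 2 * (c0 / real (Suc s0) * nrm z)"
        proof (rule overlap_sum[OF T(1) l2, where S = S])
          show "mulr (\<omega> s) (g s) k = 0" if "k \<notin> S s" for s k using that by (simp add: mulr_def S_def)
          show "card {s \<in> T. k \<in> S s} \<le> 2" for k
            using card_mono[OF S_fin[of k], of "{s \<in> T. k \<in> S s}"] S_card[of k] by fastforce
          have "(\<Sum>s\<in>T. nrm (mulr (\<omega> s) (g s)) powr p) \<le> (\<Sum>s\<in>T. (c0 / real (Suc s0)) powr p * (\<Sum>u\<in>cube (ns s). nrm (slice (s, u) z) powr p))"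
          proof (rule sum_mono)
            fix s assume s: "s \<in> T"
            have "nrm (mulr (\<omega> s) (g s)) powr p \<le> (c0 / real (Suc s)) powr p * (\<Sum>u\<in>cube (ns s). nrm (slice (s, u) z) powr p)"
              unfolding g_def mulr_cube_avg
              by (intro nrm_cube_avg G_left i z mulr_omega(3) blin_lp[OF G'_blin[OF i]]) (use c0 in auto)
            also have "\<dots> \<le> (c0 / real (Suc s0)) powr p * (\<Sum>u\<in>cube (ns s). nrm (slice (s, u) z) powr p)"
              using s T c0 p_pos by (intro mult_right_mono powr_mono2 c0_decreasing) (auto intro!: sum_nonneg)
            finally show "nrm (mulr (\<omega> s) (g s)) powr p \<le> \<dots>" .
          qed
          also have "\<dots> = (c0 / real (Suc s0)) powr p * (\<Sum>s\<in>T. \<Sum>u\<in>cube (ns s). nrm (slice (s, u) z) powr p)"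
            by (simp add: sum_distrib_left)
          also have "\<dots> \<le> (c0 / real (Suc s0)) powr p * nrm z powr p"
            by (intro mult_left_mono slices_cube_sum_le T z) auto
          also have "\<dots> = (c0 / real (Suc s0) * nrm z) powr p" by (rule powr_mult[symmetric])
          finally show "(\<Sum>s\<in>T. nrm (mulr (\<omega> s) (g s)) powr p) \<le> (c0 / real (Suc s0) * nrm z) powr p" .
        qed (use c0 in auto)
        have "nrm (E z) \<le> nrm (\<Sum>s\<in>T. X i (mulr (\<omega> s) (q s)) - mulr (\<omega> s) (X i (q s))) + nrm (\<Sum>s\<in>T. mulr (\<omega> s) (g s))"
          using Ez by (rule nrm_split) (intro lp_sum T l1 l2)+
        also have "\<dots> \<le> 2 * (1/2) ^ s0 * nrm z + 2 * (c0 / real (Suc s0) * nrm z)" using b1 b2 by linarith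
        also have "\<dots> \<le> (3 * (c0 / real (Suc s0)) + 2 * (1/2) ^ s0) * nrm z"
          using c0 by (simp add: algebra_simps mult_right_mono divide_right_mono)
        also have "\<dots> \<le> \<epsilon> * nrm z" using s0 by (intro mult_right_mono) auto
        also have "\<dots> \<le> \<epsilon> * nrm y" using z e0' by (intro mult_left_mono) auto
        finally show "nrm (E (restr (- low s0) y)) \<le> \<epsilon> * nrm y" by (simp add: z_def)
      qed
      moreover have "E y - E (restr (low s0) y) = E (restr (- low s0) y)"
        unfolding restr_compl by (rule blin_diff[OF Eb y restr_lp[OF y], symmetric])
      ultimately show ?thesis by simp
    qed
    ultimately show "\<exists>K. cpt K \<and> (\<forall>y\<in>lp. nrm (E y - K y) \<le> \<epsilon> * nrm y)" by blast
  qed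
  then show ?thesis by (simp add: E_def)
qed

end

section \<open>Calculus of extensions and factorisation of compact operators\<close>

context lp_exponent
begin

lemma
  assumes "iso_ext p M \<Phi>"
  shows iso_ext_blin: "\<And>f. f \<in> cfun M \<Longrightarrow> blin (\<Phi> f)"
    and iso_ext_cong: "\<And>f g. f \<in> cfun M \<Longrightarrow> g \<in> cfun M \<Longrightarrow> (\<And>x. x \<in> M \<Longrightarrow> f x = g x) \<Longrightarrow> cpt (\<lambda>v. \<Phi> f v - \<Phi> g v)"
    and iso_ext_lin: "\<And>f g a b. f \<in> cfun M \<Longrightarrow> g \<in> cfun M \<Longrightarrow>
        cpt (\<lambda>v. \<Phi> (\<lambda>x. a * f x + b * g x) v - (\<lambda>k. a * \<Phi> f v k + b * \<Phi> g v k))"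
    and iso_ext_mult: "\<And>f g. f \<in> cfun M \<Longrightarrow> g \<in> cfun M \<Longrightarrow> cpt (\<lambda>v. \<Phi> (\<lambda>x. f x * g x) v - \<Phi> f (\<Phi> g v))"
    and iso_ext_one: "cpt (\<lambda>v. \<Phi> (\<lambda>x. 1) v - v)"
  using assms unfolding iso_ext_def bounded_op_iff mod_compact_iff by (auto simp: o_def)

text \<open>The strict inequality pays for the infimum in \<open>ess_norm\<close>.\<close>

lemma iso_ext_ess_bdd:
  assumes "iso_ext p M \<Phi>"
  obtains C where "1 \<le> C" "\<And>f c. f \<in> cfun M \<Longrightarrow> C * sup_norm M f < c \<Longrightarrow> ess_bdd (\<Phi> f) c"
proof -
  obtain C where C: "C \<ge> 1" "\<And>f. f \<in> cfun M \<Longrightarrow> ess_norm p (\<Phi> f) \<le> C * sup_norm M f"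
    using assms unfolding iso_ext_def by blast
  show ?thesis
  proof (rule that[OF C(1)])
    fix f c assume "f \<in> cfun M" "C * sup_norm M f < c"
    then show "ess_bdd (\<Phi> f) c" using C(2)[of f] by (intro ess_norm_less iso_ext_blin[OF assms]) auto
  qed
qed

lemma cfun_intros:
  "(\<lambda>x. c) \<in> cfun M" "f \<in> cfun M \<Longrightarrow> g \<in> cfun M \<Longrightarrow> (\<lambda>x. f x + g x) \<in> cfun M"
  "f \<in> cfun M \<Longrightarrow> g \<in> cfun M \<Longrightarrow> (\<lambda>x. f x * g x) \<in> cfun M"
  "f \<in> cfun M \<Longrightarrow> g \<in> cfun M \<Longrightarrow> (\<lambda>x. f x - g x) \<in> cfun M"
  "(\<And>j. j \<in> J \<Longrightarrow> F j \<in> cfun M) \<Longrightarrow> (\<lambda>x. \<Sum>j\<in>J. F j x) \<in> cfun M"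
  by (auto simp: cfun_def intro!: continuous_intros)

lemma cpt_trans: "cpt (\<lambda>v. R v - S v) \<Longrightarrow> cpt (\<lambda>v. S v - T v) \<Longrightarrow> cpt (\<lambda>v. R v - T v)"
  using cpt_plus[of "\<lambda>v. R v - S v" "\<lambda>v. S v - T v"] by simp

lemma cpt_sym: "cpt (\<lambda>v. R v - S v) \<Longrightarrow> cpt (\<lambda>v. S v - R v)"
  using cpt_minus[OF cpt_zero, of "\<lambda>v. R v - S v"] by simp

text \<open>The \<open>T j\<close> may be any representatives modulo compact operators, so that
  products and commutators of lifts can be inserted for the summands.\<close>

lemma iso_ext_sum:
  assumes \<Phi>: "iso_ext p M \<Phi>" and "finite J" "\<And>j. j \<in> J \<Longrightarrow> F j \<in> cfun M"
    and T: "\<And>j. j \<in> J \<Longrightarrow> cpt (\<lambda>v. \<Phi> (F j) v - T j v)"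
  shows "cpt (\<lambda>v. \<Phi> (\<lambda>x. \<Sum>j\<in>J. c j * F j x) v - (\<Sum>j\<in>J. (\<lambda>k. c j * T j v k)))"
  using assms(2-)
proof (induction J)
  case empty
  have "cpt (\<lambda>v. \<Phi> (\<lambda>x. 0 * 1 + 0 * 1) v - (\<lambda>k. 0 * \<Phi> (\<lambda>x. 1) v k + 0 * \<Phi> (\<lambda>x. 1) v k))"
    by (rule iso_ext_lin[OF \<Phi>]) (rule cfun_intros)+
  then show ?case by (simp flip: zero_fun_def)
next
  case (insert b J)
  let ?F = "\<lambda>x. \<Sum>j\<in>J. c j * F j x"
  have F: "F b \<in> cfun M" "?F \<in> cfun M" using insert.prems by (auto intro!: cfun_intros)
  have IH: "cpt (\<lambda>v. \<Phi> ?F v - (\<Sum>j\<in>J. (\<lambda>k. c j * T j v k)))" using insert by auto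
  have Tb: "cpt (\<lambda>v k. c b * (\<Phi> (F b) v - T b v) k)" using insert.prems by (intro cpt_smult) auto
  have "cpt (\<lambda>v. (\<Phi> (\<lambda>x. c b * F b x + 1 * ?F x) v - (\<lambda>k. c b * \<Phi> (F b) v k + 1 * \<Phi> ?F v k))
      + ((\<lambda>k. c b * (\<Phi> (F b) v - T b v) k) + (\<Phi> ?F v - (\<Sum>j\<in>J. (\<lambda>k. c j * T j v k)))))"
    by (rule cpt_plus[OF iso_ext_lin[OF \<Phi> F] cpt_plus[OF Tb IH]])
  then show ?case
    by (rule cpt_cong) (use insert.hyps in \<open>simp add: pointwise algebra_simps\<close>)
qed

text \<open>Blocks are chosen on which the output of \<open>K\<close> decays like
  \<open>(1/4) ^ n\<close>. Amplifying block \<open>n\<close> by \<open>2 ^ n\<close> still leaves a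
  compact operator, and the damping by \<open>(1/2) ^ n\<close> that undoes it is compact
  too.\<close>

lemma cpt_factor:
  fixes K :: "seq \<Rightarrow> seq"
  assumes K: "cpt K"
  obtains K1 K2 :: "seq \<Rightarrow> seq" where "cpt K1" "cpt K2" "\<And>x. x \<in> lp \<Longrightarrow> K1 (K2 x) = K x"
proof -
  have bK: "blin K" by (rule cpt_blin[OF K])
  obtain C where C: "0 < C" "\<And>x. x \<in> lp \<Longrightarrow> nrm (K x) \<le> C * nrm x" using blin_bound[OF bK] by metis
  have "\<exists>N. \<forall>x\<in>lp. nrm (restr (- {..<N}) (K x)) \<le> C * (1/4) ^ n * nrm x" for n
  proof -
    have "C * (1/4) ^ n > 0" using C by simp
    then obtain F where F: "finite F" "\<And>x. x \<in> lp \<Longrightarrow> nrm (restr (- F) (K x)) \<le> C * (1/4) ^ n * nrm x"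
      using K unfolding cpt_def by metis
    then obtain N where N: "F \<subseteq> {..<N}" using finite_nat_bounded by blast
    show ?thesis using F(2) order_trans[OF nrm_restr_compl_mono[OF blin_lp[OF bK] N]] by blast
  qed
  then obtain N where N: "\<And>n x. x \<in> lp \<Longrightarrow> nrm (restr (- {..<N n}) (K x)) \<le> C * (1/4) ^ n * nrm x" by metis
  \<comment> \<open>The summand \<open>n\<close> makes \<open>b\<close> strictly increasing, and the
    sum puts \<open>b n\<close> beyond \<open>N n\<close> for positive \<open>n\<close>; block 0 is
    controlled by \<open>C\<close> alone.\<close>
  define b where "b = (\<lambda>n. n + (\<Sum>j=1..n. N j))"
  have b0: "b 0 = 0" by (simp add: b_def)
  have bS: "b n < b (Suc n)" for n by (simp add: b_def)
  have bmono: "strict_mono b" by (rule strict_monoI_Suc) (rule bS)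
  have ble: "m \<le> n \<Longrightarrow> b m \<le> b n" for m n using bmono by (simp add: strict_mono_less_eq)
  have bN: "N n \<le> b n" if "n > 0" for n
    using that member_le_sum[of n "{1..n}" N] by (simp add: b_def)
  define S where "S = (\<lambda>n. {b n..<b (Suc n)})"
  have ex: "\<exists>n. {n. k \<in> S n} = {n}" for k
  proof -
    have nb: "n \<le> b n" for n by (simp add: b_def)
    have "{n. b n \<le> k} \<subseteq> {..k}"
    proof
      fix n assume "n \<in> {n. b n \<le> k}"
      then show "n \<in> {..k}" using nb[of n] by simp
    qed
    then have fin: "finite {n. b n \<le> k}" using finite_subset by blast
    have "0 \<in> {n. b n \<le> k}" using b0 by simp
    then have ne: "{n. b n \<le> k} \<noteq> {}" by blast
    define m where "m = Max {n. b n \<le> k}"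
    have "b m \<le> k" using Max_in[OF fin ne] by (simp add: m_def)
    moreover have "k < b (Suc m)"
    proof (rule ccontr)
      assume "\<not> k < b (Suc m)"
      then have "Suc m \<le> m" using Max_ge[OF fin, of "Suc m"] by (simp add: m_def)
      then show False by simp
    qed
    ultimately have kS: "k \<in> S m" by (simp add: S_def)
    have uniq: "n = m" if "k \<in> S n" for n
    proof (rule ccontr)
      assume "n \<noteq> m"
      then have "Suc n \<le> m \<or> Suc m \<le> n" by linarith
      then show False using that kS ble[of "Suc n" m] ble[of "Suc m" n] by (auto simp: S_def)
    qed
    have "{n. k \<in> S n} = {m}"
    proof (intro set_eqI iffI)
      fix n assume "n \<in> {n. k \<in> S n}"
      then show "n \<in> {m}" using uniq[of n] by simp
    qed (use kS in simp)
    then show ?thesis by (rule exI)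
  qed
  have fin: "finite {n. k \<in> S n}" and card: "card {n. k \<in> S n} \<le> 2" for k using ex[of k] by auto
  define L1 where "L1 = (\<lambda>n x k. of_real ((1/2) ^ n) * restr (S n) x k :: complex)"
  define L2 where "L2 = (\<lambda>n x k. of_real (2 ^ n / C) * restr (S n) (K x) k :: complex)"
  have c1: "cpt (glue S L1)"
  proof (rule cpt_glue_summable[OF fin card])
    show "cpt (L1 n)" for n unfolding L1_def by (intro cpt_smult cpt_restr) (simp add: S_def)
    show "L1 n y k = 0" if "k \<notin> S n" for n y k using that by (simp add: L1_def restr_def)
    show "nrm (L1 n x) \<le> (1/2) ^ n * nrm x" if "x \<in> lp" for n x
      unfolding L1_def nrm_scale(2)[OF restr_lp[OF that]] using nrm_restr[OF that]
      by (simp add: norm_power norm_divide mult_left_mono divide_right_mono)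
  qed
  have c2: "cpt (glue S L2)"
  proof (rule cpt_glue_summable[OF fin card])
    show "cpt (L2 n)" for n unfolding L2_def by (intro cpt_smult cpt_comp_left[OF blin_restr K])
    show "L2 n y k = 0" if "k \<notin> S n" for n y k using that by (simp add: L2_def restr_def)
    show "nrm (L2 n x) \<le> (1/2) ^ n * nrm x" if x: "x \<in> lp" for n x
    proof -
      have Kx: "K x \<in> lp" by (rule blin_lp[OF bK x])
      have "nrm (restr (S n) (K x)) \<le> C * (1/4) ^ n * nrm x"
      proof (cases "n = 0")
        case True
        then show ?thesis using nrm_restr[OF Kx, of "S n"] C(2)[OF x] by simp
      next
        case False
        then have "S n \<subseteq> - {..<N n}" using bN[of n] by (auto simp: S_def)
        then have "nrm (restr (S n) (K x)) \<le> nrm (restr (- {..<N n}) (K x))" by (rule nrm_restr_mono[OF Kx])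
        then show ?thesis using N[OF x, of n] by linarith
      qed
      then have "2 ^ n / C * nrm (restr (S n) (K x)) \<le> 2 ^ n / C * (C * (1/4) ^ n * nrm x)"
        using C by (intro mult_left_mono) auto
      also have "\<dots> = (1/2) ^ n * nrm x"
      proof -
        have "(2 :: real) ^ n * (1/4) ^ n = (1/2) ^ n" unfolding power_mult_distrib[symmetric] by simp
        then show ?thesis using C by (simp add: field_simps)
      qed
      finally show ?thesis unfolding L2_def nrm_scale(2)[OF restr_lp[OF Kx]]
        using C by (simp add: norm_mult norm_divide norm_power)
    qed
  qed
  show ?thesis
  proof (rule that[of "\<lambda>x k. of_real C * glue S L1 x k" "glue S L2"])
    show "(\<lambda>k. of_real C * glue S L1 (glue S L2 x) k) = K x" if "x \<in> lp" for x
    proof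
      fix k
      obtain n where n: "{n. k \<in> S n} = {n}" using ex by blast
      then have "k \<in> S n" by blast
      then show "of_real C * glue S L1 (glue S L2 x) k = K x k"
        using C by (simp add: glue_def n L1_def L2_def restr_def power_divide)
    qed
  qed (use cpt_smult[OF c1] c2 in auto)
qed

end

section \<open>From an approximate to an exact left inverse\<close>

context slicing
begin

text \<open>An idle slot of \<open>cube_stack\<close> gives room for a correction that does not
  interact with \<open>V\<close> and \<open>W\<close>.\<close>

lemma spare_slot:
  assumes "u0 \<notin> cube (ns s0)"
  shows "slice (s0, u0) (V x) = 0" "W (embed (s0, u0) z) = 0"
proof -
  show "slice (s0, u0) (V x) = 0" using assms by (simp add: V_def cube_stack_def zero_fun_def)
  have "Bs s (embed (s0, u0) z) = 0" for s
  proof -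
    have "(\<Sum>u\<in>cube (ns s). A s u (slice (s, u) (embed (s0, u0) z))) = 0"
      using assms by (intro sum.neutral) (auto simp: slice_embed blin_0[OF A_blin])
    then show ?thesis by (simp add: Bs_def cube_avg_def mulr_def fun_eq_iff zero_fun_apply)
  qed
  then show "W (embed (s0, u0) z) = 0" by (simp add: W_def glue_def fun_eq_iff zero_fun_apply)
qed

text \<open>The compact defect \<open>1 - W V\<close> is factored as \<open>K1 K2\<close>;
  \<open>V'\<close> stores \<open>K2\<close> in an idle slot and \<open>W'\<close> reads it back
  through \<open>K1\<close>. Both changes are compact, so the intertwining relations
  survive.\<close>

lemma exact_dilation:
  obtains V' W' where "blin V'" "blin W'" "\<And>x. x \<in> lp \<Longrightarrow> W' (V' x) = x"
    "\<And>i. i \<in> I \<Longrightarrow> cpt (\<lambda>x. \<Theta> (\<xi> i) (V' x) - V' (X i x))"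
    "\<And>i. i \<in> I \<Longrightarrow> cpt (\<lambda>y. X i (W' y) - W' (\<Theta> (\<xi> i) y))"
proof -
  have "cpt (\<lambda>x. x - W (V x))" by (rule cpt_sym[OF W_V_cpt])
  then obtain K1 K2 :: "seq \<Rightarrow> seq" where K12: "cpt K1" "cpt K2" "\<And>x. x \<in> lp \<Longrightarrow> K1 (K2 x) = x - W (V x)"
    by (rule cpt_factor) blast
  obtain u0 where u0: "u0 \<notin> cube (ns 0)" using ex_new_if_finite[OF infinite_UNIV_nat finite_cube] by blast
  define a where "a = (0 :: nat, u0)"
  note slot = spare_slot[OF u0, folded a_def]
  define V' where "V' = (\<lambda>x. V x + embed a (K2 x))"
  define W' where "W' = (\<lambda>y. W y + K1 (slice a y))"
  have bK: "blin K1" "blin K2" using K12 cpt_blin by auto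
  have eK: "cpt (\<lambda>x. embed a (K2 x))" by (rule cpt_comp_left[OF blin_embed K12(2)])
  have Ks: "cpt (\<lambda>y. K1 (slice a y))" by (rule cpt_comp_right[OF K12(1) blin_slice])
  have V'b: "blin V'" unfolding V'_def by (intro blin_plus V_blin cpt_blin eK)
  have W'b: "blin W'" unfolding W'_def by (intro blin_plus W_blin cpt_blin Ks)
  show ?thesis
  proof (rule that[OF V'b W'b])
    fix x :: seq assume x: "x \<in> lp"
    have l: "V x \<in> lp" "embed a (K2 x) \<in> lp"
      by (rule blin_lp[OF V_blin x], rule blin_lp[OF cpt_blin[OF eK] x])
    have "W (V' x) = W (V x)" unfolding V'_def blin_add[OF W_blin l] slot by simp
    moreover have "slice a (V' x) = K2 x" unfolding V'_def blin_add[OF blin_slice l] slot by (simp add: slice_embed)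
    ultimately show "W' (V' x) = x" by (simp add: W'_def K12(3)[OF x])
  next
    fix i assume i: "i \<in> I"
    have Tb: "blin (\<Theta> (\<xi> i))" and Xb: "blin (X i)" using blin_urep[OF xi[OF i]] X_blin[OF i] by auto
    have "cpt (\<lambda>x. (\<Theta> (\<xi> i) (V x) - V (X i x)) + (\<Theta> (\<xi> i) (embed a (K2 x)) - embed a (K2 (X i x))))"
      by (intro cpt_plus intertwine_V[OF i] cpt_minus cpt_comp_left[OF Tb eK] cpt_comp_right[OF eK Xb])
    then show "cpt (\<lambda>x. \<Theta> (\<xi> i) (V' x) - V' (X i x))"
    proof (rule cpt_cong)
      fix x :: seq assume x: "x \<in> lp"
      have l: "V x \<in> lp" "embed a (K2 x) \<in> lp"
        by (rule blin_lp[OF V_blin x], rule blin_lp[OF cpt_blin[OF eK] x])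
      show "\<Theta> (\<xi> i) (V' x) - V' (X i x) = (\<Theta> (\<xi> i) (V x) - V (X i x)) + (\<Theta> (\<xi> i) (embed a (K2 x)) - embed a (K2 (X i x)))"
        unfolding V'_def blin_add[OF Tb l] by simp
    qed
    have "cpt (\<lambda>y. (X i (W y) - W (\<Theta> (\<xi> i) y)) + (X i (K1 (slice a y)) - K1 (slice a (\<Theta> (\<xi> i) y))))"
      by (intro cpt_plus intertwine_W[OF i] cpt_minus cpt_comp_left[OF Xb Ks] cpt_comp_right[OF Ks Tb])
    then show "cpt (\<lambda>y. X i (W' y) - W' (\<Theta> (\<xi> i) y))"
    proof (rule cpt_cong)
      fix y :: "(nat \<times> nat) \<times> nat \<Rightarrow> complex" assume y: "y \<in> lp"
      have l: "W y \<in> lp" "K1 (slice a y) \<in> lp" by (rule blin_lp[OF W_blin y], rule blin_lp[OF cpt_blin[OF Ks] y])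
      show "X i (W' y) - W' (\<Theta> (\<xi> i) y) = (X i (W y) - W (\<Theta> (\<xi> i) y)) + (X i (K1 (slice a y)) - K1 (slice a (\<Theta> (\<xi> i) y)))"
        unfolding W'_def blin_add[OF Xb l] by simp
    qed
  qed
qed

end

section \<open>The dilation of a given extension\<close>

locale partition_rep = universal_rep p M ns t t0
  for p :: real and M :: "'m :: metric_space set" and ns t t0 +
  fixes a :: "nat \<Rightarrow> nat \<Rightarrow> 'm \<Rightarrow> real" and D :: real
  assumes a_cont: "\<And>s j. j < ns s \<Longrightarrow> continuous_on M (a s j)"
    and a_nonneg: "\<And>s j x. 0 \<le> a s j x"
    and a_sq: "\<And>s x. x \<in> M \<Longrightarrow> (\<Sum>j<ns s. (a s j x)\<^sup>2) = 1"
    and a_sum: "\<And>s x. x \<in> M \<Longrightarrow> (\<Sum>j<ns s. a s j x) \<le> D"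
    and a_near: "\<And>s j x. x \<in> M \<Longrightarrow> j < ns s \<Longrightarrow> a s j x \<noteq> 0 \<Longrightarrow> dist x (t s j) \<le> 1 / real (Suc s)"
begin

lemma D_nonneg: "0 \<le> D"
  using a_sum[OF t0_in, of 0] sum_nonneg[of "{..<ns 0}" "\<lambda>j. a 0 j t0"] a_nonneg by fastforce

text \<open>An operator that lifts a continuous function modulo compact operators is essentially
  bounded through the supremum of that function alone; the bounds for \<open>A\<close>,
  \<open>G\<close> and \<open>G'\<close> all come from here.\<close>

lemma ess_bdd_sup:
  assumes C: "1 \<le> C" "\<And>f c. f \<in> cfun M \<Longrightarrow> C * sup_norm M f < c \<Longrightarrow> ess_bdd (\<Phi> f) c"
    and f: "f \<in> cfun M" "\<And>x. x \<in> M \<Longrightarrow> norm (f x) \<le> d" and T: "cpt (\<lambda>v. \<Phi> f v - T v)" and c: "C * d < c"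
  shows "ess_bdd T c"
proof -
  have "sup_norm M f \<le> d" by (rule sup_norm_le) (rule f)
  then have "C * sup_norm M f \<le> C * d" using C by (intro mult_left_mono) auto
  then have "ess_bdd (\<Phi> f) c" using C(2)[OF f(1)] c by simp
  then show ?thesis by (rule ess_bdd_mod_cpt) (rule cpt_sym[OF T])
qed

text \<open>At each level the tail estimates required by \<open>slicing\<close> concern finitely
  many operators, so one \<open>N s\<close> serves them all. The cut-offs are then chosen to be 1 up
  to \<open>N s\<close> and nearly central for the finitely many \<open>X i\<close>.\<close>

theorem dilation_family:
  fixes \<Phi> :: "('m \<Rightarrow> complex) \<Rightarrow> oper" and \<xi> :: "'i \<Rightarrow> 'm \<Rightarrow> complex"
  assumes \<Phi>: "iso_ext p M \<Phi>" and I: "finite I" and xi: "\<And>i. i \<in> I \<Longrightarrow> \<xi> i \<in> cfun M"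
    and lip: "\<And>i x y. i \<in> I \<Longrightarrow> x \<in> M \<Longrightarrow> y \<in> M \<Longrightarrow> norm (\<xi> i x - \<xi> i y) \<le> dist x y"
  obtains V W where "blin V" "blin W" "\<And>x. x \<in> lp \<Longrightarrow> W (V x) = x"
    "\<And>i. i \<in> I \<Longrightarrow> cpt (\<lambda>x. \<Theta> (\<xi> i) (V x) - V (\<Phi> (\<xi> i) x))"
    "\<And>i. i \<in> I \<Longrightarrow> cpt (\<lambda>y. \<Phi> (\<xi> i) (W y) - W (\<Theta> (\<xi> i) y))"
proof -
  obtain C where C: "1 \<le> C" "\<And>f c. f \<in> cfun M \<Longrightarrow> C * sup_norm M f < c \<Longrightarrow> ess_bdd (\<Phi> f) c"
    by (rule iso_ext_ess_bdd[OF \<Phi>]) blast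
  define ca where "ca = (\<lambda>s j x. complex_of_real (a s j x))"
  have ca: "ca s j \<in> cfun M" if "j < ns s" for s j
    using a_cont[OF that] by (auto simp: ca_def cfun_def intro!: continuous_intros)
  define P where "P = (\<lambda>s j. \<Phi> (ca s j))"
  have P_blin: "blin (P s j)" if "j < ns s" for s j unfolding P_def by (rule iso_ext_blin[OF \<Phi> ca[OF that]])
  define X where "X = (\<lambda>i. \<Phi> (\<xi> i))"
  have X_blin: "blin (X i)" if "i \<in> I" for i unfolding X_def by (rule iso_ext_blin[OF \<Phi> xi[OF that]])
  define A where "A = (\<lambda>s u x. \<Sum>j<ns s. (\<lambda>k. complex_of_real (radem j u) * P s j x k))"
  define G where "G = (\<lambda>s u i x. \<Sum>j<ns s. (\<lambda>k. complex_of_real (radem j u) * (\<xi> i (t s j) * P s j x k - P s j (X i x) k)))"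
  define G' where "G' = (\<lambda>s u i x. \<Sum>j<ns s. (\<lambda>k. complex_of_real (radem j u) * (X i (P s j x) k - \<xi> i (t s j) * P s j x k)))"
  define K where "K = (\<lambda>s x. (\<Sum>j<ns s. P s j (P s j x)) - x)"
  have sa: "(\<Sum>j<ns s. norm (ca s j x)) \<le> D" if "x \<in> M" for s x
    using a_sum[OF that, of s] a_nonneg by (simp add: ca_def)
  \<comment> \<open>Only functions \<open>a s j\<close> whose point \<open>t s j\<close> is within
    \<open>1 / (s + 1)\<close> of \<open>x\<close> contribute, and over that distance the Lipschitz
    function \<open>\<xi> i\<close> varies by no more.\<close>
  have sx: "(\<Sum>j<ns s. norm (\<xi> i (t s j) - \<xi> i x) * norm (ca s j x)) \<le> D / real (Suc s)" if i: "i \<in> I" and x: "x \<in> M" for s i x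
  proof -
    have "(\<Sum>j<ns s. norm (\<xi> i (t s j) - \<xi> i x) * norm (ca s j x)) \<le> (\<Sum>j<ns s. 1 / real (Suc s) * norm (ca s j x))"
    proof (rule sum_mono)
      fix j assume "j \<in> {..<ns s}"
      then have j: "j < ns s" by simp
      show "norm (\<xi> i (t s j) - \<xi> i x) * norm (ca s j x) \<le> 1 / real (Suc s) * norm (ca s j x)"
      proof (cases "a s j x = 0")
        case False
        then have "norm (\<xi> i (t s j) - \<xi> i x) \<le> 1 / real (Suc s)"
          using order_trans[OF lip[OF i t_in[OF j] x]] a_near[OF x j] by (simp add: dist_commute)
        then show ?thesis by (intro mult_right_mono) auto
      qed (simp add: ca_def)
    qed
    also have "\<dots> = 1 / real (Suc s) * (\<Sum>j<ns s. norm (ca s j x))" by (simp add: sum_distrib_left)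
    also have "\<dots> \<le> 1 / real (Suc s) * D" using sa[OF x] by (intro mult_left_mono) auto
    finally show ?thesis by simp
  qed
  \<comment> \<open>One unit of slack pays for the strict inequality in the essential bound, the
    other for the passage to tails.\<close>
  define C1 where "C1 = C * D + 2"
  have CD: "0 \<le> C * D" using C D_nonneg by simp
  have A_ess: "ess_bdd (A s u) (C * D + 1)" for s u
  proof (rule ess_bdd_sup[OF C])
    show "cpt (\<lambda>v. \<Phi> (\<lambda>x. \<Sum>j<ns s. of_real (radem j u) * ca s j x) v - A s u v)"
      unfolding A_def P_def by (rule iso_ext_sum[OF \<Phi>]) (auto intro: ca simp: cpt_zero)
    show "(\<lambda>x. \<Sum>j<ns s. of_real (radem j u) * ca s j x) \<in> cfun M" by (auto intro!: cfun_intros ca)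
    fix x assume x: "x \<in> M"
    have "norm (\<Sum>j<ns s. of_real (radem j u) * ca s j x) \<le> (\<Sum>j<ns s. norm (ca s j x))"
      by (rule sum_norm_le) (simp add: norm_mult)
    then show "norm (\<Sum>j<ns s. of_real (radem j u) * ca s j x) \<le> D" using sa[OF x, of s] by linarith
  next
    show "C * D < C * D + 1" by linarith
  qed
  have small: "C * (D / real (Suc s)) < (C * D + 1) / real (Suc s)" for s by (simp add: divide_strict_right_mono)
  \<comment> \<open>\<open>G s u i\<close> lifts the random sum of the functions
    \<open>(\<xi> i (t s j) - \<xi> i x) * ca s j x\<close>, which is small by
    \<open>sx\<close>.\<close>
  have G_ess: "ess_bdd (G s u i) ((C * D + 1) / real (Suc s))" if i: "i \<in> I" for s u i
  proof (rule ess_bdd_sup[OF C _ _ _ small])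
    let ?F = "\<lambda>j x. \<xi> i (t s j) * ca s j x + (- 1) * (ca s j x * \<xi> i x)"
    have F: "?F j \<in> cfun M" if "j < ns s" for j by (intro cfun_intros ca[OF that] xi[OF i])
    show "cpt (\<lambda>v. \<Phi> (\<lambda>x. \<Sum>j<ns s. of_real (radem j u) * ?F j x) v - G s u i v)"
      unfolding G_def
    proof (rule iso_ext_sum[OF \<Phi>])
      fix j assume "j \<in> {..<ns s}"
      then have j: "j < ns s" by simp
      have m: "(\<lambda>x. ca s j x * \<xi> i x) \<in> cfun M" by (intro cfun_intros ca[OF j] xi[OF i])
      have "cpt (\<lambda>v. (\<Phi> (?F j) v - (\<lambda>k. \<xi> i (t s j) * \<Phi> (ca s j) v k + (- 1) * \<Phi> (\<lambda>x. ca s j x * \<xi> i x) v k))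
          - (\<Phi> (\<lambda>x. ca s j x * \<xi> i x) v - \<Phi> (ca s j) (\<Phi> (\<xi> i) v)))"
        by (intro cpt_minus iso_ext_lin[OF \<Phi>] iso_ext_mult[OF \<Phi>] ca[OF j] xi[OF i] m)
      then show "cpt (\<lambda>v. \<Phi> (?F j) v - (\<lambda>k. \<xi> i (t s j) * P s j v k - P s j (X i v) k))"
        by (rule cpt_cong) (simp add: pointwise P_def X_def)
    qed (rule finite_lessThan, rule F, simp)
    show "(\<lambda>x. \<Sum>j<ns s. of_real (radem j u) * ?F j x) \<in> cfun M"
      by (rule cfun_intros(5), rule cfun_intros(3)[OF cfun_intros(1)], rule F, simp)
    fix x assume x: "x \<in> M"
    have "norm (\<Sum>j<ns s. of_real (radem j u) * ?F j x) \<le> (\<Sum>j<ns s. norm (\<xi> i (t s j) - \<xi> i x) * norm (ca s j x))"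
    proof (rule sum_norm_le)
      fix j
      have "?F j x = (\<xi> i (t s j) - \<xi> i x) * ca s j x" by (simp add: algebra_simps)
      then show "norm (of_real (radem j u) * ?F j x) \<le> norm (\<xi> i (t s j) - \<xi> i x) * norm (ca s j x)"
        by (simp add: norm_mult)
    qed
    then show "norm (\<Sum>j<ns s. of_real (radem j u) * ?F j x) \<le> D / real (Suc s)" using sx[OF i x, of s] by linarith
  qed
  have G'_ess: "ess_bdd (G' s u i) ((C * D + 1) / real (Suc s))" if i: "i \<in> I" for s u i
  proof (rule ess_bdd_sup[OF C _ _ _ small])
    let ?F = "\<lambda>j x. 1 * (\<xi> i x * ca s j x) + (- \<xi> i (t s j)) * ca s j x"
    have F: "?F j \<in> cfun M" if "j < ns s" for j by (intro cfun_intros ca[OF that] xi[OF i])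
    show "cpt (\<lambda>v. \<Phi> (\<lambda>x. \<Sum>j<ns s. of_real (radem j u) * ?F j x) v - G' s u i v)"
      unfolding G'_def
    proof (rule iso_ext_sum[OF \<Phi>])
      fix j assume "j \<in> {..<ns s}"
      then have j: "j < ns s" by simp
      have m: "(\<lambda>x. \<xi> i x * ca s j x) \<in> cfun M" by (intro cfun_intros ca[OF j] xi[OF i])
      have "cpt (\<lambda>v. (\<Phi> (?F j) v - (\<lambda>k. 1 * \<Phi> (\<lambda>x. \<xi> i x * ca s j x) v k + (- \<xi> i (t s j)) * \<Phi> (ca s j) v k))
          + (\<Phi> (\<lambda>x. \<xi> i x * ca s j x) v - \<Phi> (\<xi> i) (\<Phi> (ca s j) v)))"
        by (intro cpt_plus iso_ext_lin[OF \<Phi>] iso_ext_mult[OF \<Phi>] ca[OF j] xi[OF i] m)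
      then show "cpt (\<lambda>v. \<Phi> (?F j) v - (\<lambda>k. X i (P s j v) k - \<xi> i (t s j) * P s j v k))"
        by (rule cpt_cong) (simp add: pointwise P_def X_def)
    qed (rule finite_lessThan, rule F, simp)
    show "(\<lambda>x. \<Sum>j<ns s. of_real (radem j u) * ?F j x) \<in> cfun M"
      by (rule cfun_intros(5), rule cfun_intros(3)[OF cfun_intros(1)], rule F, simp)
    fix x assume x: "x \<in> M"
    have "norm (\<Sum>j<ns s. of_real (radem j u) * ?F j x) \<le> (\<Sum>j<ns s. norm (\<xi> i (t s j) - \<xi> i x) * norm (ca s j x))"
    proof (rule sum_norm_le)
      fix j
      have "?F j x = (\<xi> i x - \<xi> i (t s j)) * ca s j x" by (simp add: algebra_simps)
      then show "norm (of_real (radem j u) * ?F j x) \<le> norm (\<xi> i (t s j) - \<xi> i x) * norm (ca s j x)"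
        by (simp add: norm_mult norm_minus_commute)
    qed
    then show "norm (\<Sum>j<ns s. of_real (radem j u) * ?F j x) \<le> D / real (Suc s)" using sx[OF i x, of s] by linarith
  qed
  \<comment> \<open>The squares of the partition sum to 1 on \<open>M\<close>, so \<open>K s\<close>
    lifts the zero function.\<close>
  have K_cpt: "cpt (K s)" for s
  proof -
    have sq: "(\<lambda>x. ca s j x * ca s j x) \<in> cfun M" if "j < ns s" for j by (intro cfun_intros ca[OF that])
    have one: "(\<Sum>j<ns s. 1 * (ca s j x * ca s j x)) = 1" if "x \<in> M" for x
    proof -
      have "(\<Sum>j<ns s. 1 * (ca s j x * ca s j x)) = complex_of_real (\<Sum>j<ns s. (a s j x)\<^sup>2)"
        by (simp add: ca_def power2_eq_square)
      then show ?thesis using a_sq[OF that] by simp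
    qed
    have 1: "cpt (\<lambda>v. \<Phi> (\<lambda>x. \<Sum>j<ns s. 1 * (ca s j x * ca s j x)) v - (\<Sum>j<ns s. (\<lambda>k. 1 * P s j (P s j v) k)))"
      unfolding P_def by (rule iso_ext_sum[OF \<Phi>]) (auto intro!: sq iso_ext_mult[OF \<Phi>] ca)
    have 2: "cpt (\<lambda>v. \<Phi> (\<lambda>x. \<Sum>j<ns s. 1 * (ca s j x * ca s j x)) v - \<Phi> (\<lambda>x. 1) v)"
      by (rule iso_ext_cong[OF \<Phi>]) (auto intro!: cfun_intros sq ca simp only: one)
    have "cpt (\<lambda>v. (\<Sum>j<ns s. (\<lambda>k. 1 * P s j (P s j v) k)) - v)"
      by (rule cpt_trans[OF cpt_sym[OF 1] cpt_trans[OF 2 iso_ext_one[OF \<Phi>]]])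
    then show ?thesis by (simp add: K_def)
  qed
  have A_blin: "blin (A s u)" for s u unfolding A_def by (intro blin_setsum blin_smult P_blin) auto
  have G_blin: "blin (G s u i)" if i: "i \<in> I" for s u i
  proof -
    have "blin (\<lambda>x k. of_real (radem j u) * (\<xi> i (t s j) * P s j x k - P s j (X i x) k))" if "j < ns s" for j
    proof -
      have "blin (\<lambda>x. (\<lambda>k. \<xi> i (t s j) * P s j x k) - P s j (X i x))"
        by (intro blin_minus blin_comp[OF P_blin[OF that] X_blin[OF i]] blin_smult P_blin that)
      from blin_smult[OF this] show ?thesis by (simp add: minus_apply)
    qed
    then show ?thesis unfolding G_def by (intro blin_setsum) auto
  qed
  have G'_blin: "blin (G' s u i)" if i: "i \<in> I" for s u i
  proof -
    have "blin (\<lambda>x k. of_real (radem j u) * (X i (P s j x) k - \<xi> i (t s j) * P s j x k))" if "j < ns s" for j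
    proof -
      have "blin (\<lambda>x. X i (P s j x) - (\<lambda>k. \<xi> i (t s j) * P s j x k))"
        by (intro blin_minus blin_comp[OF X_blin[OF i] P_blin[OF that]] blin_smult P_blin that)
      from blin_smult[OF this] show ?thesis by (simp add: minus_apply)
    qed
    then show ?thesis unfolding G'_def by (intro blin_setsum) auto
  qed
  define c0 where "c0 = C * D + 2"
  let ?tail = "\<lambda>T c N. \<forall>x\<in>lp. nrm (T (restr (- {..<N}) x)) \<le> c * nrm x \<and> nrm (restr (- {..<N}) (T x)) \<le> c * nrm x"
  have c0s: "(C * D + 1) / real (Suc s) < c0 / real (Suc s)" for s by (simp add: c0_def divide_strict_right_mono)
  define Q where "Q = (\<lambda>s N. (\<forall>u\<in>cube (ns s). ?tail (A s u) C1 N) \<and>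
      (\<forall>u\<in>cube (ns s). \<forall>i\<in>I. ?tail (G s u i) (c0 / real (Suc s)) N) \<and>
      (\<forall>u\<in>cube (ns s). \<forall>i\<in>I. ?tail (G' s u i) (c0 / real (Suc s)) N) \<and> ?tail (K s) ((1/2) ^ s) N)"
  have exQ: "\<exists>N. Q s N" for s
  proof -
    have "\<forall>\<^sub>F N in sequentially. \<forall>u\<in>cube (ns s). ?tail (A s u) C1 N"
      by (intro eventually_ball_finite[OF finite_cube] ballI ess_bdd_tail[OF A_blin A_ess]) (simp add: C1_def)
    moreover have t2: "\<forall>\<^sub>F N in sequentially. ?tail (G s u i) (c0 / real (Suc s)) N" if "i \<in> I" for u i
      by (rule ess_bdd_tail[OF G_blin[OF that] G_ess[OF that] c0s])
    have "\<forall>\<^sub>F N in sequentially. \<forall>u\<in>cube (ns s). \<forall>i\<in>I. ?tail (G s u i) (c0 / real (Suc s)) N"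
      by (intro eventually_ball_finite[OF finite_cube] ballI eventually_ball_finite[OF I] t2)
    moreover have t3: "\<forall>\<^sub>F N in sequentially. ?tail (G' s u i) (c0 / real (Suc s)) N" if "i \<in> I" for u i
      by (rule ess_bdd_tail[OF G'_blin[OF that] G'_ess[OF that] c0s])
    have "\<forall>\<^sub>F N in sequentially. \<forall>u\<in>cube (ns s). \<forall>i\<in>I. ?tail (G' s u i) (c0 / real (Suc s)) N"
      by (intro eventually_ball_finite[OF finite_cube] ballI eventually_ball_finite[OF I] t3)
    moreover have "\<forall>\<^sub>F N in sequentially. ?tail (K s) ((1/2) ^ s) N"
      by (rule ess_bdd_tail[OF cpt_blin[OF K_cpt] ess_bdd_cpt[OF K_cpt order_refl]]) simp
    ultimately have "\<forall>\<^sub>F N in sequentially. Q s N"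
      unfolding Q_def by (intro eventually_conj)
    then show ?thesis by (rule eventually_happens'[OF sequentially_bot])
  qed
  define N where "N = (\<lambda>s. SOME N. Q s N)"
  have QN: "Q s (N s)" for s unfolding N_def by (rule someI_ex[OF exQ])
  have NA: "\<And>s u. u \<in> cube (ns s) \<Longrightarrow> ?tail (A s u) C1 (N s)"
    and NG: "\<And>s u i. u \<in> cube (ns s) \<Longrightarrow> i \<in> I \<Longrightarrow> ?tail (G s u i) (c0 / real (Suc s)) (N s)"
    and NG': "\<And>s u i. u \<in> cube (ns s) \<Longrightarrow> i \<in> I \<Longrightarrow> ?tail (G' s u i) (c0 / real (Suc s)) (N s)"
    and NK: "\<And>s. ?tail (K s) ((1/2) ^ s) (N s)"
    using QN unfolding Q_def by blast+
  have "\<forall>s u. \<exists>b\<ge>0. \<forall>x\<in>lp. nrm (A s u x) \<le> b * nrm x" using blin_bound[OF A_blin] by (metis less_imp_le)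
  then obtain bA where bA: "\<And>s u. 0 \<le> bA s u" "\<And>s u x. x \<in> lp \<Longrightarrow> nrm (A s u x) \<le> bA s u * nrm x" by metis
  \<comment> \<open>A crude bound that may grow with \<open>s\<close>: the commutators with the
    cut-offs are made small afterwards, relative to it.\<close>
  define B where "B = (\<lambda>s. \<Sum>u\<in>cube (ns s). bA s u)"
  have B0: "0 \<le> B s" for s using bA by (auto simp: B_def intro: sum_nonneg)
  have B: "nrm (A s u x) \<le> B s * nrm x" if "u \<in> cube (ns s)" "x \<in> lp" for s u x
  proof -
    have "bA s u \<le> B s" unfolding B_def using that bA by (intro member_le_sum) auto
    then show ?thesis using bA(2)[OF that(2), of s u] mult_right_mono[of "bA s u" "B s" "nrm x"] by simp
  qed
  \<comment> \<open>Dividing by all \<open>B r\<close> up to \<open>s\<close> keeps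
    \<open>\<epsilon> s' * B s\<close> small for every later \<open>s'\<close>, as needed because
    \<open>\<omega> s\<close> and \<open>\<eta> s\<close> involve cut-offs up to
    \<open>h (s + 3)\<close>. The 2 allows for differences of two cut-offs.\<close>
  define \<epsilon> where "\<epsilon> = (\<lambda>s. (1/2 :: real) ^ s / (2 * (1 + (\<Sum>r\<le>s. B r))))"
  have eps: "0 < \<epsilon> s" for s
    using B0 by (auto simp: \<epsilon>_def intro!: divide_pos_pos mult_pos_pos add_pos_nonneg sum_nonneg)
  have epsB: "\<epsilon> s' * B s \<le> (1/2) ^ s / 2" if "s \<le> s'" for s s'
  proof -
    have le: "B s \<le> 1 + (\<Sum>r\<le>s'. B r)" using that B0 member_le_sum[of s "{..s'}" B] by simp
    have pos: "0 < 1 + (\<Sum>r\<le>s'. B r)" using B0 by (intro add_pos_nonneg sum_nonneg) auto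
    have "\<epsilon> s' * B s = (1/2) ^ s' / 2 * (B s / (1 + (\<Sum>r\<le>s'. B r)))" by (simp add: \<epsilon>_def)
    also have "\<dots> \<le> (1/2) ^ s' / 2 * 1" using le pos by (intro mult_left_mono) auto
    also have "\<dots> \<le> (1/2) ^ s / 2" using that by (simp add: power_decreasing divide_right_mono)
    finally show ?thesis .
  qed
  \<comment> \<open>The \<open>s\<close> in \<open>max (N s) s\<close> makes the cut-offs exhaust
    all coordinates.\<close>
  obtain h :: "nat \<Rightarrow> nat \<Rightarrow> real" where h: "\<And>s k. 0 \<le> h s k" "\<And>s k. h s k \<le> 1" "\<And>s k. k < max (N s) s \<Longrightarrow> h s k = 1"
    "\<And>s. finite {k. h s k \<noteq> 0}"
    and hX: "\<And>s i x. i \<in> I \<Longrightarrow> x \<in> lp \<Longrightarrow> nrm (X i (mulr (h s) x) - mulr (h s) (X i x)) \<le> \<epsilon> s * nrm x"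
    and hS: "\<And>s k. h s k \<noteq> 0 \<Longrightarrow> h (Suc s) k = 1"
    by (rule quasicentral_sequence[where \<epsilon> = \<epsilon> and T = X and I = I and N = "\<lambda>s. max (N s) s"])
      (use I X_blin eps in blast)+
  define \<omega> where "\<omega> = (\<lambda>s k. h (s + 2) k - h (s + 1) k)"
  define \<eta> where "\<eta> = (\<lambda>s k. h (s + 3) k - h s k)"
  \<comment> \<open>Below \<open>N s\<close> all cut-offs from \<open>s\<close> on are 1, so
    \<open>\<omega> s\<close> and \<open>\<eta> s\<close> vanish there and the tail estimates
    apply.\<close>
  have h_add: "h (s + n) k = 1" if "k < N s" for s n k
    by (induction n) (use h(3)[of k s] hS that in auto)
  have om0: "\<omega> s k = 0" and et0: "\<eta> s k = 0" if "k < N s" for s k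
    using h_add[OF that, of 2] h_add[OF that, of 1] h_add[OF that, of 3] h_add[OF that, of 0] by (auto simp: \<omega>_def \<eta>_def)
  have om_restr: "mulr (\<omega> s) (restr (- {..<N s}) y) = mulr (\<omega> s) y" for s and y :: seq
    using om0 by (auto simp: mulr_def restr_def fun_eq_iff)
  have et_restr: "restr (- {..<N s}) (mulr (\<eta> s) y) = mulr (\<eta> s) y" for s and y :: seq
    using et0 by (auto simp: mulr_def restr_def fun_eq_iff)
  have hr: "\<bar>\<omega> s k\<bar> \<le> 1" "\<bar>\<eta> s k\<bar> \<le> 1" for s k
    using h(1)[of "s + 2" k] h(2)[of "s + 2" k] h(1)[of "s + 1" k] h(2)[of "s + 1" k]
      h(1)[of "s + 3" k] h(2)[of "s + 3" k] h(1)[of s k] h(2)[of s k] by (auto simp: \<omega>_def \<eta>_def abs_le_iff)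
  have om_le: "nrm (mulr (\<omega> s) y) \<le> nrm (restr (- {..<N s}) y)" if "y \<in> lp" for s y
  proof -
    have "nrm (mulr (\<omega> s) (restr (- {..<N s}) y)) \<le> nrm (restr (- {..<N s}) y)"
      by (intro blin_mulr(2)[OF hr(1)] restr_lp that)
    then show ?thesis by (simp only: om_restr)
  qed
  have mh: "mulr (\<lambda>k. h m k - h n k) x = mulr (h m) x - mulr (h n) x" for m n x
    by (auto simp: mulr_def pointwise left_diff_distrib)
  have comm_diff: "nrm (X i (mulr (\<lambda>k. h m k - h n k) x) - mulr (\<lambda>k. h m k - h n k) (X i x)) \<le> (\<epsilon> m + \<epsilon> n) * nrm x"
    if i: "i \<in> I" and x: "x \<in> lp" for i x m n
  proof -
    have hl: "mulr (h l) y \<in> lp" if "y \<in> lp" for l y using h(1)[of l] h(2)[of l] that by (intro blin_mulr(3)) auto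
    have Xx: "y \<in> lp \<Longrightarrow> X i y \<in> lp" for y by (rule blin_lp[OF X_blin[OF i]])
    have eq: "X i (mulr (\<lambda>k. h m k - h n k) x) - mulr (\<lambda>k. h m k - h n k) (X i x)
      = (X i (mulr (h m) x) - mulr (h m) (X i x)) - (X i (mulr (h n) x) - mulr (h n) (X i x))"
      unfolding mh blin_diff[OF X_blin[OF i] hl[OF x] hl[OF x]] by simp
    have "nrm (X i (mulr (\<lambda>k. h m k - h n k) x) - mulr (\<lambda>k. h m k - h n k) (X i x))
      \<le> nrm (X i (mulr (h m) x) - mulr (h m) (X i x)) + nrm (X i (mulr (h n) x) - mulr (h n) (X i x))"
      unfolding eq by (intro lp_diff Xx hl x)
    also have "\<dots> \<le> \<epsilon> m * nrm x + \<epsilon> n * nrm x" by (intro add_mono hX i x)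
    finally show ?thesis by (simp add: distrib_right)
  qed
  define e where "e = (\<lambda>s. max (\<epsilon> (s + 2) + \<epsilon> (s + 1)) (\<epsilon> (s + 3) + \<epsilon> s))"
  have sl1: "blin (P s j)" if "j < ns s" for s j by (rule P_blin[OF that])
  have sl2: "blin (X i)" if "i \<in> I" for i by (rule X_blin[OF that])
  have sl3: "\<xi> i \<in> cfun M" if "i \<in> I" for i by (rule xi[OF that])
  have sl4: "0 \<le> C1" "0 \<le> c0" using CD by (auto simp: C1_def c0_def)
  have sl5: "0 \<le> B s" for s by (rule B0)
  have sl6: "0 \<le> e s" for s using eps by (auto simp: e_def le_max_iff_disj intro: add_nonneg_nonneg less_imp_le)
  have sl7: "0 \<le> h s k" "h s k \<le> 1" for s k by (rule h)+
  have sl8: "finite {k. h s k \<noteq> 0}" for s by (rule h)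
  have sl9: "h (Suc s) k = 1" if "h s k \<noteq> 0" for s k by (rule hS[OF that])
  have sl10: "h s k = 1" if "k < s" for s k using that by (intro h) simp
  have sl11: "cpt (K s)" for s by (rule K_cpt)
  have sl12: "nrm (A s u x) \<le> B s * nrm x" if "u \<in> cube (ns s)" "x \<in> lp" for s u x by (rule B[OF that])
  have ex: "mulr (\<eta> s) x \<in> lp" if "x \<in> lp" for s and x :: seq by (rule blin_mulr(3)[OF hr(2) that])
  have sl13: "nrm (mulr (\<omega> s) (K s x)) \<le> (1/2) ^ s * nrm x" if x: "x \<in> lp" for s x
    using order_trans[OF om_le[OF blin_lp[OF cpt_blin[OF K_cpt] x]]] NK[of s] x by blast
  have sl14: "nrm (A s u (mulr (\<eta> s) x)) \<le> C1 * nrm (mulr (\<eta> s) x)" if u: "u \<in> cube (ns s)" and x: "x \<in> lp" for s u x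
  proof -
    have "nrm (A s u (restr (- {..<N s}) (mulr (\<eta> s) x))) \<le> C1 * nrm (mulr (\<eta> s) x)" using NA[OF u] ex[OF x] by blast
    then show ?thesis by (simp only: et_restr)
  qed
  have sl15: "nrm (mulr (\<omega> s) (A s u x)) \<le> C1 * nrm x" if u: "u \<in> cube (ns s)" and x: "x \<in> lp" for s u x
    using order_trans[OF om_le[OF blin_lp[OF A_blin x]]] NA[OF u] x by blast
  have sl16: "nrm (G s u i (mulr (\<eta> s) x)) \<le> c0 / real (Suc s) * nrm (mulr (\<eta> s) x)"
    if u: "u \<in> cube (ns s)" and i: "i \<in> I" and x: "x \<in> lp" for s u i x
  proof -
    have "nrm (G s u i (restr (- {..<N s}) (mulr (\<eta> s) x))) \<le> c0 / real (Suc s) * nrm (mulr (\<eta> s) x)"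
      using NG[OF u i] ex[OF x] by blast
    then show ?thesis by (simp only: et_restr)
  qed
  have sl17: "nrm (mulr (\<omega> s) (G' s u i x)) \<le> c0 / real (Suc s) * nrm x"
    if u: "u \<in> cube (ns s)" and i: "i \<in> I" and x: "x \<in> lp" for s u i x
    using order_trans[OF om_le[OF blin_lp[OF G'_blin[OF i] x]]] NG'[OF u i] x by blast
  have sl18: "nrm (X i (mulr (\<eta> s) x) - mulr (\<eta> s) (X i x)) \<le> e s * nrm x" if i: "i \<in> I" and x: "x \<in> lp" for s i x
  proof -
    have "nrm (X i (mulr (\<eta> s) x) - mulr (\<eta> s) (X i x)) \<le> (\<epsilon> (s + 3) + \<epsilon> s) * nrm x"
      unfolding \<eta>_def by (rule comm_diff[OF i x])
    also have "\<dots> \<le> e s * nrm x" by (intro mult_right_mono) (auto simp: e_def)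
    finally show ?thesis .
  qed
  have sl19: "nrm (X i (mulr (\<omega> s) x) - mulr (\<omega> s) (X i x)) \<le> e s * nrm x" if i: "i \<in> I" and x: "x \<in> lp" for s i x
  proof -
    have "nrm (X i (mulr (\<omega> s) x) - mulr (\<omega> s) (X i x)) \<le> (\<epsilon> (s + 2) + \<epsilon> (s + 1)) * nrm x"
      unfolding \<omega>_def by (rule comm_diff[OF i x])
    also have "\<dots> \<le> e s * nrm x" by (intro mult_right_mono) (auto simp: e_def)
    finally show ?thesis .
  qed
  have sl20: "e s * B s \<le> (1/2) ^ s" for s
    using epsB[of s "s + 2"] epsB[of s "s + 1"] epsB[of s "s + 3"] epsB[of s s] by (auto simp: e_def max_def distrib_right)
  note defs = A_def G_def G'_def K_def \<omega>_def \<eta>_def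
  note facts = sl1 sl2 sl3 sl4 sl5 sl6 sl7 sl8 sl9 sl10 sl11 sl12 sl13 sl14 sl15 sl16 sl17 sl18 sl19 sl20
  interpret sl: slicing p M ns t t0 P I X \<xi> h C1 c0 B e A G G' K \<omega> \<eta>
    by unfold_locales ((rule facts[unfolded defs]; assumption) | simp only: defs)+
  obtain V W where "blin V" "blin W" "\<And>x. x \<in> lp \<Longrightarrow> W (V x) = x"
    "\<And>i. i \<in> I \<Longrightarrow> cpt (\<lambda>x. \<Theta> (\<xi> i) (V x) - V (X i x))"
    "\<And>i. i \<in> I \<Longrightarrow> cpt (\<lambda>y. X i (W y) - W (\<Theta> (\<xi> i) y))"
    by (rule sl.exact_dilation) blast
  then show ?thesis unfolding X_def by (rule that)
qed

end

section \<open>The intertwined functions form a closed algebra\<close>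

context universal_rep
begin

definition intertwines :: "(('m \<Rightarrow> complex) \<Rightarrow> oper) \<Rightarrow> (seq \<Rightarrow> (nat \<times> nat) \<times> nat \<Rightarrow> complex) \<Rightarrow>
    (((nat \<times> nat) \<times> nat \<Rightarrow> complex) \<Rightarrow> seq) \<Rightarrow> ('m \<Rightarrow> complex) \<Rightarrow> bool" where
  "intertwines \<Phi> V W f \<longleftrightarrow> cpt (\<lambda>x. \<Theta> f (V x) - V (\<Phi> f x)) \<and> cpt (\<lambda>y. \<Phi> f (W y) - W (\<Theta> f y))"

lemma urep_cong:
  assumes "\<And>x. x \<in> M \<Longrightarrow> f x = g x"
  shows "\<Theta> f y = \<Theta> g y"
proof
  fix i :: "(nat \<times> nat) \<times> nat"
  obtain s u k where i: "i = ((s, u), k)" by (metis surj_pair)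
  show "\<Theta> f y i = \<Theta> g y i"
    by (simp add: i urep_def assms t_in t0_in)
qed

end

locale intertwining = universal_rep p M ns t t0
  for p :: real and M :: "'m :: metric_space set" and ns t t0 +
  fixes \<Phi> :: "('m \<Rightarrow> complex) \<Rightarrow> oper" and V :: "seq \<Rightarrow> (nat \<times> nat) \<times> nat \<Rightarrow> complex" and W :: "((nat \<times> nat) \<times> nat \<Rightarrow> complex) \<Rightarrow> seq"
  assumes \<Phi>: "iso_ext p M \<Phi>" and V: "blin V" and W: "blin W"
begin

abbreviation good where "good \<equiv> intertwines \<Phi> V W"

lemma \<Phi>_blin: "f \<in> cfun M \<Longrightarrow> blin (\<Phi> f)"
  by (rule iso_ext_blin[OF \<Phi>])

lemma good_one: "good (\<lambda>x. 1)"
proof -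
  have Vl: "x \<in> lp \<Longrightarrow> V x \<in> lp" for x by (rule blin_lp[OF V])
  have "cpt (\<lambda>x. V (x - \<Phi> (\<lambda>x. 1) x))"
    by (rule cpt_comp_left[OF V cpt_sym[OF iso_ext_one[OF \<Phi>]]])
  then have "cpt (\<lambda>x. \<Theta> (\<lambda>x. 1) (V x) - V (\<Phi> (\<lambda>x. 1) x))"
    by (rule cpt_cong) (simp add: urep_one blin_diff[OF V] blin_lp[OF \<Phi>_blin[OF cfun_intros(1)]])
  moreover have "cpt (\<lambda>y. \<Phi> (\<lambda>x. 1) (W y) - W y)"
    using cpt_comp_right[OF iso_ext_one[OF \<Phi>] W] by simp
  ultimately show ?thesis by (simp add: intertwines_def urep_one)
qed

lemma good_lin:
  assumes f: "f \<in> cfun M" "good f" and g: "g \<in> cfun M" "good g"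
  shows "good (\<lambda>x. a * f x + b * g x)"
proof -
  let ?h = "\<lambda>x. a * f x + b * g x"
  have bf: "blin (\<Phi> f)" and bg: "blin (\<Phi> g)" using \<Phi>_blin f g by auto
  have h: "?h \<in> cfun M" using f g by (intro cfun_intros) auto
  have L: "cpt (\<lambda>v. \<Phi> ?h v - (\<lambda>k. a * \<Phi> f v k + b * \<Phi> g v k))" by (rule iso_ext_lin[OF \<Phi> f(1) g(1)])
  have fV: "cpt (\<lambda>x. \<Theta> f (V x) - V (\<Phi> f x))" and gV: "cpt (\<lambda>x. \<Theta> g (V x) - V (\<Phi> g x))"
    and fW: "cpt (\<lambda>y. \<Phi> f (W y) - W (\<Theta> f y))" and gW: "cpt (\<lambda>y. \<Phi> g (W y) - W (\<Theta> g y))"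
    using f g by (auto simp: intertwines_def)
  have lc: "(\<lambda>k. a * \<Phi> f v k + b * \<Phi> g v k) \<in> lp" if "v \<in> lp" for v
    by (rule lin_comb_lp[OF blin_lp[OF bf that] blin_lp[OF bg that]])
  have "cpt (\<lambda>x. ((\<lambda>k. a * (\<Theta> f (V x) - V (\<Phi> f x)) k) + (\<lambda>k. b * (\<Theta> g (V x) - V (\<Phi> g x)) k))
      - V (\<Phi> ?h x - (\<lambda>k. a * \<Phi> f x k + b * \<Phi> g x k)))"
    by (rule cpt_minus[OF cpt_plus[OF cpt_smult[OF fV] cpt_smult[OF gV]] cpt_comp_left[OF V L]])
  then have "cpt (\<lambda>x. \<Theta> ?h (V x) - V (\<Phi> ?h x))"
  proof (rule cpt_cong)
    fix x :: seq assume x: "x \<in> lp"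
    have "V (\<Phi> ?h x - (\<lambda>k. a * \<Phi> f x k + b * \<Phi> g x k)) = V (\<Phi> ?h x) - (\<lambda>k. a * V (\<Phi> f x) k + b * V (\<Phi> g x) k)"
      unfolding blin_diff[OF V blin_lp[OF \<Phi>_blin[OF h] x] lc[OF x]] blin_lin[OF V blin_lp[OF bf x] blin_lp[OF bg x]] ..
    then show "\<Theta> ?h (V x) - V (\<Phi> ?h x) = ((\<lambda>k. a * (\<Theta> f (V x) - V (\<Phi> f x)) k) + (\<lambda>k. b * (\<Theta> g (V x) - V (\<Phi> g x)) k))
      - V (\<Phi> ?h x - (\<lambda>k. a * \<Phi> f x k + b * \<Phi> g x k))"
      unfolding urep_lin_fun by (simp add: pointwise algebra_simps)
  qed
  moreover have "cpt (\<lambda>y. (\<Phi> ?h (W y) - (\<lambda>k. a * \<Phi> f (W y) k + b * \<Phi> g (W y) k))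
      + ((\<lambda>k. a * (\<Phi> f (W y) - W (\<Theta> f y)) k) + (\<lambda>k. b * (\<Phi> g (W y) - W (\<Theta> g y)) k)))"
    by (rule cpt_plus[OF cpt_comp_right[OF L W] cpt_plus[OF cpt_smult[OF fW] cpt_smult[OF gW]]])
  then have "cpt (\<lambda>y. \<Phi> ?h (W y) - W (\<Theta> ?h y))"
  proof (rule cpt_cong)
    fix y :: "(nat \<times> nat) \<times> nat \<Rightarrow> complex" assume y: "y \<in> lp"
    have "W (\<Theta> ?h y) = (\<lambda>k. a * W (\<Theta> f y) k + b * W (\<Theta> g y) k)"
      unfolding urep_lin_fun by (rule blin_lin[OF W blin_lp[OF blin_urep[OF f(1)] y] blin_lp[OF blin_urep[OF g(1)] y]])
    then show "\<Phi> ?h (W y) - W (\<Theta> ?h y) = (\<Phi> ?h (W y) - (\<lambda>k. a * \<Phi> f (W y) k + b * \<Phi> g (W y) k))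
      + ((\<lambda>k. a * (\<Phi> f (W y) - W (\<Theta> f y)) k) + (\<lambda>k. b * (\<Phi> g (W y) - W (\<Theta> g y)) k))"
      by (simp add: pointwise algebra_simps)
  qed
  ultimately show ?thesis by (simp add: intertwines_def)
qed

lemma good_mult:
  assumes f: "f \<in> cfun M" "good f" and g: "g \<in> cfun M" "good g"
  shows "good (\<lambda>x. f x * g x)"
proof -
  let ?h = "\<lambda>x. f x * g x"
  have bf: "blin (\<Phi> f)" and bg: "blin (\<Phi> g)" and bTf: "blin (\<Theta> f)" and bTg: "blin (\<Theta> g)"
    using \<Phi>_blin blin_urep f g by auto
  have h: "?h \<in> cfun M" using f g by (intro cfun_intros) auto
  have L: "cpt (\<lambda>v. \<Phi> ?h v - \<Phi> f (\<Phi> g v))" by (rule iso_ext_mult[OF \<Phi> f(1) g(1)])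
  have fV: "cpt (\<lambda>x. \<Theta> f (V x) - V (\<Phi> f x))" and gV: "cpt (\<lambda>x. \<Theta> g (V x) - V (\<Phi> g x))"
    and fW: "cpt (\<lambda>y. \<Phi> f (W y) - W (\<Theta> f y))" and gW: "cpt (\<lambda>y. \<Phi> g (W y) - W (\<Theta> g y))"
    using f g by (auto simp: intertwines_def)
  have "cpt (\<lambda>x. (\<Theta> f (\<Theta> g (V x) - V (\<Phi> g x)) + (\<Theta> f (V (\<Phi> g x)) - V (\<Phi> f (\<Phi> g x)))) - V (\<Phi> ?h x - \<Phi> f (\<Phi> g x)))"
    by (rule cpt_minus[OF cpt_plus[OF cpt_comp_left[OF bTf gV] cpt_comp_right[OF fV bg]] cpt_comp_left[OF V L]])
  then have "cpt (\<lambda>x. \<Theta> ?h (V x) - V (\<Phi> ?h x))"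
  proof (rule cpt_cong)
    fix x :: seq assume x: "x \<in> lp"
    note l = blin_lp[OF bTg blin_lp[OF V x]] blin_lp[OF V blin_lp[OF bg x]] blin_lp[OF \<Phi>_blin[OF h] x] blin_lp[OF bf blin_lp[OF bg x]]
    show "\<Theta> ?h (V x) - V (\<Phi> ?h x) = (\<Theta> f (\<Theta> g (V x) - V (\<Phi> g x)) + (\<Theta> f (V (\<Phi> g x)) - V (\<Phi> f (\<Phi> g x)))) - V (\<Phi> ?h x - \<Phi> f (\<Phi> g x))"
      unfolding blin_diff[OF bTf l(1,2)] blin_diff[OF V l(3,4)] urep_mult by simp
  qed
  moreover have "cpt (\<lambda>y. (\<Phi> ?h (W y) - \<Phi> f (\<Phi> g (W y))) + (\<Phi> f (\<Phi> g (W y) - W (\<Theta> g y)) + (\<Phi> f (W (\<Theta> g y)) - W (\<Theta> f (\<Theta> g y)))))"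
    by (rule cpt_plus[OF cpt_comp_right[OF L W] cpt_plus[OF cpt_comp_left[OF bf gW] cpt_comp_right[OF fW bTg]]])
  then have "cpt (\<lambda>y. \<Phi> ?h (W y) - W (\<Theta> ?h y))"
  proof (rule cpt_cong)
    fix y :: "(nat \<times> nat) \<times> nat \<Rightarrow> complex" assume y: "y \<in> lp"
    note l = blin_lp[OF bg blin_lp[OF W y]] blin_lp[OF W blin_lp[OF bTg y]]
    show "\<Phi> ?h (W y) - W (\<Theta> ?h y) = (\<Phi> ?h (W y) - \<Phi> f (\<Phi> g (W y))) + (\<Phi> f (\<Phi> g (W y) - W (\<Theta> g y)) + (\<Phi> f (W (\<Theta> g y)) - W (\<Theta> f (\<Theta> g y))))"
      unfolding blin_diff[OF bf l] urep_mult by simp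
  qed
  ultimately show ?thesis by (simp add: intertwines_def)
qed

text \<open>\<open>\<Phi>\<close> is linear only modulo compact operators, so
  \<open>\<Phi> f\<close> and \<open>\<Phi> g\<close> differ by a small operator plus the compact
  \<open>R - K0\<close>: \<open>R\<close> repairs linearity, and \<open>K0\<close> realises the
  essential bound for \<open>f - g\<close>. Both intertwining defects of \<open>f\<close> are thus
  norm limits of compact operators.\<close>

lemma good_limit:
  assumes f: "f \<in> cfun M" and approx: "\<And>\<epsilon>. 0 < \<epsilon> \<Longrightarrow> \<exists>g. g \<in> cfun M \<and> good g \<and> (\<forall>x\<in>M. norm (f x - g x) \<le> \<epsilon>)"
  shows "good f"
proof -
  obtain C where C: "1 \<le> C" "\<And>f c. f \<in> cfun M \<Longrightarrow> C * sup_norm M f < c \<Longrightarrow> ess_bdd (\<Phi> f) c"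
    by (rule iso_ext_ess_bdd[OF \<Phi>]) blast
  obtain \<kappa> where k: "1 \<le> \<kappa>" "\<And>f y. f \<in> cfun M \<Longrightarrow> y \<in> lp \<Longrightarrow> \<Theta> f y \<in> lp \<and> nrm (\<Theta> f y) \<le> \<kappa> * sup_norm M f * nrm y"
    by (rule urep_bounded) blast
  obtain v where v: "0 < v" "\<And>x. x \<in> lp \<Longrightarrow> nrm (V x) \<le> v * nrm x" using blin_bound[OF V] by metis
  obtain w where w: "0 < w" "\<And>x. x \<in> lp \<Longrightarrow> nrm (W x) \<le> w * nrm x" using blin_bound[OF W] by metis
  \<comment> \<open>A common bound for the errors in both relations: \<open>\<kappa>\<close> comes
    from \<open>\<Theta>\<close>, \<open>C + 1\<close> from \<open>\<Phi>\<close>, and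
    \<open>v + w\<close> from \<open>V\<close> and \<open>W\<close>.\<close>
  define b where "b = (\<kappa> + C + 1) * (v + w)"
  have b: "b > 0" using k C v w by (simp add: b_def add_pos_pos)
  have key: "\<exists>g R K0. g \<in> cfun M \<and> good g \<and> cpt R \<and> cpt K0 \<and>
      (\<forall>x\<in>lp. \<Phi> f x = \<Phi> g x + R x - K0 x + (\<Phi> (\<lambda>x. 1 * f x + (- 1) * g x) x + K0 x)) \<and>
      (\<forall>x\<in>lp. (\<Phi> (\<lambda>x. 1 * f x + (- 1) * g x) x + K0 x) \<in> lp \<and> nrm (\<Phi> (\<lambda>x. 1 * f x + (- 1) * g x) x + K0 x) \<le> (C + 1) * \<delta> * nrm x) \<and>
      (\<forall>y. \<Theta> f y = \<Theta> g y + \<Theta> (\<lambda>x. 1 * f x + (- 1) * g x) y) \<and>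
      (\<forall>y\<in>lp. \<Theta> (\<lambda>x. 1 * f x + (- 1) * g x) y \<in> lp \<and> nrm (\<Theta> (\<lambda>x. 1 * f x + (- 1) * g x) y) \<le> \<kappa> * \<delta> * nrm y)" if d: "\<delta> > 0" for \<delta>
  proof -
    obtain g where g: "g \<in> cfun M" "good g" "\<And>x. x \<in> M \<Longrightarrow> norm (f x - g x) \<le> \<delta>" using approx[OF d] by blast
    let ?d = "\<lambda>x. 1 * f x + (- 1) * g x"
    have dc: "?d \<in> cfun M" using f g by (intro cfun_intros) auto
    have sd: "sup_norm M ?d \<le> \<delta>" by (rule sup_norm_le) (use g(3) in simp)
    have "C * sup_norm M ?d \<le> C * \<delta>" by (rule mult_left_mono[OF sd]) (use C(1) in simp)
    moreover have "(C + 1) * \<delta> = C * \<delta> + \<delta>" by (simp add: distrib_right)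
    ultimately have "C * sup_norm M ?d < (C + 1) * \<delta>" using d by linarith
    then have "ess_bdd (\<Phi> ?d) ((C + 1) * \<delta>)" by (rule C(2)[OF dc])
    then obtain K0 where K0: "cpt K0" "\<And>x. x \<in> lp \<Longrightarrow> nrm (\<Phi> ?d x + K0 x) \<le> (C + 1) * \<delta> * nrm x"
      unfolding ess_bdd_def by blast
    define R where "R = (\<lambda>x. (\<lambda>k. 1 * \<Phi> f x k + (- 1) * \<Phi> g x k) - \<Phi> ?d x)"
    have R: "cpt R" unfolding R_def by (rule cpt_sym[OF iso_ext_lin[OF \<Phi> f g(1)]])
    have "\<Phi> f x = \<Phi> g x + R x - K0 x + (\<Phi> ?d x + K0 x)" for x by (simp add: R_def pointwise)
    moreover have "\<Theta> f y = \<Theta> g y + \<Theta> ?d y" for y unfolding urep_lin_fun by (simp add: pointwise)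
    moreover have "\<Phi> ?d x + K0 x \<in> lp" if "x \<in> lp" for x
      by (rule lp_add(1)[OF blin_lp[OF \<Phi>_blin[OF dc] that] blin_lp[OF cpt_blin[OF K0(1)] that]])
    moreover have "nrm (\<Theta> ?d y) \<le> \<kappa> * \<delta> * nrm y" if y: "y \<in> lp" for y
    proof -
      have "nrm (\<Theta> ?d y) \<le> \<kappa> * sup_norm M ?d * nrm y" using k(2)[OF dc y] by blast
      also have "\<dots> \<le> \<kappa> * \<delta> * nrm y" using sd k(1) by (intro mult_right_mono mult_left_mono) auto
      finally show ?thesis .
    qed
    ultimately show ?thesis using g(1,2) R K0 k(2)[OF dc] by blast
  qed
  have fb: "blin (\<Phi> f)" and Tb: "blin (\<Theta> f)" using \<Phi>_blin blin_urep f by auto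
  have "cpt (\<lambda>x. \<Theta> f (V x) - V (\<Phi> f x))"
  proof (rule cptI_approx)
    show "blin (\<lambda>x. \<Theta> f (V x) - V (\<Phi> f x))" by (intro blin_minus blin_comp[OF Tb V] blin_comp[OF V fb])
    fix \<epsilon> :: real assume e: "\<epsilon> > 0"
    define \<delta> where "\<delta> = \<epsilon> / b"
    have d: "\<delta> > 0" using e b by (simp add: \<delta>_def)
    obtain g R K0 where g: "g \<in> cfun M" "good g" and R: "cpt R" and K0: "cpt K0"
      and eq: "\<And>x. x \<in> lp \<Longrightarrow> \<Phi> f x = \<Phi> g x + R x - K0 x + (\<Phi> (\<lambda>x. 1 * f x + (- 1) * g x) x + K0 x)"
      and le: "\<And>x. x \<in> lp \<Longrightarrow> (\<Phi> (\<lambda>x. 1 * f x + (- 1) * g x) x + K0 x) \<in> lp \<and> nrm (\<Phi> (\<lambda>x. 1 * f x + (- 1) * g x) x + K0 x) \<le> (C + 1) * \<delta> * nrm x"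
      and Teq: "\<And>y. \<Theta> f y = \<Theta> g y + \<Theta> (\<lambda>x. 1 * f x + (- 1) * g x) y"
      and Tle: "\<And>y. y \<in> lp \<Longrightarrow> \<Theta> (\<lambda>x. 1 * f x + (- 1) * g x) y \<in> lp \<and> nrm (\<Theta> (\<lambda>x. 1 * f x + (- 1) * g x) y) \<le> \<kappa> * \<delta> * nrm y"
      using key[OF d] by blast
    define L where "L = (\<lambda>x. \<Phi> (\<lambda>x. 1 * f x + (- 1) * g x) x + K0 x)"
    define T where "T = (\<lambda>y. \<Theta> (\<lambda>x. 1 * f x + (- 1) * g x) y)"
    have "cpt (\<lambda>x. (\<Theta> g (V x) - V (\<Phi> g x)) - V (R x - K0 x))"
      using g(2) unfolding intertwines_def by (intro cpt_minus[OF _ cpt_comp_left[OF V cpt_minus[OF R K0]]]) (rule conjunct1)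
    moreover have "nrm ((\<Theta> f (V x) - V (\<Phi> f x)) - ((\<Theta> g (V x) - V (\<Phi> g x)) - V (R x - K0 x))) \<le> \<epsilon> * nrm x" if x: "x \<in> lp" for x
    proof -
      have Vx: "V x \<in> lp" by (rule blin_lp[OF V x])
      have gl: "\<Phi> g x \<in> lp" "R x \<in> lp" "K0 x \<in> lp"
        by (rule blin_lp[OF \<Phi>_blin[OF g(1)] x], rule blin_lp[OF cpt_blin[OF R] x], rule blin_lp[OF cpt_blin[OF K0] x])
      have Ll: "L x \<in> lp" "nrm (L x) \<le> (C + 1) * \<delta> * nrm x" using le[OF x] by (auto simp: L_def)
      have Tl: "T (V x) \<in> lp" "nrm (T (V x)) \<le> \<kappa> * \<delta> * nrm (V x)" using Tle[OF Vx] by (auto simp: T_def)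
      have "V (\<Phi> f x) = V (\<Phi> g x) + V (R x - K0 x) + V (L x)"
      proof -
        have e1: "\<Phi> f x = (\<Phi> g x + (R x - K0 x)) + L x" using eq[OF x] by (simp add: L_def algebra_simps)
        have e2: "V ((\<Phi> g x + (R x - K0 x)) + L x) = V (\<Phi> g x + (R x - K0 x)) + V (L x)" by (rule blin_add[OF V lp_add(1)[OF gl(1) lp_diff(1)[OF gl(2,3)]] Ll(1)])
        have e3: "V (\<Phi> g x + (R x - K0 x)) = V (\<Phi> g x) + V (R x - K0 x)" by (rule blin_add[OF V gl(1) lp_diff(1)[OF gl(2,3)]])
        show ?thesis unfolding e1 e2 e3 ..
      qed
      moreover have "\<Theta> f (V x) = \<Theta> g (V x) + T (V x)" unfolding T_def by (rule Teq)
      ultimately have E: "(\<Theta> f (V x) - V (\<Phi> f x)) - ((\<Theta> g (V x) - V (\<Phi> g x)) - V (R x - K0 x)) = T (V x) - V (L x)"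
        by (simp add: algebra_simps)
      have "nrm (T (V x) - V (L x)) \<le> nrm (T (V x)) + nrm (V (L x))" by (rule lp_diff(2)[OF Tl(1) blin_lp[OF V Ll(1)]])
      also have "\<dots> \<le> \<kappa> * \<delta> * (v * nrm x) + v * ((C + 1) * \<delta> * nrm x)"
        using le_mult_trans[OF Tl(2) v(2)[OF x]] le_mult_trans[OF v(2)[OF Ll(1)] Ll(2)] k(1) d v(1) by (intro add_mono) auto
      also have "\<dots> = (\<kappa> + C + 1) * v * (\<delta> * nrm x)" by (simp add: algebra_simps)
      also have "\<dots> \<le> b * (\<delta> * nrm x)" unfolding b_def using k(1) C(1) v(1) w(1) d
        by (intro mult_right_mono mult_left_mono) auto
      also have "\<dots> = \<epsilon> * nrm x" using b by (simp add: \<delta>_def)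
      finally show ?thesis unfolding E .
    qed
    ultimately show "\<exists>K. cpt K \<and> (\<forall>x\<in>lp. nrm ((\<Theta> f (V x) - V (\<Phi> f x)) - K x) \<le> \<epsilon> * nrm x)" by blast
  qed
  moreover have "cpt (\<lambda>y. \<Phi> f (W y) - W (\<Theta> f y))"
  proof (rule cptI_approx)
    show "blin (\<lambda>y. \<Phi> f (W y) - W (\<Theta> f y))" by (intro blin_minus blin_comp[OF fb W] blin_comp[OF W Tb])
    fix \<epsilon> :: real assume e: "\<epsilon> > 0"
    define \<delta> where "\<delta> = \<epsilon> / b"
    have d: "\<delta> > 0" using e b by (simp add: \<delta>_def)
    obtain g R K0 where g: "g \<in> cfun M" "good g" and R: "cpt R" and K0: "cpt K0"
      and eq: "\<And>x. x \<in> lp \<Longrightarrow> \<Phi> f x = \<Phi> g x + R x - K0 x + (\<Phi> (\<lambda>x. 1 * f x + (- 1) * g x) x + K0 x)"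
      and le: "\<And>x. x \<in> lp \<Longrightarrow> (\<Phi> (\<lambda>x. 1 * f x + (- 1) * g x) x + K0 x) \<in> lp \<and> nrm (\<Phi> (\<lambda>x. 1 * f x + (- 1) * g x) x + K0 x) \<le> (C + 1) * \<delta> * nrm x"
      and Teq: "\<And>y. \<Theta> f y = \<Theta> g y + \<Theta> (\<lambda>x. 1 * f x + (- 1) * g x) y"
      and Tle: "\<And>y. y \<in> lp \<Longrightarrow> \<Theta> (\<lambda>x. 1 * f x + (- 1) * g x) y \<in> lp \<and> nrm (\<Theta> (\<lambda>x. 1 * f x + (- 1) * g x) y) \<le> \<kappa> * \<delta> * nrm y"
      using key[OF d] by blast
    define L where "L = (\<lambda>x. \<Phi> (\<lambda>x. 1 * f x + (- 1) * g x) x + K0 x)"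
    define T where "T = (\<lambda>y. \<Theta> (\<lambda>x. 1 * f x + (- 1) * g x) y)"
    have "cpt (\<lambda>y. (\<Phi> g (W y) - W (\<Theta> g y)) + (R (W y) - K0 (W y)))"
      using g(2) unfolding intertwines_def
      by (intro cpt_plus[OF _ cpt_minus[OF cpt_comp_right[OF R W] cpt_comp_right[OF K0 W]]]) (rule conjunct2)
    moreover have "nrm ((\<Phi> f (W y) - W (\<Theta> f y)) - ((\<Phi> g (W y) - W (\<Theta> g y)) + (R (W y) - K0 (W y)))) \<le> \<epsilon> * nrm y" if y: "y \<in> lp" for y
    proof -
      have Wy: "W y \<in> lp" by (rule blin_lp[OF W y])
      have Ll: "L (W y) \<in> lp" "nrm (L (W y)) \<le> (C + 1) * \<delta> * nrm (W y)" using le[OF Wy] by (auto simp: L_def)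
      have Tl: "T y \<in> lp" "nrm (T y) \<le> \<kappa> * \<delta> * nrm y" using Tle[OF y] by (auto simp: T_def)
      have "\<Phi> f (W y) = \<Phi> g (W y) + (R (W y) - K0 (W y)) + L (W y)" using eq[OF Wy] by (simp add: L_def algebra_simps)
      moreover have "W (\<Theta> f y) = W (\<Theta> g y) + W (T y)"
        unfolding Teq[of y] T_def[symmetric] by (rule blin_add[OF W blin_lp[OF blin_urep[OF g(1)] y] Tl(1)])
      ultimately have E: "(\<Phi> f (W y) - W (\<Theta> f y)) - ((\<Phi> g (W y) - W (\<Theta> g y)) + (R (W y) - K0 (W y))) = L (W y) - W (T y)"
        by (simp add: algebra_simps)
      have "nrm (L (W y) - W (T y)) \<le> nrm (L (W y)) + nrm (W (T y))" by (rule lp_diff(2)[OF Ll(1) blin_lp[OF W Tl(1)]])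
      also have "\<dots> \<le> (C + 1) * \<delta> * (w * nrm y) + w * (\<kappa> * \<delta> * nrm y)"
        using le_mult_trans[OF Ll(2) w(2)[OF y]] le_mult_trans[OF w(2)[OF Tl(1)] Tl(2)] C(1) d w(1) by (intro add_mono) auto
      also have "\<dots> = (\<kappa> + C + 1) * w * (\<delta> * nrm y)" by (simp add: algebra_simps)
      also have "\<dots> \<le> b * (\<delta> * nrm y)" unfolding b_def using k(1) C(1) v(1) w(1) d
        by (intro mult_right_mono mult_left_mono) auto
      also have "\<dots> = \<epsilon> * nrm y" using b by (simp add: \<delta>_def)
      finally show ?thesis unfolding E .
    qed
    ultimately show "\<exists>K. cpt K \<and> (\<forall>y\<in>lp. nrm ((\<Phi> f (W y) - W (\<Theta> f y)) - K y) \<le> \<epsilon> * nrm y)" by blast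
  qed
  ultimately show ?thesis by (simp add: intertwines_def)
qed

lemma good_const: "good (\<lambda>x. c)"
  using good_lin[OF cfun_intros(1) good_one cfun_intros(1) good_one, of c 0] by simp

lemma good_sum:
  assumes "finite J" "\<And>j. j \<in> J \<Longrightarrow> F j \<in> cfun M \<and> good (F j)"
  shows "good (\<lambda>x. \<Sum>j\<in>J. F j x)"
  using assms
proof (induction J)
  case empty
  then show ?case using good_const[of 0] by simp
next
  case (insert b J)
  have c: "(\<lambda>x. \<Sum>j\<in>J. F j x) \<in> cfun M" using insert.prems by (intro cfun_intros) auto
  show ?case using good_lin[of "F b" "\<lambda>x. \<Sum>j\<in>J. F j x" 1 1] insert c by simp
qed

end

text \<open>By Stone-Weierstrass it suffices to intertwine the coordinate functions.\<close>

lemma intertwines_all: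
  fixes M :: "(real ^ 'd) set"
  assumes "intertwining p M ns t t0 \<Phi> V W"
    and coord: "\<And>i. universal_rep.intertwines p ns t t0 \<Phi> V W (\<lambda>x. complex_of_real (x $ i))" and f: "f \<in> cfun M"
  shows "universal_rep.intertwines p ns t t0 \<Phi> V W f"
proof -
  interpret intertwining p M ns t t0 \<Phi> V W by fact
  have coord: "good (\<lambda>x. complex_of_real (x $ i))" for i by (rule coord)
  have cc: "(\<lambda>x :: real ^ 'd. complex_of_real (x $ i)) \<in> cfun M" for i
    by (auto simp: cfun_def intro!: continuous_intros)
  have poly: "good (\<lambda>x. complex_of_real (q x)) \<and> (\<lambda>x. complex_of_real (q x)) \<in> cfun M"
    if "real_polynomial_function q" for q :: "real ^ 'd \<Rightarrow> real"
    using that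
  proof (induction q rule: real_polynomial_function.induct)
    case (linear q)
    then have lin: "linear q" by (rule bounded_linear.linear)
    have qe: "q x = (\<Sum>i\<in>UNIV. (x $ i) * q (axis i 1))" for x
    proof -
      have "q x = q (\<Sum>i\<in>UNIV. (x $ i) *\<^sub>R axis i 1)"
        using basis_expansion[of x] by (simp add: scalar_mult_eq_scaleR)
      also have "\<dots> = (\<Sum>i\<in>UNIV. (x $ i) * q (axis i 1))"
        by (simp add: linear_sum[OF lin] linear_cmul[OF lin])
      finally show ?thesis .
    qed
    have eq: "(\<lambda>x. complex_of_real (q x)) = (\<lambda>x. \<Sum>i\<in>UNIV. complex_of_real (x $ i) * complex_of_real (q (axis i 1)))"
      by (rule ext, subst qe) simp
    have m: "(\<lambda>x. complex_of_real (x $ i) * complex_of_real (q (axis i 1))) \<in> cfun M" for i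
      by (intro cfun_intros cc)
    have "good (\<lambda>x. complex_of_real (x $ i) * complex_of_real (q (axis i 1)))" for i
      by (rule good_mult[OF cc coord cfun_intros(1) good_const])
    then show ?case unfolding eq using m by (intro conjI good_sum cfun_intros(5)) auto
  next
    case (const c)
    then show ?case using good_const cfun_intros(1) by simp
  next
    case (add f g)
    then show ?case using good_lin[of "\<lambda>x. complex_of_real (f x)" "\<lambda>x. complex_of_real (g x)" 1 1]
      by (auto intro: cfun_intros)
  next
    case (mult f g)
    then show ?case using good_mult[of "\<lambda>x. complex_of_real (f x)" "\<lambda>x. complex_of_real (g x)"]
      by (auto intro: cfun_intros)
  qed
  show ?thesis
  proof (rule good_limit[OF f])
    fix \<epsilon> :: real assume e: "\<epsilon> > 0"
    have fc: "continuous_on M f" using f by (simp add: cfun_def)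
    have "continuous_on M (\<lambda>x. Re (f x))" "continuous_on M (\<lambda>x. Im (f x))" by (intro continuous_intros fc)+
    then obtain q r where q: "real_polynomial_function q" "\<And>x. x \<in> M \<Longrightarrow> \<bar>Re (f x) - q x\<bar> < \<epsilon> / 2"
      and r: "real_polynomial_function r" "\<And>x. x \<in> M \<Longrightarrow> \<bar>Im (f x) - r x\<bar> < \<epsilon> / 2"
      using Stone_Weierstrass_real_polynomial_function[OF compact_M, of _ "\<epsilon> / 2"] e by (metis half_gt_zero)
    let ?g = "\<lambda>x. 1 * complex_of_real (q x) + \<i> * complex_of_real (r x)"
    have "good ?g" using poly[OF q(1)] poly[OF r(1)] by (intro good_lin) auto
    moreover have "?g \<in> cfun M" using poly[OF q(1)] poly[OF r(1)] by (intro cfun_intros) auto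
    moreover have "norm (f x - ?g x) \<le> \<epsilon>" if x: "x \<in> M" for x
    proof -
      have "norm (f x - ?g x) \<le> \<bar>Re (f x - ?g x)\<bar> + \<bar>Im (f x - ?g x)\<bar>" by (rule cmod_le)
      also have "\<dots> \<le> \<epsilon> / 2 + \<epsilon> / 2" using q(2)[OF x] r(2)[OF x] by simp
      finally show ?thesis by simp
    qed
    ultimately show "\<exists>g. g \<in> cfun M \<and> good g \<and> (\<forall>x\<in>M. norm (f x - g x) \<le> \<epsilon>)" by blast
  qed
qed

section \<open>The semigroup of extensions\<close>

definition evens :: "seq \<Rightarrow> seq" where "evens x = (\<lambda>n. x (2 * n))"

definition odds :: "seq \<Rightarrow> seq" where "odds x = (\<lambda>n. x (2 * n + 1))"

lemma evens_odds_interleave [simp]: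
  "evens (interleave x y) = x" "odds (interleave x y) = y" "interleave (evens z) (odds z) = z"
  by (auto simp: evens_def odds_def interleave_def fun_eq_iff elim: oddE)

text \<open>Extension by zero along an injection, a right inverse of reindexing by \<open>g\<close>;
  it exhibits \<open>interleave\<close> as a sum of two bounded operators.\<close>

definition spread :: "('i \<Rightarrow> 'j) \<Rightarrow> ('i \<Rightarrow> complex) \<Rightarrow> 'j \<Rightarrow> complex" where
  "spread g x = (\<lambda>j. if j \<in> range g then x (inv g j) else 0)"

lemma interleave_spread: "interleave x y = spread (\<lambda>n. 2 * n) x + spread (\<lambda>n. 2 * n + 1) y"
proof
  fix n :: nat
  have i: "inj (\<lambda>n :: nat. 2 * n)" "inj (\<lambda>n :: nat. 2 * n + 1)" by (auto simp: inj_def)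
  show "interleave x y n = (spread (\<lambda>n. 2 * n) x + spread (\<lambda>n. 2 * n + 1) y) n"
  proof (cases "even n")
    case True
    then obtain m where m: "n = 2 * m" by blast
    have "n \<notin> range (\<lambda>n. 2 * n + 1)" using True by auto
    then show ?thesis using inv_f_f[OF i(1), of m] by (simp add: m interleave_def spread_def plus_fun_apply)
  next
    case False
    then obtain m where m: "n = 2 * m + 1" by (blast elim: oddE)
    have "n \<notin> range (\<lambda>n. 2 * n)" using False by auto
    then show ?thesis using inv_f_f[OF i(2), of m] by (simp add: m interleave_def spread_def plus_fun_apply)
  qed
qed

definition isum :: "oper \<Rightarrow> oper \<Rightarrow> oper" where
  "isum T1 T2 = (\<lambda>x. interleave (T1 (evens x)) (T2 (odds x)))"

lemma ext_sum_isum: "ext_sum \<Phi> \<Psi> f = isum (\<Phi> f) (\<Psi> f)"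
  by (simp add: ext_sum_def isum_def evens_def odds_def)

lemma interleave_diff: "interleave x y - interleave x' y' = interleave (x - x') (y - y')"
  by (auto simp: interleave_def pointwise)

lemma isum_isum: "isum T1 T2 (isum S1 S2 x) = isum (\<lambda>x. T1 (S1 x)) (\<lambda>x. T2 (S2 x)) x"
  by (simp add: isum_def)

lemma isum_diff: "isum T1 T2 x - isum S1 S2 x = isum (\<lambda>x. T1 x - S1 x) (\<lambda>x. T2 x - S2 x) x"
  by (simp add: isum_def interleave_diff)

context lp_exponent
begin

lemma blin_spread:
  assumes g: "inj g"
  shows "blin (spread g)"
proof -
  have b: "spread g x \<in> lp \<and> nrm (spread g x) \<le> nrm x" if x: "x \<in> lp" for x
  proof -
    have "(\<Sum>j\<in>F. norm (spread g x j) powr p) \<le> nrm x powr p" if F: "finite F" for F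
    proof -
      have "(\<Sum>j\<in>F. norm (spread g x j) powr p) = (\<Sum>j\<in>F \<inter> range g. norm (x (inv g j)) powr p)"
        using F p_pos by (intro sum.mono_neutral_cong_right) (auto simp: spread_def)
      also have "\<dots> = (\<Sum>i\<in>inv g ` (F \<inter> range g). norm (x i) powr p)"
        by (subst sum.reindex) (auto simp: inj_on_def inv_f_f[OF g])
      also have "\<dots> \<le> nrm x powr p" using F by (intro sum_le_nrm x) auto
      finally show ?thesis .
    qed
    then show ?thesis using lp_nrm_bound[of "nrm x" "spread g x"] by auto
  qed
  show ?thesis by (rule blinI[of _ 1]) (use b in \<open>auto simp: spread_def fun_eq_iff\<close>)
qed

lemma inj_double: "inj (\<lambda>n :: nat. 2 * n)" "inj (\<lambda>n :: nat. 2 * n + 1)"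
  by (auto simp: inj_def)

lemma blin_evens: "blin evens" and blin_odds: "blin odds"
  unfolding evens_def odds_def by (intro blin_reindex inj_double)+

lemma blin_interleave: "blin S \<Longrightarrow> blin T \<Longrightarrow> blin (\<lambda>x. interleave (S x) (T x))"
  unfolding interleave_spread
  by (rule blin_plus[OF blin_comp[OF blin_spread[OF inj_double(1)]] blin_comp[OF blin_spread[OF inj_double(2)]]])

lemma cpt_interleave: "cpt S \<Longrightarrow> cpt T \<Longrightarrow> cpt (\<lambda>x. interleave (S x) (T x))"
  unfolding interleave_spread
  by (rule cpt_plus[OF cpt_comp_left[OF blin_spread[OF inj_double(1)]] cpt_comp_left[OF blin_spread[OF inj_double(2)]]])

lemma evens_lp: "x \<in> lp \<Longrightarrow> evens x \<in> lp" and odds_lp: "x \<in> lp \<Longrightarrow> odds x \<in> lp"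
  by (rule blin_lp[OF blin_evens], assumption, rule blin_lp[OF blin_odds])

lemma blin_isum: "blin S \<Longrightarrow> blin T \<Longrightarrow> blin (isum S T)"
  unfolding isum_def by (rule blin_interleave[OF blin_comp[OF _ blin_evens] blin_comp[OF _ blin_odds]])

lemma cpt_isum: "cpt S \<Longrightarrow> cpt T \<Longrightarrow> cpt (isum S T)"
  unfolding isum_def by (rule cpt_interleave[OF cpt_comp_right[OF _ blin_evens] cpt_comp_right[OF _ blin_odds]])

lemma isum_cong:
  "(\<And>x. x \<in> lp \<Longrightarrow> T1 x = S1 x) \<Longrightarrow> (\<And>x. x \<in> lp \<Longrightarrow> T2 x = S2 x) \<Longrightarrow> x \<in> lp \<Longrightarrow> isum T1 T2 x = isum S1 S2 x"
  by (simp add: isum_def evens_lp odds_lp)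

section \<open>Equivalence as a congruence for sums\<close>

lemma inverse_ops_iff: "inverse_ops p S S' \<longleftrightarrow> blin S \<and> blin S' \<and> (\<forall>x\<in>lp. S (S' x) = x \<and> S' (S x) = x)"
  by (simp add: inverse_ops_def bounded_op_iff lp_space_eq)

lemma ext_equiv_iff: "ext_equiv p M \<Phi> \<Psi> \<longleftrightarrow> (\<exists>S S'. inverse_ops p S S' \<and> (\<forall>f\<in>cfun M. cpt (\<lambda>x. \<Psi> f x - S (\<Phi> f (S' x)))))"
  by (simp add: ext_equiv_def mod_compact_iff)

lemma ext_equivI:
  assumes "blin S" "blin S'" "\<And>x. x \<in> lp \<Longrightarrow> S (S' x) = x" "\<And>x. x \<in> lp \<Longrightarrow> S' (S x) = x"
    "\<And>f. f \<in> cfun M \<Longrightarrow> cpt (\<lambda>x. \<Psi> f x - S (\<Phi> f (S' x)))"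
  shows "ext_equiv p M \<Phi> \<Psi>"
  unfolding ext_equiv_iff inverse_ops_iff using assms by blast

text \<open>Bounded lifts are all that the semigroup computations ask for, and this property passes
  to sums at once.\<close>

definition op_family :: "'m::topological_space set \<Rightarrow> (('m \<Rightarrow> complex) \<Rightarrow> oper) \<Rightarrow> bool" where
  "op_family M \<Phi> \<longleftrightarrow> (\<forall>f\<in>cfun M. blin (\<Phi> f))"

lemma op_family_iso_ext: "iso_ext p M \<Phi> \<Longrightarrow> op_family M \<Phi>"
  by (simp add: op_family_def iso_ext_blin)

lemma op_family_sum: "op_family M \<Phi> \<Longrightarrow> op_family M \<Psi> \<Longrightarrow> op_family M (ext_sum \<Phi> \<Psi>)"
  by (simp add: op_family_def ext_sum_isum blin_isum)

lemma ext_equiv_exact: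
  assumes "blin S" "blin S'" "\<And>x. x \<in> lp \<Longrightarrow> S (S' x) = x" "\<And>x. x \<in> lp \<Longrightarrow> S' (S x) = x"
    "\<And>f x. f \<in> cfun M \<Longrightarrow> x \<in> lp \<Longrightarrow> \<Psi> f x = S (\<Phi> f (S' x))"
  shows "ext_equiv p M \<Phi> \<Psi>"
proof (rule ext_equivI[OF assms(1-4)])
  fix f assume "f \<in> cfun M"
  then show "cpt (\<lambda>x. \<Psi> f x - S (\<Phi> f (S' x)))"
    by (intro cpt_cong[OF cpt_zero]) (simp add: assms(5))
qed

lemma ext_equiv_refl: "ext_equiv p M \<Phi> \<Phi>"
  by (rule ext_equiv_exact[OF blin_id blin_id]) auto

lemma ext_equiv_sym:
  assumes \<Phi>: "op_family M \<Phi>" and \<Psi>: "op_family M \<Psi>" and eq: "ext_equiv p M \<Phi> \<Psi>"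
  shows "ext_equiv p M \<Psi> \<Phi>"
proof -
  obtain S S' where S: "blin S" "blin S'" "\<And>x. x \<in> lp \<Longrightarrow> S (S' x) = x" "\<And>x. x \<in> lp \<Longrightarrow> S' (S x) = x"
    and c: "\<And>f. f \<in> cfun M \<Longrightarrow> cpt (\<lambda>x. \<Psi> f x - S (\<Phi> f (S' x)))"
    using eq unfolding ext_equiv_iff inverse_ops_iff by blast
  show ?thesis
  proof (rule ext_equivI[OF S(2,1,4,3)])
    fix f assume f: "f \<in> cfun M"
    have b: "blin (\<Phi> f)" "blin (\<Psi> f)" using \<Phi> \<Psi> f by (auto simp: op_family_def)
    have "cpt (\<lambda>x. S' (\<Psi> f (S x) - S (\<Phi> f (S' (S x)))))"
      by (rule cpt_comp_left[OF S(2) cpt_comp_right[OF c[OF f] S(1)]])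
    then have "cpt (\<lambda>x. S' (\<Psi> f (S x)) - \<Phi> f x)"
    proof (rule cpt_cong)
      fix x :: seq assume x: "x \<in> lp"
      have l: "\<Psi> f (S x) \<in> lp" "\<Phi> f x \<in> lp" "S (\<Phi> f x) \<in> lp"
        by (rule blin_lp[OF b(2) blin_lp[OF S(1) x]], rule blin_lp[OF b(1) x], rule blin_lp[OF S(1) blin_lp[OF b(1) x]])
      show "S' (\<Psi> f (S x)) - \<Phi> f x = S' (\<Psi> f (S x) - S (\<Phi> f (S' (S x))))"
        unfolding S(4)[OF x] blin_diff[OF S(2) l(1,3)] S(4)[OF l(2)] ..
    qed
    then show "cpt (\<lambda>x. \<Phi> f x - S' (\<Psi> f (S x)))" by (rule cpt_sym)
  qed
qed

lemma ext_equiv_trans: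
  assumes \<Phi>: "op_family M \<Phi>" and \<Psi>: "op_family M \<Psi>"
    and eq: "ext_equiv p M \<Phi> \<Psi>" "ext_equiv p M \<Psi> \<Omega>"
  shows "ext_equiv p M \<Phi> \<Omega>"
proof -
  obtain S S' where S: "blin S" "blin S'" "\<And>x. x \<in> lp \<Longrightarrow> S (S' x) = x" "\<And>x. x \<in> lp \<Longrightarrow> S' (S x) = x"
    and c: "\<And>f. f \<in> cfun M \<Longrightarrow> cpt (\<lambda>x. \<Psi> f x - S (\<Phi> f (S' x)))"
    using eq(1) unfolding ext_equiv_iff inverse_ops_iff by blast
  obtain T T' where T: "blin T" "blin T'" "\<And>x. x \<in> lp \<Longrightarrow> T (T' x) = x" "\<And>x. x \<in> lp \<Longrightarrow> T' (T x) = x"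
    and d: "\<And>f. f \<in> cfun M \<Longrightarrow> cpt (\<lambda>x. \<Omega> f x - T (\<Psi> f (T' x)))"
    using eq(2) unfolding ext_equiv_iff inverse_ops_iff by blast
  show ?thesis
  proof (rule ext_equivI[OF blin_comp[OF T(1) S(1)] blin_comp[OF S(2) T(2)]])
    show "T (S (S' (T' x))) = x" if "x \<in> lp" for x
      unfolding S(3)[OF blin_lp[OF T(2) that]] by (rule T(3)[OF that])
    show "S' (T' (T (S x))) = x" if "x \<in> lp" for x
      unfolding T(4)[OF blin_lp[OF S(1) that]] by (rule S(4)[OF that])
    fix f assume f: "f \<in> cfun M"
    have b: "blin (\<Phi> f)" "blin (\<Psi> f)" using \<Phi> \<Psi> f by (auto simp: op_family_def)
    have "cpt (\<lambda>x. (\<Omega> f x - T (\<Psi> f (T' x))) + T (\<Psi> f (T' x) - S (\<Phi> f (S' (T' x)))))"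
      by (rule cpt_plus[OF d[OF f] cpt_comp_left[OF T(1) cpt_comp_right[OF c[OF f] T(2)]]])
    then show "cpt (\<lambda>x. \<Omega> f x - T (S (\<Phi> f (S' (T' x)))))"
    proof (rule cpt_cong)
      fix x :: seq assume x: "x \<in> lp"
      have x': "T' x \<in> lp" by (rule blin_lp[OF T(2) x])
      have l: "\<Psi> f (T' x) \<in> lp" "S (\<Phi> f (S' (T' x))) \<in> lp"
        by (rule blin_lp[OF b(2) x'], rule blin_lp[OF S(1) blin_lp[OF b(1) blin_lp[OF S(2) x']]])
      show "\<Omega> f x - T (S (\<Phi> f (S' (T' x)))) = (\<Omega> f x - T (\<Psi> f (T' x))) + T (\<Psi> f (T' x) - S (\<Phi> f (S' (T' x))))"
        unfolding blin_diff[OF T(1) l] by simp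
    qed
  qed
qed

lemma ext_equiv_sum:
  assumes "ext_equiv p M \<Phi> \<Phi>'" "ext_equiv p M \<Psi> \<Psi>'"
  shows "ext_equiv p M (ext_sum \<Phi> \<Psi>) (ext_sum \<Phi>' \<Psi>')"
proof -
  obtain S S' where S: "blin S" "blin S'" "\<And>x. x \<in> lp \<Longrightarrow> S (S' x) = x" "\<And>x. x \<in> lp \<Longrightarrow> S' (S x) = x"
    and c: "\<And>f. f \<in> cfun M \<Longrightarrow> cpt (\<lambda>x. \<Phi>' f x - S (\<Phi> f (S' x)))"
    using assms(1) unfolding ext_equiv_iff inverse_ops_iff by blast
  obtain T T' where T: "blin T" "blin T'" "\<And>x. x \<in> lp \<Longrightarrow> T (T' x) = x" "\<And>x. x \<in> lp \<Longrightarrow> T' (T x) = x"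
    and d: "\<And>f. f \<in> cfun M \<Longrightarrow> cpt (\<lambda>x. \<Psi>' f x - T (\<Psi> f (T' x)))"
    using assms(2) unfolding ext_equiv_iff inverse_ops_iff by blast
  have id: "isum (\<lambda>x. x) (\<lambda>x. x) x = x" for x by (simp add: isum_def)
  show ?thesis
  proof (rule ext_equivI[OF blin_isum[OF S(1) T(1)] blin_isum[OF S(2) T(2)]])
    show "isum S T (isum S' T' x) = x" if "x \<in> lp" for x
      unfolding isum_isum using isum_cong[OF S(3) T(3) that] id by simp
    show "isum S' T' (isum S T x) = x" if "x \<in> lp" for x
      unfolding isum_isum using isum_cong[OF S(4) T(4) that] id by simp
    show "cpt (\<lambda>x. ext_sum \<Phi>' \<Psi>' f x - isum S T (ext_sum \<Phi> \<Psi> f (isum S' T' x)))" if f: "f \<in> cfun M" for f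
      unfolding ext_sum_isum isum_isum isum_diff by (rule cpt_isum[OF c[OF f] d[OF f]])
  qed
qed

text \<open>Conjugation by the coordinate permutation that exchanges even and odd places.\<close>

lemma ext_sum_commute: "ext_equiv p M (ext_sum \<Phi> \<Psi>) (ext_sum \<Psi> \<Phi>)"
proof -
  have b: "blin (\<lambda>x. interleave (odds x) (evens x))" by (rule blin_interleave[OF blin_odds blin_evens])
  show ?thesis by (rule ext_equiv_exact[OF b b]) (simp_all add: ext_sum_isum isum_def)
qed

lemma ext_sum_assoc: "ext_equiv p M (ext_sum (ext_sum \<Phi> \<Psi>) \<Omega>) (ext_sum \<Phi> (ext_sum \<Psi> \<Omega>))"
proof -
  have b: "blin (\<lambda>x. interleave (evens (evens x)) (interleave (odds (evens x)) (odds x)))"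
    by (rule blin_interleave[OF blin_comp[OF blin_evens blin_evens] blin_interleave[OF blin_comp[OF blin_odds blin_evens] blin_odds]])
  have b': "blin (\<lambda>x. interleave (interleave (evens x) (evens (odds x))) (odds (odds x)))"
    by (rule blin_interleave[OF blin_interleave[OF blin_evens blin_comp[OF blin_evens blin_odds]] blin_comp[OF blin_odds blin_odds]])
  show ?thesis by (rule ext_equiv_exact[OF b b']) (simp_all add: ext_sum_isum isum_def)
qed

text \<open>\<open>\<theta> = \<Psi> + \<Omega> = (\<Psi> + \<Psi>) + \<Omega> = \<Psi> + \<theta>\<close>.\<close>

lemma ext_equiv_absorb:
  assumes fam: "op_family M \<theta>" "op_family M \<Psi>" "op_family M \<Omega>"
    and idem: "ext_equiv p M \<Psi> (ext_sum \<Psi> \<Psi>)" and summand: "ext_equiv p M \<theta> (ext_sum \<Psi> \<Omega>)"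
  shows "ext_equiv p M \<theta> (ext_sum \<Psi> \<theta>)"
proof -
  note fams = fam op_family_sum
  have 1: "ext_equiv p M (ext_sum \<Psi> \<Omega>) (ext_sum (ext_sum \<Psi> \<Psi>) \<Omega>)"
    by (rule ext_equiv_sum[OF idem ext_equiv_refl])
  have 2: "ext_equiv p M (ext_sum (ext_sum \<Psi> \<Psi>) \<Omega>) (ext_sum \<Psi> (ext_sum \<Psi> \<Omega>))" by (rule ext_sum_assoc)
  have 3: "ext_equiv p M (ext_sum \<Psi> (ext_sum \<Psi> \<Omega>)) (ext_sum \<Psi> \<theta>)"
    by (intro ext_equiv_sum ext_equiv_refl ext_equiv_sym[OF _ _ summand] fams)
  have "ext_equiv p M \<theta> (ext_sum (ext_sum \<Psi> \<Psi>) \<Omega>)"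
    by (rule ext_equiv_trans[OF _ _ summand 1]) (intro fams)+
  then have "ext_equiv p M \<theta> (ext_sum \<Psi> (ext_sum \<Psi> \<Omega>))"
    by (rule ext_equiv_trans[rotated 2, OF _ 2]) (intro fams)+
  then show ?thesis
    by (rule ext_equiv_trans[rotated 2, OF _ 3]) (intro fams)+
qed

lemma idempotent_absorbing_unique:
  assumes fam: "op_family M \<theta>" "op_family M \<theta>'" "op_family M \<Omega>" "op_family M \<Omega>'"
    and idem: "ext_equiv p M \<theta> (ext_sum \<theta> \<theta>)" "ext_equiv p M \<theta>' (ext_sum \<theta>' \<theta>')"
    and summand: "ext_equiv p M \<theta> (ext_sum \<theta>' \<Omega>)" "ext_equiv p M \<theta>' (ext_sum \<theta> \<Omega>')"
  shows "ext_equiv p M \<theta> \<theta>'"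
proof -
  note fams = fam op_family_sum
  have 1: "ext_equiv p M \<theta> (ext_sum \<theta>' \<theta>)" by (rule ext_equiv_absorb[OF fam(1,2,3) idem(2) summand(1)])
  have 2: "ext_equiv p M \<theta>' (ext_sum \<theta> \<theta>')" by (rule ext_equiv_absorb[OF fam(2,1,4) idem(1) summand(2)])
  have 3: "ext_equiv p M (ext_sum \<theta> \<theta>') \<theta>'" by (rule ext_equiv_sym[OF _ _ 2]) (intro fams)+
  have "ext_equiv p M \<theta> (ext_sum \<theta> \<theta>')"
    by (rule ext_equiv_trans[OF _ _ 1 ext_sum_commute]) (intro fams)+
  then show ?thesis by (rule ext_equiv_trans[rotated 2, OF _ 3]) (intro fams)+
qed

end

section \<open>Square partitions of unity of bounded multiplicity\<close>

definition tent :: "real \<Rightarrow> real" where "tent x = max 0 (1 - \<bar>x\<bar>)"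

lemma tent_bounds: "0 \<le> tent x" "tent x \<le> 1" "tent x = 0 \<longleftrightarrow> 1 \<le> \<bar>x\<bar>"
  by (auto simp: tent_def max_def)

text \<open>A function vanishing outside the open interval from -1 to 1 sees only the two integers
  around \<open>y\<close>; this serves both the tents and their square roots.\<close>

lemma sum_two_translates:
  fixes g :: "real \<Rightarrow> real" and y :: real
  assumes g: "\<And>x. 1 \<le> \<bar>x\<bar> \<Longrightarrow> g x = 0" and K: "finite K" "\<lfloor>y\<rfloor> \<in> K" "\<lfloor>y\<rfloor> + 1 \<in> K"
  shows "(\<Sum>k\<in>K. g (y - of_int k)) = g (y - of_int \<lfloor>y\<rfloor>) + g (y - of_int \<lfloor>y\<rfloor> - 1)"
proof -
  have "(\<Sum>k\<in>K. g (y - of_int k)) = (\<Sum>k\<in>{\<lfloor>y\<rfloor>, \<lfloor>y\<rfloor> + 1}. g (y - of_int k))"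
  proof (rule sum.mono_neutral_right[OF K(1)])
    show "\<forall>k\<in>K - {\<lfloor>y\<rfloor>, \<lfloor>y\<rfloor> + 1}. g (y - of_int k) = 0"
    proof
      fix k assume "k \<in> K - {\<lfloor>y\<rfloor>, \<lfloor>y\<rfloor> + 1}"
      then have "k \<le> \<lfloor>y\<rfloor> - 1 \<or> k \<ge> \<lfloor>y\<rfloor> + 2" by auto
      then have "1 \<le> \<bar>y - of_int k\<bar>" by linarith
      then show "g (y - of_int k) = 0" by (rule g)
    qed
  qed (use K in auto)
  then show ?thesis by (simp add: algebra_simps)
qed

text \<open>Products over the coordinates of square roots of tents on a grid of width
  \<open>\<delta>\<close>. Neighbouring tents sum to 1, hence so do the squares of the products. In
  each coordinate at most two roots are nonzero, each at most 1, so the functions themselves sum to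
  at most \<open>2 ^ CARD('d)\<close> for every mesh.\<close>

lemma square_partition:
  fixes M :: "(real ^ 'd) set"
  assumes M: "bounded M" and t0: "t0 \<in> M" and \<epsilon>: "0 < \<epsilon>"
  shows "\<exists>n t a. (\<forall>j<n. t j \<in> M \<and> continuous_on M (a j)) \<and> (\<forall>j x. 0 \<le> a j x) \<and>
    (\<forall>x\<in>M. (\<Sum>j<(n::nat). (a j x)\<^sup>2) = 1 \<and> (\<Sum>j<n. a j x) \<le> 2 ^ CARD('d) \<and> (\<forall>j<n. a j x \<noteq> (0::real) \<longrightarrow> dist x (t j) \<le> \<epsilon>))"
proof -
  \<comment> \<open>Two points in the support of one function differ by at most
    \<open>2 * \<delta>\<close> in every coordinate; summed over the coordinates this is
    \<open>\<epsilon>\<close>.\<close>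
  define \<delta> where "\<delta> = \<epsilon> / (2 * real CARD('d))"
  have d: "\<delta> > 0" using \<epsilon> by (simp add: \<delta>_def)
  obtain b where b: "\<And>x. x \<in> M \<Longrightarrow> norm x \<le> b" using M by (auto simp: bounded_iff)
  \<comment> \<open>The \<open>+ 1\<close> leaves room for the upper end of the grid cell.\<close>
  obtain N0 :: nat where N0: "b / \<delta> + 1 \<le> real N0" using real_arch_simple by blast
  define K where "K = {- int N0..int N0}"
  have K: "\<lfloor>x $ i / \<delta>\<rfloor> \<in> K" "\<lfloor>x $ i / \<delta>\<rfloor> + 1 \<in> K" if "x \<in> M" for x i
  proof -
    have "\<bar>x $ i\<bar> \<le> b" using component_le_norm_cart[of x i] b[OF that] by linarith
    then have "\<bar>x $ i / \<delta>\<bar> \<le> b / \<delta>" using d by (simp add: abs_divide divide_right_mono)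
    then have "\<bar>x $ i / \<delta>\<bar> + 1 \<le> real N0" using N0 by linarith
    then show "\<lfloor>x $ i / \<delta>\<rfloor> \<in> K" "\<lfloor>x $ i / \<delta>\<rfloor> + 1 \<in> K" unfolding K_def atLeastAtMost_iff by linarith+
  qed
  define J where "J = (PiE UNIV (\<lambda>_. K) :: ('d \<Rightarrow> int) set)"
  have J: "finite J" unfolding J_def K_def by (intro finite_PiE) auto
  define A where "A = (\<lambda>(j :: 'd \<Rightarrow> int) (x :: real ^ 'd). \<Prod>i\<in>UNIV. sqrt (tent (x $ i / \<delta> - of_int (j i))))"
  have A0: "0 \<le> A j x" for j x unfolding A_def by (intro prod_nonneg) (simp add: tent_bounds)
  have A_cont: "continuous_on M (A j)" for j
    unfolding A_def tent_def using d by (intro continuous_intros) auto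
  have A_sq: "(\<Sum>j\<in>J. (A j x)\<^sup>2) = 1" if x: "x \<in> M" for x
  proof -
    have "(\<Sum>j\<in>J. (A j x)\<^sup>2) = (\<Sum>j\<in>J. \<Prod>i\<in>UNIV. tent (x $ i / \<delta> - of_int (j i)))"
      by (simp add: A_def prod_power_distrib tent_bounds)
    also have "\<dots> = (\<Prod>i\<in>(UNIV :: 'd set). \<Sum>k\<in>K. tent (x $ i / \<delta> - of_int k))"
      unfolding J_def by (rule prod_sum_PiE[symmetric]) (auto simp: K_def)
    also have "\<dots> = (\<Prod>i\<in>(UNIV :: 'd set). 1)"
    proof (rule prod.cong[OF refl])
      fix i :: 'd
      define y where "y = x $ i / \<delta>"
      have "(\<Sum>k\<in>K. tent (y - of_int k)) = tent (y - of_int \<lfloor>y\<rfloor>) + tent (y - of_int \<lfloor>y\<rfloor> - 1)"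
        by (rule sum_two_translates) (use K[OF x, of i] tent_bounds in \<open>auto simp: y_def K_def\<close>)
      also have "\<dots> = 1"
      proof -
        have "0 \<le> y - of_int \<lfloor>y\<rfloor>" "y - of_int \<lfloor>y\<rfloor> < 1" by linarith+
        then show ?thesis by (simp add: tent_def)
      qed
      finally show "(\<Sum>k\<in>K. tent (x $ i / \<delta> - of_int k)) = 1" by (simp add: y_def)
    qed
    finally show ?thesis by simp
  qed
  have A_sum: "(\<Sum>j\<in>J. A j x) \<le> 2 ^ CARD('d)" if x: "x \<in> M" for x
  proof -
    have "(\<Sum>j\<in>J. A j x) = (\<Prod>i\<in>(UNIV :: 'd set). \<Sum>k\<in>K. sqrt (tent (x $ i / \<delta> - of_int k)))"
      unfolding J_def A_def by (rule prod_sum_PiE[symmetric]) (auto simp: K_def)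
    also have "\<dots> \<le> (\<Prod>i\<in>(UNIV :: 'd set). 2)"
    proof (intro prod_mono conjI sum_nonneg)
      fix i :: 'd
      define y where "y = x $ i / \<delta>"
      have "(\<Sum>k\<in>K. sqrt (tent (y - of_int k))) = sqrt (tent (y - of_int \<lfloor>y\<rfloor>)) + sqrt (tent (y - of_int \<lfloor>y\<rfloor> - 1))"
        by (rule sum_two_translates[where g = "\<lambda>x. sqrt (tent x)"]) (use K[OF x, of i] tent_bounds in \<open>auto simp: y_def K_def\<close>)
      also have "\<dots> \<le> 1 + 1" by (intro add_mono) (simp_all add: tent_bounds)
      finally show "(\<Sum>k\<in>K. sqrt (tent (x $ i / \<delta> - of_int k))) \<le> 2" by (simp add: y_def)
    qed (simp add: tent_bounds)
    finally show ?thesis by simp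
  qed
  \<comment> \<open>Grid points need not lie in \<open>M\<close>, so a point of \<open>M\<close> in
    the support is taken; functions vanishing on \<open>M\<close> get the dummy
    \<open>t0\<close>.\<close>
  define t where "t = (\<lambda>j. if \<exists>y\<in>M. A j y \<noteq> 0 then SOME y. y \<in> M \<and> A j y \<noteq> 0 else t0)"
  have t: "t j \<in> M" "x \<in> M \<Longrightarrow> A j x \<noteq> 0 \<Longrightarrow> A j (t j) \<noteq> 0" for j x
  proof -
    have *: "(\<exists>y\<in>M. A j y \<noteq> 0) \<Longrightarrow> (SOME y. y \<in> M \<and> A j y \<noteq> 0) \<in> M \<and> A j (SOME y. y \<in> M \<and> A j y \<noteq> 0) \<noteq> 0"
      by (rule someI_ex) blast
    show "t j \<in> M" using * t0 by (auto simp: t_def)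
    show "x \<in> M \<Longrightarrow> A j x \<noteq> 0 \<Longrightarrow> A j (t j) \<noteq> 0" using * by (auto simp: t_def)
  qed
  have near: "dist x (t j) \<le> \<epsilon>" if x: "x \<in> M" "A j x \<noteq> 0" for x j
  proof -
    have c: "\<bar>y $ i - \<delta> * of_int (j i)\<bar> \<le> \<delta>" if "A j y \<noteq> 0" for y i
    proof -
      have "tent (y $ i / \<delta> - of_int (j i)) \<noteq> 0" using that by (auto simp: A_def)
      then have "\<bar>y $ i / \<delta> - of_int (j i)\<bar> < 1" by (simp add: tent_bounds not_le)
      then have "\<delta> * \<bar>y $ i / \<delta> - of_int (j i)\<bar> \<le> \<delta>" using d by simp
      moreover have "\<delta> * \<bar>y $ i / \<delta> - of_int (j i)\<bar> = \<bar>\<delta> * (y $ i / \<delta> - of_int (j i))\<bar>" using d by (simp add: abs_mult)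
      ultimately show ?thesis using d by (simp add: right_diff_distrib)
    qed
    have "dist x (t j) = norm (x - t j)" by (simp add: dist_norm)
    also have "\<dots> \<le> (\<Sum>i\<in>UNIV. \<bar>(x - t j) $ i\<bar>)" by (rule norm_le_l1_cart)
    also have "\<dots> \<le> (\<Sum>i\<in>(UNIV :: 'd set). 2 * \<delta>)"
    proof (rule sum_mono)
      fix i
      show "\<bar>(x - t j) $ i\<bar> \<le> 2 * \<delta>" using c[OF x(2), of i] c[OF t(2)[OF x], of i] by (simp add: abs_le_iff)
    qed
    also have "\<dots> = \<epsilon>" by (simp add: \<delta>_def)
    finally show ?thesis .
  qed
  obtain e where e: "bij_betw e {0..<card J} J" using ex_bij_betw_nat_finite[OF J] by blast
  have sum_e: "(\<Sum>l<card J. F (e l)) = (\<Sum>j\<in>J. F j)" for F :: "('d \<Rightarrow> int) \<Rightarrow> real"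
    using sum.reindex_bij_betw[OF e, of F] by (simp add: atLeast0LessThan)
  show ?thesis
    by (rule exI[of _ "card J"], rule exI[of _ "\<lambda>l. t (e l)"], rule exI[of _ "\<lambda>l. A (e l)"])
      (use t(1) A_cont A0 A_sq A_sum near in \<open>auto simp: sum_e sum_e[of "\<lambda>j. (A j x)\<^sup>2" for x] sum_e[of "\<lambda>j. A j x" for x]\<close>)
qed

lemma partition_rep_exists:
  fixes M :: "(real ^ 'd) set"
  assumes p: "1 < p" and M: "compact M" "M \<noteq> {}"
  obtains ns t t0 a D where "partition_rep p M ns t t0 a D"
proof -
  obtain t0 where t0: "t0 \<in> M" using M by blast
  have "\<forall>s::nat. \<exists>n t a. (\<forall>j<n. t j \<in> M \<and> continuous_on M (a j)) \<and> (\<forall>j x. 0 \<le> a j x) \<and>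
    (\<forall>x\<in>M. (\<Sum>j<(n::nat). (a j x)\<^sup>2) = 1 \<and> (\<Sum>j<n. a j x) \<le> 2 ^ CARD('d) \<and> (\<forall>j<n. a j x \<noteq> (0::real) \<longrightarrow> dist x (t j) \<le> 1 / real (Suc s)))"
    by (rule allI, rule square_partition[OF compact_imp_bounded[OF M(1)] t0]) simp
  then obtain ns t a where *: "\<And>s::nat. (\<forall>j<ns s. t s j \<in> M \<and> continuous_on M (a s j)) \<and> (\<forall>j x. 0 \<le> a s j x) \<and>
    (\<forall>x\<in>M. (\<Sum>j<(ns s::nat). (a s j x)\<^sup>2) = 1 \<and> (\<Sum>j<ns s. a s j x) \<le> 2 ^ CARD('d) \<and> (\<forall>j<ns s. a s j x \<noteq> (0::real) \<longrightarrow> dist x (t s j) \<le> 1 / real (Suc s)))"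
    by metis
  have "partition_rep p M ns t t0 a (2 ^ CARD('d))"
  proof
    show "1 < p" "compact M" "t0 \<in> M" by fact+
    show "\<exists>s. \<exists>j<ns s. dist x (t s j) < e" if x: "x \<in> M" and e: "0 < e" for x e
    proof -
      obtain s where s: "1 / real (Suc s) < e" using e reals_Archimedean[of e] by (auto simp: inverse_eq_divide)
      \<comment> \<open>Some function of the partition is nonzero at \<open>x\<close>, and its
        sample point is then near \<open>x\<close>.\<close>
      have "(\<Sum>j<ns s. (a s j x)\<^sup>2) \<noteq> 0" using *[of s] x by simp
      then obtain j where "j < ns s" "a s j x \<noteq> 0" by (auto elim!: sum.not_neutral_contains_not_neutral)
      then have "dist x (t s j) \<le> 1 / real (Suc s)" using *[of s] x by blast
      then show ?thesis using s \<open>j < ns s\<close> by (intro exI[of _ s] exI[of _ j]) auto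
    qed
  qed (use * in blast)+
  then show ?thesis by (rule that)
qed

section \<open>The universal trivial extension\<close>

context lp_exponent
begin

lemma iso_extI:
  assumes "\<And>f. f \<in> cfun M \<Longrightarrow> blin (\<Phi> f)"
    and "\<And>f g. f \<in> cfun M \<Longrightarrow> g \<in> cfun M \<Longrightarrow> (\<And>x. x \<in> M \<Longrightarrow> f x = g x) \<Longrightarrow> cpt (\<lambda>v. \<Phi> f v - \<Phi> g v)"
    and "\<And>f g a b. f \<in> cfun M \<Longrightarrow> g \<in> cfun M \<Longrightarrow>
        cpt (\<lambda>v. \<Phi> (\<lambda>x. a * f x + b * g x) v - (\<lambda>k. a * \<Phi> f v k + b * \<Phi> g v k))"
    and "\<And>f g. f \<in> cfun M \<Longrightarrow> g \<in> cfun M \<Longrightarrow> cpt (\<lambda>v. \<Phi> (\<lambda>x. f x * g x) v - \<Phi> f (\<Phi> g v))"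
    and "cpt (\<lambda>v. \<Phi> (\<lambda>x. 1) v - v)"
    and "1 \<le> C" "\<And>f. f \<in> cfun M \<Longrightarrow> sup_norm M f / C \<le> ess_norm p (\<Phi> f) \<and> ess_norm p (\<Phi> f) \<le> C * sup_norm M f"
  shows "iso_ext p M \<Phi>"
  unfolding iso_ext_def bounded_op_iff mod_compact_iff o_def id_apply
proof (intro conjI ballI allI impI exI[of _ C])
  show "cpt (\<lambda>v. \<Phi> f v - \<Phi> g v)" if "f \<in> cfun M" "g \<in> cfun M" "\<forall>x\<in>M. f x = g x" for f g
    using that by (intro assms(2)) auto
  show "sup_norm M f / C \<le> ess_norm p (\<Phi> f)" "ess_norm p (\<Phi> f) \<le> C * sup_norm M f" if "f \<in> cfun M" for f
    using assms(7)[OF that] by blast+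
qed (rule assms, assumption+ | rule assms)+

end

section \<open>Transport to sequences and splitting of the multiplicity\<close>

definition enc :: "(nat \<times> nat) \<times> nat \<Rightarrow> nat" where
  "enc = (\<lambda>(a, k). prod_encode (prod_encode a, k))"

definition dec :: "nat \<Rightarrow> (nat \<times> nat) \<times> nat" where
  "dec n = (prod_decode (fst (prod_decode n)), snd (prod_decode n))"

lemma dec_enc [simp]: "dec (enc i) = i" and enc_dec [simp]: "enc (dec n) = n"
  by (auto simp: enc_def dec_def split: prod.splits)

definition lift :: "seq \<Rightarrow> (nat \<times> nat) \<times> nat \<Rightarrow> complex" where "lift x = (\<lambda>i. x (enc i))"

definition lower :: "((nat \<times> nat) \<times> nat \<Rightarrow> complex) \<Rightarrow> seq" where "lower y = (\<lambda>n. y (dec n))"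

lemma lift_lower [simp]: "lift (lower y) = y" "lower (lift x) = x"
  by (simp_all add: lift_def lower_def)

lemma lower_diff: "lower (x - y) = lower x - lower y" and lift_add: "lift (u + v) = lift u + lift v"
  by (auto simp: lower_def lift_def pointwise)

text \<open>Splits the multiplicity index by parity. \<open>urep\<close> does not touch this index,
  so the representation is conjugate to its double by a relabelling of coordinates.\<close>

definition half :: "nat \<Rightarrow> ('a \<times> nat \<Rightarrow> complex) \<Rightarrow> 'a \<times> nat \<Rightarrow> complex" where
  "half b y = (\<lambda>(a, k). y (a, 2 * k + b))"

definition merge :: "('a \<times> nat \<Rightarrow> complex) \<Rightarrow> ('a \<times> nat \<Rightarrow> complex) \<Rightarrow> 'a \<times> nat \<Rightarrow> complex" where
  "merge y z = (\<lambda>(a, k). if even k then y (a, k div 2) else z (a, k div 2))"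

lemma half_merge [simp]: "half 0 (merge y z) = y" "half (Suc 0) (merge y z) = z" "merge (half 0 y) (half (Suc 0) y) = y"
  by (auto simp: half_def merge_def fun_eq_iff elim: oddE)

lemma merge_spread: "merge y z = spread (\<lambda>(a, k). (a, 2 * k)) y + spread (\<lambda>(a, k). (a, 2 * k + 1)) z"
proof
  fix i :: "'a \<times> nat"
  obtain a k where i: "i = (a, k)" by (metis surj_pair)
  let ?g = "\<lambda>(a :: 'a, k :: nat). (a, 2 * k)" and ?h = "\<lambda>(a :: 'a, k :: nat). (a, 2 * k + 1)"
  have inj: "inj ?g" "inj ?h" by (auto simp: inj_def)
  show "merge y z i = (spread ?g y + spread ?h z) i"
  proof (cases "even k")
    case True
    then obtain m where m: "k = 2 * m" by blast
    have "i = ?g (a, m)" by (simp add: i m)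
    then have "i \<in> range ?g" "inv ?g i = (a, m)" using inv_f_f[OF inj(1), of "(a, m)"] by auto
    moreover have "i \<notin> range ?h" by (auto simp: i m) presburger
    ultimately show ?thesis by (simp add: spread_def plus_fun_apply merge_def i m)
  next
    case False
    then obtain m where m: "k = 2 * m + 1" by (blast elim: oddE)
    have "i = ?h (a, m)" by (simp add: i m)
    then have "i \<in> range ?h" "inv ?h i = (a, m)" using inv_f_f[OF inj(2), of "(a, m)"] by auto
    moreover have "i \<notin> range ?g" by (auto simp: i m) presburger
    ultimately show ?thesis by (simp add: spread_def plus_fun_apply merge_def i m)
  qed
qed

lemma urep_half: "urep ns t t0 f (half b y) = half b (urep ns t t0 f y)"
  by (auto simp: urep_def half_def fun_eq_iff)

context lp_exponent
begin

lemma blin_lift: "blin lift" and blin_lower: "blin lower"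
  unfolding lift_def lower_def
  by (intro blin_reindex injI, metis dec_enc, intro blin_reindex injI, metis enc_dec)

lemma nrm_lift: "x \<in> lp \<Longrightarrow> nrm (lift x) \<le> nrm x" and nrm_lower: "y \<in> lp \<Longrightarrow> nrm (lower y) \<le> nrm y"
  unfolding lift_def lower_def
  by (rule reindex_lp, metis dec_enc injI, assumption, rule reindex_lp, metis enc_dec injI, assumption)

lemma blin_half: "blin (half b)"
proof -
  have eq: "half b = (\<lambda>y i. y ((\<lambda>(a, k). (a, 2 * k + b)) i))" by (auto simp: half_def fun_eq_iff)
  show ?thesis unfolding eq by (rule blin_reindex) (auto simp: inj_def)
qed

lemma blin_merge: "blin S \<Longrightarrow> blin T \<Longrightarrow> blin (\<lambda>x. merge (S x) (T x))"
  unfolding merge_spread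
  by (rule blin_plus[OF blin_comp[OF blin_spread] blin_comp[OF blin_spread]]) (auto simp: inj_def)

end

context universal_rep
begin

definition \<theta> :: "('m \<Rightarrow> complex) \<Rightarrow> oper" where "\<theta> f x = lower (\<Theta> f (lift x))"

lemma theta_blin: "f \<in> cfun M \<Longrightarrow> blin (\<theta> f)"
  unfolding \<theta>_def by (rule blin_comp[OF blin_lower blin_comp[OF blin_urep blin_lift]])

lemma theta_cong: "(\<And>x. x \<in> M \<Longrightarrow> f x = g x) \<Longrightarrow> \<theta> f v = \<theta> g v"
  unfolding \<theta>_def by (simp add: urep_cong[of f g])

lemma theta_lin: "\<theta> (\<lambda>x. a * f x + b * g x) v = (\<lambda>k. a * \<theta> f v k + b * \<theta> g v k)"
  unfolding \<theta>_def urep_lin_fun by (simp add: lower_def)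

lemma theta_mult: "\<theta> (\<lambda>x. f x * g x) v = \<theta> f (\<theta> g v)"
  by (simp add: \<theta>_def urep_mult)

lemma theta_one: "\<theta> (\<lambda>x. 1) v = v"
  by (simp add: \<theta>_def urep_one)

lemma theta_bounded:
  obtains \<kappa> where "1 \<le> \<kappa>" "\<And>f x. f \<in> cfun M \<Longrightarrow> x \<in> lp \<Longrightarrow> nrm (\<theta> f x) \<le> \<kappa> * sup_norm M f * nrm x"
proof -
  obtain \<kappa> where k: "1 \<le> \<kappa>" "\<And>f y. f \<in> cfun M \<Longrightarrow> y \<in> lp \<Longrightarrow> \<Theta> f y \<in> lp \<and> nrm (\<Theta> f y) \<le> \<kappa> * sup_norm M f * nrm y"
    by (rule urep_bounded) blast
  show ?thesis
  proof (rule that[OF k(1)])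
    fix f :: "'m \<Rightarrow> complex" and x :: seq assume f: "f \<in> cfun M" and x: "x \<in> lp"
    have l: "lift x \<in> lp" by (rule blin_lp[OF blin_lift x])
    have "nrm (\<theta> f x) \<le> nrm (\<Theta> f (lift x))" unfolding \<theta>_def using k(2)[OF f l] nrm_lower by blast
    also have "\<dots> \<le> \<kappa> * sup_norm M f * nrm (lift x)" using k(2)[OF f l] by blast
    also have "\<dots> \<le> \<kappa> * sup_norm M f * nrm x"
      using nrm_lift[OF x] k(1) sup_norm_nonneg[OF f] by (intro mult_left_mono) auto
    finally show "nrm (\<theta> f x) \<le> \<kappa> * sup_norm M f * nrm x" .
  qed
qed

lemma theta_lower_bound:
  assumes f: "f \<in> cfun M" and K: "cpt K" and c: "0 \<le> c" "\<And>x. x \<in> lp \<Longrightarrow> nrm (\<theta> f x + K x) \<le> c * nrm x"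
  shows "sup_norm M f \<le> c"
proof (rule urep_lower_bound[OF f _ c(1)])
  show "cpt (\<lambda>y. lift (K (lower y)))" by (rule cpt_comp_left[OF blin_lift cpt_comp_right[OF K blin_lower]])
  fix y :: "(nat \<times> nat) \<times> nat \<Rightarrow> complex" assume y: "y \<in> lp"
  have l: "lower y \<in> lp" by (rule blin_lp[OF blin_lower y])
  have s: "\<theta> f (lower y) + K (lower y) \<in> lp"
    by (rule lp_add(1)[OF blin_lp[OF theta_blin[OF f] l] blin_lp[OF cpt_blin[OF K] l]])
  have eq: "\<Theta> f y + lift (K (lower y)) = lift (\<theta> f (lower y) + K (lower y))"
    unfolding lift_add by (simp add: \<theta>_def)
  have "nrm (\<Theta> f y + lift (K (lower y))) \<le> nrm (\<theta> f (lower y) + K (lower y))"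
    unfolding eq by (rule nrm_lift[OF s])
  also have "\<dots> \<le> c * nrm (lower y)" by (rule c(2)[OF l])
  also have "\<dots> \<le> c * nrm y" by (rule mult_left_mono[OF nrm_lower[OF y] c(1)])
  finally show "nrm (\<Theta> f y + lift (K (lower y))) \<le> c * nrm y" .
qed

text \<open>\<open>\<theta>\<close> is linear, multiplicative and unital exactly, not only modulo
  compact operators, and so is its own lifting. Both lower bounds come from
  \<open>theta_lower_bound\<close>, with zero correction for the operator norm.\<close>

lemma theta_trivial: "trivial_ext p M \<theta>"
proof -
  obtain \<kappa> where k: "1 \<le> \<kappa>" "\<And>f x. f \<in> cfun M \<Longrightarrow> x \<in> lp \<Longrightarrow> nrm (\<theta> f x) \<le> \<kappa> * sup_norm M f * nrm x"
    by (rule theta_bounded) blast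
  have zero: "cpt (\<lambda>v. \<theta> f v - \<theta> f v)" for f by (simp add: cpt_zero)
  have op_le: "op_norm p (\<theta> f) \<le> \<kappa> * sup_norm M f" if f: "f \<in> cfun M" for f
    using k(1) sup_norm_nonneg[OF f] by (intro op_norm_le theta_blin f k(2)) auto
  have le_op: "sup_norm M f \<le> op_norm p (\<lambda>x. \<theta> f x + K x)" if f: "f \<in> cfun M" and K: "cpt K" for f K
  proof -
    have b: "blin (\<lambda>x. \<theta> f x + K x)" by (rule blin_plus[OF theta_blin[OF f] cpt_blin[OF K]])
    show ?thesis by (rule theta_lower_bound[OF f K op_norm_nonneg[OF b] op_norm_bound[OF b]])
  qed
  have scale: "sup_norm M f / \<kappa> \<le> sup_norm M f" if f: "f \<in> cfun M" for f
    using k(1) sup_norm_nonneg[OF f] by (simp add: divide_le_eq mult_le_cancel_left1)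
  have "iso_ext p M \<theta>"
  proof (rule iso_extI[where C = \<kappa>])
    show "f \<in> cfun M \<Longrightarrow> blin (\<theta> f)" for f by (rule theta_blin)
    show "1 \<le> \<kappa>" by (rule k(1))
    show "cpt (\<lambda>v. \<theta> f v - \<theta> g v)" if "\<And>x. x \<in> M \<Longrightarrow> f x = g x" for f g
      using zero[of g] theta_cong[of f g] that by simp
    show "cpt (\<lambda>v. \<theta> (\<lambda>x. a * f x + b * g x) v - (\<lambda>k. a * \<theta> f v k + b * \<theta> g v k))" for f g a b
      unfolding theta_lin using cpt_zero by simp
    show "cpt (\<lambda>v. \<theta> (\<lambda>x. f x * g x) v - \<theta> f (\<theta> g v))" for f g
      unfolding theta_mult using cpt_zero by simp
    show "cpt (\<lambda>v. \<theta> (\<lambda>x. 1) v - v)" unfolding theta_one using cpt_zero by simp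
    fix f assume f: "f \<in> cfun M"
    have "sup_norm M f \<le> ess_norm p (\<theta> f)" by (rule ess_norm_ge[OF theta_blin[OF f] le_op[OF f]])
    moreover have "ess_norm p (\<theta> f) \<le> \<kappa> * sup_norm M f"
    proof (rule ess_norm_le[OF theta_blin[OF f]])
      show "0 \<le> \<kappa> * sup_norm M f" using k(1) sup_norm_nonneg[OF f] by simp
      show "ess_bdd (\<theta> f) (\<kappa> * sup_norm M f)"
        unfolding ess_bdd_def using k(2)[OF f] cpt_zero by (intro exI[of _ "\<lambda>x. 0"]) simp
    qed
    ultimately show "sup_norm M f / \<kappa> \<le> ess_norm p (\<theta> f) \<and> ess_norm p (\<theta> f) \<le> \<kappa> * sup_norm M f"
      using scale[OF f] by linarith
  qed
  moreover have "sup_norm M f / \<kappa> \<le> op_norm p (\<theta> f)" if f: "f \<in> cfun M" for f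
    using scale[OF f] le_op[OF f cpt_zero] by simp
  ultimately show ?thesis
    unfolding trivial_ext_def bounded_op_iff mod_compact_iff
    by (intro conjI exI[of _ \<theta>] ballI allI impI exI[of _ \<kappa>])
      (assumption | rule theta_blin theta_lin theta_mult theta_one k(1) op_le zero | (rule theta_cong, blast) | blast)+
qed

text \<open>Halving the multiplicity commutes with the representation, so the equivalence holds
  exactly.\<close>

lemma theta_idempotent: "ext_equiv p M \<theta> (ext_sum \<theta> \<theta>)"
proof -
  define S where "S = (\<lambda>x. interleave (lower (half 0 (lift x))) (lower (half 1 (lift x))))"
  define S' where "S' = (\<lambda>x. lower (merge (lift (evens x)) (lift (odds x))))"
  show ?thesis
  proof (rule ext_equiv_exact)
    show "blin S" unfolding S_def
      by (intro blin_interleave blin_comp[OF blin_lower blin_comp[OF blin_half blin_lift]])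
    show "blin S'" unfolding S'_def
      by (rule blin_comp[OF blin_lower blin_merge[OF blin_comp[OF blin_lift blin_evens] blin_comp[OF blin_lift blin_odds]]])
    show "S (S' x) = x" for x by (simp add: S_def S'_def)
    show "S' (S x) = x" for x by (simp add: S_def S'_def)
    show "ext_sum \<theta> \<theta> f x = S (\<theta> f (S' x))" for f x
      by (simp add: ext_sum_isum isum_def S_def S'_def \<theta>_def urep_half[symmetric])
  qed
qed

text \<open>\<open>V W\<close> is an idempotent with complement \<open>Q\<close>, and intertwining
  makes the off-diagonal corners of \<open>\<theta>\<close> compact. Hence the compression by
  \<open>Q\<close> is multiplicative modulo compact operators. The summand
  \<open>V (\<theta> f) W\<close> of \<open>\<Psi>\<close> makes it unital and, being a copy of
  \<open>\<theta>\<close>, essentially bounded below.\<close>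

lemma theta_absorbs:
  assumes \<Phi>: "iso_ext p M \<Phi>" and V: "blin V" and W: "blin W" and WV: "\<And>x. x \<in> lp \<Longrightarrow> W (V x) = x"
    and iV: "\<And>f. f \<in> cfun M \<Longrightarrow> cpt (\<lambda>x. \<theta> f (V x) - V (\<Phi> f x))"
    and iW: "\<And>f. f \<in> cfun M \<Longrightarrow> cpt (\<lambda>x. \<Phi> f (W x) - W (\<theta> f x))"
  obtains \<Psi> where "iso_ext p M \<Psi>" "ext_equiv p M (ext_sum \<theta> \<theta>) (ext_sum \<Phi> \<Psi>)"
proof -
  define Q where "Q = (\<lambda>x. x - V (W x))"
  have Q: "blin Q" unfolding Q_def by (rule blin_minus[OF blin_id blin_comp[OF V W]])
  have Vl: "x \<in> lp \<Longrightarrow> V x \<in> lp" and Wl: "x \<in> lp \<Longrightarrow> W x \<in> lp" and Ql: "x \<in> lp \<Longrightarrow> Q x \<in> lp" for x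
    using blin_lp[OF V] blin_lp[OF W] blin_lp[OF Q] by auto
  have WQ: "W (Q x) = 0" if x: "x \<in> lp" for x
    unfolding Q_def blin_diff[OF W x Vl[OF Wl[OF x]]] WV[OF Wl[OF x]] by simp
  have QV: "Q (V x) = 0" if x: "x \<in> lp" for x unfolding Q_def WV[OF x] by simp
  have QQ: "Q (Q x) = Q x" if x: "x \<in> lp" for x
    by (subst Q_def) (simp add: WQ[OF x] blin_0[OF V])
  have VWQ: "V (W x) + Q x = x" for x by (simp add: Q_def)
  define \<Psi> where "\<Psi> = (\<lambda>f x. V (\<theta> f (W x)) + Q (\<theta> f (Q x)))"
  have tl: "f \<in> cfun M \<Longrightarrow> x \<in> lp \<Longrightarrow> \<theta> f x \<in> lp" for f x by (rule blin_lp[OF theta_blin])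
  have tb: "blin (\<lambda>x. V (\<theta> f (W x)))" "blin (\<lambda>x. Q (\<theta> f (Q x)))" if "f \<in> cfun M" for f
    using blin_comp[OF V blin_comp[OF theta_blin[OF that] W]] blin_comp[OF Q blin_comp[OF theta_blin[OF that] Q]] by auto
  have Psi_blin: "blin (\<Psi> f)" if "f \<in> cfun M" for f unfolding \<Psi>_def by (rule blin_plus[OF tb[OF that]])
  \<comment> \<open>Modulo compact operators \<open>\<theta> f\<close> maps the range of
    \<open>V\<close> into itself, where \<open>Q\<close> vanishes.\<close>
  have cQV: "cpt (\<lambda>x. Q (\<theta> f (V x)))" if f: "f \<in> cfun M" for f
  proof -
    have "cpt (\<lambda>x. Q (\<theta> f (V x) - V (\<Phi> f x)))" by (rule cpt_comp_left[OF Q iV[OF f]])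
    then show ?thesis
    proof (rule cpt_cong)
      fix x :: seq assume x: "x \<in> lp"
      have P: "\<Phi> f x \<in> lp" by (rule blin_lp[OF iso_ext_blin[OF \<Phi> f] x])
      show "Q (\<theta> f (V x)) = Q (\<theta> f (V x) - V (\<Phi> f x))"
        unfolding blin_diff[OF Q tl[OF f Vl[OF x]] Vl[OF P]] QV[OF P] by simp
    qed
  qed
  \<comment> \<open>Modulo compact operators this is \<open>\<Phi> f\<close> after
    \<open>W Q\<close>, and \<open>W Q = 0\<close>.\<close>
  have cWQ: "cpt (\<lambda>x. W (\<theta> f (Q x)))" if f: "f \<in> cfun M" for f
  proof -
    have "cpt (\<lambda>x. 0 - (\<Phi> f (W (Q x)) - W (\<theta> f (Q x))))" by (rule cpt_minus[OF cpt_zero cpt_comp_right[OF iW[OF f] Q]])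
    then show ?thesis
      by (rule cpt_cong) (simp add: WQ blin_0[OF iso_ext_blin[OF \<Phi> f]])
  qed
  obtain \<kappa> where k: "1 \<le> \<kappa>" "\<And>f x. f \<in> cfun M \<Longrightarrow> x \<in> lp \<Longrightarrow> nrm (\<theta> f x) \<le> \<kappa> * sup_norm M f * nrm x"
    by (rule theta_bounded) blast
  obtain v where v: "0 < v" "\<And>x. x \<in> lp \<Longrightarrow> nrm (V x) \<le> v * nrm x" using blin_bound[OF V] by metis
  obtain w where w: "0 < w" "\<And>x. x \<in> lp \<Longrightarrow> nrm (W x) \<le> w * nrm x" using blin_bound[OF W] by metis
  obtain q where q: "0 < q" "\<And>x. x \<in> lp \<Longrightarrow> nrm (Q x) \<le> q * nrm x" using blin_bound[OF Q] by metis
  \<comment> \<open>Dominates the upper constant \<open>(v * w + q * q) * \<kappa>\<close> as well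
    as the \<open>w * v\<close> of the lower estimate; the 1 ensures
    \<open>1 \<le> C\<close>.\<close>
  define C where "C = 1 + w * v + (v * w + q * q) * \<kappa>"
  have nn: "0 \<le> w * v" "0 \<le> (v * w + q * q) * \<kappa>" using v w q k by (auto intro!: mult_nonneg_nonneg add_nonneg_nonneg)
  have Psi_iso: "iso_ext p M \<Psi>"
  proof (rule iso_extI[where C = C])
    show "f \<in> cfun M \<Longrightarrow> blin (\<Psi> f)" for f by (rule Psi_blin)
    show "1 \<le> C" using nn by (simp add: C_def)
    show "cpt (\<lambda>x. \<Psi> f x - \<Psi> g x)" if "\<And>x. x \<in> M \<Longrightarrow> f x = g x" for f g
      unfolding \<Psi>_def using theta_cong[of f g] that cpt_zero by simp
    show "cpt (\<lambda>v. \<Psi> (\<lambda>x. a * f x + b * g x) v - (\<lambda>k. a * \<Psi> f v k + b * \<Psi> g v k))" if f: "f \<in> cfun M" and g: "g \<in> cfun M" for f g a b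
    proof (rule cpt_cong[OF cpt_zero])
      fix x :: seq assume x: "x \<in> lp"
      show "\<Psi> (\<lambda>x. a * f x + b * g x) x - (\<lambda>k. a * \<Psi> f x k + b * \<Psi> g x k) = 0"
        unfolding \<Psi>_def theta_lin blin_lin[OF V tl[OF f Wl[OF x]] tl[OF g Wl[OF x]]] blin_lin[OF Q tl[OF f Ql[OF x]] tl[OF g Ql[OF x]]]
        by (simp add: pointwise algebra_simps)
    qed
    show "cpt (\<lambda>x. \<Psi> (\<lambda>x. f x * g x) x - \<Psi> f (\<Psi> g x))" if f: "f \<in> cfun M" and g: "g \<in> cfun M" for f g
    proof -
      \<comment> \<open>The failure of multiplicativity is the product of the two corners.\<close>
      have "cpt (\<lambda>x. Q (\<theta> f (V (W (\<theta> g (Q x))))))"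
        by (rule cpt_comp_right[OF cQV[OF f] cpt_blin[OF cWQ[OF g]]])
      then show ?thesis
      proof (rule cpt_cong)
        fix x :: seq assume x: "x \<in> lp"
        define a where "a = \<theta> g (W x)"
        define b where "b = \<theta> g (Q x)"
        have ab: "a \<in> lp" "b \<in> lp" unfolding a_def b_def by (rule tl[OF g Wl[OF x]], rule tl[OF g Ql[OF x]])
        have 1: "W (V a + Q b) = a" unfolding blin_add[OF W Vl[OF ab(1)] Ql[OF ab(2)]] WV[OF ab(1)] WQ[OF ab(2)] by simp
        have 2: "Q (V a + Q b) = Q b" unfolding blin_add[OF Q Vl[OF ab(1)] Ql[OF ab(2)]] QV[OF ab(1)] QQ[OF ab(2)] by simp
        have "\<Psi> f (\<Psi> g x) = V (\<theta> f a) + Q (\<theta> f (Q b))"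
          using 1 2 by (simp add: \<Psi>_def a_def[symmetric] b_def[symmetric])
        moreover have "\<Psi> (\<lambda>x. f x * g x) x = V (\<theta> f a) + Q (\<theta> f b)" by (simp add: \<Psi>_def theta_mult a_def b_def)
        moreover have "Q (\<theta> f b) = Q (\<theta> f (V (W b))) + Q (\<theta> f (Q b))"
        proof -
          have e1: "\<theta> f b = \<theta> f (V (W b)) + \<theta> f (Q b)"
            using blin_add[OF theta_blin[OF f] Vl[OF Wl[OF ab(2)]] Ql[OF ab(2)]] VWQ[of b] by simp
          show ?thesis unfolding e1 by (rule blin_add[OF Q tl[OF f Vl[OF Wl[OF ab(2)]]] tl[OF f Ql[OF ab(2)]]])
        qed
        ultimately show "\<Psi> (\<lambda>x. f x * g x) x - \<Psi> f (\<Psi> g x) = Q (\<theta> f (V (W (\<theta> g (Q x)))))"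
          by (simp add: b_def)
      qed
    qed
    show "cpt (\<lambda>x. \<Psi> (\<lambda>x. 1) x - x)"
      by (rule cpt_cong[OF cpt_zero]) (simp add: \<Psi>_def theta_one QQ VWQ)
    fix f assume f: "f \<in> cfun M"
    define s where "s = sup_norm M f"
    have s: "0 \<le> s" using sup_norm_nonneg[OF f] by (simp add: s_def)
    have ks: "0 \<le> \<kappa> * s" using k s by simp
    have up: "nrm (\<Psi> f x) \<le> (v * w + q * q) * \<kappa> * s * nrm x" if x: "x \<in> lp" for x
    proof -
      have "nrm (V (\<theta> f (W x))) \<le> v * (\<kappa> * s * (w * nrm x))"
        unfolding s_def
        by (rule le_mult_trans[OF v(2)[OF tl[OF f Wl[OF x]]] le_mult_trans[OF k(2)[OF f Wl[OF x]] w(2)[OF x]]])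
          (use ks v in \<open>auto simp: s_def\<close>)
      moreover have "nrm (Q (\<theta> f (Q x))) \<le> q * (\<kappa> * s * (q * nrm x))"
        unfolding s_def
        by (rule le_mult_trans[OF q(2)[OF tl[OF f Ql[OF x]]] le_mult_trans[OF k(2)[OF f Ql[OF x]] q(2)[OF x]]])
          (use ks q in \<open>auto simp: s_def\<close>)
      moreover have "nrm (\<Psi> f x) \<le> nrm (V (\<theta> f (W x))) + nrm (Q (\<theta> f (Q x)))"
        unfolding \<Psi>_def by (rule lp_add(2)[OF Vl[OF tl[OF f Wl[OF x]]] Ql[OF tl[OF f Ql[OF x]]]])
      ultimately show ?thesis by (simp add: algebra_simps)
    qed
    have "ess_norm p (\<Psi> f) \<le> (v * w + q * q) * \<kappa> * s"
    proof (rule ess_norm_le[OF Psi_blin[OF f]])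
      show "0 \<le> (v * w + q * q) * \<kappa> * s" using nn s by simp
      show "ess_bdd (\<Psi> f) ((v * w + q * q) * \<kappa> * s)"
        unfolding ess_bdd_def using up cpt_zero by (intro exI[of _ "\<lambda>x. 0"]) simp
    qed
    also have "\<dots> \<le> C * s" using nn s by (intro mult_right_mono) (auto simp: C_def)
    finally have le: "ess_norm p (\<Psi> f) \<le> C * s" .
    \<comment> \<open>Compressing \<open>\<Psi> f + K\<close> between \<open>W\<close> and
      \<open>V\<close> returns \<open>\<theta> f\<close> plus a compact operator, to which
      \<open>theta_lower_bound\<close> applies.\<close>
    have "s / (w * v) \<le> ess_norm p (\<Psi> f)"
    proof (rule ess_norm_ge[OF Psi_blin[OF f]])
      fix K :: "seq \<Rightarrow> seq" assume K: "cpt K"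
      have b: "blin (\<lambda>x. \<Psi> f x + K x)" by (rule blin_plus[OF Psi_blin[OF f] cpt_blin[OF K]])
      define c where "c = op_norm p (\<lambda>x. \<Psi> f x + K x)"
      have c: "0 \<le> c" "\<And>x. x \<in> lp \<Longrightarrow> nrm (\<Psi> f x + K x) \<le> c * nrm x"
        unfolding c_def by (rule op_norm_nonneg[OF b], rule op_norm_bound[OF b])
      have "s \<le> w * (c * v)" unfolding s_def
      proof (rule theta_lower_bound[OF f])
        show "cpt (\<lambda>x. W (K (V x)))" by (rule cpt_comp_left[OF W cpt_comp_right[OF K V]])
        show "0 \<le> w * (c * v)" using w c v by simp
        fix x :: seq assume x: "x \<in> lp"
        have l: "V (\<theta> f x) \<in> lp" "\<Psi> f (V x) \<in> lp" "K (V x) \<in> lp"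
          by (rule Vl[OF tl[OF f x]], rule blin_lp[OF Psi_blin[OF f] Vl[OF x]], rule blin_lp[OF cpt_blin[OF K] Vl[OF x]])
        have "\<Psi> f (V x) = V (\<theta> f x)"
          unfolding \<Psi>_def WV[OF x] QV[OF x] blin_0[OF theta_blin[OF f]] blin_0[OF Q] by simp
        then have "\<theta> f x + W (K (V x)) = W (\<Psi> f (V x) + K (V x))"
          unfolding blin_add[OF W l(2,3)] by (simp add: WV[OF tl[OF f x]])
        moreover have "nrm (W (\<Psi> f (V x) + K (V x))) \<le> w * (c * (v * nrm x))"
          by (rule le_mult_trans[OF w(2)[OF lp_add(1)[OF l(2,3)]] le_mult_trans[OF c(2)[OF Vl[OF x]] v(2)[OF x]]])
            (use c w in auto)
        ultimately show "nrm (\<theta> f x + W (K (V x))) \<le> w * (c * v) * nrm x" by (simp add: mult.assoc)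
      qed
      then show "s / (w * v) \<le> op_norm p (\<lambda>x. \<Psi> f x + K x)"
        unfolding c_def[symmetric] using v w by (simp add: field_simps)
    qed
    moreover have "s / C \<le> s / (w * v)" using s v w nn by (intro divide_left_mono) (auto simp: C_def add_pos_pos intro!: mult_pos_pos add_pos_nonneg)
    ultimately show "sup_norm M f / C \<le> ess_norm p (\<Psi> f) \<and> ess_norm p (\<Psi> f) \<le> C * sup_norm M f"
      using le by (simp add: s_def)
  qed
  \<comment> \<open>\<open>J\<close> exchanges the first summand with the range of \<open>V\<close>
    in the second and fixes the range of \<open>Q\<close>, hence is an involution.\<close>
  define J where "J = (\<lambda>z. interleave (W (odds z)) (V (evens z) + Q (odds z)))"
  have J: "blin J" unfolding J_def
    by (rule blin_interleave[OF blin_comp[OF W blin_odds] blin_plus[OF blin_comp[OF V blin_evens] blin_comp[OF Q blin_odds]]])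
  have JJ: "J (J z) = z" if z: "z \<in> lp" for z
  proof -
    have x: "evens z \<in> lp" "odds z \<in> lp" using z evens_lp odds_lp by auto
    have "J (J z) = interleave (W (V (evens z) + Q (odds z))) (V (W (odds z)) + Q (V (evens z) + Q (odds z)))"
      by (simp add: J_def)
    also have "\<dots> = interleave (evens z) (odds z)"
      unfolding blin_add[OF W Vl[OF x(1)] Ql[OF x(2)]] blin_add[OF Q Vl[OF x(1)] Ql[OF x(2)]] WV[OF x(1)] WQ[OF x(2)] QV[OF x(1)] QQ[OF x(2)]
      by (simp add: VWQ)
    finally show ?thesis by simp
  qed
  have "ext_equiv p M (ext_sum \<theta> \<theta>) (ext_sum \<Phi> \<Psi>)"
  proof (rule ext_equivI[OF J J JJ JJ])
    fix f assume f: "f \<in> cfun M"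
    have c1: "cpt (\<lambda>x. 0 - W (\<theta> f (V x) - V (\<Phi> f x)))" by (rule cpt_minus[OF cpt_zero cpt_comp_left[OF W iV[OF f]]])
    have "cpt (\<lambda>z. interleave ((0 - W (\<theta> f (V (evens z)) - V (\<Phi> f (evens z)))) - W (\<theta> f (Q (odds z)))) (0 - Q (\<theta> f (V (evens z)))))"
      by (rule cpt_interleave[OF cpt_minus[OF cpt_comp_right[OF c1 blin_evens] cpt_comp_right[OF cWQ[OF f] blin_odds]]
            cpt_minus[OF cpt_zero cpt_comp_right[OF cQV[OF f] blin_evens]]])
    then show "cpt (\<lambda>z. ext_sum \<Phi> \<Psi> f z - J (ext_sum \<theta> \<theta> f (J z)))"
    proof (rule cpt_cong)
      fix z :: seq assume z: "z \<in> lp"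
      define x where "x = evens z"
      define y where "y = odds z"
      have xy: "x \<in> lp" "y \<in> lp" using z evens_lp odds_lp by (auto simp: x_def y_def)
      have P: "\<Phi> f x \<in> lp" by (rule blin_lp[OF iso_ext_blin[OF \<Phi> f] xy(1)])
      note l = tl[OF f Vl[OF xy(1)]] tl[OF f Ql[OF xy(2)]]
      have t: "\<theta> f (V x + Q y) = \<theta> f (V x) + \<theta> f (Q y)" by (rule blin_add[OF theta_blin[OF f] Vl[OF xy(1)] Ql[OF xy(2)]])
      have "J (ext_sum \<theta> \<theta> f (J z)) = interleave (W (\<theta> f (V x + Q y))) (V (\<theta> f (W y)) + Q (\<theta> f (V x + Q y)))"
        by (simp add: J_def ext_sum_isum isum_def x_def y_def)
      also have "\<dots> = interleave (W (\<theta> f (V x)) + W (\<theta> f (Q y))) (V (\<theta> f (W y)) + (Q (\<theta> f (V x)) + Q (\<theta> f (Q y))))"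
        unfolding t blin_add[OF W l] blin_add[OF Q l] ..
      finally have 1: "J (ext_sum \<theta> \<theta> f (J z)) = interleave (W (\<theta> f (V x)) + W (\<theta> f (Q y))) (V (\<theta> f (W y)) + (Q (\<theta> f (V x)) + Q (\<theta> f (Q y))))" .
      have 2: "ext_sum \<Phi> \<Psi> f z = interleave (\<Phi> f x) (V (\<theta> f (W y)) + Q (\<theta> f (Q y)))"
        by (simp add: ext_sum_isum isum_def \<Psi>_def x_def y_def)
      have 3: "W (\<theta> f (V x) - V (\<Phi> f x)) = W (\<theta> f (V x)) - \<Phi> f x"
        unfolding blin_diff[OF W l(1) Vl[OF P]] WV[OF P] ..
      show "ext_sum \<Phi> \<Psi> f z - J (ext_sum \<theta> \<theta> f (J z)) =
        interleave ((0 - W (\<theta> f (V (evens z)) - V (\<Phi> f (evens z)))) - W (\<theta> f (Q (odds z)))) (0 - Q (\<theta> f (V (evens z))))"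
        unfolding x_def[symmetric] y_def[symmetric] 1 2 3 interleave_diff by (simp add: algebra_simps)
    qed
  qed
  with Psi_iso show ?thesis by (rule that)
qed

end

theorem theorem1p1:
  fixes p :: real and M :: "(real ^ 'd) set"
  assumes "1 < p" and "compact M" and "M \<noteq> {}"
  shows "\<exists>\<theta>. trivial_ext p M \<theta> \<and>
           ext_equiv p M \<theta> (ext_sum \<theta> \<theta>) \<and>
           (\<forall>\<phi>. iso_ext p M \<phi> \<longrightarrow>
              (\<exists>\<psi>. iso_ext p M \<psi> \<and> ext_equiv p M \<theta> (ext_sum \<phi> \<psi>))) \<and>
           (\<forall>\<theta>'. iso_ext p M \<theta>' \<and> ext_equiv p M \<theta>' (ext_sum \<theta>' \<theta>') \<and>
              (\<forall>\<phi>. iso_ext p M \<phi> \<longrightarrow>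
                 (\<exists>\<psi>. iso_ext p M \<psi> \<and> ext_equiv p M \<theta>' (ext_sum \<phi> \<psi>)))
              \<longrightarrow> ext_equiv p M \<theta> \<theta>')"
proof -
  obtain ns t t0 a D where "partition_rep p M ns t t0 a D"
    using partition_rep_exists[OF assms] .
  then interpret partition_rep p M ns t t0 a D .
  have triv: "trivial_ext p M \<theta>" by (rule theta_trivial)
  then have iso: "iso_ext p M \<theta>" by (simp add: trivial_ext_def)
  have absorb: "\<exists>\<psi>. iso_ext p M \<psi> \<and> ext_equiv p M \<theta> (ext_sum \<phi> \<psi>)" if \<phi>: "iso_ext p M \<phi>" for \<phi>
  proof -
    \<comment> \<open>The coordinate functions are finitely many and 1-Lipschitz, as the dilation
      requires, and their polynomials are dense.\<close>
    let ?\<xi> = "\<lambda>i (x :: real ^ 'd). complex_of_real (x $ i)"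
    have xi: "?\<xi> i \<in> cfun M" for i by (auto simp: cfun_def intro!: continuous_intros)
    have lip: "norm (?\<xi> i x - ?\<xi> i y) \<le> dist x y" for i x y
      using dist_vec_nth_le[of x i y] by (simp add: dist_real_def flip: of_real_diff)
    obtain V W where V: "blin V" and W: "blin W" and WV: "\<And>x. x \<in> lp \<Longrightarrow> W (V x) = x"
      and iV: "\<And>i. cpt (\<lambda>x. \<Theta> (?\<xi> i) (V x) - V (\<phi> (?\<xi> i) x))"
      and iW: "\<And>i. cpt (\<lambda>y. \<phi> (?\<xi> i) (W y) - W (\<Theta> (?\<xi> i) y))"
      by (rule dilation_family[OF \<phi>, of UNIV ?\<xi>]) (use xi lip in auto)
    have "intertwining p M ns t t0 \<phi> V W" by unfold_locales (rule \<phi> V W)+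
    then have good: "intertwines \<phi> V W f" if "f \<in> cfun M" for f
      by (rule intertwines_all) (use iV iW that in \<open>auto simp: intertwines_def\<close>)
    obtain \<psi> where \<psi>: "iso_ext p M \<psi>" "ext_equiv p M (ext_sum \<theta> \<theta>) (ext_sum \<phi> \<psi>)"
    proof (rule theta_absorbs[OF \<phi> blin_comp[OF blin_lower V] blin_comp[OF W blin_lift]])
      show "W (lift (lower (V x))) = x" if "x \<in> lp" for x using WV[OF that] by simp
      fix f assume f: "f \<in> cfun M"
      have "cpt (\<lambda>x. lower (\<Theta> f (V x) - V (\<phi> f x)))"
        using good[OF f] unfolding intertwines_def by (intro cpt_comp_left[OF blin_lower]) auto
      then show "cpt (\<lambda>x. \<theta> f (lower (V x)) - lower (V (\<phi> f x)))" by (simp add: \<theta>_def lower_diff)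
      have "cpt (\<lambda>y. \<phi> f (W y) - W (\<Theta> f y))" using good[OF f] by (simp add: intertwines_def)
      from cpt_comp_right[OF this blin_lift]
      show "cpt (\<lambda>x. \<phi> f (W (lift x)) - W (lift (\<theta> f x)))" by (simp add: \<theta>_def)
    qed
    note fam = op_family_iso_ext[OF iso]
    from \<psi> show ?thesis
      by (intro exI[of _ \<psi>] conjI) (assumption | rule ext_equiv_trans[OF fam op_family_sum[OF fam fam] theta_idempotent])+
  qed
  have unique: "ext_equiv p M \<theta> \<theta>'"
    if \<theta>': "iso_ext p M \<theta>'" "ext_equiv p M \<theta>' (ext_sum \<theta>' \<theta>')"
      and univ: "\<forall>\<phi>. iso_ext p M \<phi> \<longrightarrow> (\<exists>\<psi>. iso_ext p M \<psi> \<and> ext_equiv p M \<theta>' (ext_sum \<phi> \<psi>))" for \<theta>'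
  proof -
    obtain \<psi> where \<psi>: "iso_ext p M \<psi>" "ext_equiv p M \<theta> (ext_sum \<theta>' \<psi>)" using absorb[OF \<theta>'(1)] by blast
    obtain \<psi>' where \<psi>': "iso_ext p M \<psi>'" "ext_equiv p M \<theta>' (ext_sum \<theta> \<psi>')" using univ iso by blast
    show ?thesis
      by (rule idempotent_absorbing_unique[OF op_family_iso_ext[OF iso] op_family_iso_ext[OF \<theta>'(1)]
            op_family_iso_ext[OF \<psi>(1)] op_family_iso_ext[OF \<psi>'(1)] theta_idempotent \<theta>'(2) \<psi>(2) \<psi>'(2)])
  qed
  show ?thesis
  proof (rule exI[of _ \<theta>], intro conjI allI impI)
    show "trivial_ext p M \<theta>" by (rule triv)
    show "ext_equiv p M \<theta> (ext_sum \<theta> \<theta>)" by (rule theta_idempotent)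
    show "\<exists>\<psi>. iso_ext p M \<psi> \<and> ext_equiv p M \<theta> (ext_sum \<phi> \<psi>)" if "iso_ext p M \<phi>" for \<phi>
      by (rule absorb[OF that])
    show "ext_equiv p M \<theta> \<theta>'"
      if "iso_ext p M \<theta>' \<and> ext_equiv p M \<theta>' (ext_sum \<theta>' \<theta>') \<and>
        (\<forall>\<phi>. iso_ext p M \<phi> \<longrightarrow> (\<exists>\<psi>. iso_ext p M \<psi> \<and> ext_equiv p M \<theta>' (ext_sum \<phi> \<psi>)))" for \<theta>'
      by (rule unique[OF conjunct1[OF that] conjunct1[OF conjunct2[OF that]] conjunct2[OF conjunct2[OF that]]])
  qed
qed

end
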